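(* There exists $\beta_\star\ge\frac1{2\sqrt2}$ such that, for every $x\in\mathbb R^2$, the partial differential equation $$\begin{cases}\partial_t g(t,y;x)-\partial_{y_1}g(t,y;x)\,\partial_{y_2}g(t,y;x)=0,\\ g(0,y;x)=\phi(y;x)\end{cases}$$ admits a unique differentiable solution $g(\cdot,\cdot;x)$ on $[0,\beta_\star^2/2)\times\mathbb R_+^2$, and such that for every $\beta<\beta_\star$ ($\beta\ge0$) and almost every realization of $(W_{ij})_{i,j}$, $(\chi^1_i)_i$ and $(\chi^2_i)_i$, the following holds. We have $$\lim_{N\to+\infty} f_N=\inf_{m\in\mathbb R^2}\sup_{x\in\mathbb R^2}\Big\{g\big(\tfrac{\beta^2}{2},0;x\big)+m\cdot x-(m_1+m_2)\Big\}-\tfrac{\beta^2}{2},$$ and the $\mathbb R^2$-valued mean magnetization $m_N$ satisfies a large deviation principle under $\langle\cdot\rangle_N$ with rate function $J$ defined for $m\in\mathbb R^2$ by $$J(m)=-(m_1+m_2)+g^*\big(\tfrac{\beta^2}{2},0;m\big)+\sup_{m'\in\mathbb R^2}\Big\{m_1'+m_2'-g^*\big(\tfrac{\beta^2}{2},0;m'\big)\Big\},$$ where $g^*\big(\tfrac{\beta^2}{2},0;m\big)=\sup_{x\in\mathbb R^2}\big\{x\cdot m+g\big(\tfrac{\beta^2}{2},0;x\big)\big\}$.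
   Context: $\mathbb R_+=[0,\infty)$. $(W_{ij})_{i,j\ge1}$ are independent centered Gaussian random variables with variance $1$; $(\chi^1_i)_{i\ge1}$ and $(\chi^2_i)_{i\ge1}$ are i.i.d. centered $\pm1$ Bernoulli random variables, independent of $(W_{ij})$. For $\sigma=(\sigma_1,\sigma_2)\in\{-1,1\}^N\times\{-1,1\}^N$, $$E_N(\sigma)=\frac{\beta}{\sqrt N}\sum_{i,j=1}^N W_{ij}\sigma_{1,i}\sigma_{2,j}+\sum_{i=1}^N\chi^1_i\sigma_{1,i}+\sum_{i=1}^N\chi^2_i\sigma_{2,i},$$ $$f_N=-\frac1N\log\Big(\frac1{4^N}\sum_{\sigma}e^{E_N(\sigma)}\Big),\qquad \langle u(\sigma)\rangle_N=\frac{\sum_\sigma u(\sigma)e^{E_N(\sigma)}}{\sum_\sigma e^{E_N(\sigma)}},$$ where the sums run over $\sigma\in\{-1,1\}^N\times\{-1,1\}^N$, and $$m_N=\Big(\frac1N\sum_{i=1}^N\chi^1_i\sigma_{1,i},\ \frac1N\sum_{i=1}^N\chi^2_i\sigma_{2,i}\Big)\in\mathbb R^2 .$$ With $\eta$ a standard real Gaussian and $\chi$ an independent centered $\pm1$ Bernoulli variable, for $y\in\mathbb R_+^2$, $x\in\mathbb R^2$, $$\phi(y;x)=\sum_{i=1}^2\Big(-\mathbb E\log\cosh(\sqrt{2y_i}\,\eta+x_i\chi)+y_i\Big).$$ Large deviation principle: random variables $X_N$ in $\mathbb R^d$ with associated probability measures $\mathbb P_N$ satisfy a large deviation principle with rate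 function $I:\mathbb R^d\to[0,\infty]$ if for every Borel set $A\subseteq\mathbb R^d$, $-\inf_{A^\circ}I\le\liminf_N\frac1N\log\mathbb P_N\{X_N\in A\}\le\limsup_N\frac1N\log\mathbb P_N\{X_N\in A\}\le-\inf_{\bar A}I$, where $A^\circ,\bar A$ are the interior and closure of $A$. *)

theory Defs
  imports "HOL-Probability.Probability"
begin

section \<open>The spin glass\<close>

text \<open>The functions \<open>W\<close>, \<open>\<chi>1\<close>, \<open>\<chi>2\<close> of this section are a fixed realization of the disorder.
  Sites are numbered \<open>1, \<dots>, N\<close>; extensionality of the function space makes the set of
  configurations finite, with \<open>4 ^ N\<close> elements.\<close>

type_synonym config = "(nat \<Rightarrow> real) \<times> (nat \<Rightarrow> real)"

definition configs :: "nat \<Rightarrow> config set" where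
  "configs N = ({1..N} \<rightarrow>\<^sub>E {-1, 1}) \<times> ({1..N} \<rightarrow>\<^sub>E {-1, 1})"

definition energy ::
  "real \<Rightarrow> (nat \<Rightarrow> nat \<Rightarrow> real) \<Rightarrow> (nat \<Rightarrow> real) \<Rightarrow> (nat \<Rightarrow> real) \<Rightarrow> nat \<Rightarrow> config \<Rightarrow> real" where
  "energy \<beta> W \<chi>1 \<chi>2 N \<sigma> =
     \<beta> / sqrt (real N) * (\<Sum>i=1..N. \<Sum>j=1..N. W i j * fst \<sigma> i * snd \<sigma> j)
     + (\<Sum>i=1..N. \<chi>1 i * fst \<sigma> i) + (\<Sum>i=1..N. \<chi>2 i * snd \<sigma> i)"

definition free_energy ::
  "real \<Rightarrow> (nat \<Rightarrow> nat \<Rightarrow> real) \<Rightarrow> (nat \<Rightarrow> real) \<Rightarrow> (nat \<Rightarrow> real) \<Rightarrow> nat \<Rightarrow> real" where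
  "free_energy \<beta> W \<chi>1 \<chi>2 N =
     - (1 / real N) * ln (1 / 4 ^ N * (\<Sum>\<sigma>\<in>configs N. exp (energy \<beta> W \<chi>1 \<chi>2 N \<sigma>)))"

definition gibbs_measure ::
  "real \<Rightarrow> (nat \<Rightarrow> nat \<Rightarrow> real) \<Rightarrow> (nat \<Rightarrow> real) \<Rightarrow> (nat \<Rightarrow> real) \<Rightarrow> nat \<Rightarrow> config measure" where
  "gibbs_measure \<beta> W \<chi>1 \<chi>2 N = point_measure (configs N)
     (\<lambda>\<sigma>. ennreal (exp (energy \<beta> W \<chi>1 \<chi>2 N \<sigma>) / (\<Sum>\<tau>\<in>configs N. exp (energy \<beta> W \<chi>1 \<chi>2 N \<tau>))))"

definition magnetization :: "(nat \<Rightarrow> real) \<Rightarrow> (nat \<Rightarrow> real) \<Rightarrow> nat \<Rightarrow> config \<Rightarrow> real^2" where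
  "magnetization \<chi>1 \<chi>2 N \<sigma> =
     vector [1 / real N * (\<Sum>i=1..N. \<chi>1 i * fst \<sigma> i), 1 / real N * (\<Sum>i=1..N. \<chi>2 i * snd \<sigma> i)]"

lemma finite_configs [simp]: "finite (configs N)"
  unfolding configs_def by (intro finite_cartesian_product finite_PiE) auto

lemma card_configs: "card (configs N) = 4 ^ N"
  unfolding configs_def
  by (simp add: card_cartesian_product card_PiE card_insert_if numeral_eq_Suc flip: power_mult_distrib)

text \<open>Integration against the Gibbs measure is the bracket \<open>\<langle>u(\<sigma>)\<rangle>\<close>.\<close>

lemma integral_gibbs_measure:
  fixes u :: "config \<Rightarrow> real"
  shows "integral\<^sup>L (gibbs_measure \<beta> W \<chi>1 \<chi>2 N) u =
    (\<Sum>\<sigma>\<in>configs N. u \<sigma> * exp (energy \<beta> W \<chi>1 \<chi>2 N \<sigma>)) / (\<Sum>\<sigma>\<in>configs N. exp (energy \<beta> W \<chi>1 \<chi>2 N \<sigma>))"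
  unfolding gibbs_measure_def
  by (subst lebesgue_integral_point_measure_finite)
     (auto simp: sum_nonneg sum_divide_distrib mult.commute intro!: divide_nonneg_nonneg)


section \<open>The Hamilton--Jacobi equation\<close>

definition rademacher :: "real measure" where
  "rademacher = distr (measure_pmf (pmf_of_set {-1, 1})) borel (\<lambda>x. x)"

definition initial_condition :: "real^2 \<Rightarrow> real^2 \<Rightarrow> real" where
  "initial_condition y x = (\<Sum>i\<in>UNIV.
     - (\<integral>p. ln (cosh (sqrt (2 * y $ i) * fst p + x $ i * snd p))
          \<partial>(density lborel std_normal_density \<Otimes>\<^sub>M rademacher))
     + y $ i)"

definition orthant :: "(real^2) set" where
  "orthant = {y. \<forall>i. 0 \<le> y $ i}"

text \<open>Differentiability on the set \<open>[0, T) \<times> \<real>\<^sub>+\<^sup>2\<close>, which is not open, is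
  relative to that set, hence one-sided on its boundary. The derivative \<open>D\<close> is unique
  (\<open>hj_derivative_unique\<close>), and its values at the basis vectors are the partial derivatives.\<close>

definition hj_domain :: "real \<Rightarrow> (real \<times> (real^2)) set" where
  "hj_domain T = {0..<T} \<times> orthant"

definition hj_solution :: "real \<Rightarrow> (real^2 \<Rightarrow> real) \<Rightarrow> (real \<Rightarrow> real^2 \<Rightarrow> real) \<Rightarrow> bool" where
  "hj_solution T \<phi> g \<longleftrightarrow>
     (\<forall>y\<in>orthant. g 0 y = \<phi> y) \<and>
     (\<forall>p\<in>hj_domain T. \<exists>D.
        ((\<lambda>(t, y). g t y) has_derivative D) (at p within hj_domain T) \<and>
        D (1, 0) - D (0, axis 1 1) * D (0, axis 2 1) = 0)"

lemma hj_derivative_unique: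
  fixes f :: "real \<times> (real^2) \<Rightarrow> real"
  assumes "p \<in> hj_domain T"
    and "(f has_derivative D) (at p within hj_domain T)"
    and "(f has_derivative D') (at p within hj_domain T)"
  shows "D = D'"
proof (rule frechet_derivative_unique_within[OF assms(2,3)])
  fix i :: "real \<times> (real^2)" and e :: real
  assume i: "i \<in> Basis" and e: "e > 0"
  obtain t y where p: "p = (t, y)" "0 \<le> t" "t < T" "\<forall>k. 0 \<le> y $ k"
    using assms(1) by (auto simp: hj_domain_def orthant_def)
  define d where "d = min (e / 2) ((T - t) / 2)"
  have d: "0 < d" "d < e" "t + d < T"
    using p e by (auto simp: d_def min_def field_simps)
  have "p + d *\<^sub>R i \<in> hj_domain T"
    using i p d by (auto simp: Basis_prod_def hj_domain_def orthant_def Basis_vec_def axis_def)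
  then show "\<exists>d. 0 < \<bar>d\<bar> \<and> \<bar>d\<bar> < e \<and> p + d *\<^sub>R i \<in> hj_domain T"
    using d by (intro exI[of _ d]) auto
qed


section \<open>Large deviations\<close>

definition ereal_ln :: "real \<Rightarrow> ereal" where
  "ereal_ln p = (if p = 0 then -\<infinity> else ereal (ln p))"

definition large_deviation_principle ::
  "(nat \<Rightarrow> 's measure) \<Rightarrow> (nat \<Rightarrow> 's \<Rightarrow> 'a::euclidean_space) \<Rightarrow> ('a \<Rightarrow> ereal) \<Rightarrow> bool" where
  "large_deviation_principle P X I \<longleftrightarrow>
     (\<forall>a. 0 \<le> I a) \<and>
     (\<forall>A\<in>sets borel.
        (let r = (\<lambda>N. ereal (1 / real N) * ereal_ln (measure (P N) {s \<in> space (P N). X N s \<in> A}))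
         in - (INF a\<in>interior A. I a) \<le> liminf r \<and>
            liminf r \<le> limsup r \<and>
            limsup r \<le> - (INF a\<in>closure A. I a)))"

text \<open>With \<open>h = g (\<beta>\<^sup>2/2, 0; \<cdot>)\<close>, the next two functions are \<open>g\<^sup>*(\<beta>\<^sup>2/2, 0; \<cdot>)\<close> and \<open>J\<close>.
  Note the sign of \<open>h\<close> in the conjugate. Values are extended, since the conjugate may be \<open>\<infinity>\<close>.\<close>

definition conjugate :: "(real^2 \<Rightarrow> real) \<Rightarrow> real^2 \<Rightarrow> ereal" where
  "conjugate h m = (SUP x. ereal (x \<bullet> m + h x))"

definition magnetization_rate :: "(real^2 \<Rightarrow> real) \<Rightarrow> real^2 \<Rightarrow> ereal" where
  "magnetization_rate h m =
     - ereal (m $ 1 + m $ 2) + conjugate h m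
     + (SUP m'. ereal (m' $ 1 + m' $ 2) - conjugate h m')"

end

theory Submission
  imports Defs
begin

text \<open>With \<open>\<psi> (y, x) = y - E (ln (cosh (sqrt (2 y) \<eta> + x)))\<close>, whose derivative in \<open>y\<close> is
  \<open>q (y, x) = E ((tanh (sqrt (2 y) \<eta> + x))\<^sup>2)\<close>, the solution is
  \<open>g (t, y; x) = \<psi> (y\<^sub>1 + t p\<^sub>2, x\<^sub>1) + \<psi> (y\<^sub>2 + t p\<^sub>1, x\<^sub>2) - t p\<^sub>1 p\<^sub>2\<close> for the fixed point
  \<open>p\<^sub>1 = q (y\<^sub>1 + t p\<^sub>2, x\<^sub>1)\<close>, \<open>p\<^sub>2 = q (y\<^sub>2 + t p\<^sub>1, x\<^sub>2)\<close>, which is unique for \<open>t < 1 / 16\<close> since \<open>q\<close> is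
  2-Lipschitz in \<open>y\<close>. It is critical in \<open>p\<close>, so its gradient is \<open>p\<close>. Uniqueness is a Holmgren-type
  argument: the difference with another solution satisfies a linear equation with small speed up to
  a quadratic term, and is shown to vanish by comparison with a barrier near a minimal point, on the
  closure of its support, of a function with noncharacteristic level sets.

  For the free energy with external fields \<open>x\<^sub>i \<chi>\<^sup>i\<close>, a Gaussian interpolation between the model and
  independent spins in Gaussian fields of variance \<open>\<beta>\<^sup>2 p\<^sub>2\<close> and \<open>\<beta>\<^sup>2 p\<^sub>1\<close> has an error proportional
  to the average of \<open>(R\<^sub>1 - p\<^sub>1) (R\<^sub>2 - p\<^sub>2)\<close>, where \<open>R\<^sub>1\<close>, \<open>R\<^sub>2\<close> are the overlaps of two replicas; for
  \<open>8 \<beta>\<^sup>2 < 1\<close> coupling two replicas through this product keeps it small along the interpolation.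
  Gaussian concentration yields almost sure convergence, simultaneously for all \<open>x\<close> by Lipschitz
  continuity. The limit is differentiable in \<open>x\<close>, so the Gaertner--Ellis theorem applies to the
  magnetization, and the variational formulas are Legendre duality.\<close>

section \<open>Gaussian means\<close>

text \<open>The value 1/(2 sqrt 2) has one source. Reducing replica averages to one pair of replicas
  costs a factor 8, hence a loss of \<open>4 * \<beta>\<^sup>2 * N\<close> in the exponent of a
  replica coupling that starts at \<open>N / 2\<close>, the Hoeffding exponent of independent spins.
  The balance is \<open>8 * \<beta>\<^sup>2 < 1\<close>, that is \<open>t < 1 / 16\<close> for
  \<open>t = \<beta>\<^sup>2 / 2\<close>. The signs \<chi> do not affect the limit, because Gaussian
  means of even functions are even in the field; so the interpolation can be run with frozen signs.

  The obstacle to uniqueness is that a competing solution is merely differentiable, with no bound on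
  its gradient, that the Hamiltonian is neither convex nor concave, and that no values are
  prescribed on the faces of the orthant. What remains usable is a single point: where the
  difference w first ceases to vanish, differentiability forces its whole derivative to be zero, so
  w = o(r) at distance r, while a barrier of small but fixed slope has height of order r. On the
  faces, the sign of the gradient of the known solution takes the place of boundary values.\<close>

definition gauss :: "real measure" where
  "gauss = density lborel (\<lambda>x. ennreal (std_normal_density x))"

lemma sets_gauss [simp, measurable_cong]: "sets gauss = sets borel"
  and space_gauss [simp]: "space gauss = UNIV"
  by (simp_all add: gauss_def)

global_interpretation gauss: prob_space gauss
  unfolding gauss_def by (rule prob_space_normal_density) simp

lemma integrable_gauss_iff:
  fixes f :: "real \<Rightarrow> real"
  assumes "f \<in> borel_measurable borel"
  shows "integrable gauss f \<longleftrightarrow> integrable lborel (\<lambda>x. std_normal_density x * f x)"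
  unfolding gauss_def using assms by (subst integrable_density) auto

lemma integral_gauss:
  fixes f :: "real \<Rightarrow> real"
  assumes "f \<in> borel_measurable borel"
  shows "(\<integral>x. f x \<partial>gauss) = (\<integral>x. std_normal_density x * f x \<partial>lborel)"
  unfolding gauss_def using assms by (subst integral_density) auto

lemma integrable_gauss_abs: "integrable gauss (\<lambda>x. \<bar>x\<bar>)"
  using integrable_std_normal_moment_abs[of 1] by (simp add: integrable_gauss_iff)

text \<open>Completing the square: an exponential tilt of the standard normal law is a shift of its
  mean, so exponential moments are read off a normal density of total mass 1.\<close>

lemma std_normal_density_exp:
  "std_normal_density x * exp (a * x) = exp (a\<^sup>2 / 2) * normal_density a 1 x"
  unfolding normal_density_def
  by (simp add: exp_add[symmetric] power2_eq_square field_simps)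

lemma integrable_gauss_exp: "integrable gauss (\<lambda>x. exp (a * x))"
  and integral_gauss_exp: "(\<integral>x. exp (a * x) \<partial>gauss) = exp (a\<^sup>2 / 2)"
  by (simp_all add: integrable_gauss_iff integral_gauss std_normal_density_exp)

lemma gauss_distr_uminus: "distr gauss gauss uminus = gauss"
proof -
  have "distributed gauss lborel (\<lambda>x. x) (\<lambda>x. ennreal (std_normal_density x))"
    unfolding distributed_def by (auto simp: gauss_def distr_id2 cong: distr_cong)
  from gauss.normal_density_affine[OF this, of "-1" 0]
  have "distributed gauss lborel (\<lambda>x. - x) (\<lambda>x. ennreal (std_normal_density x))" by simp
  then have "distr gauss lborel uminus = gauss"
    unfolding distributed_def gauss_def by simp
  moreover have "distr gauss lborel uminus = distr gauss gauss uminus"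
    by (rule distr_cong) auto
  ultimately show ?thesis by simp
qed

lemma integral_gauss_uminus:
  fixes f :: "real \<Rightarrow> real"
  assumes "f \<in> borel_measurable borel"
  shows "(\<integral>x. f (- x) \<partial>gauss) = (\<integral>x. f x \<partial>gauss)"
proof -
  have "(\<integral>x. f x \<partial>gauss) = (\<integral>x. f x \<partial>distr gauss gauss uminus)" by (simp add: gauss_distr_uminus)
  also have "\<dots> = (\<integral>x. f (- x) \<partial>gauss)" using assms by (subst integral_distr) auto
  finally show ?thesis by simp
qed

lemma abs_diff_le_of_deriv_bounded:
  fixes f :: "real \<Rightarrow> real"
  assumes "\<And>x. (f has_real_derivative f' x) (at x)" "\<And>x. \<bar>f' x\<bar> \<le> B"
  shows "\<bar>f a - f b\<bar> \<le> B * \<bar>a - b\<bar>"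
  using field_differentiable_bound[of UNIV f f' B b a] assms by (auto simp: abs_minus_commute)

text \<open>Quadratic decay, obtained from \<open>exp x \<ge> 1 + x\<close>, is enough to kill
  boundary terms against functions of linear growth.\<close>

lemma std_normal_density_le: 
  assumes "x \<noteq> 0" shows "std_normal_density x \<le> 2 / x\<^sup>2"
proof -
  have "x\<^sup>2 / 2 \<le> exp (x\<^sup>2 / 2)" using exp_ge_add_one_self[of "x\<^sup>2/2"] by linarith
  then have "exp (- x\<^sup>2 / 2) \<le> 2 / x\<^sup>2"
    using assms by (simp add: exp_minus field_simps)
  moreover have "1 / sqrt (2 * pi) \<le> 1" using pi_gt3 by (simp add: field_simps)
  then have "1 / sqrt (2 * pi) * exp (- x\<^sup>2 / 2) \<le> 1 * exp (- x\<^sup>2 / 2)" 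
    by (intro mult_right_mono) auto
  ultimately show ?thesis unfolding std_normal_density_def by linarith
qed

lemma DERIV_std_normal_density:
  "(std_normal_density has_real_derivative - x * std_normal_density x) (at x)"
  unfolding std_normal_density_def
  by (rule derivative_eq_intros refl | simp)+

lemma gauss_integrable_lipschitz:
  fixes f :: "real \<Rightarrow> real"
  assumes "\<And>x. \<bar>f x\<bar> \<le> A + B * \<bar>x\<bar>" "f \<in> borel_measurable borel"
  shows "integrable gauss f"
proof (rule Bochner_Integration.integrable_bound)
  show "integrable gauss (\<lambda>x. A + B * \<bar>x\<bar>)" 
    by (intro Bochner_Integration.integrable_add integrable_mult_right integrable_gauss_abs) auto
  show "AE x in gauss. norm (f x) \<le> norm (A + B * \<bar>x\<bar>)"
    using assms(1) by (intro always_eventually) (auto intro: order_trans[OF _ abs_ge_self])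
qed (use assms in auto)

text \<open>Stein's identity. \<open>std_normal_density x * (x * F x - F' x)\<close> is the
  derivative of minus \<open>std_normal_density x * F x\<close>, which tends to 0 at both ends
  because a bounded derivative limits \<open>F\<close> to linear growth.\<close>

lemma gauss_integral_by_parts:
  fixes F F' :: "real \<Rightarrow> real"
  assumes D: "\<And>x. (F has_real_derivative F' x) (at x)" and c: "continuous_on UNIV F'"
    and B: "\<And>x. \<bar>F' x\<bar> \<le> B"
  shows "integrable gauss (\<lambda>x. x * F x)" "(\<integral>x. x * F x \<partial>gauss) = (\<integral>x. F' x \<partial>gauss)"
proof -
  have B0: "B \<ge> 0" using B[of 0] by linarith
  have growth: "\<bar>F x\<bar> \<le> \<bar>F 0\<bar> + B * \<bar>x\<bar>" for x
    using abs_diff_le_of_deriv_bounded[OF D B, of x 0] by auto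
  have cF: "continuous_on UNIV F" using D by (auto intro!: DERIV_continuous_on continuous_at_imp_continuous_on DERIV_isCont)
  have [measurable]: "F \<in> borel_measurable borel" "F' \<in> borel_measurable borel"
    using cF c by (auto intro: borel_measurable_continuous_onI)
  have iF': "integrable gauss F'"
    using B by (intro gauss.integrable_const_bound[of _ B]) auto
  have "integrable lborel (\<lambda>x. std_normal_density x * (\<bar>F 0\<bar> * \<bar>x\<bar>^1 + B * \<bar>x\<bar>^2))"
    unfolding distrib_left mult.left_commute[of "std_normal_density _"]
    by (intro Bochner_Integration.integrable_add integrable_mult_right integrable_std_normal_moment_abs)
  then have "integrable gauss (\<lambda>x. \<bar>F 0\<bar> * \<bar>x\<bar>^1 + B * \<bar>x\<bar>^2)"
    by (subst integrable_gauss_iff) auto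
  then show i1: "integrable gauss (\<lambda>x. x * F x)"
  proof (rule Bochner_Integration.integrable_bound)
    show "AE x in gauss. norm (x * F x) \<le> norm (\<bar>F 0\<bar> * \<bar>x\<bar> ^ 1 + B * \<bar>x\<bar> ^ 2)"
    proof (intro always_eventually allI)
      fix x :: real
      have "\<bar>x\<bar> * \<bar>F x\<bar> \<le> \<bar>x\<bar> * (\<bar>F 0\<bar> + B * \<bar>x\<bar>)" using growth[of x] by (intro mult_left_mono) auto
      also have "\<dots> = \<bar>F 0\<bar> * \<bar>x\<bar> ^ 1 + B * \<bar>x\<bar> ^ 2" by (simp add: algebra_simps power2_eq_square)
      finally show "norm (x * F x) \<le> norm (\<bar>F 0\<bar> * \<bar>x\<bar> ^ 1 + B * \<bar>x\<bar> ^ 2)"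
        by (simp add: abs_mult)
    qed
  qed auto
  let ?G = "\<lambda>x. - (std_normal_density x * F x)"
  let ?g = "\<lambda>x. std_normal_density x * (x * F x - F' x)"
  have ig: "integrable lborel ?g"
    using i1 iF' by (subst integrable_gauss_iff[symmetric]) (auto intro: Bochner_Integration.integrable_diff)
  have dG: "(?G has_vector_derivative ?g x) (at x)" for x
    unfolding has_real_derivative_iff_has_vector_derivative[symmetric]
    by (rule derivative_eq_intros DERIV_std_normal_density D refl)+ (simp add: algebra_simps)
  have bd: "\<bar>?G x\<bar> \<le> 2 * (\<bar>F 0\<bar> + B) / \<bar>x\<bar>" if "\<bar>x\<bar> \<ge> 1" for x
  proof -
    have "\<bar>F 0\<bar> * 1 \<le> \<bar>F 0\<bar> * \<bar>x\<bar>" using that by (intro mult_left_mono) auto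
    then have "\<bar>F x\<bar> \<le> (\<bar>F 0\<bar> + B) * \<bar>x\<bar>" using growth[of x] by (simp add: algebra_simps)
    then have "\<bar>?G x\<bar> \<le> 2 / x\<^sup>2 * ((\<bar>F 0\<bar> + B) * \<bar>x\<bar>)"
      using std_normal_density_le[of x] that unfolding abs_minus_cancel abs_mult
      by (intro mult_mono) auto
    also have "\<dots> = 2 * (\<bar>F 0\<bar> + B) / \<bar>x\<bar>" using that 
      by (simp add: power2_eq_square field_simps abs_if split: if_splits)
    finally show ?thesis .
  qed
  have lim: "(?G \<longlongrightarrow> 0) at_top" "(?G \<longlongrightarrow> 0) at_bot"
  proof -
    have "((\<lambda>x::real. 2 * (\<bar>F 0\<bar> + B) / \<bar>x\<bar>) \<longlongrightarrow> 0) at_infinity"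
      using filterlim_norm_at_top[where 'a=real]
      by (intro tendsto_divide_0[OF tendsto_const] filterlim_at_top_imp_at_infinity) (simp add: filterlim_cong[OF refl refl, of norm "\<lambda>x::real. \<bar>x\<bar>"])
    note * = this
    have *: "((\<lambda>x::real. 2 * (\<bar>F 0\<bar> + B) / \<bar>x\<bar>) \<longlongrightarrow> 0) at_top" "((\<lambda>x::real. 2 * (\<bar>F 0\<bar> + B) / \<bar>x\<bar>) \<longlongrightarrow> 0) at_bot"
      using * tendsto_mono[OF at_top_le_at_infinity] tendsto_mono[OF at_bot_le_at_infinity] by auto
    have "eventually (\<lambda>x::real. norm (?G x) \<le> 2 * (\<bar>F 0\<bar> + B) / \<bar>x\<bar>) at_top"
      using eventually_ge_at_top[of 1] by eventually_elim (simp only: real_norm_def, rule bd, simp)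
    from Lim_null_comparison[OF this *(1)] show "(?G \<longlongrightarrow> 0) at_top" .
    have "eventually (\<lambda>x::real. norm (?G x) \<le> 2 * (\<bar>F 0\<bar> + B) / \<bar>x\<bar>) at_bot"
      using eventually_le_at_bot[of "-1"] by eventually_elim (simp only: real_norm_def, rule bd, simp)
    from Lim_null_comparison[OF this *(2)] show "(?G \<longlongrightarrow> 0) at_bot" .
  qed
  have "(LBINT x=-\<infinity>..\<infinity>. ?g x) = 0 - 0"
  proof (rule interval_integral_FTC_integrable[of _ _ ?G])
    show "isCont ?g x" for x
      using cF c unfolding continuous_on_eq_continuous_at[OF open_UNIV] std_normal_density_def
      by (auto intro!: continuous_intros)
    show "set_integrable lborel (einterval (-\<infinity>) \<infinity>) ?g"
      using ig by (simp add: set_integrable_def)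
    show "((?G \<circ> real_of_ereal) \<longlongrightarrow> 0) (at_right (- \<infinity>))" "((?G \<circ> real_of_ereal) \<longlongrightarrow> 0) (at_left \<infinity>)"
      using lim by (simp_all only: ereal_tendsto_simps)
  qed (use dG in auto)
  then have "(\<integral>x. ?g x \<partial>lborel) = 0"
    by (simp add: interval_lebesgue_integral_def set_lebesgue_integral_def)
  then have "(\<integral>x. x * F x - F' x \<partial>gauss) = 0"
    by (subst integral_gauss) auto
  then show "(\<integral>x. x * F x \<partial>gauss) = (\<integral>x. F' x \<partial>gauss)"
    using Bochner_Integration.integral_diff[OF i1 iF'] by simp
qed

text \<open>Dominated convergence along sequences: by the mean value inequality, a bound on
  \<open>f'\<close> near \<open>t0\<close> also dominates the difference quotients.\<close>

lemma has_real_derivative_integral: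
  fixes f f' :: "real \<Rightarrow> 'a \<Rightarrow> real"
  assumes d: "d > 0"
    and i: "\<And>t. \<bar>t - t0\<bar> < d \<Longrightarrow> integrable M (f t)"
    and D: "\<And>t x. \<bar>t - t0\<bar> < d \<Longrightarrow> x \<in> space M \<Longrightarrow> ((\<lambda>t. f t x) has_real_derivative f' t x) (at t)"
    and B: "\<And>t x. \<bar>t - t0\<bar> < d \<Longrightarrow> x \<in> space M \<Longrightarrow> \<bar>f' t x\<bar> \<le> B x"
    and iB: "integrable M B" and m: "f' t0 \<in> borel_measurable M"
  shows "((\<lambda>t. \<integral>x. f t x \<partial>M) has_real_derivative (\<integral>x. f' t0 x \<partial>M)) (at t0)"
  unfolding has_field_derivative_iff tendsto_at_iff_sequentially comp_def
proof (intro allI impI)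
  fix X :: "nat \<Rightarrow> real"
  assume X0: "\<forall>i. X i \<in> UNIV - {t0}" and X: "X \<longlonglongrightarrow> t0"
  \<comment> \<open>The derivative and its bound are known only within \<open>d\<close> of
    \<open>t0\<close>, so an initial segment of the sequence is dropped.\<close>
  obtain N where N: "\<And>n. n \<ge> N \<Longrightarrow> \<bar>X n - t0\<bar> < d"
    using LIMSEQ_D[OF X d] by auto
  define Y where "Y n = X (n + N)" for n
  have Y: "Y \<longlonglongrightarrow> t0" unfolding Y_def by (rule LIMSEQ_ignore_initial_segment[OF X])
  have Yd: "\<bar>Y n - t0\<bar> < d" "Y n \<noteq> t0" for n using N X0 by (auto simp: Y_def)
  have "(\<lambda>n. \<integral>x. (f (Y n) x - f t0 x) / (Y n - t0) \<partial>M) \<longlonglongrightarrow> (\<integral>x. f' t0 x \<partial>M)"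
  proof (rule integral_dominated_convergence[where w = B])
    show "AE x in M. (\<lambda>n. (f (Y n) x - f t0 x) / (Y n - t0)) \<longlonglongrightarrow> f' t0 x"
    proof (rule AE_I2)
      fix x assume x: "x \<in> space M"
      have "((\<lambda>t. (f t x - f t0 x) / (t - t0)) \<longlongrightarrow> f' t0 x) (at t0)"
        using D[of t0 x] x d by (simp add: has_field_derivative_iff)
      then show "(\<lambda>n. (f (Y n) x - f t0 x) / (Y n - t0)) \<longlonglongrightarrow> f' t0 x"
        unfolding tendsto_at_iff_sequentially comp_def using Y Yd by auto
    qed
    show "AE x in M. norm ((f (Y n) x - f t0 x) / (Y n - t0)) \<le> B x" for n
    proof (rule AE_I2)
      fix x assume x: "x \<in> space M"
      have "norm (f (Y n) x - f t0 x) \<le> B x * norm (Y n - t0)"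
      proof (rule field_differentiable_bound[where S="ball t0 d" and f' = "\<lambda>t. f' t x"])
        show "((\<lambda>t. f t x) has_real_derivative f' z x) (at z within ball t0 d)" if "z \<in> ball t0 d" for z
          using D[of z x] that x by (auto simp: dist_real_def abs_minus_commute intro: has_field_derivative_at_within)
      qed (use Yd d B x in \<open>auto simp: dist_real_def abs_minus_commute\<close>)
      then show "norm ((f (Y n) x - f t0 x) / (Y n - t0)) \<le> B x"
        using Yd[of n] by (simp add: abs_divide field_simps)
    qed
    show "(\<lambda>x. (f (Y n) x - f t0 x) / (Y n - t0)) \<in> borel_measurable M" for n
      using i[OF Yd(1)[of n]] i[of t0] d by auto
  qed (use m iB in auto)
  moreover have "(\<integral>x. (f (Y n) x - f t0 x) / (Y n - t0) \<partial>M) = ((\<integral>x. f (Y n) x \<partial>M) - (\<integral>x. f t0 x \<partial>M)) / (Y n - t0)" for n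
    using i[OF Yd(1)[of n]] i[of t0] d
    by (subst Bochner_Integration.integral_divide_zero, subst Bochner_Integration.integral_diff) auto
  ultimately have "(\<lambda>n. ((\<integral>x. f (X (n + N)) x \<partial>M) - (\<integral>x. f t0 x \<partial>M)) / (X (n + N) - t0)) \<longlonglongrightarrow> (\<integral>x. f' t0 x \<partial>M)"
    by (simp only: Y_def)
  then show "(\<lambda>n. ((\<integral>x. f (X n) x \<partial>M) - (\<integral>x. f t0 x \<partial>M)) / (X n - t0)) \<longlonglongrightarrow> (\<integral>x. f' t0 x \<partial>M)"
    by (rule LIMSEQ_offset)
qed

text \<open>The mean of \<open>f\<close> under the normal law with mean \<open>x\<close> and
  variance \<open>v\<close>. In the variance, rather than the standard deviation, it evolves by the
  heat equation with factor 1/2.\<close>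

definition gauss_mean :: "(real \<Rightarrow> real) \<Rightarrow> real \<Rightarrow> real \<Rightarrow> real" where
  "gauss_mean f v x = (\<integral>z. f (sqrt v * z + x) \<partial>gauss)"

locale bounded_derivative =
  fixes f f1 :: "real \<Rightarrow> real" and B :: real
  assumes D: "\<And>x. (f has_real_derivative f1 x) (at x)"
    and c1: "continuous_on UNIV f1"
    and B: "\<And>x. \<bar>f1 x\<bar> \<le> B"
begin

lemma B_nonneg: "0 \<le> B" using B[of 0] by linarith

lemma lipschitz: "\<bar>f a - f b\<bar> \<le> B * \<bar>a - b\<bar>"
  by (rule abs_diff_le_of_deriv_bounded[OF D B])

lemma continuous: "continuous_on UNIV f"
  using D by (auto intro!: DERIV_continuous_on continuous_at_imp_continuous_on DERIV_isCont)

lemma measurable_f [measurable]: "f \<in> borel_measurable borel"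
  using continuous by (rule borel_measurable_continuous_onI)

lemma measurable_f1 [measurable]: "f1 \<in> borel_measurable borel"
  using c1 by (rule borel_measurable_continuous_onI)

lemma integrable_gauss_mean: "integrable gauss (\<lambda>z. f (a * z + x))"
proof (rule gauss_integrable_lipschitz)
  fix z
  have "\<bar>f (a * z + x) - f x\<bar> \<le> B * \<bar>a * z\<bar>" using lipschitz[of "a * z + x" x] by simp
  then show "\<bar>f (a * z + x)\<bar> \<le> \<bar>f x\<bar> + B * \<bar>a\<bar> * \<bar>z\<bar>" by (simp add: abs_mult)
qed measurable

lemma gauss_mean_lipschitz: "\<bar>gauss_mean f v x - gauss_mean f v y\<bar> \<le> B * \<bar>x - y\<bar>"
proof -
  have "gauss_mean f v x - gauss_mean f v y = (\<integral>z. f (sqrt v * z + x) - f (sqrt v * z + y) \<partial>gauss)"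
    unfolding gauss_mean_def using integrable_gauss_mean by simp
  also have "\<bar>\<dots>\<bar> \<le> (\<integral>z. \<bar>f (sqrt v * z + x) - f (sqrt v * z + y)\<bar> \<partial>gauss)"
    by (rule integral_abs_bound)
  also have "\<dots> \<le> (\<integral>z. B * \<bar>x - y\<bar> \<partial>gauss)"
    using lipschitz[of "sqrt v * z + x" "sqrt v * z + y" for z]
    by (intro integral_mono integrable_abs Bochner_Integration.integrable_diff integrable_gauss_mean) auto
  finally show ?thesis using gauss.prob_space by simp
qed

lemma gauss_mean_continuous_variance: "continuous_on UNIV (\<lambda>v. gauss_mean f v x)"
proof -
  define E where "E = (\<integral>z. \<bar>z\<bar> \<partial>gauss)"
  have E: "\<bar>gauss_mean f v x - gauss_mean f w x\<bar> \<le> B * E * \<bar>sqrt v - sqrt w\<bar>" for v w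
  proof -
    have "gauss_mean f v x - gauss_mean f w x = (\<integral>z. f (sqrt v * z + x) - f (sqrt w * z + x) \<partial>gauss)"
      unfolding gauss_mean_def using integrable_gauss_mean by simp
    also have "\<bar>\<dots>\<bar> \<le> (\<integral>z. \<bar>f (sqrt v * z + x) - f (sqrt w * z + x)\<bar> \<partial>gauss)"
      by (rule integral_abs_bound)
    also have "\<dots> \<le> (\<integral>z. B * (\<bar>sqrt v - sqrt w\<bar> * \<bar>z\<bar>) \<partial>gauss)"
    proof (rule integral_mono)
      show "\<bar>f (sqrt v * z + x) - f (sqrt w * z + x)\<bar> \<le> B * (\<bar>sqrt v - sqrt w\<bar> * \<bar>z\<bar>)" for z
        using lipschitz[of "sqrt v * z + x" "sqrt w * z + x"] by (simp flip: abs_mult left_diff_distrib)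
    qed (intro integrable_abs Bochner_Integration.integrable_diff integrable_gauss_mean integrable_mult_right
          integrable_gauss_abs)+
    finally show ?thesis by (simp add: E_def mult_ac)
  qed
  show ?thesis
    unfolding continuous_on_def
  proof
    fix w :: real
    have "((\<lambda>v. B * E * \<bar>sqrt v - sqrt w\<bar>) \<longlongrightarrow> B * E * \<bar>sqrt w - sqrt w\<bar>) (at w)"
      by (rule tendsto_mult_left[OF tendsto_rabs[OF tendsto_diff[OF tendsto_real_sqrt[OF tendsto_ident_at] tendsto_const]]])
    then have *: "((\<lambda>v. B * E * \<bar>sqrt v - sqrt w\<bar>) \<longlongrightarrow> 0) (at w)" by simp
    have "((\<lambda>v. gauss_mean f v x - gauss_mean f w x) \<longlongrightarrow> 0) (at w)"
      by (rule Lim_null_comparison[OF always_eventually *]) (simp add: E)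
    then show "((\<lambda>v. gauss_mean f v x) \<longlongrightarrow> gauss_mean f w x) (at w within UNIV)"
      by (simp add: LIM_zero_iff)
  qed
qed

lemma DERIV_gauss_mean_mean: "((\<lambda>x. gauss_mean f v x) has_real_derivative gauss_mean f1 v x) (at x)"
  unfolding gauss_mean_def
proof (rule has_real_derivative_integral[where d=1 and B="\<lambda>_. B"])
  fix t z :: real
  have "((\<lambda>t. sqrt v * z + t) has_real_derivative 1) (at t)"
    by (auto intro!: derivative_eq_intros)
  from DERIV_chain2[OF D this]
  show "((\<lambda>t. f (sqrt v * z + t)) has_real_derivative f1 (sqrt v * z + t)) (at t)" by simp
qed (use integrable_gauss_mean B in auto)

end

locale bounded_derivative2 = bounded_derivative f f1 B1 + d1: bounded_derivative f1 f2 B2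
  for f f1 f2 B1 B2
begin

text \<open>The heat equation: the increment of a Gaussian mean in the variance comes from Gaussian
  integration by parts.\<close>

lemma DERIV_gauss_mean_variance:
  assumes "v > 0"
  shows "((\<lambda>v. gauss_mean f v x) has_real_derivative gauss_mean f2 v x / 2) (at v)"
proof -
  have "((\<lambda>v. \<integral>z. f (sqrt v * z + x) \<partial>gauss) has_real_derivative
      (\<integral>z. f1 (sqrt v * z + x) * (inverse (sqrt v) / 2 * z) \<partial>gauss)) (at v)"
  \<comment> \<open>A window of half-width \<open>v / 2\<close> keeps the variance above
    \<open>v / 2\<close>, where the derivative of \<open>sqrt\<close> is bounded.\<close>
  proof (rule has_real_derivative_integral[where d="v/2" and B="\<lambda>z. B1 * (inverse (sqrt (v/2)) / 2 * \<bar>z\<bar>)" and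
        f' = "\<lambda>t z. f1 (sqrt t * z + x) * (inverse (sqrt t) / 2 * z)"])
    fix t z :: real assume "\<bar>t - v\<bar> < v / 2"
    then have t: "t > v / 2" by (auto simp: abs_if split: if_splits)
    then have t0: "t > 0" using assms by simp
    from t show "((\<lambda>t. f (sqrt t * z + x)) has_real_derivative f1 (sqrt t * z + x) * (inverse (sqrt t) / 2 * z)) (at t)"
      using assms by (intro DERIV_chain2[OF D]) (rule derivative_eq_intros refl | simp)+
    have "\<bar>f1 (sqrt t * z + x)\<bar> * (inverse (sqrt t) / 2 * \<bar>z\<bar>) \<le> B1 * (inverse (sqrt (v/2)) / 2 * \<bar>z\<bar>)"
      using t assms B B_nonneg
      by (intro mult_mono) (auto intro!: le_imp_inverse_le divide_right_mono mult_right_mono)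
    moreover have "\<bar>inverse (sqrt t) / 2 * z\<bar> = inverse (sqrt t) / 2 * \<bar>z\<bar>"
      using t0 by (simp add: abs_mult)
    ultimately show "\<bar>f1 (sqrt t * z + x) * (inverse (sqrt t) / 2 * z)\<bar> \<le> B1 * (inverse (sqrt (v/2)) / 2 * \<bar>z\<bar>)"
      by (simp only: abs_mult[of "f1 _"])
  next
    show "integrable gauss (\<lambda>z. B1 * (inverse (sqrt (v / 2)) / 2 * \<bar>z\<bar>))"
      by (intro integrable_mult_right integrable_gauss_abs)
  qed (use assms integrable_gauss_mean in auto)
  also have "(\<integral>z. f1 (sqrt v * z + x) * (inverse (sqrt v) / 2 * z) \<partial>gauss)
      = inverse (sqrt v) / 2 * (\<integral>z. z * f1 (sqrt v * z + x) \<partial>gauss)"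
    by (subst integral_mult_right_zero[symmetric]) (simp add: mult_ac)
  also have "(\<integral>z. z * f1 (sqrt v * z + x) \<partial>gauss) = (\<integral>z. f2 (sqrt v * z + x) * sqrt v \<partial>gauss)"
  proof (rule gauss_integral_by_parts(2)[where B="B2 * sqrt v"])
    show "((\<lambda>z. f1 (sqrt v * z + x)) has_real_derivative f2 (sqrt v * z + x) * sqrt v) (at z)" for z
      by (intro DERIV_chain2[OF d1.D]) (rule derivative_eq_intros refl | simp)+
    show "continuous_on UNIV (\<lambda>z. f2 (sqrt v * z + x) * sqrt v)"
      by (intro continuous_intros continuous_on_compose2[OF d1.c1]) auto
  qed (use d1.B assms in \<open>auto simp: abs_mult intro!: mult_right_mono\<close>)
  also have "inverse (sqrt v) / 2 * \<dots> = gauss_mean f2 v x / 2"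
    using assms by (simp add: gauss_mean_def)
  finally show ?thesis by (simp add: gauss_mean_def)
qed

lemma gauss_mean_mvt:
  assumes "0 \<le> v" "v < w"
  obtains u where "v < u" "u < w" "gauss_mean f w x - gauss_mean f v x = (w - v) * (gauss_mean f2 u x / 2)"
proof -
  have "continuous_on {v..w} (\<lambda>v. gauss_mean f v x)"
    by (rule continuous_on_subset[OF gauss_mean_continuous_variance]) auto
  moreover have "(\<lambda>v. gauss_mean f v x) differentiable (at u)" if "v < u" "u < w" for u
    using DERIV_gauss_mean_variance[of u x] assms that real_differentiable_def by force
  ultimately obtain l u where u: "v < u" "u < w" "DERIV (\<lambda>v. gauss_mean f v x) u :> l"
    "gauss_mean f w x - gauss_mean f v x = (w - v) * l"
    using MVT[OF assms(2)] by blast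
  have "l = gauss_mean f2 u x / 2"
    using DERIV_unique[OF u(3) DERIV_gauss_mean_variance] u assms by auto
  with u that show ?thesis by blast
qed

text \<open>After integration by parts the derivative in the variance is half a mean of
  \<open>f2\<close>; the singularity of \<open>sqrt v\<close> at 0 leaves no trace.\<close>

lemma gauss_mean_lipschitz_variance:
  assumes "0 \<le> v" "0 \<le> w"
  shows "\<bar>gauss_mean f v x - gauss_mean f w x\<bar> \<le> B2 / 2 * \<bar>v - w\<bar>"
proof -
  have b: "\<bar>gauss_mean f2 u x\<bar> \<le> B2" for u
  proof -
    have "\<bar>gauss_mean f2 u x\<bar> \<le> (\<integral>z. \<bar>f2 (sqrt u * z + x)\<bar> \<partial>gauss)"
      unfolding gauss_mean_def by (rule integral_abs_bound)
    also have "\<dots> \<le> (\<integral>z. B2 \<partial>gauss)"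
      using d1.B d1.B_nonneg by (intro integral_mono integrable_abs gauss.integrable_const_bound[of _ B2]) auto
    finally show ?thesis using gauss.prob_space by simp
  qed
  have "\<bar>gauss_mean f w x - gauss_mean f v x\<bar> \<le> B2 / 2 * (w - v)" if vw: "0 \<le> v" "v < w" for v w
  proof -
    obtain u where "gauss_mean f w x - gauss_mean f v x = (w - v) * (gauss_mean f2 u x / 2)"
      using gauss_mean_mvt[OF vw] by metis
    then have "\<bar>gauss_mean f w x - gauss_mean f v x\<bar> = (w - v) * (\<bar>gauss_mean f2 u x\<bar> / 2)"
      using vw by (simp only:) (simp add: abs_mult)
    also have "\<dots> \<le> (w - v) * (B2 / 2)" using b[of u] vw by (intro mult_left_mono) auto
    finally show ?thesis by (simp add: mult.commute)
  qed
  from this[of v w] this[of w v] assms d1.B_nonneg show ?thesis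
    by (cases v w rule: linorder_cases) (auto simp: abs_minus_commute)
qed

end

section \<open>Gaussian means of log cosh, tanh and its square\<close>

definition lncosh :: "real \<Rightarrow> real" where "lncosh x = ln (cosh x)"

lemma tanh_sq_le: "(tanh x :: real)\<^sup>2 \<le> 1"
  using tanh_real_bounds[of x] by (simp add: abs_square_le_1 abs_le_iff)

lemma tanh_abs_le: "\<bar>tanh x :: real\<bar> \<le> 1"
  using tanh_real_bounds[of x] by auto

interpretation lncosh: bounded_derivative2 lncosh tanh "\<lambda>x. 1 - (tanh x)\<^sup>2" 1 1
proof
  show "(lncosh has_real_derivative tanh x) (at x)" for x
    unfolding lncosh_def by (rule derivative_eq_intros refl | simp add: tanh_def)+
  show "(tanh has_real_derivative 1 - (tanh x)\<^sup>2) (at x)" for x :: real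
    by (rule derivative_eq_intros refl | simp)+
  show "\<bar>1 - (tanh x)\<^sup>2\<bar> \<le> 1" for x :: real using tanh_sq_le[of x] by simp
qed (use tanh_abs_le in \<open>auto intro!: continuous_intros\<close>)

text \<open>Elementary estimates in \<open>u = (tanh x)\<^sup>2\<close>, which lies in [0, 1]. The
  two constants make \<open>LQ\<close> 1-Lipschitz in the variance and 2-Lipschitz in the
  mean.\<close>

lemma tanh_sq_bounds:
  fixes x :: real
  shows "\<bar>2 * tanh x * (1 - (tanh x)\<^sup>2)\<bar> \<le> 2"
    "\<bar>(1 - (tanh x)\<^sup>2) * (2 - 6 * (tanh x)\<^sup>2)\<bar> \<le> 2"
proof -
  define u where "u = (tanh x)\<^sup>2"
  have u: "0 \<le> u" "u \<le> 1" using tanh_sq_le by (auto simp: u_def)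
  have "\<bar>2 * tanh x * (1 - u)\<bar> = 2 * (\<bar>tanh x\<bar> * (1 - u))" using u by (simp add: abs_mult)
  also have "\<bar>tanh x\<bar> * (1 - u) \<le> 1 * 1" using u tanh_abs_le by (intro mult_mono) auto
  finally show "\<bar>2 * tanh x * (1 - (tanh x)\<^sup>2)\<bar> \<le> 2" by (simp add: u_def)
  have "(1 - u) * (2 - 6 * u) = 2 - 8 * u + 6 * u\<^sup>2" by (simp add: algebra_simps power2_eq_square)
  moreover have "u\<^sup>2 \<le> u" using u by (simp add: power2_eq_square mult_left_le)
  moreover have "6 * u\<^sup>2 - 8 * u + 4 = 6 * (u - 2/3)\<^sup>2 + 4/3" by (simp add: power2_eq_square algebra_simps)
  ultimately have "\<bar>(1 - u) * (2 - 6 * u)\<bar> \<le> 2" using u zero_le_power2[of "u - 2/3"]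
    unfolding abs_le_iff by linarith
  then show "\<bar>(1 - (tanh x)\<^sup>2) * (2 - 6 * (tanh x)\<^sup>2)\<bar> \<le> 2" by (simp add: u_def)
qed

interpretation tanh_sq: bounded_derivative2 "\<lambda>x. (tanh x)\<^sup>2" "\<lambda>x. 2 * tanh x * (1 - (tanh x)\<^sup>2)"
  "\<lambda>x. (1 - (tanh x)\<^sup>2) * (2 - 6 * (tanh x)\<^sup>2)" 2 2
proof
  show "((\<lambda>x. (tanh x)\<^sup>2) has_real_derivative 2 * tanh x * (1 - (tanh x)\<^sup>2)) (at x)" for x :: real
    by (rule derivative_eq_intros refl | simp)+
  show "((\<lambda>x. 2 * tanh x * (1 - (tanh x)\<^sup>2)) has_real_derivative (1 - (tanh x)\<^sup>2) * (2 - 6 * (tanh x)\<^sup>2)) (at x)" for x :: real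
    by (rule derivative_eq_intros refl | simp)+ (simp add: power2_eq_square algebra_simps)
qed (use tanh_sq_bounds in \<open>auto intro!: continuous_intros\<close>)

text \<open>The gradient of \<open>LC\<close> is \<open>(1 - LQ) / 2\<close> in the variance and
  \<open>LT\<close> in the mean. Hence \<open>y - LC (2 * y) x\<close> has the derivative
  \<open>LQ (2 * y) x\<close> in \<open>y\<close>.\<close>

definition LC :: "real \<Rightarrow> real \<Rightarrow> real" where "LC = gauss_mean lncosh"
definition LT :: "real \<Rightarrow> real \<Rightarrow> real" where "LT = gauss_mean tanh"
definition LQ :: "real \<Rightarrow> real \<Rightarrow> real" where "LQ = gauss_mean (\<lambda>x. (tanh x)\<^sup>2)"

lemma gauss_mean_sech_sq: "gauss_mean (\<lambda>x. 1 - (tanh x)\<^sup>2) v x = 1 - LQ v x"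
  unfolding LQ_def gauss_mean_def using tanh_sq.integrable_gauss_mean gauss.prob_space by simp

lemma LQ_nonneg: "0 \<le> LQ v x"
  unfolding LQ_def gauss_mean_def by (intro integral_nonneg_AE) auto

lemma LQ_le_1: "LQ v x \<le> 1"
proof -
  have "LQ v x \<le> (\<integral>z. 1 \<partial>gauss)" unfolding LQ_def gauss_mean_def
    by (intro integral_mono tanh_sq.integrable_gauss_mean) (auto simp: tanh_sq_le)
  then show ?thesis using gauss.prob_space by simp
qed

text \<open>Otherwise the Gaussian variable would be almost surely constant and have the exponential
  moments of a constant, which fails for the exponents 1 and -1. The uniqueness argument takes the
  strict positivity of the gradient off the faces from here.\<close>

lemma LQ_pos:
  assumes "v > 0" shows "LQ v x > 0"
proof (rule ccontr)
  assume "\<not> LQ v x > 0"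
  then have "LQ v x = 0" using LQ_nonneg[of v x] by simp
  then have "AE z in gauss. (tanh (sqrt v * z + x))\<^sup>2 = 0"
    unfolding LQ_def gauss_mean_def
    by (subst (asm) integral_nonneg_eq_0_iff_AE[OF tanh_sq.integrable_gauss_mean]) auto
  then have *: "AE z in gauss. z = - x / sqrt v"
    by eventually_elim (use assms in \<open>auto simp: field_simps add_eq_0_iff\<close>)
  have "exp (a\<^sup>2 / 2) = exp (a * (- x / sqrt v))" for a
  proof -
    have "exp (a\<^sup>2 / 2) = (\<integral>z. exp (a * z) \<partial>gauss)" by (simp add: integral_gauss_exp)
    also have "\<dots> = (\<integral>z. exp (a * (- x / sqrt v)) \<partial>gauss)"
      by (rule integral_cong_AE) (use * in auto)
    finally show ?thesis using gauss.prob_space by simp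
  qed
  from this[of 1] this[of "-1"] show False by simp
qed

lemma LQ_lipschitz:
  assumes "0 \<le> v" "0 \<le> w"
  shows "\<bar>LQ v x - LQ w y\<bar> \<le> \<bar>v - w\<bar> + 2 * \<bar>x - y\<bar>"
proof -
  have "\<bar>LQ v x - LQ w x\<bar> \<le> \<bar>v - w\<bar>"
    using tanh_sq.gauss_mean_lipschitz_variance[OF assms, of x] by (simp add: LQ_def)
  moreover have "\<bar>LQ w x - LQ w y\<bar> \<le> 2 * \<bar>x - y\<bar>"
    using tanh_sq.gauss_mean_lipschitz by (simp add: LQ_def)
  ultimately show ?thesis by linarith
qed

text \<open>Taylor's formula with Lipschitz first derivatives: change the variance at mean
  \<open>y\<close>, change the mean at variance \<open>v\<close>, and pay for having taken the
  variance slope at \<open>y\<close> instead of \<open>x\<close>.\<close>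

lemma LC_remainder:
  assumes "0 \<le> v" "0 \<le> w"
  shows "\<bar>LC w y - LC v x - (1 - LQ v x) / 2 * (w - v) - LT v x * (y - x)\<bar> \<le> 2 * (\<bar>w - v\<bar> + \<bar>y - x\<bar>)\<^sup>2"
proof -
  have 1: "\<bar>LC w y - LC v y - (1 - LQ v y) / 2 * (w - v)\<bar> \<le> (w - v)\<^sup>2"
  proof -
    \<comment> \<open>The mean value theorem is applied upwards from the smaller variance, since
      that end may be 0.\<close>
    have "\<exists>u. min v w \<le> u \<and> u \<le> max v w \<and> LC w y - LC v y = (w - v) * ((1 - LQ u y) / 2)"
    proof (cases v w rule: linorder_cases)
      case less
      obtain u where "v < u" "u < w" "LC w y - LC v y = (w - v) * ((1 - LQ u y) / 2)"
        using lncosh.gauss_mean_mvt[OF assms(1) less, of y] unfolding LC_def gauss_mean_sech_sq by metis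
      then show ?thesis by (intro exI[of _ u]) auto
    next
      case greater
      obtain u where "w < u" "u < v" "LC v y - LC w y = (v - w) * ((1 - LQ u y) / 2)"
        using lncosh.gauss_mean_mvt[OF assms(2) greater, of y] unfolding LC_def gauss_mean_sech_sq by metis
      then show ?thesis by (intro exI[of _ u]) (auto simp: algebra_simps)
    qed auto
    then obtain u where u: "min v w \<le> u" "u \<le> max v w" "LC w y - LC v y = (w - v) * ((1 - LQ u y) / 2)" by blast
    have "LC w y - LC v y - (1 - LQ v y) / 2 * (w - v) = (w - v) * ((LQ v y - LQ u y) / 2)"
      unfolding u by (simp add: field_simps)
    then have "\<bar>LC w y - LC v y - (1 - LQ v y) / 2 * (w - v)\<bar> = \<bar>w - v\<bar> * (\<bar>LQ v y - LQ u y\<bar> / 2)"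
      by (simp only:) (simp add: abs_mult)
    also have "\<bar>LQ v y - LQ u y\<bar> / 2 \<le> \<bar>w - v\<bar>"
    proof -
      have "0 \<le> u" "\<bar>v - u\<bar> \<le> \<bar>w - v\<bar>" using u(1,2) assms by linarith+
      then have "\<bar>LQ v y - LQ u y\<bar> \<le> \<bar>w - v\<bar>"
        using LQ_lipschitz[of v u y y] assms by (auto intro: order_trans)
      moreover have "a / 2 \<le> b" if "a \<le> b" "0 \<le> a" for a b :: real using that by linarith
      ultimately show ?thesis by (meson abs_ge_zero)
    qed
    then have "\<bar>w - v\<bar> * (\<bar>LQ v y - LQ u y\<bar> / 2) \<le> \<bar>w - v\<bar> * \<bar>w - v\<bar>" by (rule mult_left_mono) simp
    finally show ?thesis by (simp add: power2_eq_square)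
  qed
  have 2: "\<bar>LC v y - LC v x - LT v x * (y - x)\<bar> \<le> (y - x)\<^sup>2"
  proof -
    have "\<exists>u. \<bar>u - x\<bar> \<le> \<bar>y - x\<bar> \<and> LC v y - LC v x = (y - x) * LT v u"
    proof (cases x y rule: linorder_cases)
      case less
      from MVT2[OF less lncosh.DERIV_gauss_mean_mean[of v]] show ?thesis by (force simp: LC_def LT_def)
    next
      case greater
      from MVT2[OF greater lncosh.DERIV_gauss_mean_mean[of v]] obtain u where
        "y < u" "u < x" "LC v x - LC v y = (x - y) * LT v u" by (auto simp: LC_def LT_def)
      then show ?thesis by (intro exI[of _ u]) (auto simp: algebra_simps)
    qed auto
    then obtain u where u: "\<bar>u - x\<bar> \<le> \<bar>y - x\<bar>" "LC v y - LC v x = (y - x) * LT v u" by blast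
    have "\<bar>LT v u - LT v x\<bar> \<le> \<bar>u - x\<bar>" using lncosh.d1.gauss_mean_lipschitz[of v u x] by (simp add: LT_def)
    then have "\<bar>y - x\<bar> * \<bar>LT v u - LT v x\<bar> \<le> \<bar>y - x\<bar> * \<bar>y - x\<bar>" using u by (intro mult_left_mono) auto
    moreover have "LC v y - LC v x - LT v x * (y - x) = (y - x) * (LT v u - LT v x)" unfolding u by (simp add: algebra_simps)
    ultimately show ?thesis by (simp add: abs_mult[symmetric] power2_eq_square)
  qed
  have 3: "\<bar>(LQ v x - LQ v y) / 2 * (w - v)\<bar> \<le> \<bar>y - x\<bar> * \<bar>w - v\<bar>"
    unfolding abs_mult using LQ_lipschitz[OF assms(1,1), of x y] by (intro mult_right_mono) (auto simp: abs_minus_commute)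
  have "LC w y - LC v x - (1 - LQ v x) / 2 * (w - v) - LT v x * (y - x) =
    (LC w y - LC v y - (1 - LQ v y) / 2 * (w - v)) + (LC v y - LC v x - LT v x * (y - x)) + (LQ v x - LQ v y) / 2 * (w - v)"
    by (simp add: field_simps)
  then have "\<bar>LC w y - LC v x - (1 - LQ v x) / 2 * (w - v) - LT v x * (y - x)\<bar> \<le> (w - v)\<^sup>2 + (y - x)\<^sup>2 + \<bar>y - x\<bar> * \<bar>w - v\<bar>"
    using 1 2 3 by linarith
  also have "\<dots> \<le> 2 * (\<bar>w - v\<bar> + \<bar>y - x\<bar>)\<^sup>2"
    by (simp add: power2_sum abs_mult[symmetric]) (simp add: abs_mult)
  finally show ?thesis .
qed

text \<open>The Gaussian law is symmetric and \<open>cosh\<close> is even; this is how the random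
  signs in front of the field disappear from the limit.\<close>

lemma LC_uminus: "LC v (- x) = LC v x"
proof -
  have "LC v (- x) = (\<integral>z. lncosh (sqrt v * (- z) + - x) \<partial>gauss)"
    unfolding LC_def gauss_mean_def by (rule integral_gauss_uminus[symmetric]) measurable
  also have "\<dots> = (\<integral>z. lncosh (- (sqrt v * z + x)) \<partial>gauss)" by (simp add: algebra_simps)
  finally show ?thesis unfolding LC_def gauss_mean_def lncosh_def cosh_minus .
qed

lemma LQ_uminus: "LQ v (- x) = LQ v x"
proof -
  have "LQ v (- x) = (\<integral>z. (tanh (sqrt v * (- z) + - x))\<^sup>2 \<partial>gauss)"
    unfolding LQ_def gauss_mean_def by (rule integral_gauss_uminus[symmetric]) measurable
  also have "\<dots> = (\<integral>z. (tanh (- (sqrt v * z + x)))\<^sup>2 \<partial>gauss)" by (simp add: algebra_simps)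
  finally show ?thesis unfolding LQ_def gauss_mean_def tanh_minus by simp
qed

section \<open>Concentration for sub-Gaussian product measures\<close>

text \<open>The left side is the exponential moment of a variable with values in {-1, 1} and mean
  \<open>m\<close>, so this is Hoeffding's lemma. The case \<open>u < 0\<close> follows by flipping
  both signs.\<close>

lemma cosh_add_sinh_le:
  fixes u m :: real
  assumes "\<bar>m\<bar> \<le> 1"
  shows "cosh u + m * sinh u \<le> exp (u * m + u\<^sup>2 / 2)"
proof -
  have *: "cosh u + m * sinh u \<le> exp (u * m + u\<^sup>2 / 2)" if "\<bar>m\<bar> \<le> 1" "u \<ge> 0" for u m :: real
  proof -
    have pos: "cosh u + m * sinh u > 0"
    proof -
      have "\<bar>m * sinh u\<bar> \<le> 1 * sinh u" unfolding abs_mult using that by (intro mult_mono) auto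
      moreover have "sinh u < cosh u" by (simp add: cosh_def sinh_def field_simps)
      ultimately show ?thesis by (auto simp: abs_le_iff)
    qed
    have "1 + (1 + m) / 2 * (exp (2 * u) - 1) = exp u * (cosh u + m * sinh u)"
    proof -
      have "exp (2 * u) = exp u * exp u" by (simp flip: exp_add)
      then show ?thesis unfolding cosh_def sinh_def exp_minus by (simp only:) (simp add: field_simps)
    qed
    then have "ln (1 + (1 + m) / 2 * (exp (2 * u) - 1)) = u + ln (cosh u + m * sinh u)"
      using pos by (simp add: ln_mult)
    then have "ln (cosh u + m * sinh u) \<le> u * m + u\<^sup>2 / 2"
      using Hoeffdings_lemma_aux[of "2 * u" "(1 + m) / 2"] that by (simp add: field_simps power2_eq_square abs_le_iff)
    then show ?thesis using pos by (metis exp_le_cancel_iff exp_ln)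
  qed
  show ?thesis
  proof (cases "u \<ge> 0")
    case False
    with *[of "- m" "- u"] assms show ?thesis by simp
  qed (use * assms in simp)
qed

text \<open>The product of the two exponential moments is that of \<open>X - X'\<close> for an
  independent copy \<open>X'\<close>. In this symmetrized form the condition needs no centring and
  passes directly to Lipschitz images.\<close>

definition sub_gaussian :: "real measure \<Rightarrow> bool" where
  "sub_gaussian \<mu> \<longleftrightarrow> prob_space \<mu> \<and> sets \<mu> = sets borel \<and>
     (\<forall>a. integrable \<mu> (\<lambda>x. exp (a * x))) \<and>
     (\<forall>a. (\<integral>x. exp (a * x) \<partial>\<mu>) * (\<integral>x. exp (- a * x) \<partial>\<mu>) \<le> exp (a\<^sup>2))"

lemma sub_gaussian_prob_space: "sub_gaussian \<mu> \<Longrightarrow> prob_space \<mu>"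
  and sub_gaussian_sets: "sub_gaussian \<mu> \<Longrightarrow> sets \<mu> = sets borel"
  and sub_gaussian_exp: "sub_gaussian \<mu> \<Longrightarrow> integrable \<mu> (\<lambda>x. exp (a * x))"
  and sub_gaussian_mgf: "sub_gaussian \<mu> \<Longrightarrow> (\<integral>x. exp (a * x) \<partial>\<mu>) * (\<integral>x. exp (- a * x) \<partial>\<mu>) \<le> exp (a\<^sup>2)"
  unfolding sub_gaussian_def by blast+

lemma sub_gaussian_gauss: "sub_gaussian gauss"
  unfolding sub_gaussian_def using gauss.prob_space_axioms
  by (auto simp: integrable_gauss_exp integral_gauss_exp integral_gauss_exp[of "- a" for a, simplified] simp flip: exp_add)

lemma prob_space_rademacher: "prob_space rademacher"
  unfolding rademacher_def by (rule prob_space.prob_space_distr) (auto intro: measure_pmf.prob_space_axioms)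

lemma sets_rademacher [simp, measurable_cong]: "sets rademacher = sets borel"
  by (simp add: rademacher_def)

lemma integral_rademacher:
  fixes f :: "real \<Rightarrow> real"
  assumes "f \<in> borel_measurable borel"
  shows "(\<integral>x. f x \<partial>rademacher) = (f 1 + f (- 1)) / 2"
  unfolding rademacher_def using assms
  by (subst integral_distr) (auto simp: integral_pmf_of_set)

lemma integrable_rademacher:
  fixes f :: "real \<Rightarrow> real"
  assumes "f \<in> borel_measurable borel"
  shows "integrable rademacher f"
  unfolding rademacher_def using assms
  by (subst integrable_distr_eq) (auto intro!: integrable_measure_pmf_finite)

lemma AE_rademacher: "AE x in rademacher. x \<in> {-1, 1}"
  unfolding rademacher_def by (subst AE_distr_iff) (auto simp: AE_measure_pmf_iff)

lemma sub_gaussian_rademacher: "sub_gaussian rademacher"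
proof -
  have "cosh a * cosh a \<le> exp (a\<^sup>2)" for a :: real
  proof -
    have "cosh a * cosh a \<le> exp (a\<^sup>2 / 2) * exp (a\<^sup>2 / 2)"
      using cosh_add_sinh_le[of 0 a] by (intro mult_mono) auto
    then show ?thesis by (simp flip: exp_add)
  qed
  moreover have "(\<integral>x. exp (a * x) \<partial>rademacher) = cosh a" for a :: real
    by (subst integral_rademacher) (auto simp: cosh_def)
  moreover have "(\<integral>x. exp (- a * x) \<partial>rademacher) = cosh a" for a :: real
    by (subst integral_rademacher) (auto simp: cosh_def)
  ultimately show ?thesis
    unfolding sub_gaussian_def using prob_space_rademacher
    by (simp add: integrable_rademacher)
qed

text \<open>With an independent copy \<open>X'\<close>, the distance of \<open>\<phi> X\<close> and
  \<open>\<phi> X'\<close> is at most \<open>L\<close> times that of \<open>X\<close> and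
  \<open>X'\<close>, and cosh is monotone in the absolute value; this carries the symmetrized bound
  over to \<open>\<phi> X\<close>. Jensen's inequality then replaces the copy by the mean.\<close>

lemma sub_gaussian_lipschitz:
  fixes \<phi> :: "real \<Rightarrow> real"
  assumes "sub_gaussian \<mu>" and [measurable]: "\<phi> \<in> borel_measurable borel"
    and L: "\<And>x y. \<bar>\<phi> x - \<phi> y\<bar> \<le> L * \<bar>x - y\<bar>"
  shows "integrable \<mu> \<phi>" "integrable \<mu> (\<lambda>x. exp (\<phi> x))"
    "(\<integral>x. exp (\<phi> x - integral\<^sup>L \<mu> \<phi>) \<partial>\<mu>) \<le> exp (L\<^sup>2)"
proof -
  interpret prob_space \<mu> by (rule sub_gaussian_prob_space[OF assms(1)])
  have [measurable_cong]: "sets \<mu> = sets borel" by (rule sub_gaussian_sets[OF assms(1)])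
  have ie: "integrable \<mu> (\<lambda>x. exp (a * x))" for a by (rule sub_gaussian_exp[OF assms(1)])
  have L0: "L \<ge> 0" using L[of 1 0] by simp
  have bound: "exp \<bar>a * x\<bar> \<le> exp (a * x) + exp (- a * x)" for a x :: real
    by (cases "a * x \<ge> 0") auto
  have exp_int: "integrable \<mu> (\<lambda>x. exp (s * \<phi> x))" if "\<bar>s\<bar> = 1" for s
  proof (rule Bochner_Integration.integrable_bound)
    show "integrable \<mu> (\<lambda>x. exp \<bar>\<phi> 0\<bar> * (exp (L * x) + exp (- L * x)))"
      by (intro integrable_mult_right Bochner_Integration.integrable_add ie)
    show "AE x in \<mu>. norm (exp (s * \<phi> x)) \<le> norm (exp \<bar>\<phi> 0\<bar> * (exp (L * x) + exp (- L * x)))"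
    proof (intro always_eventually allI)
      fix x
      have "s * \<phi> x \<le> \<bar>s * \<phi> x\<bar>" by simp
      also have "\<dots> \<le> \<bar>\<phi> 0\<bar> + \<bar>L * x\<bar>" using L[of x 0] that L0 by (simp add: abs_mult)
      finally have "exp (s * \<phi> x) \<le> exp \<bar>\<phi> 0\<bar> * exp \<bar>L * x\<bar>" by (simp flip: exp_add)
      also have "\<dots> \<le> exp \<bar>\<phi> 0\<bar> * (exp (L * x) + exp (- L * x))"
        by (intro mult_left_mono bound) auto
      finally show "norm (exp (s * \<phi> x)) \<le> norm (exp \<bar>\<phi> 0\<bar> * (exp (L * x) + exp (- L * x)))"
        by (simp add: abs_mult)
    qed
  qed measurable
  have i1: "integrable \<mu> (\<lambda>x. exp (\<phi> x))" and i2: "integrable \<mu> (\<lambda>x. exp (- \<phi> x))"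
    using exp_int[of 1] exp_int[of "-1"] by auto
  show "integrable \<mu> (\<lambda>x. exp (\<phi> x))" by (rule i1)
  show i0: "integrable \<mu> \<phi>"
  proof (rule Bochner_Integration.integrable_bound)
    show "integrable \<mu> (\<lambda>x. exp (\<phi> x) + exp (- \<phi> x))" using i1 i2 by simp
    show "AE x in \<mu>. norm (\<phi> x) \<le> norm (exp (\<phi> x) + exp (- \<phi> x))"
    proof (intro always_eventually allI)
      fix x
      show "norm (\<phi> x) \<le> norm (exp (\<phi> x) + exp (- \<phi> x))"
        using exp_ge_add_one_self[of "\<phi> x"] exp_ge_add_one_self[of "- \<phi> x"] exp_gt_zero[of "\<phi> x"] exp_gt_zero[of "- \<phi> x"]
        unfolding real_norm_def by linarith
    qed
  qed measurable
  define c where "c = integral\<^sup>L \<mu> \<phi>"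
  define A where "A = (\<integral>x. exp (\<phi> x) \<partial>\<mu>)"
  define A' where "A' = (\<integral>x. exp (- \<phi> x) \<partial>\<mu>)"
  define C where "C = (\<integral>x. exp (L * x) \<partial>\<mu>)"
  define C' where "C' = (\<integral>x. exp (- L * x) \<partial>\<mu>)"
  have cosh_mono: "exp (\<phi> x) * exp (- \<phi> y) + exp (- \<phi> x) * exp (\<phi> y)
       \<le> exp (L * x) * exp (- L * y) + exp (- L * x) * exp (L * y)" for x y
  proof -
    have "cosh \<bar>\<phi> x - \<phi> y\<bar> \<le> cosh \<bar>L * (x - y)\<bar>"
      using L[of x y] L0 by (subst cosh_real_nonneg_le_iff) (auto simp: abs_mult)
    then have "cosh (\<phi> x - \<phi> y) \<le> cosh (L * (x - y))" by simp
    then show ?thesis by (simp add: cosh_def algebra_simps flip: exp_add)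
  qed
  have "2 * (A * A') = (\<integral>y. A * exp (- \<phi> y) + A' * exp (\<phi> y) \<partial>\<mu>)"
    using i1 i2 by (simp add: A_def A'_def)
  also have "\<dots> = (\<integral>y. (\<integral>x. exp (\<phi> x) * exp (- \<phi> y) + exp (- \<phi> x) * exp (\<phi> y) \<partial>\<mu>) \<partial>\<mu>)"
    using i1 i2 by (simp add: A_def A'_def)
  also have "\<dots> \<le> (\<integral>y. (\<integral>x. exp (L * x) * exp (- L * y) + exp (- L * x) * exp (L * y) \<partial>\<mu>) \<partial>\<mu>)"
    using i1 i2 ie ie[of "- L"] by (intro integral_mono cosh_mono) (auto simp: A_def[symmetric])
  also have "\<dots> = (\<integral>y. C * exp (- L * y) + C' * exp (L * y) \<partial>\<mu>)"
    using ie ie[of "- L"] by (simp add: C_def C'_def)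
  also have "\<dots> = 2 * (C * C')"
    using ie ie[of "- L"] by (simp add: C_def C'_def)
  finally have AA:  "A * A' \<le> exp (L\<^sup>2)"
    using sub_gaussian_mgf[OF assms(1), of L] unfolding C_def C'_def by linarith
  \<comment> \<open>Jensen's inequality by way of the tangent line of exp: the mean of
    \<open>exp (c - \<phi> x)\<close> is at least 1, so the factor \<open>A'\<close> can be
    removed.\<close>
  have "(\<integral>x. 1 - (\<phi> x - c) \<partial>\<mu>) \<le> (\<integral>x. exp c * exp (- \<phi> x) \<partial>\<mu>)"
  proof (rule integral_mono)
    show "1 - (\<phi> x - c) \<le> exp c * exp (- \<phi> x)" for x
      using exp_ge_add_one_self[of "c - \<phi> x"] by (simp add: exp_diff exp_minus divide_inverse)
  qed (use i0 i2 in auto)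
  then have "1 \<le> exp c * A'" using i0 prob_space by (simp add: A'_def c_def)
  moreover have "0 \<le> A" unfolding A_def by (intro integral_nonneg_AE) auto
  ultimately have "exp (- c) * A * 1 \<le> exp (- c) * A * (exp c * A')" by (intro mult_left_mono) auto
  also have "\<dots> = A * A'" by (simp add: mult_exp_exp mult_ac)
  finally have "exp (- c) * A \<le> exp (L\<^sup>2)" using AA by simp
  then show "(\<integral>x. exp (\<phi> x - integral\<^sup>L \<mu> \<phi>) \<partial>\<mu>) \<le> exp (L\<^sup>2)"
    using i1 by (simp add: A_def c_def exp_diff exp_minus divide_inverse mult.commute)
qed

text \<open>With the other coordinates frozen, the one-dimensional bound has the constant
  \<open>exp ((L i)\<^sup>2)\<close>, which does not depend on them and so factors out of the
  remaining integral.\<close>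

lemma integrate_out_coordinate:
  fixes F :: "('i \<Rightarrow> real) \<Rightarrow> real" and L :: "'i \<Rightarrow> real"
  assumes \<mu>: "\<And>k. sub_gaussian (\<mu> k)" and insert: "finite J" "i \<notin> J"
    and mF [measurable]: "F \<in> borel_measurable (PiM (insert i J) \<mu>)"
    and LF': "\<forall>j\<in>insert i J. \<forall>z s t. \<bar>F (z(j := s)) - F (z(j := t))\<bar> \<le> L j * \<bar>s - t\<bar>"
  defines "G \<equiv> (\<lambda>x. \<integral>y. F (x(i := y)) \<partial>\<mu> i)"
  shows "G \<in> borel_measurable (PiM J \<mu>)"
    and "\<And>z j s t. j \<in> J \<Longrightarrow> \<bar>G (z(j := s)) - G (z(j := t))\<bar> \<le> L j * \<bar>s - t\<bar>"
    and "(\<integral>\<^sup>+z. ennreal (exp (F z - c)) \<partial>PiM (insert i J) \<mu>)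
      \<le> ennreal (exp ((L i)\<^sup>2)) * (\<integral>\<^sup>+z. ennreal (exp (G z - c)) \<partial>PiM J \<mu>)"
proof -
  have LF: "\<bar>F (z(j := s)) - F (z(j := t))\<bar> \<le> L j * \<bar>s - t\<bar>" if "j \<in> insert i J" for z j s t
    using LF' that by blast
  have pr: "prob_space (\<mu> l)" for l by (rule sub_gaussian_prob_space[OF \<mu>])
  have psf: "product_sigma_finite \<mu>"
    by (rule product_sigma_finite.intro) (rule prob_space_imp_sigma_finite[OF pr])
  have sets_\<mu>: "sets (\<mu> i) = sets borel" by (rule sub_gaussian_sets[OF \<mu>])
    \<comment> \<open>The Lipschitz hypothesis covers every \<open>x\<close>, also outside the
      product space, so each section is continuous and hence measurable.\<close>
    have Fm: "(\<lambda>y. F (x(i := y))) \<in> borel_measurable borel" for x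
    proof -
      have "continuous_on UNIV (\<lambda>y. F (x(i := y)))"
      proof (rule continuous_on_subset[OF lipschitz_on_continuous_on])
        show "(max 0 (L i))-lipschitz_on UNIV (\<lambda>y. F (x(i := y)))"
        proof (rule lipschitz_onI)
          fix s t
          have "\<bar>F (x(i := s)) - F (x(i := t))\<bar> \<le> L i * \<bar>s - t\<bar>" by (rule LF) simp
          also have "\<dots> \<le> max 0 (L i) * \<bar>s - t\<bar>" by (rule mult_right_mono) auto
          finally show "dist (F (x(i := s))) (F (x(i := t))) \<le> max 0 (L i) * dist s t"
            by (simp add: dist_real_def)
        qed simp
      qed auto
      then show ?thesis by (rule borel_measurable_continuous_onI)
    qed
    have lip: "\<bar>F (x(i := s)) - F (x(i := t))\<bar> \<le> L i * \<bar>s - t\<bar>" for x s t using LF by auto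
    note sg = sub_gaussian_lipschitz[OF \<mu>[of i] Fm lip]
    have Fint: "integrable (\<mu> i) (\<lambda>y. F (x(i := y)))" for x by (rule sg(1))
    have Fpair [measurable]: "(\<lambda>(x, y). F (x(i := y))) \<in> borel_measurable (PiM J \<mu> \<Otimes>\<^sub>M \<mu> i)"
      using measurable_comp[OF measurable_add_dim mF] by (simp add: comp_def case_prod_beta)
    show mG [measurable]: "G \<in> borel_measurable (PiM J \<mu>)"
      unfolding G_def using Fpair by (intro sigma_finite_measure.borel_measurable_lebesgue_integral[OF prob_space_imp_sigma_finite[OF pr]]) (simp add: case_prod_beta)
    show "\<bar>G (z(j := s)) - G (z(j := t))\<bar> \<le> L j * \<bar>s - t\<bar>" if "j \<in> J" for z j s t
    proof -
      have ji: "j \<noteq> i" using that insert by auto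
      have "G (z(j := s)) - G (z(j := t)) = (\<integral>y. F (z(j := s, i := y)) - F (z(j := t, i := y)) \<partial>\<mu> i)"
        unfolding G_def using Fint by simp
      also have "\<bar>\<dots>\<bar> \<le> (\<integral>y. \<bar>F (z(j := s, i := y)) - F (z(j := t, i := y))\<bar> \<partial>\<mu> i)"
        by (rule integral_abs_bound)
      also have "\<dots> \<le> (\<integral>y. L j * \<bar>s - t\<bar> \<partial>\<mu> i)"
      proof (rule integral_mono)
        show "\<bar>F (z(j := s, i := y)) - F (z(j := t, i := y))\<bar> \<le> L j * \<bar>s - t\<bar>" for y
        proof -
          have e: "z(j := u, i := y) = z(i := y, j := u)" for u by (rule fun_upd_twist[OF ji])
          show ?thesis unfolding e[of s] e[of t] by (rule LF[OF insertI2[OF that]])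
        qed
        show "integrable (\<mu> i) (\<lambda>y. \<bar>F (z(j := s, i := y)) - F (z(j := t, i := y))\<bar>)"
          by (intro integrable_abs Bochner_Integration.integrable_diff Fint)
        show "integrable (\<mu> i) (\<lambda>y. L j * \<bar>s - t\<bar>)"
          by (rule finite_measure.integrable_const[OF prob_space.finite_measure[OF pr]])
      qed
      finally show ?thesis using prob_space.prob_space[OF pr[of i]] by simp
    qed
    have "(\<integral>\<^sup>+z. ennreal (exp (F z - c)) \<partial>PiM (insert i J) \<mu>)
      = (\<integral>\<^sup>+x. (\<integral>\<^sup>+y. ennreal (exp (F (x(i := y)) - c)) \<partial>\<mu> i) \<partial>PiM J \<mu>)"
      by (rule product_sigma_finite.product_nn_integral_insert[OF psf]) (use insert(1,2) mF in simp_all)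
    also have "\<dots> \<le> (\<integral>\<^sup>+x. ennreal (exp ((L i)\<^sup>2)) * ennreal (exp (G x - c)) \<partial>PiM J \<mu>)"
    proof (rule nn_integral_mono)
      fix x
      have i: "integrable (\<mu> i) (\<lambda>y. exp (F (x(i := y)) - G x))" using sg(2)[of x] by (simp add: exp_diff)
      have "(\<integral>\<^sup>+y. ennreal (exp (F (x(i := y)) - c)) \<partial>\<mu> i) = (\<integral>\<^sup>+y. ennreal (exp (G x - c)) * ennreal (exp (F (x(i := y)) - G x)) \<partial>\<mu> i)"
        by (intro nn_integral_cong) (simp flip: ennreal_mult' exp_add)
      also have "\<dots> = ennreal (exp (G x - c)) * (\<integral>\<^sup>+y. ennreal (exp (F (x(i := y)) - G x)) \<partial>\<mu> i)"
        by (rule nn_integral_cmult, rule measurable_compose[OF borel_measurable_integrable[OF i] measurable_ennreal])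
      also have "\<dots> \<le> ennreal (exp (G x - c)) * ennreal (exp ((L i)\<^sup>2))"
      proof (rule mult_left_mono)
        have "(\<integral>\<^sup>+y. ennreal (exp (F (x(i := y)) - G x)) \<partial>\<mu> i) = ennreal (\<integral>y. exp (F (x(i := y)) - G x) \<partial>\<mu> i)"
          using i by (intro nn_integral_eq_integral) auto
        also have "\<dots> \<le> ennreal (exp ((L i)\<^sup>2))"
          using sg(3)[of x] by (intro ennreal_leI) (simp add: G_def)
        finally show "(\<integral>\<^sup>+y. ennreal (exp (F (x(i := y)) - G x)) \<partial>\<mu> i) \<le> ennreal (exp ((L i)\<^sup>2))" .
      qed (rule zero_le)
      finally show "(\<integral>\<^sup>+y. ennreal (exp (F (x(i := y)) - c)) \<partial>\<mu> i) \<le> ennreal (exp ((L i)\<^sup>2)) * ennreal (exp (G x - c))"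
        by (simp only: mult.commute)
    qed
    also have "\<dots> = ennreal (exp ((L i)\<^sup>2)) * (\<integral>\<^sup>+x. ennreal (exp (G x - c)) \<partial>PiM J \<mu>)"
      by (intro nn_integral_cmult) measurable
    finally show "(\<integral>\<^sup>+z. ennreal (exp (F z - c)) \<partial>PiM (insert i J) \<mu>)
      \<le> ennreal (exp ((L i)\<^sup>2)) * (\<integral>\<^sup>+z. ennreal (exp (G z - c)) \<partial>PiM J \<mu>)" .
qed

text \<open>Coordinatewise Lipschitz functions of independent sub-Gaussian variables: integrating out one
  coordinate at a time preserves the Lipschitz bounds for the remaining ones.\<close>

lemma sub_gaussian_tensorization:
  fixes F :: "('i \<Rightarrow> real) \<Rightarrow> real"
  assumes \<mu>: "\<And>k. sub_gaussian (\<mu> k)" and "finite J"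
    and "F \<in> borel_measurable (PiM J \<mu>)"
    and "\<And>z k s t. k \<in> J \<Longrightarrow> \<bar>F (z(k := s)) - F (z(k := t))\<bar> \<le> L k * \<bar>s - t\<bar>"
  shows "integrable (PiM J \<mu>) F \<and>
    (\<integral>\<^sup>+z. ennreal (exp (F z - integral\<^sup>L (PiM J \<mu>) F)) \<partial>PiM J \<mu>) \<le> ennreal (exp (\<Sum>k\<in>J. (L k)\<^sup>2))"
  using assms(2-)
proof (induction J arbitrary: F rule: finite_induct)
  case empty
  have "prob_space (PiM {} \<mu>)" by (rule prob_space_PiM) (rule sub_gaussian_prob_space[OF \<mu>])
  then interpret P: prob_space "PiM {} \<mu>" .
  have sp: "space (PiM {} \<mu>) = {\<lambda>_. undefined}" by (simp add: space_PiM)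
  have eq: "F z = F (\<lambda>_. undefined)" if "z \<in> space (PiM {} \<mu>)" for z using that by (simp add: sp)
  have "integral\<^sup>L (PiM {} \<mu>) F = (\<integral>z. F (\<lambda>_. undefined) \<partial>PiM {} \<mu>)"
    by (intro Bochner_Integration.integral_cong refl) (rule eq)
  then have int: "integral\<^sup>L (PiM {} \<mu>) F = F (\<lambda>_. undefined)" using P.prob_space by simp
  have "integrable (PiM {} \<mu>) F"
  proof (rule P.integrable_const_bound[of _ "\<bar>F (\<lambda>_. undefined)\<bar>"])
    show "AE z in PiM {} \<mu>. norm (F z) \<le> \<bar>F (\<lambda>_. undefined)\<bar>"
      by (rule AE_I2) (metis eq order_refl real_norm_def)
  qed (rule empty)
  moreover have "(\<integral>\<^sup>+z. ennreal (exp (F z - integral\<^sup>L (PiM {} \<mu>) F)) \<partial>PiM {} \<mu>) = (\<integral>\<^sup>+z. 1 \<partial>PiM {} \<mu>)"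
    by (intro nn_integral_cong) (subst eq, assumption, simp add: int)
  ultimately show ?case using P.emeasure_space_1 by simp
next
  case (insert i J)
  have pr: "prob_space (\<mu> l)" for l by (rule sub_gaussian_prob_space[OF \<mu>])
  have psf: "product_sigma_finite \<mu>"
    by (rule product_sigma_finite.intro) (rule prob_space_imp_sigma_finite[OF pr])
  have prJ: "prob_space (PiM (insert i J) \<mu>)" by (rule prob_space_PiM[OF pr])
  have sets_\<mu>: "sets (\<mu> i) = sets borel" by (rule sub_gaussian_sets[OF \<mu>])
  define G where "G x = (\<integral>y. F (x(i := y)) \<partial>\<mu> i)" for x
  define c where "c = integral\<^sup>L (PiM J \<mu>) G"
  have LF: "\<forall>j\<in>insert i J. \<forall>z s t. \<bar>F (z(j := s)) - F (z(j := t))\<bar> \<le> L j * \<bar>s - t\<bar>"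
    using insert.prems(2) by blast
  note out = integrate_out_coordinate[OF \<mu> insert(1,2) insert.prems(1) LF, folded G_def]
  have [measurable]: "F \<in> borel_measurable (PiM (insert i J) \<mu>)" by (rule insert.prems(1))
  have IH: "integrable (PiM J \<mu>) G" "(\<integral>\<^sup>+z. ennreal (exp (G z - c)) \<partial>PiM J \<mu>) \<le> ennreal (exp (\<Sum>k\<in>J. (L k)\<^sup>2))"
    using insert.IH[OF out(1,2)] unfolding c_def by auto
  \<comment> \<open>The same bounds for \<open>- F\<close>. Exponential moments of both signs
    dominate the absolute value of \<open>F - c\<close> and make \<open>F\<close> integrable, after
    which Fubini identifies \<open>c\<close> as its mean.\<close>
  have mF': "(\<lambda>z. - F z) \<in> borel_measurable (PiM (insert i J) \<mu>)" by measurable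
  have LF': "\<forall>j\<in>insert i J. \<forall>z s t. \<bar>- F (z(j := s)) - - F (z(j := t))\<bar> \<le> L j * \<bar>s - t\<bar>"
    using LF by (simp only: minus_diff_minus abs_minus_cancel)
  note out' = integrate_out_coordinate[OF \<mu> insert(1,2) mF' LF', unfolded Bochner_Integration.integral_minus, folded G_def]
  have IH': "(\<integral>\<^sup>+z. ennreal (exp (- G z - - c)) \<partial>PiM J \<mu>) \<le> ennreal (exp (\<Sum>k\<in>J. (L k)\<^sup>2))"
    using insert.IH[OF out'(1,2)] unfolding c_def by simp
  have fin: "ennreal x * ennreal y < \<infinity>" for x y by (simp add: ennreal_mult_less_top)
  have bd: "(\<integral>\<^sup>+z. ennreal (exp (F z - c)) \<partial>PiM (insert i J) \<mu>) \<le> ennreal (exp ((L i)\<^sup>2)) * ennreal (exp (\<Sum>k\<in>J. (L k)\<^sup>2))"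
    by (rule order_trans[OF out(3) mult_left_mono[OF IH(2)]]) (rule zero_le)
  have bd': "(\<integral>\<^sup>+z. ennreal (exp (- F z - - c)) \<partial>PiM (insert i J) \<mu>) \<le> ennreal (exp ((L i)\<^sup>2)) * ennreal (exp (\<Sum>k\<in>J. (L k)\<^sup>2))"
    by (rule order_trans[OF out'(3) mult_left_mono[OF IH']]) (rule zero_le)
  have e1: "integrable (PiM (insert i J) \<mu>) (\<lambda>z. exp (F z - c))"
    using le_less_trans[OF bd fin] by (intro integrableI_bounded) auto
  have e2: "integrable (PiM (insert i J) \<mu>) (\<lambda>z. exp (c - F z))"
    using le_less_trans[OF bd' fin] by (intro integrableI_bounded) auto
  have "integrable (PiM (insert i J) \<mu>) (\<lambda>z. F z - c)"
  proof (rule Bochner_Integration.integrable_bound)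
    show "integrable (PiM (insert i J) \<mu>) (\<lambda>z. exp (F z - c) + exp (c - F z))" using e1 e2 by simp
    show "AE z in PiM (insert i J) \<mu>. norm (F z - c) \<le> norm (exp (F z - c) + exp (c - F z))"
    proof (intro always_eventually allI)
      fix z
      show "norm (F z - c) \<le> norm (exp (F z - c) + exp (c - F z))"
        using exp_ge_add_one_self[of "F z - c"] exp_ge_add_one_self[of "c - F z"] exp_gt_zero[of "F z - c"] exp_gt_zero[of "c - F z"]
        unfolding real_norm_def by linarith
    qed
  qed measurable
  from Bochner_Integration.integrable_add[OF this finite_measure.integrable_const[OF prob_space.finite_measure[OF prJ], of c]]
  have iF: "integrable (PiM (insert i J) \<mu>) F" by simp
  have "integral\<^sup>L (PiM (insert i J) \<mu>) F = c"
    unfolding c_def product_sigma_finite.product_integral_insert[OF psf insert(1,2) iF] by (simp add: G_def[abs_def])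
  moreover have "ennreal (exp ((L i)\<^sup>2)) * ennreal (exp (\<Sum>k\<in>J. (L k)\<^sup>2)) = ennreal (exp (\<Sum>k\<in>insert i J. (L k)\<^sup>2))"
    using insert(1,2) by (simp flip: ennreal_mult' exp_add)
  ultimately show ?case using iF bd by simp
qed

lemma sub_gaussian_concentration:
  fixes F :: "('i \<Rightarrow> real) \<Rightarrow> real"
  assumes \<mu>: "\<And>k. sub_gaussian (\<mu> k)" and J: "finite J"
    and F [measurable]: "F \<in> borel_measurable (PiM J \<mu>)"
    and L: "\<And>z k s t. k \<in> J \<Longrightarrow> \<bar>F (z(k := s)) - F (z(k := t))\<bar> \<le> L k * \<bar>s - t\<bar>"
    and S: "(\<Sum>k\<in>J. (L k)\<^sup>2) \<le> S" "0 < S" and "\<epsilon> > 0"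
  shows "measure (PiM J \<mu>) {z \<in> space (PiM J \<mu>). \<bar>F z - integral\<^sup>L (PiM J \<mu>) F\<bar> \<ge> \<epsilon>} \<le> 2 * exp (- \<epsilon>\<^sup>2 / (4 * S))"
proof -
  have pr: "prob_space (\<mu> l)" for l by (rule sub_gaussian_prob_space[OF \<mu>])
  have "prob_space (PiM J \<mu>)" by (rule prob_space_PiM[OF pr])
  then interpret P: prob_space "PiM J \<mu>" .
  define c where "c = integral\<^sup>L (PiM J \<mu>) F"
  \<comment> \<open>The minimizer of \<open>- r * \<epsilon> + r\<^sup>2 * S\<close>, with minimum
    \<open>- \<epsilon>\<^sup>2 / (4 * S)\<close>.\<close>
  define r where "r = \<epsilon> / (2 * S)"
  have r: "r > 0" using assms by (simp add: r_def)
  have tail: "measure (PiM J \<mu>) {z \<in> space (PiM J \<mu>). \<epsilon> \<le> s * (F z - c)} \<le> exp (- \<epsilon>\<^sup>2 / (4 * S))" if s: "\<bar>s\<bar> = 1" for s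
  proof -
    let ?A = "{z \<in> space (PiM J \<mu>). \<epsilon> \<le> s * (F z - c)}"
    have "(\<lambda>z. r * s * F z) \<in> borel_measurable (PiM J \<mu>)" by measurable
    moreover have "\<bar>r * s * F (z(k := u)) - r * s * F (z(k := v))\<bar> \<le> r * L k * \<bar>u - v\<bar>" if "k \<in> J" for z k u v
    proof -
      have "\<bar>r * s * F (z(k := u)) - r * s * F (z(k := v))\<bar> = r * \<bar>F (z(k := u)) - F (z(k := v))\<bar>"
        using r s by (simp add: abs_mult flip: right_diff_distrib)
      also have "\<dots> \<le> r * (L k * \<bar>u - v\<bar>)" using r L[OF that] by (intro mult_left_mono) auto
      finally show ?thesis by (simp add: mult.assoc)
    qed
    ultimately have T: "(\<integral>\<^sup>+z. ennreal (exp (r * s * F z - (\<integral>z. r * s * F z \<partial>PiM J \<mu>))) \<partial>PiM J \<mu>) \<le> ennreal (exp (\<Sum>k\<in>J. (r * L k)\<^sup>2))"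
      using sub_gaussian_tensorization[where \<mu>=\<mu> and F="\<lambda>z. r * s * F z" and L="\<lambda>k. r * L k", OF \<mu> J] by blast
    have T': "(\<integral>\<^sup>+z. ennreal (exp (r * s * (F z - c))) \<partial>PiM J \<mu>) \<le> ennreal (exp (r\<^sup>2 * S))"
    proof -
      have "(\<Sum>k\<in>J. (r * L k)\<^sup>2) \<le> r\<^sup>2 * S" using S(1)
        by (simp add: power_mult_distrib mult_left_mono flip: sum_distrib_left)
      then have "ennreal (exp (\<Sum>k\<in>J. (r * L k)\<^sup>2)) \<le> ennreal (exp (r\<^sup>2 * S))" by (intro ennreal_leI) simp
      from order_trans[OF T this] show ?thesis by (simp add: c_def right_diff_distrib)
    qed
    have "emeasure (PiM J \<mu>) ?A = (\<integral>\<^sup>+z. indicator ?A z \<partial>PiM J \<mu>)" by simp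
    also have "\<dots> \<le> (\<integral>\<^sup>+z. ennreal (exp (- r * \<epsilon>)) * ennreal (exp (r * s * (F z - c))) \<partial>PiM J \<mu>)"
    proof (rule nn_integral_mono)
      fix z
      show "indicator ?A z \<le> ennreal (exp (- r * \<epsilon>)) * ennreal (exp (r * s * (F z - c)))"
      proof (cases "z \<in> ?A")
        case True
        then have "r * \<epsilon> \<le> r * (s * (F z - c))" using r by (intro mult_left_mono) auto
        then have "1 \<le> exp (- r * \<epsilon>) * exp (r * s * (F z - c))" by (simp add: mult.assoc flip: exp_add)
        then show ?thesis using True by (simp add: ennreal_le_iff2 flip: ennreal_mult' ennreal_1)
      qed simp
    qed
    also have "\<dots> = ennreal (exp (- r * \<epsilon>)) * (\<integral>\<^sup>+z. ennreal (exp (r * s * (F z - c))) \<partial>PiM J \<mu>)"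
      by (intro nn_integral_cmult) measurable
    also have "\<dots> \<le> ennreal (exp (- r * \<epsilon>)) * ennreal (exp (r\<^sup>2 * S))" by (intro mult_left_mono T') auto
    also have "\<dots> = ennreal (exp (- \<epsilon>\<^sup>2 / (4 * S)))"
      using S by (simp add: r_def power2_eq_square field_simps flip: ennreal_mult' exp_add)
    finally show ?thesis by (simp add: P.emeasure_eq_measure)
  qed
  have "measure (PiM J \<mu>) {z \<in> space (PiM J \<mu>). \<bar>F z - c\<bar> \<ge> \<epsilon>} \<le>
    measure (PiM J \<mu>) ({z \<in> space (PiM J \<mu>). \<epsilon> \<le> 1 * (F z - c)} \<union> {z \<in> space (PiM J \<mu>). \<epsilon> \<le> -1 * (F z - c)})"
    by (intro P.finite_measure_mono) (auto simp: abs_if)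
  also have "\<dots> \<le> exp (- \<epsilon>\<^sup>2 / (4 * S)) + exp (- \<epsilon>\<^sup>2 / (4 * S))"
    by (intro order_trans[OF measure_Un_le] add_mono tail) auto
  finally show ?thesis by (simp add: c_def)
qed

section \<open>Gaussian interpolation and replicas\<close>

lemma integrable_gauss_PiM_component:
  assumes "finite I" "k \<in> I"
  shows "integrable (PiM I (\<lambda>_. gauss)) (\<lambda>g. \<bar>g k\<bar>)"
proof -
  have "distr (PiM I (\<lambda>_. gauss)) gauss (\<lambda>g. g k) = gauss"
    by (rule distr_PiM_component) (auto simp: assms gauss.prob_space_axioms)
  then have "integrable (distr (PiM I (\<lambda>_. gauss)) gauss (\<lambda>g. g k)) (\<lambda>x. \<bar>x\<bar>)"
    using integrable_gauss_abs by simp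
  then show ?thesis using assms by (subst (asm) integrable_distr_eq) auto
qed

lemma product_sigma_finite_gauss: "product_sigma_finite (\<lambda>_. gauss)"
  by (rule product_sigma_finite.intro) (rule gauss.sigma_finite_measure_axioms)

lemma prob_space_PiM_gauss: "prob_space (PiM I (\<lambda>_. gauss))"
  by (rule prob_space_PiM) (rule gauss.prob_space_axioms)

text \<open>Fubini in the coordinate \<open>k\<close> reduces the claim to Stein's identity with the
  other Gaussians frozen; the bound on \<open>F\<close> supplies the integrability of
  \<open>g k * F g\<close>.\<close>

lemma gauss_PiM_by_parts:
  fixes F F' :: "('k \<Rightarrow> real) \<Rightarrow> real"
  assumes I: "finite I" "k \<in> I"
    and mF: "F \<in> borel_measurable (PiM I (\<lambda>_. gauss))" and mF': "F' \<in> borel_measurable (PiM I (\<lambda>_. gauss))"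
    and D: "\<And>g t. ((\<lambda>t. F (g(k := t))) has_real_derivative F' (g(k := t))) (at t)"
    and c: "\<And>g t. isCont (\<lambda>t. F' (g(k := t))) t"
    and A: "\<And>g. \<bar>F g\<bar> \<le> A" and B: "\<And>g. \<bar>F' g\<bar> \<le> B"
  shows "integrable (PiM I (\<lambda>_. gauss)) (\<lambda>g. g k * F g)"
    and "(\<integral>g. g k * F g \<partial>PiM I (\<lambda>_. gauss)) = (\<integral>g. F' g \<partial>PiM I (\<lambda>_. gauss))"
proof -
  let ?P = "PiM I (\<lambda>_. gauss)"
  have fm: "finite_measure ?P" using prob_space_PiM_gauss by (rule prob_space.finite_measure)
  have mk: "(\<lambda>g. g k) \<in> borel_measurable ?P" using I by measurable
  show i1: "integrable ?P (\<lambda>g. g k * F g)"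
  proof (rule Bochner_Integration.integrable_bound)
    show "integrable ?P (\<lambda>g. A * \<bar>g k\<bar>)"
      by (intro integrable_mult_right integrable_gauss_PiM_component I)
    show "AE g in ?P. norm (g k * F g) \<le> norm (A * \<bar>g k\<bar>)"
      using mult_left_mono[OF A, of "\<bar>g k\<bar>" for g] order_trans[OF abs_ge_zero A]
      by (intro always_eventually allI) (simp add: abs_mult mult.commute)
  qed (use mk mF in measurable)
  have i2: "integrable ?P F'"
    by (rule finite_measure.integrable_const_bound[OF fm, of _ B]) (use B mF' in auto)
  obtain J where J: "I = insert k J" "k \<notin> J" "finite J" using I by (metis finite_insert mk_disjoint_insert)
  have "(\<integral>g. g k * F g \<partial>?P) = (\<integral>x. (\<integral>y. y * F (x(k := y)) \<partial>gauss) \<partial>PiM J (\<lambda>_. gauss))"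
    using product_sigma_finite.product_integral_insert[OF product_sigma_finite_gauss J(3,2), of "\<lambda>g. g k * F g"] i1
    unfolding J(1) by simp
  also have "\<dots> = (\<integral>x. (\<integral>y. F' (x(k := y)) \<partial>gauss) \<partial>PiM J (\<lambda>_. gauss))"
    using D c B by (intro Bochner_Integration.integral_cong refl gauss_integral_by_parts(2)[where B=B] continuous_at_imp_continuous_on) auto
  also have "\<dots> = (\<integral>g. F' g \<partial>?P)"
    using product_sigma_finite.product_integral_insert[OF product_sigma_finite_gauss J(3,2), of F'] i2
    unfolding J(1) by simp
  finally show "(\<integral>g. g k * F g \<partial>?P) = (\<integral>g. F' g \<partial>?P)" .
qed

section \<open>Gibbs averages in Gaussian disorder and their derivatives\<close>

locale gibbs =
  fixes S :: "'s set" and I :: "'k set" and u :: "'k \<Rightarrow> 's \<Rightarrow> real" and h :: "'s \<Rightarrow> real"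
  assumes finite_S: "finite S" and S_nonempty: "S \<noteq> {}" and finite_I: "finite I"
    and u: "\<And>k \<sigma>. k \<in> I \<Longrightarrow> \<sigma> \<in> S \<Longrightarrow> \<bar>u k \<sigma>\<bar> = 1"
begin

definition H :: "('k \<Rightarrow> real) \<Rightarrow> 's \<Rightarrow> real" where "H z \<sigma> = (\<Sum>k\<in>I. z k * u k \<sigma>) + h \<sigma>"
definition Z :: "('k \<Rightarrow> real) \<Rightarrow> real" where "Z z = (\<Sum>\<sigma>\<in>S. exp (H z \<sigma>))"
definition weight :: "('k \<Rightarrow> real) \<Rightarrow> 's \<Rightarrow> real" where "weight z \<sigma> = exp (H z \<sigma>) / Z z"
definition av :: "('s \<Rightarrow> real) \<Rightarrow> ('k \<Rightarrow> real) \<Rightarrow> real" where "av f z = (\<Sum>\<sigma>\<in>S. f \<sigma> * weight z \<sigma>)"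
definition av2 :: "('s \<Rightarrow> 's \<Rightarrow> real) \<Rightarrow> ('k \<Rightarrow> real) \<Rightarrow> real" where
  "av2 f z = (\<Sum>\<sigma>\<in>S. \<Sum>\<tau>\<in>S. f \<sigma> \<tau> * (weight z \<sigma> * weight z \<tau>))"

lemma Z_pos: "Z z > 0"
  unfolding Z_def using finite_S S_nonempty by (intro sum_pos) auto

lemma weight_pos: "weight z \<sigma> > 0"
  unfolding weight_def using Z_pos by simp

lemma weight_sum: "(\<Sum>\<sigma>\<in>S. weight z \<sigma>) = 1"
  unfolding weight_def sum_divide_distrib[symmetric] Z_def[symmetric] using Z_pos[of z] by simp

lemma av_bound:
  assumes "\<And>\<sigma>. \<sigma> \<in> S \<Longrightarrow> \<bar>f \<sigma>\<bar> \<le> A"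
  shows "\<bar>av f z\<bar> \<le> A"
proof -
  have "\<bar>av f z\<bar> \<le> (\<Sum>\<sigma>\<in>S. A * weight z \<sigma>)"
    unfolding av_def using assms weight_pos[of z]
    by (intro order_trans[OF sum_abs] sum_mono) (auto simp: abs_mult abs_of_pos[OF weight_pos] less_imp_le intro!: mult_right_mono)
  then show ?thesis by (simp add: weight_sum flip: sum_distrib_left)
qed

lemma av2_alt: "av2 f z = av (\<lambda>\<sigma>. av (f \<sigma>) z) z"
  unfolding av2_def av_def by (simp add: sum_distrib_left sum_distrib_right mult_ac)

lemma av2_bound:
  assumes "\<And>\<sigma> \<tau>. \<sigma> \<in> S \<Longrightarrow> \<tau> \<in> S \<Longrightarrow> \<bar>f \<sigma> \<tau>\<bar> \<le> A"
  shows "\<bar>av2 f z\<bar> \<le> A"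
  unfolding av2_alt by (intro av_bound assms)

lemma DERIV_weight:
  assumes "\<And>\<sigma>. \<sigma> \<in> S \<Longrightarrow> ((\<lambda>t. H (z t) \<sigma>) has_real_derivative X \<sigma>) (at t0)" "\<sigma> \<in> S"
  shows "((\<lambda>t. weight (z t) \<sigma>) has_real_derivative weight (z t0) \<sigma> * (X \<sigma> - av X (z t0))) (at t0)"
proof -
  have e: "((\<lambda>t. exp (H (z t) \<sigma>)) has_real_derivative exp (H (z t0) \<sigma>) * X \<sigma>) (at t0)" if "\<sigma> \<in> S" for \<sigma>
    using assms(1)[OF that] by (rule DERIV_fun_exp)
  have "((\<lambda>t. Z (z t)) has_real_derivative (\<Sum>\<sigma>\<in>S. exp (H (z t0) \<sigma>) * X \<sigma>)) (at t0)"
    unfolding Z_def by (intro DERIV_sum e)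
  from DERIV_divide[OF e[OF assms(2)] this] Z_pos[of "z t0"]
  have D: "((\<lambda>t. exp (H (z t) \<sigma>) / Z (z t)) has_real_derivative
     (exp (H (z t0) \<sigma>) * X \<sigma> * Z (z t0) - exp (H (z t0) \<sigma>) * (\<Sum>\<sigma>\<in>S. exp (H (z t0) \<sigma>) * X \<sigma>)) / (Z (z t0) * Z (z t0))) (at t0)"
    by (simp add: less_imp_neq[THEN not_sym])
  have "av X (z t0) = (\<Sum>\<sigma>\<in>S. exp (H (z t0) \<sigma>) * X \<sigma>) / Z (z t0)"
    unfolding av_def weight_def sum_divide_distrib by (intro sum.cong) auto
  then have "(\<Sum>\<sigma>\<in>S. exp (H (z t0) \<sigma>) * X \<sigma>) = av X (z t0) * Z (z t0)"
    using Z_pos[of "z t0"] by simp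
  then show ?thesis unfolding weight_def using Z_pos[of "z t0"]
    by (intro DERIV_cong[OF D]) (simp add: field_simps)
qed

lemma DERIV_av:
  assumes "\<And>\<sigma>. \<sigma> \<in> S \<Longrightarrow> ((\<lambda>t. H (z t) \<sigma>) has_real_derivative X \<sigma>) (at t0)"
  shows "((\<lambda>t. av f (z t)) has_real_derivative av (\<lambda>\<sigma>. f \<sigma> * X \<sigma>) (z t0) - av f (z t0) * av X (z t0)) (at t0)"
proof -
  have "((\<lambda>t. av f (z t)) has_real_derivative (\<Sum>\<sigma>\<in>S. f \<sigma> * (weight (z t0) \<sigma> * (X \<sigma> - av X (z t0))))) (at t0)"
    unfolding av_def[of f] by (intro DERIV_sum DERIV_cmult DERIV_weight assms)
  also have "(\<Sum>\<sigma>\<in>S. f \<sigma> * (weight (z t0) \<sigma> * (X \<sigma> - av X (z t0)))) = av (\<lambda>\<sigma>. f \<sigma> * X \<sigma>) (z t0) - av f (z t0) * av X (z t0)"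
    unfolding av_def[of f] av_def[of "\<lambda>\<sigma>. f \<sigma> * X \<sigma>"] sum_distrib_right sum_subtractf[symmetric]
    by (intro sum.cong) (auto simp: algebra_simps)
  finally show ?thesis .
qed

text \<open>Both replicas react to a change of the Hamiltonian, and each of the two normalizations
  subtracts one \<open>av X\<close>. The test function moves as well, because the tilt of the
  replica coupling will depend on time.\<close>

lemma DERIV_av2_time:
  assumes "\<And>\<sigma>. \<sigma> \<in> S \<Longrightarrow> ((\<lambda>t. H (z t) \<sigma>) has_real_derivative X \<sigma>) (at t0)"
    and f: "\<And>\<sigma> \<tau>. \<sigma> \<in> S \<Longrightarrow> \<tau> \<in> S \<Longrightarrow> ((\<lambda>t. f t \<sigma> \<tau>) has_real_derivative f' \<sigma> \<tau>) (at t0)"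
  shows "((\<lambda>t. av2 (f t) (z t)) has_real_derivative
     av2 f' (z t0) + (av2 (\<lambda>\<sigma> \<tau>. f t0 \<sigma> \<tau> * (X \<sigma> + X \<tau>)) (z t0) - 2 * av X (z t0) * av2 (f t0) (z t0))) (at t0)"
proof -
  let ?w = "weight (z t0)" and ?x = "av X (z t0)"
  have "((\<lambda>t. av2 (f t) (z t)) has_real_derivative (\<Sum>\<sigma>\<in>S. \<Sum>\<tau>\<in>S. f' \<sigma> \<tau> * (?w \<sigma> * ?w \<tau>)
     + (?w \<sigma> * (X \<sigma> - ?x) * ?w \<tau> + ?w \<tau> * (X \<tau> - ?x) * ?w \<sigma>) * f t0 \<sigma> \<tau>)) (at t0)"
    unfolding av2_def by (intro DERIV_sum DERIV_mult DERIV_weight assms)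
  also have "(\<Sum>\<sigma>\<in>S. \<Sum>\<tau>\<in>S. f' \<sigma> \<tau> * (?w \<sigma> * ?w \<tau>)
     + (?w \<sigma> * (X \<sigma> - ?x) * ?w \<tau> + ?w \<tau> * (X \<tau> - ?x) * ?w \<sigma>) * f t0 \<sigma> \<tau>) =
     (\<Sum>\<sigma>\<in>S. \<Sum>\<tau>\<in>S. f' \<sigma> \<tau> * (?w \<sigma> * ?w \<tau>) + (f t0 \<sigma> \<tau> * (X \<sigma> + X \<tau>) * (?w \<sigma> * ?w \<tau>) - 2 * ?x * (f t0 \<sigma> \<tau> * (?w \<sigma> * ?w \<tau>))))"
    by (intro sum.cong refl) (simp add: algebra_simps)
  also have "\<dots> = av2 f' (z t0) + (av2 (\<lambda>\<sigma> \<tau>. f t0 \<sigma> \<tau> * (X \<sigma> + X \<tau>)) (z t0) - 2 * ?x * av2 (f t0) (z t0))"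
    unfolding av2_def sum.distrib sum_subtractf sum_distrib_left ..
  finally show ?thesis .
qed

lemma DERIV_av2:
  assumes "\<And>\<sigma>. \<sigma> \<in> S \<Longrightarrow> ((\<lambda>t. H (z t) \<sigma>) has_real_derivative X \<sigma>) (at t0)"
  shows "((\<lambda>t. av2 f (z t)) has_real_derivative
     av2 (\<lambda>\<sigma> \<tau>. f \<sigma> \<tau> * (X \<sigma> + X \<tau>)) (z t0) - 2 * av X (z t0) * av2 f (z t0)) (at t0)"
  using DERIV_av2_time[OF assms, of "\<lambda>_. f" "\<lambda>_ _. 0"] by (simp add: av2_def)

lemma DERIV_lnZ:
  assumes "\<And>\<sigma>. \<sigma> \<in> S \<Longrightarrow> ((\<lambda>t. H (z t) \<sigma>) has_real_derivative X \<sigma>) (at t0)"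
  shows "((\<lambda>t. ln (Z (z t))) has_real_derivative av X (z t0)) (at t0)"
proof -
  have e: "((\<lambda>t. exp (H (z t) \<sigma>)) has_real_derivative exp (H (z t0) \<sigma>) * X \<sigma>) (at t0)" if "\<sigma> \<in> S" for \<sigma>
    using assms(1)[OF that] by (rule DERIV_fun_exp)
  have "((\<lambda>t. Z (z t)) has_real_derivative (\<Sum>\<sigma>\<in>S. exp (H (z t0) \<sigma>) * X \<sigma>)) (at t0)"
    unfolding Z_def by (intro DERIV_sum e)
  from DERIV_chain2[OF DERIV_ln[OF Z_pos] this]
  show ?thesis unfolding av_def weight_def sum_divide_distrib[symmetric]
    by (rule DERIV_cong) (simp add: sum_distrib_left sum_divide_distrib field_simps)
qed

end

locale gaussian_gibbs = gibbs S I u h for S :: "'s set" and I :: "'k set" and u h +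
  fixes c c' :: "'k \<Rightarrow> real \<Rightarrow> real" and C :: real
  assumes c: "\<And>k t. k \<in> I \<Longrightarrow> (c k has_real_derivative c' k t) (at t)"
    and c_bound: "\<And>k t. k \<in> I \<Longrightarrow> \<bar>c k t\<bar> \<le> C" and c'_bound: "\<And>k t. k \<in> I \<Longrightarrow> \<bar>c' k t\<bar> \<le> C"
begin

abbreviation P :: "('k \<Rightarrow> real) measure" where "P \<equiv> PiM I (\<lambda>_. gauss)"

definition zz :: "real \<Rightarrow> ('k \<Rightarrow> real) \<Rightarrow> 'k \<Rightarrow> real" where "zz t g k = c k t * g k"

lemma H_measurable [measurable]: "(\<lambda>g. H (zz t g) \<sigma>) \<in> borel_measurable P"
  unfolding H_def zz_def by measurable

lemma Z_measurable [measurable]: "(\<lambda>g. Z (zz t g)) \<in> borel_measurable P"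
  unfolding Z_def by measurable

lemma weight_measurable [measurable]: "(\<lambda>g. weight (zz t g) \<sigma>) \<in> borel_measurable P"
  unfolding weight_def by measurable

lemma av_measurable [measurable]: "(\<lambda>g. av f (zz t g)) \<in> borel_measurable P"
  unfolding av_def by measurable

lemma av2_measurable [measurable]: "(\<lambda>g. av2 f (zz t g)) \<in> borel_measurable P"
  unfolding av2_def by measurable

lemma DERIV_H_time: "((\<lambda>t. H (zz t g) \<sigma>) has_real_derivative (\<Sum>k\<in>I. c' k t * g k * u k \<sigma>)) (at t)"
proof -
  have "((\<lambda>t. H (zz t g) \<sigma>) has_real_derivative (\<Sum>k\<in>I. c' k t * g k * u k \<sigma>) + 0) (at t)"
    unfolding H_def zz_def by (intro DERIV_add DERIV_sum DERIV_const DERIV_cmult_right c)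
  then show ?thesis by simp
qed

lemma DERIV_H_component:
  assumes "k \<in> I"
  shows "((\<lambda>s. H (zz t (g(k := s))) \<sigma>) has_real_derivative c k t * u k \<sigma>) (at s)"
proof -
  have "H (zz t (g(k := s))) \<sigma> = c k t * u k \<sigma> * s + ((\<Sum>j\<in>I - {k}. zz t g j * u j \<sigma>) + h \<sigma>)" for s
    unfolding H_def zz_def using assms finite_I by (subst sum.remove[of _ k]) (auto intro!: sum.cong)
  then show ?thesis by (auto intro!: derivative_eq_intros)
qed

lemma integrable_bounded:
  fixes F :: "('k \<Rightarrow> real) \<Rightarrow> real"
  assumes "F \<in> borel_measurable P" "\<And>g. \<bar>F g\<bar> \<le> B"
  shows "integrable P F"
  by (rule finite_measure.integrable_const_bound[OF prob_space.finite_measure[OF prob_space_PiM_gauss], of _ B])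
     (use assms in auto)

lemma av_sum_field: "av (\<lambda>\<sigma>. \<Sum>k\<in>I. a k * u k \<sigma>) z = (\<Sum>k\<in>I. a k * av (u k) z)"
  unfolding av_def sum_distrib_right sum_distrib_left by (subst sum.swap) (simp add: mult_ac)

lemma integrable_lnZ: "integrable P (\<lambda>g. ln (Z (zz t g)))"
proof (rule Bochner_Integration.integrable_bound)
  define K where "K = \<bar>ln (real (card S))\<bar> + (\<Sum>\<sigma>\<in>S. \<bar>h \<sigma>\<bar>)"
  show "integrable P (\<lambda>g. (\<Sum>k\<in>I. C * \<bar>g k\<bar>) + K)"
    by (intro Bochner_Integration.integrable_add Bochner_Integration.integrable_sum integrable_mult_right
        integrable_gauss_PiM_component finite_I
        finite_measure.integrable_const[OF prob_space.finite_measure[OF prob_space_PiM_gauss]])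
  show "AE g in P. norm (ln (Z (zz t g))) \<le> norm ((\<Sum>k\<in>I. C * \<bar>g k\<bar>) + K)"
  proof (intro always_eventually allI)
    fix g
    let ?m = "(\<Sum>k\<in>I. C * \<bar>g k\<bar>) + (\<Sum>\<sigma>\<in>S. \<bar>h \<sigma>\<bar>)"
    have Hb: "\<bar>H (zz t g) \<sigma>\<bar> \<le> ?m" if "\<sigma> \<in> S" for \<sigma>
    proof -
      have "\<bar>\<Sum>k\<in>I. zz t g k * u k \<sigma>\<bar> \<le> (\<Sum>k\<in>I. C * \<bar>g k\<bar>)"
        using u[OF _ that] c_bound[of _ t]
        by (intro order_trans[OF sum_abs] sum_mono) (auto simp: abs_mult zz_def intro!: mult_right_mono)
      moreover have "\<bar>h \<sigma>\<bar> \<le> (\<Sum>\<sigma>\<in>S. \<bar>h \<sigma>\<bar>)" using that finite_S by (intro member_le_sum) auto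
      ultimately show ?thesis unfolding H_def by linarith
    qed
    have c0: "card S > 0" using finite_S S_nonempty by (simp add: card_gt_0_iff)
    have "Z (zz t g) \<le> real (card S) * exp ?m"
      unfolding Z_def using Hb by (intro sum_bounded_above) (auto simp: abs_le_iff)
    then have "ln (Z (zz t g)) \<le> ln (real (card S) * exp ?m)" using Z_pos c0 by (subst ln_le_cancel_iff) auto
    then have u1: "ln (Z (zz t g)) \<le> ln (real (card S)) + ?m" using c0 by (simp add: ln_mult)
    have "real (card S) * exp (- ?m) \<le> Z (zz t g)"
      unfolding Z_def
    proof (intro sum_bounded_below)
      show "exp (- ?m) \<le> exp (H (zz t g) \<sigma>)" if "\<sigma> \<in> S" for \<sigma> using Hb[OF that] unfolding exp_le_cancel_iff by linarith
    qed
    then have "ln (real (card S) * exp (- ?m)) \<le> ln (Z (zz t g))" using Z_pos c0 by (subst ln_le_cancel_iff) auto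
    then have u2: "ln (real (card S)) - ?m \<le> ln (Z (zz t g))" using c0 by (simp add: ln_mult)
    from u1 u2 show "norm (ln (Z (zz t g))) \<le> norm ((\<Sum>k\<in>I. C * \<bar>g k\<bar>) + K)"
      unfolding K_def real_norm_def by linarith
  qed
qed measurable

text \<open>Stein's identity in every \<open>g k\<close>: as the spins square to 1, the derivative
  of \<open>av (u k)\<close> in \<open>g k\<close> is \<open>c k t\<close> times one minus the
  square of \<open>av (u k)\<close>.\<close>

lemma DERIV_mean_lnZ:
  "((\<lambda>t. \<integral>g. ln (Z (zz t g)) \<partial>P) has_real_derivative
     (\<Sum>k\<in>I. c k t * c' k t * (\<integral>g. 1 - (av (u k) (zz t g))\<^sup>2 \<partial>P))) (at t)"
proof -
  let ?D = "\<lambda>t g. \<Sum>k\<in>I. c' k t * g k * av (u k) (zz t g)"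
  have avu: "\<bar>av (u k) z\<bar> \<le> 1" if "k \<in> I" for k z using u that by (intro av_bound) auto
  have "((\<lambda>t. \<integral>g. ln (Z (zz t g)) \<partial>P) has_real_derivative (\<integral>g. ?D t g \<partial>P)) (at t)"
  proof (rule has_real_derivative_integral[where d=1 and B="\<lambda>g. \<Sum>k\<in>I. C * \<bar>g k\<bar>"])
    fix s g
    show "((\<lambda>t. ln (Z (zz t g))) has_real_derivative ?D s g) (at s)"
      using DERIV_lnZ[of "\<lambda>t. zz t g", OF DERIV_H_time] by (simp add: av_sum_field)
    show "\<bar>?D s g\<bar> \<le> (\<Sum>k\<in>I. C * \<bar>g k\<bar>)"
    proof (intro order_trans[OF sum_abs] sum_mono)
      fix k assume k: "k \<in> I"
      have "\<bar>c' k s\<bar> * \<bar>g k\<bar> * \<bar>av (u k) (zz s g)\<bar> \<le> C * \<bar>g k\<bar> * 1"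
        using c'_bound[OF k, of s] avu[OF k] by (intro mult_mono mult_right_mono) (auto intro: order_trans[OF abs_ge_zero])
      then show "\<bar>c' k s * g k * av (u k) (zz s g)\<bar> \<le> C * \<bar>g k\<bar>" by (simp add: abs_mult)
    qed
  next
    show "integrable P (\<lambda>g. \<Sum>k\<in>I. C * \<bar>g k\<bar>)"
      by (intro Bochner_Integration.integrable_sum integrable_mult_right integrable_gauss_PiM_component finite_I)
  qed (auto intro: integrable_lnZ)
  also have "(\<integral>g. ?D t g \<partial>P) = (\<Sum>k\<in>I. c k t * c' k t * (\<integral>g. 1 - (av (u k) (zz t g))\<^sup>2 \<partial>P))"
  proof -
    have ibp: "integrable P (\<lambda>g. g k * av (u k) (zz t g))"
      "(\<integral>g. g k * av (u k) (zz t g) \<partial>P) = (\<integral>g. c k t * (1 - (av (u k) (zz t g))\<^sup>2) \<partial>P)" if k: "k \<in> I" for k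
    proof -
      have D: "((\<lambda>s. av (u k) (zz t (g(k := s)))) has_real_derivative c k t * (1 - (av (u k) (zz t (g(k := s))))\<^sup>2)) (at s)" for g s
      proof -
        have "av (\<lambda>\<sigma>. u k \<sigma> * (c k t * u k \<sigma>)) z = c k t" for z
        proof -
          have "av (\<lambda>\<sigma>. u k \<sigma> * (c k t * u k \<sigma>)) z = (\<Sum>\<sigma>\<in>S. c k t * weight z \<sigma>)"
            unfolding av_def
          proof (intro sum.cong refl)
            fix \<sigma> assume "\<sigma> \<in> S"
            then have "u k \<sigma> * u k \<sigma> = 1" using u[OF k, of \<sigma>] by (auto simp: abs_if split: if_splits)
            then show "u k \<sigma> * (c k t * u k \<sigma>) * weight z \<sigma> = c k t * weight z \<sigma>" by (simp add: mult.left_commute[of _ "c k t"])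
          qed
          then show ?thesis by (simp add: weight_sum flip: sum_distrib_left)
        qed
        moreover have "av (\<lambda>\<sigma>. c k t * u k \<sigma>) z = c k t * av (u k) z" for z
          unfolding av_def by (simp add: sum_distrib_left mult_ac)
        moreover have "((\<lambda>s. av (u k) (zz t (g(k := s)))) has_real_derivative av (\<lambda>\<sigma>. u k \<sigma> * (c k t * u k \<sigma>)) (zz t (g(k := s)))
          - av (u k) (zz t (g(k := s))) * av (\<lambda>\<sigma>. c k t * u k \<sigma>) (zz t (g(k := s)))) (at s)"
          by (rule DERIV_av) (rule DERIV_H_component[OF k])
        ultimately show ?thesis
          by (simp add: power2_eq_square algebra_simps)
      qed
      have cont: "isCont (\<lambda>s. c k t * (1 - (av (u k) (zz t (g(k := s))))\<^sup>2)) s" for g s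
        by (intro continuous_intros DERIV_isCont[OF D])
      have b: "\<bar>c k t * (1 - (av (u k) (zz t g))\<^sup>2)\<bar> \<le> C * 1" for g
      proof -
        have "(av (u k) (zz t g))\<^sup>2 \<le> 1" using avu[OF k] by (simp add: abs_square_le_1)
        then show ?thesis unfolding abs_mult using c_bound[OF k, of t]
          by (intro mult_mono) (auto intro: order_trans[OF abs_ge_zero])
      qed
      show "integrable P (\<lambda>g. g k * av (u k) (zz t g))"
        by (rule gauss_PiM_by_parts(1)[OF finite_I k _ _ D cont avu[OF k] b]) measurable
      show "(\<integral>g. g k * av (u k) (zz t g) \<partial>P) = (\<integral>g. c k t * (1 - (av (u k) (zz t g))\<^sup>2) \<partial>P)"
        by (rule gauss_PiM_by_parts(2)[OF finite_I k _ _ D cont avu[OF k] b]) measurable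
    qed
    have "(\<integral>g. ?D t g \<partial>P) = (\<Sum>k\<in>I. \<integral>g. c' k t * (g k * av (u k) (zz t g)) \<partial>P)"
      using ibp(1) by (simp add: mult.assoc Bochner_Integration.integral_sum)
    also have "\<dots> = (\<Sum>k\<in>I. c k t * c' k t * (\<integral>g. 1 - (av (u k) (zz t g))\<^sup>2 \<partial>P))"
    proof (intro sum.cong refl)
      fix k assume k: "k \<in> I"
      show "(\<integral>g. c' k t * (g k * av (u k) (zz t g)) \<partial>P) = c k t * c' k t * (\<integral>g. 1 - (av (u k) (zz t g))\<^sup>2 \<partial>P)"
        by (simp only: integral_mult_right_zero ibp(2)[OF k]) (simp only: mult_ac)
    qed
    finally show ?thesis .
  qed
  finally show ?thesis .
qed

text \<open>Differentiating in time brings down \<open>g k\<close>, which Stein's identity trades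
  for a derivative in \<open>g k\<close>. Further replicas enter through the normalizations: the
  coefficient -4 belongs to one new replica paired with an old one, 6 to two new replicas paired
  with each other.\<close>

lemma DERIV_mean_av2:
  assumes f: "\<And>t \<sigma> \<tau>. \<sigma> \<in> S \<Longrightarrow> \<tau> \<in> S \<Longrightarrow> ((\<lambda>t. f t \<sigma> \<tau>) has_real_derivative f' t \<sigma> \<tau>) (at t)"
    and A: "\<And>t \<sigma> \<tau>. \<sigma> \<in> S \<Longrightarrow> \<tau> \<in> S \<Longrightarrow> \<bar>f t \<sigma> \<tau>\<bar> \<le> A"
    and A': "\<And>t \<sigma> \<tau>. \<sigma> \<in> S \<Longrightarrow> \<tau> \<in> S \<Longrightarrow> \<bar>f' t \<sigma> \<tau>\<bar> \<le> A'"
  shows "((\<lambda>t. \<integral>g. av2 (f t) (zz t g) \<partial>P) has_real_derivative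
     (\<integral>g. av2 (f' t) (zz t g) + (\<Sum>k\<in>I. c k t * c' k t *
        (2 * av2 (\<lambda>\<sigma> \<tau>. f t \<sigma> \<tau> * (u k \<sigma> * u k \<tau>)) (zz t g)
         - 4 * av (u k) (zz t g) * av2 (\<lambda>\<sigma> \<tau>. f t \<sigma> \<tau> * (u k \<sigma> + u k \<tau>)) (zz t g)
         + 6 * (av (u k) (zz t g))\<^sup>2 * av2 (f t) (zz t g))) \<partial>P)) (at t)"
proof -
  have A0: "A \<ge> 0" using A[of _ _ t] S_nonempty by (meson abs_ge_zero all_not_in_conv order_trans)
  have C0: "C \<ge> 0" if "k \<in> I" for k using c_bound[OF that, of t] by linarith
  have avu: "\<bar>av (u k) z\<bar> \<le> 1" if "k \<in> I" for k z using u that by (intro av_bound) auto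
  let ?F = "\<lambda>k t z. av2 (\<lambda>\<sigma> \<tau>. f t \<sigma> \<tau> * (u k \<sigma> + u k \<tau>)) z - 2 * av (u k) z * av2 (f t) z"
  have uu: "\<bar>f t \<sigma> \<tau> * (u k \<sigma> + u k \<tau>)\<bar> \<le> A * 2" if "k \<in> I" "\<sigma> \<in> S" "\<tau> \<in> S" for k t \<sigma> \<tau>
    unfolding abs_mult using A[OF that(2,3), of t] u[OF that(1,2)] u[OF that(1,3)] A0 by (intro mult_mono) auto
  have avAf: "\<bar>av2 (f t) z\<bar> \<le> A" for t z by (intro av2_bound A)
  have prod2: "\<bar>a * b\<bar> \<le> x * y" if "\<bar>a\<bar> \<le> x" "\<bar>b\<bar> \<le> y" for a b x y :: real
    unfolding abs_mult using that by (intro mult_mono) auto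
  have Fb: "\<bar>?F k t z\<bar> \<le> 4 * A" if k: "k \<in> I" for k t z
  proof -
    have "\<bar>av2 (\<lambda>\<sigma> \<tau>. f t \<sigma> \<tau> * (u k \<sigma> + u k \<tau>)) z\<bar> \<le> A * 2" by (intro av2_bound uu k)
    moreover have "\<bar>(2 * av (u k) z) * av2 (f t) z\<bar> \<le> 2 * A" using avu[OF k, of z] avAf by (intro prod2) auto
    ultimately show ?thesis by linarith
  qed
  let ?D = "\<lambda>t g. av2 (f' t) (zz t g) + (\<Sum>k\<in>I. c' k t * g k * ?F k t (zz t g))"
  have intf: "integrable P (\<lambda>g. av2 (f t) (zz t g))" for t by (rule integrable_bounded[OF _ avAf]) measurable
  have "((\<lambda>t. \<integral>g. av2 (f t) (zz t g) \<partial>P) has_real_derivative (\<integral>g. ?D t g \<partial>P)) (at t)"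
  proof (rule has_real_derivative_integral[where d=1 and B="\<lambda>g. A' + (\<Sum>k\<in>I. C * \<bar>g k\<bar> * (4 * A))"])
    fix s g
    have e1: "av (\<lambda>\<sigma>. \<Sum>k\<in>I. c' k s * g k * u k \<sigma>) z = (\<Sum>k\<in>I. c' k s * g k * av (u k) z)" for z
      by (rule av_sum_field)
    have e2: "av2 (\<lambda>\<sigma> \<tau>. f s \<sigma> \<tau> * ((\<Sum>k\<in>I. c' k s * g k * u k \<sigma>) + (\<Sum>k\<in>I. c' k s * g k * u k \<tau>))) z =
      (\<Sum>k\<in>I. c' k s * g k * av2 (\<lambda>\<sigma> \<tau>. f s \<sigma> \<tau> * (u k \<sigma> + u k \<tau>)) z)" for z
    proof -
      have "av2 (\<lambda>\<sigma> \<tau>. f s \<sigma> \<tau> * ((\<Sum>k\<in>I. c' k s * g k * u k \<sigma>) + (\<Sum>k\<in>I. c' k s * g k * u k \<tau>))) z =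
        (\<Sum>\<sigma>\<in>S. \<Sum>\<tau>\<in>S. \<Sum>k\<in>I. c' k s * g k * (f s \<sigma> \<tau> * (u k \<sigma> + u k \<tau>) * (weight z \<sigma> * weight z \<tau>)))"
        unfolding av2_def sum.distrib[symmetric] sum_distrib_left sum_distrib_right by (intro sum.cong refl) (simp add: algebra_simps)
      also have "\<dots> = (\<Sum>k\<in>I. \<Sum>\<sigma>\<in>S. \<Sum>\<tau>\<in>S. c' k s * g k * (f s \<sigma> \<tau> * (u k \<sigma> + u k \<tau>) * (weight z \<sigma> * weight z \<tau>)))"
        by (simp only: sum.swap[of _ I])
      finally show ?thesis by (simp only: av2_def sum_distrib_left)
    qed
    have "av2 (f' s) (zz s g) + (av2 (\<lambda>\<sigma> \<tau>. f s \<sigma> \<tau> * ((\<Sum>k\<in>I. c' k s * g k * u k \<sigma>) + (\<Sum>k\<in>I. c' k s * g k * u k \<tau>))) (zz s g)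
        - 2 * av (\<lambda>\<sigma>. \<Sum>k\<in>I. c' k s * g k * u k \<sigma>) (zz s g) * av2 (f s) (zz s g)) = ?D s g"
      unfolding e1 e2 by (simp add: right_diff_distrib sum_subtractf sum_distrib_left sum_distrib_right mult_ac)
    then show "((\<lambda>t. av2 (f t) (zz t g)) has_real_derivative ?D s g) (at s)"
      using DERIV_av2_time[of "\<lambda>t. zz t g" "\<lambda>\<sigma>. \<Sum>k\<in>I. c' k s * g k * u k \<sigma>" s f "f' s", OF DERIV_H_time f] by simp
    have "\<bar>\<Sum>k\<in>I. c' k s * g k * ?F k s (zz s g)\<bar> \<le> (\<Sum>k\<in>I. C * \<bar>g k\<bar> * (4 * A))"
    proof (intro order_trans[OF sum_abs] sum_mono)
      fix k assume k: "k \<in> I"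
      show "\<bar>c' k s * g k * ?F k s (zz s g)\<bar> \<le> C * \<bar>g k\<bar> * (4 * A)"
        using c'_bound[OF k, of s] Fb[OF k] by (intro prod2) auto
    qed
    moreover have "\<bar>av2 (f' s) (zz s g)\<bar> \<le> A'" by (intro av2_bound A')
    ultimately show "\<bar>?D s g\<bar> \<le> A' + (\<Sum>k\<in>I. C * \<bar>g k\<bar> * (4 * A))" by linarith
  next
    show "integrable P (\<lambda>g. A' + (\<Sum>k\<in>I. C * \<bar>g k\<bar> * (4 * A)))"
      by (intro Bochner_Integration.integrable_add Bochner_Integration.integrable_sum integrable_mult_right integrable_mult_left
          integrable_gauss_PiM_component finite_I
        finite_measure.integrable_const[OF prob_space.finite_measure[OF prob_space_PiM_gauss]])
  qed (auto intro: intf)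
  also have "(\<integral>g. ?D t g \<partial>P) = (\<integral>g. av2 (f' t) (zz t g) + (\<Sum>k\<in>I. c k t * c' k t *
        (2 * av2 (\<lambda>\<sigma> \<tau>. f t \<sigma> \<tau> * (u k \<sigma> * u k \<tau>)) (zz t g)
         - 4 * av (u k) (zz t g) * av2 (\<lambda>\<sigma> \<tau>. f t \<sigma> \<tau> * (u k \<sigma> + u k \<tau>)) (zz t g)
         + 6 * (av (u k) (zz t g))\<^sup>2 * av2 (f t) (zz t g))) \<partial>P)"
  proof -
    let ?F' = "\<lambda>k z. c k t * (2 * av2 (\<lambda>\<sigma> \<tau>. f t \<sigma> \<tau> * (u k \<sigma> * u k \<tau>)) z
         - 4 * av (u k) z * av2 (\<lambda>\<sigma> \<tau>. f t \<sigma> \<tau> * (u k \<sigma> + u k \<tau>)) z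
         + 6 * (av (u k) z)\<^sup>2 * av2 (f t) z)"
    have F'b: "\<bar>?F' k z\<bar> \<le> C * (16 * A)" if k: "k \<in> I" for k z
    proof (rule prod2[OF c_bound[OF k]])
      have "\<bar>av2 (\<lambda>\<sigma> \<tau>. f t \<sigma> \<tau> * (u k \<sigma> * u k \<tau>)) z\<bar> \<le> A * 1"
        using A u[OF k] by (intro av2_bound prod2) (auto simp: abs_mult)
      moreover have "\<bar>(4 * av (u k) z) * av2 (\<lambda>\<sigma> \<tau>. f t \<sigma> \<tau> * (u k \<sigma> + u k \<tau>)) z\<bar> \<le> 4 * (A * 2)"
        using avu[OF k, of z] by (intro prod2 av2_bound uu k) auto
      moreover have "\<bar>(6 * (av (u k) z)\<^sup>2) * av2 (f t) z\<bar> \<le> 6 * A"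
        using avu[OF k, of z] avAf by (intro prod2) (auto simp: abs_square_le_1)
      ultimately show "\<bar>2 * av2 (\<lambda>\<sigma> \<tau>. f t \<sigma> \<tau> * (u k \<sigma> * u k \<tau>)) z
         - 4 * av (u k) z * av2 (\<lambda>\<sigma> \<tau>. f t \<sigma> \<tau> * (u k \<sigma> + u k \<tau>)) z
         + 6 * (av (u k) z)\<^sup>2 * av2 (f t) z\<bar> \<le> 16 * A" by linarith
    qed
    have ibp: "integrable P (\<lambda>g. g k * ?F k t (zz t g))"
      "(\<integral>g. g k * ?F k t (zz t g) \<partial>P) = (\<integral>g. ?F' k (zz t g) \<partial>P)" if k: "k \<in> I" for k
    proof -
      have Da: "((\<lambda>s. av F (zz t (g(k := s)))) has_real_derivative av (\<lambda>\<sigma>. F \<sigma> * (c k t * u k \<sigma>)) (zz t (g(k := s)))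
          - av F (zz t (g(k := s))) * av (\<lambda>\<sigma>. c k t * u k \<sigma>) (zz t (g(k := s)))) (at s)" for F g s
        by (rule DERIV_av) (rule DERIV_H_component[OF k])
      have D2: "((\<lambda>s. av2 F (zz t (g(k := s)))) has_real_derivative av2 (\<lambda>\<sigma> \<tau>. F \<sigma> \<tau> * (c k t * u k \<sigma> + c k t * u k \<tau>)) (zz t (g(k := s)))
          - 2 * av (\<lambda>\<sigma>. c k t * u k \<sigma>) (zz t (g(k := s))) * av2 F (zz t (g(k := s)))) (at s)" for F g s
        by (rule DERIV_av2) (rule DERIV_H_component[OF k])
      have sq: "u k \<sigma> * u k \<sigma> = 1" if "\<sigma> \<in> S" for \<sigma> using u[OF k that] by (auto simp: abs_if split: if_splits)
      have a1: "av (\<lambda>\<sigma>. u k \<sigma> * (c k t * u k \<sigma>)) z = c k t" for z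
      proof -
        have "av (\<lambda>\<sigma>. u k \<sigma> * (c k t * u k \<sigma>)) z = (\<Sum>\<sigma>\<in>S. c k t * weight z \<sigma>)"
          unfolding av_def using sq by (intro sum.cong) (auto simp: mult_ac)
        then show ?thesis by (simp add: weight_sum flip: sum_distrib_left)
      qed
      have a2: "av (\<lambda>\<sigma>. c k t * u k \<sigma>) z = c k t * av (u k) z" for z
        unfolding av_def by (simp add: sum_distrib_left mult_ac)
      have a3: "av2 (\<lambda>\<sigma> \<tau>. f t \<sigma> \<tau> * (c k t * u k \<sigma> + c k t * u k \<tau>)) z = c k t * av2 (\<lambda>\<sigma> \<tau>. f t \<sigma> \<tau> * (u k \<sigma> + u k \<tau>)) z" for z
        unfolding av2_def by (simp add: sum_distrib_left algebra_simps)
      \<comment> \<open>The term \<open>2 * av2 (f t)\<close>, produced by squares of spins, cancels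
        against the one that comes from the derivative of \<open>av (u k)\<close>; no diagonal term
        survives in \<open>?F'\<close>.\<close>
      have a4: "av2 (\<lambda>\<sigma> \<tau>. f t \<sigma> \<tau> * (u k \<sigma> + u k \<tau>) * (c k t * u k \<sigma> + c k t * u k \<tau>)) z
         = c k t * (2 * av2 (f t) z + 2 * av2 (\<lambda>\<sigma> \<tau>. f t \<sigma> \<tau> * (u k \<sigma> * u k \<tau>)) z)" for z
      proof -
        have "f t \<sigma> \<tau> * (u k \<sigma> + u k \<tau>) * (c k t * u k \<sigma> + c k t * u k \<tau>) * (weight z \<sigma> * weight z \<tau>) =
           c k t * (2 * (f t \<sigma> \<tau> * (weight z \<sigma> * weight z \<tau>)) + 2 * (f t \<sigma> \<tau> * (u k \<sigma> * u k \<tau>) * (weight z \<sigma> * weight z \<tau>)))"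
          if "\<sigma> \<in> S" "\<tau> \<in> S" for \<sigma> \<tau>
        proof -
          have "(u k \<sigma> + u k \<tau>) * (c k t * u k \<sigma> + c k t * u k \<tau>) = c k t * (u k \<sigma> * u k \<sigma> + u k \<tau> * u k \<tau> + 2 * (u k \<sigma> * u k \<tau>))"
            by (simp add: algebra_simps)
          then have "(u k \<sigma> + u k \<tau>) * (c k t * u k \<sigma> + c k t * u k \<tau>) = c k t * (2 + 2 * (u k \<sigma> * u k \<tau>))"
            using sq that by simp
          then show ?thesis by (simp only: mult.assoc) (simp add: algebra_simps)
        qed
        then show ?thesis unfolding av2_def sum_distrib_left sum.distrib[symmetric] by (intro sum.cong refl) auto
      qed
      have D: "((\<lambda>s. ?F k t (zz t (g(k := s)))) has_real_derivative ?F' k (zz t (g(k := s)))) (at s)" for g s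
        by (rule DERIV_cong[OF DERIV_diff[OF D2 DERIV_mult[OF DERIV_cmult[OF Da] D2]]])
          (unfold a1 a2 a3 a4, simp add: algebra_simps power2_eq_square)
      have ca: "isCont (\<lambda>s. av F (zz t (g(k := s)))) s" for F g s using Da by (rule DERIV_isCont)
      have c2: "isCont (\<lambda>s. av2 F (zz t (g(k := s)))) s" for F g s using D2 by (rule DERIV_isCont)
      have cont: "isCont (\<lambda>s. ?F' k (zz t (g(k := s)))) s" for g s
        by (intro continuous_intros ca c2)
      show "integrable P (\<lambda>g. g k * ?F k t (zz t g))"
        by (rule gauss_PiM_by_parts(1)[OF finite_I k _ _ D cont Fb[OF k] F'b[OF k]]) measurable
      show "(\<integral>g. g k * ?F k t (zz t g) \<partial>P) = (\<integral>g. ?F' k (zz t g) \<partial>P)"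
        by (rule gauss_PiM_by_parts(2)[OF finite_I k _ _ D cont Fb[OF k] F'b[OF k]]) measurable
    qed
    have i0: "integrable P (\<lambda>g. av2 (f' t) (zz t g))" by (rule integrable_bounded[where B=A']) (auto intro: av2_bound A')
    have iF': "integrable P (\<lambda>g. ?F' k (zz t g))" if "k \<in> I" for k
      by (rule integrable_bounded[OF _ F'b[OF that]]) measurable
    have "(\<integral>g. ?D t g \<partial>P) = (\<integral>g. av2 (f' t) (zz t g) \<partial>P) + (\<integral>g. (\<Sum>k\<in>I. c' k t * (g k * ?F k t (zz t g))) \<partial>P)"
      unfolding mult.assoc[of "c' _ t"]
      by (intro Bochner_Integration.integral_add i0 Bochner_Integration.integrable_sum integrable_mult_right ibp(1))
    also have "(\<integral>g. (\<Sum>k\<in>I. c' k t * (g k * ?F k t (zz t g))) \<partial>P) = (\<Sum>k\<in>I. \<integral>g. c' k t * (g k * ?F k t (zz t g)) \<partial>P)"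
      by (intro Bochner_Integration.integral_sum integrable_mult_right ibp(1))
    also have "\<dots> = (\<Sum>k\<in>I. \<integral>g. c' k t * ?F' k (zz t g) \<partial>P)"
      using ibp(2) by (intro sum.cong refl) (simp only: integral_mult_right_zero)
    also have "\<dots> = (\<integral>g. (\<Sum>k\<in>I. c' k t * ?F' k (zz t g)) \<partial>P)"
      by (intro Bochner_Integration.integral_sum[symmetric] integrable_mult_right iF')
    also have "(\<integral>g. av2 (f' t) (zz t g) \<partial>P) + \<dots> = (\<integral>g. av2 (f' t) (zz t g) + (\<Sum>k\<in>I. c' k t * ?F' k (zz t g)) \<partial>P)"
      by (intro Bochner_Integration.integral_add[symmetric] i0 Bochner_Integration.integrable_sum integrable_mult_right iF')
    finally show ?thesis by (simp add: mult_ac)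
  qed
  finally show ?thesis .
qed

end

text \<open>Twice the difference of the two sides is the double sum of
  \<open>w s * w t * (\<phi> (q s) - \<phi> (q t)) * (q s - q t)\<close>, and each term is
  nonnegative by monotonicity.\<close>

lemma chebyshev_weighted_sum:
  fixes w q :: "'a \<Rightarrow> real" and \<phi> :: "real \<Rightarrow> real"
  assumes "finite S" "\<And>s. s \<in> S \<Longrightarrow> 0 \<le> w s" "mono \<phi>"
  shows "(\<Sum>s\<in>S. w s * \<phi> (q s)) * (\<Sum>s\<in>S. w s * q s) \<le> (\<Sum>s\<in>S. w s) * (\<Sum>s\<in>S. w s * (\<phi> (q s) * q s))"
proof -
  let ?T = "\<lambda>s t. w s * w t * ((\<phi> (q s) - \<phi> (q t)) * (q s - q t))"
  have m: "0 \<le> (\<phi> (q s) - \<phi> (q t)) * (q s - q t)" for s t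
  proof (cases "q s \<le> q t")
    case True
    then show ?thesis using monoD[OF assms(3) True] by (intro mult_nonpos_nonpos) auto
  next
    case False
    then show ?thesis using monoD[OF assms(3), of "q t" "q s"] by (intro mult_nonneg_nonneg) auto
  qed
  have "0 \<le> (\<Sum>s\<in>S. \<Sum>t\<in>S. ?T s t)"
  proof (intro sum_nonneg)
    fix s t assume "s \<in> S" "t \<in> S"
    then show "0 \<le> ?T s t" using assms(2)[of s] assms(2)[of t] m[of s t] by simp
  qed
  also have "(\<Sum>s\<in>S. \<Sum>t\<in>S. ?T s t) =
      (\<Sum>s\<in>S. \<Sum>t\<in>S. w t * (w s * (\<phi> (q s) * q s))) + (\<Sum>s\<in>S. \<Sum>t\<in>S. w s * (w t * (\<phi> (q t) * q t)))
      - ((\<Sum>s\<in>S. \<Sum>t\<in>S. w s * \<phi> (q s) * (w t * q t)) + (\<Sum>s\<in>S. \<Sum>t\<in>S. w t * \<phi> (q t) * (w s * q s)))"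
    unfolding sum.distrib[symmetric] sum_subtractf[symmetric] by (intro sum.cong refl; simp add: algebra_simps)
  also have "(\<Sum>s\<in>S. \<Sum>t\<in>S. w t * (w s * (\<phi> (q s) * q s))) = (\<Sum>s\<in>S. w s) * (\<Sum>s\<in>S. w s * (\<phi> (q s) * q s))"
    unfolding sum_product by (rule sum.swap)
  also have "(\<Sum>s\<in>S. \<Sum>t\<in>S. w t * \<phi> (q t) * (w s * q s)) = (\<Sum>s\<in>S. w s * \<phi> (q s)) * (\<Sum>s\<in>S. w s * q s)"
    unfolding sum_product by (rule sum.swap)
  finally show ?thesis unfolding sum_product[symmetric] by linarith
qed

context gaussian_gibbs
begin

lemma av_linear: "av (\<lambda>\<sigma>. a * f \<sigma> + b * g \<sigma>) z = a * av f z + b * av g z"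
  unfolding av_def by (simp add: algebra_simps sum.distrib sum_distrib_left)

lemma av_mono: "(\<And>\<sigma>. \<sigma> \<in> S \<Longrightarrow> f \<sigma> \<le> g \<sigma>) \<Longrightarrow> av f z \<le> av g z"
  unfolding av_def using weight_pos[of z] by (intro sum_mono mult_right_mono) (auto intro: less_imp_le)

lemma av2_mono: "(\<And>\<sigma> \<tau>. \<sigma> \<in> S \<Longrightarrow> \<tau> \<in> S \<Longrightarrow> f \<sigma> \<tau> \<le> g \<sigma> \<tau>) \<Longrightarrow> av2 f z \<le> av2 g z"
  unfolding av2_alt by (intro av_mono)

lemma av_cmult: "av (\<lambda>\<sigma>. a * f \<sigma>) z = a * av f z"
  unfolding av_def by (simp add: sum_distrib_left mult_ac)

lemma av_cmult_right: "av (\<lambda>\<sigma>. f \<sigma> * a) z = av f z * a"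
  using av_cmult[of a f z] by (simp only: mult.commute)

lemma av2_cmult: "av2 (\<lambda>\<sigma> \<tau>. a * f \<sigma> \<tau>) z = a * av2 f z"
  unfolding av2_alt by (simp add: av_cmult)

lemma av2_add: "av2 (\<lambda>\<sigma> \<tau>. f \<sigma> \<tau> + g \<sigma> \<tau>) z = av2 f z + av2 g z"
  unfolding av2_def by (simp add: sum.distrib distrib_right)

lemma av_const: "av (\<lambda>\<sigma>. a) z = a"
  unfolding av_def by (simp add: weight_sum flip: sum_distrib_left)

lemma av_cong: "(\<And>\<sigma>. \<sigma> \<in> S \<Longrightarrow> f \<sigma> = g \<sigma>) \<Longrightarrow> av f z = av g z"
  unfolding av_def by (intro sum.cong) auto

lemma av2_cong: "(\<And>\<sigma> \<tau>. \<sigma> \<in> S \<Longrightarrow> \<tau> \<in> S \<Longrightarrow> f \<sigma> \<tau> = g \<sigma> \<tau>) \<Longrightarrow> av2 f z = av2 g z"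
  unfolding av2_def by (intro sum.cong) auto

lemma av2_swap: "av2 (\<lambda>\<sigma> \<tau>. f \<tau> \<sigma>) z = av2 f z"
  unfolding av2_def by (subst sum.swap) (simp add: mult.commute)

lemma av_chebyshev:
  assumes "mono \<phi>"
  shows "av (\<lambda>\<sigma>. \<phi> (q \<sigma>)) z * av q z \<le> av (\<lambda>\<sigma>. \<phi> (q \<sigma>) * q \<sigma>) z"
  using chebyshev_weighted_sum[OF finite_S _ assms, of "weight z" q] weight_pos[of z]
  by (simp add: av_def weight_sum mult_ac less_imp_le)

lemma av2_chebyshev:
  assumes "mono \<phi>"
  shows "av2 (\<lambda>\<sigma> \<tau>. \<phi> (q \<sigma> \<tau>)) z * av2 q z \<le> av2 (\<lambda>\<sigma> \<tau>. \<phi> (q \<sigma> \<tau>) * q \<sigma> \<tau>) z"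
proof -
  have e: "av2 f z = (\<Sum>s\<in>S \<times> S. (weight z (fst s) * weight z (snd s)) * f (fst s) (snd s))" for f
    unfolding av2_def sum.cartesian_product by (simp add: case_prod_beta mult.commute)
  have "(\<Sum>s\<in>S \<times> S. weight z (fst s) * weight z (snd s)) = 1"
    using e[of "\<lambda>_ _. 1"] by (simp add: av2_alt av_const)
  then show ?thesis
    using chebyshev_weighted_sum[OF finite_cartesian_product[OF finite_S finite_S] _ assms,
        of "\<lambda>s. weight z (fst s) * weight z (snd s)" "\<lambda>s. q (fst s) (snd s)"] weight_pos[of z]
    unfolding e by (simp add: less_imp_le)
qed

text \<open>With symmetric covariances the Gaussian derivative of a two-replica average involves four
  replicas. Chebyshev's inequality reduces every term to one in which test function and overlap
  refer to the same pair of replicas.\<close>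

lemma replica_derivative_le:
  assumes \<phi>: "mono \<phi>" "\<And>x. 0 \<le> \<phi> x" and a: "0 \<le> a"
    and C: "\<And>\<sigma> \<tau>. \<sigma> \<in> S \<Longrightarrow> \<tau> \<in> S \<Longrightarrow> (\<Sum>k\<in>I. cc k * (u k \<sigma> * u k \<tau>)) = a * (A \<sigma> \<tau> + K)"
    and A: "\<And>\<sigma> \<tau>. \<sigma> \<in> S \<Longrightarrow> \<tau> \<in> S \<Longrightarrow> \<bar>A \<sigma> \<tau>\<bar> \<le> Q \<sigma> \<tau> / 2"
    and Q: "\<And>\<sigma> \<tau>. Q \<sigma> \<tau> = Q \<tau> \<sigma>"
  defines "f \<equiv> (\<lambda>\<sigma> \<tau>. \<phi> (Q \<sigma> \<tau>))"
  shows "(\<Sum>k\<in>I. cc k * (2 * av2 (\<lambda>\<sigma> \<tau>. f \<sigma> \<tau> * (u k \<sigma> * u k \<tau>)) z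
         - 4 * av (u k) z * av2 (\<lambda>\<sigma> \<tau>. f \<sigma> \<tau> * (u k \<sigma> + u k \<tau>)) z
         + 6 * (av (u k) z)\<^sup>2 * av2 f z)) \<le> 8 * a * av2 (\<lambda>\<sigma> \<tau>. f \<sigma> \<tau> * Q \<sigma> \<tau>) z"
proof -
  have f0: "0 \<le> f \<sigma> \<tau>" for \<sigma> \<tau> by (simp add: f_def \<phi>)
  have swap1: "(\<Sum>k\<in>I. cc k * av (g k) z) = av (\<lambda>\<sigma>. \<Sum>k\<in>I. cc k * g k \<sigma>) z" for g :: "'k \<Rightarrow> 's \<Rightarrow> real"
    unfolding av_def sum_distrib_left sum_distrib_right by (subst sum.swap) (simp add: mult_ac)
  have swap2: "(\<Sum>k\<in>I. cc k * av2 (g k) z) = av2 (\<lambda>\<sigma> \<tau>. \<Sum>k\<in>I. cc k * g k \<sigma> \<tau>) z" for g :: "'k \<Rightarrow> 's \<Rightarrow> 's \<Rightarrow> real"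
    unfolding av2_alt swap1 ..
  define M where "M \<sigma> = av (A \<sigma>) z" for \<sigma>
  define MQ where "MQ \<sigma> = av (Q \<sigma>) z" for \<sigma>
  have Mabs: "\<bar>M \<sigma>\<bar> \<le> MQ \<sigma> / 2" if "\<sigma> \<in> S" for \<sigma>
  proof -
    have "av (A \<sigma>) z \<le> av (\<lambda>\<tau>. (1/2) * Q \<sigma> \<tau>) z" "av (\<lambda>\<tau>. (-1/2) * Q \<sigma> \<tau>) z \<le> av (A \<sigma>) z"
      using A[OF that] by (intro av_mono; force simp: abs_le_iff)+
    then show ?thesis unfolding av_cmult M_def MQ_def by (simp add: abs_le_iff)
  qed
  have T1: "(\<Sum>k\<in>I. cc k * av2 (\<lambda>\<sigma> \<tau>. f \<sigma> \<tau> * (u k \<sigma> * u k \<tau>)) z) = a * av2 (\<lambda>\<sigma> \<tau>. f \<sigma> \<tau> * A \<sigma> \<tau>) z + a * K * av2 f z"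
  proof -
    have "(\<Sum>k\<in>I. cc k * av2 (\<lambda>\<sigma> \<tau>. f \<sigma> \<tau> * (u k \<sigma> * u k \<tau>)) z) = av2 (\<lambda>\<sigma> \<tau>. a * (f \<sigma> \<tau> * A \<sigma> \<tau>) + a * K * f \<sigma> \<tau>) z"
      unfolding swap2
    proof (rule av2_cong)
      fix \<sigma> \<tau> assume st: "\<sigma> \<in> S" "\<tau> \<in> S"
      have "(\<Sum>k\<in>I. cc k * (f \<sigma> \<tau> * (u k \<sigma> * u k \<tau>))) = f \<sigma> \<tau> * (\<Sum>k\<in>I. cc k * (u k \<sigma> * u k \<tau>))"
        by (simp add: sum_distrib_left mult_ac)
      then show "(\<Sum>k\<in>I. cc k * (f \<sigma> \<tau> * (u k \<sigma> * u k \<tau>))) = a * (f \<sigma> \<tau> * A \<sigma> \<tau>) + a * K * f \<sigma> \<tau>"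
        unfolding C[OF st] by (simp add: algebra_simps)
    qed
    then show ?thesis by (simp add: av2_add av2_cmult)
  qed
  have T2: "(\<Sum>k\<in>I. cc k * (av (u k) z * av2 (\<lambda>\<sigma> \<tau>. f \<sigma> \<tau> * (u k \<sigma> + u k \<tau>)) z)) =
      a * av2 (\<lambda>\<sigma> \<tau>. f \<sigma> \<tau> * (M \<sigma> + M \<tau>)) z + 2 * a * K * av2 f z"
  proof -
    have "(\<Sum>k\<in>I. cc k * (av (u k) z * av2 (\<lambda>\<sigma> \<tau>. f \<sigma> \<tau> * (u k \<sigma> + u k \<tau>)) z)) =
      av2 (\<lambda>\<sigma> \<tau>. a * (f \<sigma> \<tau> * (M \<sigma> + M \<tau>)) + 2 * a * K * f \<sigma> \<tau>) z"
      unfolding swap2 av2_cmult[symmetric, of "av (u _) z"]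
    proof (rule av2_cong)
      fix \<sigma> \<tau> assume st: "\<sigma> \<in> S" "\<tau> \<in> S"
      have m: "(\<Sum>k\<in>I. cc k * (u k \<sigma> * av (u k) z)) = a * M \<sigma> + a * K" if "\<sigma> \<in> S" for \<sigma>
      proof -
        have "(\<Sum>k\<in>I. cc k * (u k \<sigma> * av (u k) z)) = av (\<lambda>\<rho>. a * A \<sigma> \<rho> + (a * K) * 1) z"
          unfolding av_cmult[symmetric, of "u _ \<sigma>"] swap1 using C[OF that] by (intro av_cong) (simp add: algebra_simps)
        then show ?thesis unfolding av_linear av_const M_def by simp
      qed
      have "(\<Sum>k\<in>I. cc k * (av (u k) z * (f \<sigma> \<tau> * (u k \<sigma> + u k \<tau>)))) =
         f \<sigma> \<tau> * ((\<Sum>k\<in>I. cc k * (u k \<sigma> * av (u k) z)) + (\<Sum>k\<in>I. cc k * (u k \<tau> * av (u k) z)))"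
        unfolding sum.distrib[symmetric] sum_distrib_left by (intro sum.cong refl) (simp add: algebra_simps)
      then show "(\<Sum>k\<in>I. cc k * (av (u k) z * (f \<sigma> \<tau> * (u k \<sigma> + u k \<tau>)))) = a * (f \<sigma> \<tau> * (M \<sigma> + M \<tau>)) + 2 * a * K * f \<sigma> \<tau>"
        unfolding m[OF st(1)] m[OF st(2)] by (simp add: algebra_simps)
    qed
    then show ?thesis by (simp add: av2_add av2_cmult)
  qed
  have T3: "(\<Sum>k\<in>I. cc k * ((av (u k) z)\<^sup>2 * av2 f z)) = (a * av2 A z + a * K) * av2 f z"
  proof -
    have "(\<Sum>k\<in>I. cc k * (av (u k) z)\<^sup>2) = av2 (\<lambda>\<sigma> \<tau>. a * A \<sigma> \<tau> + a * K) z"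
    proof -
      have "(av (u k) z)\<^sup>2 = av2 (\<lambda>\<sigma> \<tau>. u k \<sigma> * u k \<tau>) z" for k
        by (simp only: av2_alt av_cmult av_cmult_right power2_eq_square)
      then have "(\<Sum>k\<in>I. cc k * (av (u k) z)\<^sup>2) = av2 (\<lambda>\<sigma> \<tau>. \<Sum>k\<in>I. cc k * (u k \<sigma> * u k \<tau>)) z"
        by (simp add: swap2)
      also have "\<dots> = av2 (\<lambda>\<sigma> \<tau>. a * A \<sigma> \<tau> + a * K) z" by (rule av2_cong) (simp add: C algebra_simps)
      finally show ?thesis .
    qed
    then have "(\<Sum>k\<in>I. cc k * (av (u k) z)\<^sup>2) = a * av2 A z + a * K"
      by (simp add: av2_add av2_cmult) (simp add: av2_alt av_const)
    then show ?thesis unfolding mult.assoc[symmetric] sum_distrib_right[symmetric] by simp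
  qed
  have "(\<Sum>k\<in>I. cc k * (2 * av2 (\<lambda>\<sigma> \<tau>. f \<sigma> \<tau> * (u k \<sigma> * u k \<tau>)) z
         - 4 * av (u k) z * av2 (\<lambda>\<sigma> \<tau>. f \<sigma> \<tau> * (u k \<sigma> + u k \<tau>)) z
         + 6 * (av (u k) z)\<^sup>2 * av2 f z)) =
     2 * (\<Sum>k\<in>I. cc k * av2 (\<lambda>\<sigma> \<tau>. f \<sigma> \<tau> * (u k \<sigma> * u k \<tau>)) z)
     - 4 * (\<Sum>k\<in>I. cc k * (av (u k) z * av2 (\<lambda>\<sigma> \<tau>. f \<sigma> \<tau> * (u k \<sigma> + u k \<tau>)) z))
     + 6 * (\<Sum>k\<in>I. cc k * ((av (u k) z)\<^sup>2 * av2 f z))"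
    unfolding sum_distrib_left sum.distrib[symmetric] sum_subtractf[symmetric] by (intro sum.cong refl) (simp add: algebra_simps)
  \<comment> \<open>The constant \<open>K\<close> drops out, as its coefficients add up to 2 - 8 + 6
    = 0. Only the variable part \<open>A\<close> of the covariance has to be small.\<close>
  also have "\<dots> = a * (2 * av2 (\<lambda>\<sigma> \<tau>. f \<sigma> \<tau> * A \<sigma> \<tau>) z - 4 * av2 (\<lambda>\<sigma> \<tau>. f \<sigma> \<tau> * (M \<sigma> + M \<tau>)) z + 6 * (av2 f z * av2 A z))"
    unfolding T1 T2 T3 by (simp add: algebra_simps)
  also have "\<dots> \<le> a * (8 * av2 (\<lambda>\<sigma> \<tau>. f \<sigma> \<tau> * Q \<sigma> \<tau>) z)"
  proof (rule mult_left_mono[OF _ a])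
    let ?R = "av2 (\<lambda>\<sigma> \<tau>. f \<sigma> \<tau> * Q \<sigma> \<tau>) z"
    have 1: "av2 (\<lambda>\<sigma> \<tau>. f \<sigma> \<tau> * A \<sigma> \<tau>) z \<le> (1/2) * ?R"
      unfolding av2_cmult[symmetric]
    proof (rule av2_mono)
      fix \<sigma> \<tau> assume "\<sigma> \<in> S" "\<tau> \<in> S"
      then have "f \<sigma> \<tau> * A \<sigma> \<tau> \<le> f \<sigma> \<tau> * (Q \<sigma> \<tau> / 2)" using A by (intro mult_left_mono f0) (force simp: abs_le_iff)
      then show "f \<sigma> \<tau> * A \<sigma> \<tau> \<le> 1 / 2 * (f \<sigma> \<tau> * Q \<sigma> \<tau>)" by simp
    qed
    \<comment> \<open>Given the first replica, \<open>f\<close> and \<open>Q\<close> are averaged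
      over two independent second replicas. Both increase with the same overlap, so Chebyshev's
      inequality lets them share one replica.\<close>
    have left: "av2 (\<lambda>\<sigma> \<tau>. f \<sigma> \<tau> * MQ \<sigma>) z \<le> ?R"
    proof -
      have "av2 (\<lambda>\<sigma> \<tau>. f \<sigma> \<tau> * MQ \<sigma>) z = av (\<lambda>\<sigma>. av (f \<sigma>) z * av (Q \<sigma>) z) z"
        by (simp only: av2_alt MQ_def av_cmult_right)
      also have "\<dots> \<le> ?R" unfolding av2_alt f_def by (intro av_mono av_chebyshev \<phi>)
      finally show ?thesis .
    qed
    have right: "av2 (\<lambda>\<sigma> \<tau>. f \<sigma> \<tau> * MQ \<tau>) z \<le> ?R"
    proof -
      have "av2 (\<lambda>\<sigma> \<tau>. f \<sigma> \<tau> * MQ \<tau>) z = av2 (\<lambda>\<sigma> \<tau>. f \<sigma> \<tau> * MQ \<sigma>) z"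
        using av2_swap[of "\<lambda>\<sigma> \<tau>. f \<sigma> \<tau> * MQ \<sigma>" z] Q unfolding f_def by simp
      with left show ?thesis by simp
    qed
    have "- av2 (\<lambda>\<sigma> \<tau>. f \<sigma> \<tau> * (M \<sigma> + M \<tau>)) z = av2 (\<lambda>\<sigma> \<tau>. (-1) * (f \<sigma> \<tau> * (M \<sigma> + M \<tau>))) z"
      unfolding av2_cmult by simp
    also have "\<dots> \<le> av2 (\<lambda>\<sigma> \<tau>. (1/2) * (f \<sigma> \<tau> * MQ \<sigma>) + (1/2) * (f \<sigma> \<tau> * MQ \<tau>)) z"
    proof (rule av2_mono)
      fix \<sigma> \<tau> assume st: "\<sigma> \<in> S" "\<tau> \<in> S"
      have "- (M \<sigma> + M \<tau>) \<le> MQ \<sigma> / 2 + MQ \<tau> / 2" using Mabs[OF st(1)] Mabs[OF st(2)] by linarith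
      from mult_left_mono[OF this f0[of \<sigma> \<tau>]]
      show "- 1 * (f \<sigma> \<tau> * (M \<sigma> + M \<tau>)) \<le> 1 / 2 * (f \<sigma> \<tau> * MQ \<sigma>) + 1 / 2 * (f \<sigma> \<tau> * MQ \<tau>)"
        by (simp add: algebra_simps)
    qed
    also have "\<dots> \<le> ?R" unfolding av2_add av2_cmult using left right by simp
    finally have 2: "- av2 (\<lambda>\<sigma> \<tau>. f \<sigma> \<tau> * (M \<sigma> + M \<tau>)) z \<le> ?R" .
    have "av2 A z \<le> av2 (\<lambda>\<sigma> \<tau>. (1/2) * Q \<sigma> \<tau>) z" using A by (intro av2_mono) (force simp: abs_le_iff)
    moreover have "0 \<le> av2 f z" unfolding av2_def using weight_pos[of z] f0
      by (intro sum_nonneg mult_nonneg_nonneg) (auto intro: less_imp_le)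
    ultimately have "av2 f z * av2 A z \<le> av2 f z * ((1/2) * av2 Q z)" unfolding av2_cmult by (intro mult_left_mono)
    also have "\<dots> \<le> (1/2) * ?R" using av2_chebyshev[OF \<phi>(1), of Q z] by (simp add: f_def)
    finally have 3: "av2 f z * av2 A z \<le> (1/2) * ?R" .
    \<comment> \<open>The factor 8 is 2 * (1/2) + 4 * 1 + 6 * (1/2).\<close>
    show "2 * av2 (\<lambda>\<sigma> \<tau>. f \<sigma> \<tau> * A \<sigma> \<tau>) z - 4 * av2 (\<lambda>\<sigma> \<tau>. f \<sigma> \<tau> * (M \<sigma> + M \<tau>)) z + 6 * (av2 f z * av2 A z) \<le> 8 * ?R"
      using 1 2 3 by linarith
  qed
  finally show ?thesis by (simp only: mult_ac)
qed

end

section \<open>Overlap control along the interpolation\<close>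

locale replica_coupling = gaussian_gibbs S I u h c c' C
  for S :: "'s set" and I :: "'k set" and u h c c' C +
  fixes a0 K E0 l0 B :: real and A Q :: "'s \<Rightarrow> 's \<Rightarrow> real"
  assumes cov: "\<And>\<sigma> \<tau> t. \<sigma> \<in> S \<Longrightarrow> \<tau> \<in> S \<Longrightarrow>
      (\<Sum>k\<in>I. c k t * c' k t * (u k \<sigma> * u k \<tau>)) = a0 * (sin t * cos t) * (A \<sigma> \<tau> + K)"
    and a0: "0 \<le> a0" and diag: "\<And>\<sigma>. \<sigma> \<in> S \<Longrightarrow> A \<sigma> \<sigma> = E0"
    and AQ: "\<And>\<sigma> \<tau>. \<sigma> \<in> S \<Longrightarrow> \<tau> \<in> S \<Longrightarrow> \<bar>A \<sigma> \<tau>\<bar> \<le> Q \<sigma> \<tau> / 2"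
    and Q_sym: "\<And>\<sigma> \<tau>. Q \<sigma> \<tau> = Q \<tau> \<sigma>"
    and l0: "4 * a0 < l0"
    and start: "(\<integral>g. av2 (\<lambda>\<sigma> \<tau>. exp (l0 * Q \<sigma> \<tau>)) (zz 0 g) \<partial>P) \<le> B" and B: "1 \<le> B"
begin

text \<open>The exponent falls at the rate \<open>8 * a0 * sin t * cos t\<close>, exactly the growth
  that \<open>replica_derivative_le\<close> allows for the Gaussian part; the mean of the tilt
  therefore cannot increase.\<close>

definition tilt :: "real \<Rightarrow> 's \<Rightarrow> 's \<Rightarrow> real" where
  "tilt t \<sigma> \<tau> = exp ((l0 - 4 * a0 * (sin t)\<^sup>2) * Q \<sigma> \<tau>)"

lemma Q_nonneg: "\<sigma> \<in> S \<Longrightarrow> \<tau> \<in> S \<Longrightarrow> 0 \<le> Q \<sigma> \<tau>"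
  using AQ[of \<sigma> \<tau>] by linarith

lemma mean_tilt_decreasing:
  assumes "0 \<le> t" "t \<le> pi / 2"
  shows "(\<integral>g. av2 (tilt t) (zz t g) \<partial>P) \<le> B"
proof -
  \<comment> \<open>A crude maximum over the finite configuration space; it makes the tilt and its
    time derivative bounded, as differentiation under the integral demands.\<close>
  define Qm where "Qm = (\<Sum>\<sigma>\<in>S. \<Sum>\<tau>\<in>S. Q \<sigma> \<tau>)"
  have Qm: "Q \<sigma> \<tau> \<le> Qm" if "\<sigma> \<in> S" "\<tau> \<in> S" for \<sigma> \<tau>
  proof -
    have "Q \<sigma> \<tau> \<le> (\<Sum>\<tau>\<in>S. Q \<sigma> \<tau>)" using that Q_nonneg finite_S by (intro member_le_sum) auto
    also have "\<dots> \<le> Qm" unfolding Qm_def using that Q_nonneg finite_S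
      by (intro member_le_sum[of \<sigma> S "\<lambda>\<sigma>. \<Sum>\<tau>\<in>S. Q \<sigma> \<tau>"] sum_nonneg) auto
    finally show ?thesis .
  qed
  have sin2: "0 \<le> (sin t)\<^sup>2" "(sin t)\<^sup>2 \<le> 1" for t :: real by (auto simp: abs_square_le_1)
  have l: "0 \<le> l0 - 4 * a0 * (sin t)\<^sup>2" "l0 - 4 * a0 * (sin t)\<^sup>2 \<le> l0" for t :: real
    using l0 a0 sin2[of t] mult_left_le[OF sin2(2)[of t], of "4 * a0"] by auto
  have l00: "0 \<le> l0" using l0 a0 by linarith
  let ?f' = "\<lambda>t \<sigma> \<tau>. - 8 * (a0 * (sin t * cos t)) * (tilt t \<sigma> \<tau> * Q \<sigma> \<tau>)"
  have tb: "\<bar>tilt t \<sigma> \<tau>\<bar> \<le> exp (l0 * Qm)" if "\<sigma> \<in> S" "\<tau> \<in> S" for t \<sigma> \<tau>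
    unfolding tilt_def using l[of t] l00 Qm[OF that] Q_nonneg[OF that] by (auto intro!: mult_mono)
  have tD: "((\<lambda>t. tilt t \<sigma> \<tau>) has_real_derivative ?f' t \<sigma> \<tau>) (at t)" for t \<sigma> \<tau>
    unfolding tilt_def by (rule derivative_eq_intros refl | simp)+
  have f'b: "\<bar>?f' t \<sigma> \<tau>\<bar> \<le> 8 * (a0 * (1 * 1)) * (exp (l0 * Qm) * Qm)" if "\<sigma> \<in> S" "\<tau> \<in> S" for t \<sigma> \<tau>
    unfolding abs_mult using tb[OF that, of t] a0 Qm[OF that] Q_nonneg[OF that] abs_sin_le_one[of t] abs_cos_le_one[of t]
    by (intro mult_mono mult_nonneg_nonneg) auto
  have DF: "((\<lambda>t. \<integral>g. av2 (tilt t) (zz t g) \<partial>P) has_real_derivative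
     (\<integral>g. av2 (?f' s) (zz s g) + (\<Sum>k\<in>I. c k s * c' k s *
        (2 * av2 (\<lambda>\<sigma> \<tau>. tilt s \<sigma> \<tau> * (u k \<sigma> * u k \<tau>)) (zz s g)
         - 4 * av (u k) (zz s g) * av2 (\<lambda>\<sigma> \<tau>. tilt s \<sigma> \<tau> * (u k \<sigma> + u k \<tau>)) (zz s g)
         + 6 * (av (u k) (zz s g))\<^sup>2 * av2 (tilt s) (zz s g))) \<partial>P)) (at s)" for s
    by (rule DERIV_mean_av2[OF tD tb f'b])
  have le0: "(\<integral>g. av2 (?f' s) (zz s g) + (\<Sum>k\<in>I. c k s * c' k s *
        (2 * av2 (\<lambda>\<sigma> \<tau>. tilt s \<sigma> \<tau> * (u k \<sigma> * u k \<tau>)) (zz s g)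
         - 4 * av (u k) (zz s g) * av2 (\<lambda>\<sigma> \<tau>. tilt s \<sigma> \<tau> * (u k \<sigma> + u k \<tau>)) (zz s g)
         + 6 * (av (u k) (zz s g))\<^sup>2 * av2 (tilt s) (zz s g))) \<partial>P) \<le> 0" if "0 \<le> s" "s \<le> pi / 2" for s
  proof -
    have a: "0 \<le> a0 * (sin s * cos s)" using that a0 by (intro mult_nonneg_nonneg sin_ge_zero cos_ge_zero) auto
    have 1: "(\<Sum>k\<in>I. c k s * c' k s *
        (2 * av2 (\<lambda>\<sigma> \<tau>. tilt s \<sigma> \<tau> * (u k \<sigma> * u k \<tau>)) z
         - 4 * av (u k) z * av2 (\<lambda>\<sigma> \<tau>. tilt s \<sigma> \<tau> * (u k \<sigma> + u k \<tau>)) z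
         + 6 * (av (u k) z)\<^sup>2 * av2 (tilt s) z)) \<le> 8 * (a0 * (sin s * cos s)) * av2 (\<lambda>\<sigma> \<tau>. tilt s \<sigma> \<tau> * Q \<sigma> \<tau>) z" for z
      using replica_derivative_le[of "\<lambda>x. exp ((l0 - 4 * a0 * (sin s)\<^sup>2) * x)" "a0 * (sin s * cos s)" "\<lambda>k. c k s * c' k s" A K Q z] 
        l[of s] a cov AQ Q_sym unfolding tilt_def[abs_def] by (auto simp: monoI mult_left_mono)
    have 2: "av2 (?f' s) z = - 8 * (a0 * (sin s * cos s)) * av2 (\<lambda>\<sigma> \<tau>. tilt s \<sigma> \<tau> * Q \<sigma> \<tau>) z" for z
      by (rule av2_cmult)
    have "av2 (?f' s) z + (\<Sum>k\<in>I. c k s * c' k s *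
        (2 * av2 (\<lambda>\<sigma> \<tau>. tilt s \<sigma> \<tau> * (u k \<sigma> * u k \<tau>)) z
         - 4 * av (u k) z * av2 (\<lambda>\<sigma> \<tau>. tilt s \<sigma> \<tau> * (u k \<sigma> + u k \<tau>)) z
         + 6 * (av (u k) z)\<^sup>2 * av2 (tilt s) z)) \<le> 0" for z
      using 1[of z] 2[of z] by linarith
    from integral_nonneg_AE[OF always_eventually[OF allI], where M=P and f="\<lambda>g. - (av2 (?f' s) (zz s g) + (\<Sum>k\<in>I. c k s * c' k s *
        (2 * av2 (\<lambda>\<sigma> \<tau>. tilt s \<sigma> \<tau> * (u k \<sigma> * u k \<tau>)) (zz s g)
         - 4 * av (u k) (zz s g) * av2 (\<lambda>\<sigma> \<tau>. tilt s \<sigma> \<tau> * (u k \<sigma> + u k \<tau>)) (zz s g)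
         + 6 * (av (u k) (zz s g))\<^sup>2 * av2 (tilt s) (zz s g))))"] this
    show ?thesis by (simp only: Bochner_Integration.integral_minus neg_0_le_iff_le)
  qed
  have "(\<integral>g. av2 (tilt t) (zz t g) \<partial>P) \<le> (\<integral>g. av2 (tilt 0) (zz 0 g) \<partial>P)"
  proof (rule DERIV_nonpos_imp_nonincreasing[of 0 t "\<lambda>t. \<integral>g. av2 (tilt t) (zz t g) \<partial>P"])
    fix s assume s: "0 \<le> s" "s \<le> t"
    show "\<exists>y. ((\<lambda>t. \<integral>g. av2 (tilt t) (zz t g) \<partial>P) has_real_derivative y) (at s) \<and> y \<le> 0"
      by (rule exI, rule conjI, rule DF, rule le0) (use s assms in auto)
  qed (rule assms)
  also have "tilt 0 = (\<lambda>\<sigma> \<tau>. exp (l0 * Q \<sigma> \<tau>))" by (simp add: tilt_def fun_eq_iff)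
  finally show ?thesis using start by simp
qed

text \<open>Jensen's inequality turns the bound \<open>B\<close> on an exponential moment into a
  bound of order \<open>ln B\<close> on the mean. The rate is the exponent
  \<open>l0 - 4 * a0\<close> that the tilt still has at the end of the interpolation.\<close>

lemma mean_Q_le:
  assumes "0 \<le> t" "t \<le> pi / 2"
  shows "(\<integral>g. av2 Q (zz t g) \<partial>P) \<le> ln B / (l0 - 4 * a0)"
proof -
  define L where "L = l0 - 4 * a0"
  have L: "L > 0" using l0 by (simp add: L_def)
  define Qm where "Qm = (\<Sum>\<sigma>\<in>S. \<Sum>\<tau>\<in>S. \<bar>Q \<sigma> \<tau>\<bar>)"
  define Tm where "Tm = (\<Sum>\<sigma>\<in>S. \<Sum>\<tau>\<in>S. tilt t \<sigma> \<tau>)"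
  have le: "f \<sigma> \<tau> \<le> (\<Sum>\<sigma>\<in>S. \<Sum>\<tau>\<in>S. f \<sigma> \<tau>)" if "\<sigma> \<in> S" "\<tau> \<in> S" "\<And>\<sigma> \<tau>. 0 \<le> f \<sigma> \<tau>" for \<sigma> \<tau> and f :: "'s \<Rightarrow> 's \<Rightarrow> real"
  proof -
    have "f \<sigma> \<tau> \<le> (\<Sum>\<tau>\<in>S. f \<sigma> \<tau>)" using that finite_S by (intro member_le_sum) auto
    also have "\<dots> \<le> (\<Sum>\<sigma>\<in>S. \<Sum>\<tau>\<in>S. f \<sigma> \<tau>)" using that finite_S
      by (intro member_le_sum[of \<sigma> S "\<lambda>\<sigma>. \<Sum>\<tau>\<in>S. f \<sigma> \<tau>"] sum_nonneg) auto
    finally show ?thesis .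
  qed
  have iQ: "integrable P (\<lambda>g. av2 Q (zz t g))"
    by (rule integrable_bounded[where B=Qm], measurable, rule av2_bound, unfold Qm_def, rule le) auto
  have iT: "integrable P (\<lambda>g. av2 (tilt t) (zz t g))"
    by (rule integrable_bounded[where B=Tm], measurable, rule av2_bound, unfold Tm_def abs_of_pos[OF exp_gt_zero] tilt_def, rule le) auto
  \<comment> \<open>The tangent line of exp at \<open>ln B\<close>, the point for which the mean
    bound comes out as \<open>ln B / L\<close>.\<close>
  have *: "B * (1 + L * av2 Q z - ln B) \<le> av2 (tilt t) z" for z
  proof -
    have "B * (1 + L * av2 Q z - ln B) = av2 (\<lambda>\<sigma> \<tau>. B * (1 - ln B) + B * L * Q \<sigma> \<tau>) z"
      unfolding av2_add av2_cmult by (simp add: av2_alt av_const algebra_simps)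
    also have "\<dots> \<le> av2 (tilt t) z"
    proof (rule av2_mono)
      fix \<sigma> \<tau> assume st: "\<sigma> \<in> S" "\<tau> \<in> S"
      have "L * Q \<sigma> \<tau> \<le> (l0 - 4 * a0 * (sin t)\<^sup>2) * Q \<sigma> \<tau>"
        unfolding L_def using a0 mult_left_le[of "(sin t)\<^sup>2" "4 * a0"] by (intro mult_right_mono Q_nonneg st) (auto simp: abs_square_le_1)
      then have "exp (L * Q \<sigma> \<tau>) \<le> tilt t \<sigma> \<tau>" unfolding tilt_def by simp
      moreover have "B * (1 + (L * Q \<sigma> \<tau> - ln B)) \<le> B * exp (L * Q \<sigma> \<tau> - ln B)"
        using B exp_ge_add_one_self by (intro mult_left_mono) auto
      moreover have "B * exp (L * Q \<sigma> \<tau> - ln B) = exp (L * Q \<sigma> \<tau>)" using B by (simp add: exp_diff)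
      ultimately show "B * (1 - ln B) + B * L * Q \<sigma> \<tau> \<le> tilt t \<sigma> \<tau>" by (simp add: algebra_simps)
    qed
    finally show ?thesis .
  qed
  have "(\<integral>g. B * (1 + L * av2 Q (zz t g) - ln B) \<partial>P) \<le> (\<integral>g. av2 (tilt t) (zz t g) \<partial>P)"
    using iQ iT finite_measure.integrable_const[OF prob_space.finite_measure[OF prob_space_PiM_gauss]]
    by (intro integral_mono *) (auto intro!: integrable_mult_right Bochner_Integration.integrable_diff Bochner_Integration.integrable_add)
  also have "\<dots> \<le> B" by (rule mean_tilt_decreasing[OF assms])
  also have "(\<integral>g. B * (1 + L * av2 Q (zz t g) - ln B) \<partial>P) = (\<integral>g. B * L * av2 Q (zz t g) + B * (1 - ln B) \<partial>P)"
    by (simp add: algebra_simps)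
  also have "\<dots> = B * (1 + L * (\<integral>g. av2 Q (zz t g) \<partial>P) - ln B)"
    using prob_space.prob_space[OF prob_space_PiM_gauss, of I]
    by (subst Bochner_Integration.integral_add[OF integrable_mult_right[OF iQ]
          finite_measure.integrable_const[OF prob_space.finite_measure[OF prob_space_PiM_gauss]]])
       (simp add: algebra_simps)
  finally have "L * (\<integral>g. av2 Q (zz t g) \<partial>P) \<le> ln B" using B by (simp add: mult_le_cancel_left1)
  then show ?thesis unfolding L_def[symmetric] using L by (subst pos_le_divide_eq) (simp_all add: mult.commute)
qed

text \<open>The derivative is \<open>a0 * sin t * cos t\<close> times \<open>E0\<close> minus the
  mean of \<open>A\<close>, again free of \<open>K\<close>. The part with \<open>E0\<close>
  integrates to \<open>a0 * E0 / 2\<close>; the other is at most half the mean of \<open>Q\<close>,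
  over a time of length \<open>pi / 2\<close>.\<close>

lemma mean_lnZ_interpolation:
  "\<bar>(\<integral>g. ln (Z (zz (pi / 2) g)) \<partial>P) - (\<integral>g. ln (Z (zz 0 g)) \<partial>P) - a0 * E0 / 2\<bar> \<le> pi / 2 * (a0 * (ln B / (l0 - 4 * a0)) / 2)"
proof -
  define b where "b = ln B / (l0 - 4 * a0)"
  have avu: "\<bar>av (u k) z\<bar> \<le> 1" if "k \<in> I" for k z using u that by (intro av_bound) auto
  have D: "((\<lambda>t. \<integral>g. ln (Z (zz t g)) \<partial>P) has_real_derivative
     a0 * (sin t * cos t) * (E0 - (\<integral>g. av2 A (zz t g) \<partial>P))) (at t)" for t
  proof -
    have "(\<Sum>k\<in>I. c k t * c' k t * (1 - (av (u k) z)\<^sup>2)) = a0 * (sin t * cos t) * (E0 - av2 A z)" for z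
    proof -
      obtain \<sigma> where \<sigma>: "\<sigma> \<in> S" using S_nonempty by auto
      have "(\<Sum>k\<in>I. c k t * c' k t) = (\<Sum>k\<in>I. c k t * c' k t * (u k \<sigma> * u k \<sigma>))"
      proof (intro sum.cong refl)
        fix k assume "k \<in> I"
        then have "u k \<sigma> * u k \<sigma> = 1" using u[OF _ \<sigma>, of k] by (auto simp: abs_if split: if_splits)
        then show "c k t * c' k t = c k t * c' k t * (u k \<sigma> * u k \<sigma>)" by simp
      qed
      also have "\<dots> = a0 * (sin t * cos t) * (E0 + K)" using cov[OF \<sigma> \<sigma>] diag[OF \<sigma>] by simp
      finally have 1: "(\<Sum>k\<in>I. c k t * c' k t) = a0 * (sin t * cos t) * (E0 + K)" .
      have "(av (u k) z)\<^sup>2 = av2 (\<lambda>\<sigma> \<tau>. u k \<sigma> * u k \<tau>) z" for k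
        by (simp only: av2_alt av_cmult av_cmult_right power2_eq_square)
      then have "(\<Sum>k\<in>I. c k t * c' k t * (av (u k) z)\<^sup>2) = av2 (\<lambda>\<sigma> \<tau>. \<Sum>k\<in>I. c k t * c' k t * (u k \<sigma> * u k \<tau>)) z"
        unfolding av2_def sum_distrib_right sum_distrib_left by (simp add: sum.swap[of _ I] sum_distrib_left sum_distrib_right mult.assoc)
      also have "\<dots> = av2 (\<lambda>\<sigma> \<tau>. a0 * (sin t * cos t) * A \<sigma> \<tau> + a0 * (sin t * cos t) * K) z"
        by (rule av2_cong) (simp only: cov distrib_left)
      also have "\<dots> = a0 * (sin t * cos t) * (av2 A z + K)"
        by (simp add: av2_add av2_cmult) (simp add: av2_alt av_const algebra_simps)
      finally show ?thesis using 1 by (simp add: right_diff_distrib sum_subtractf algebra_simps)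
    qed
    moreover have "(\<Sum>k\<in>I. c k t * c' k t * (\<integral>g. 1 - (av (u k) (zz t g))\<^sup>2 \<partial>P)) =
       (\<integral>g. (\<Sum>k\<in>I. c k t * c' k t * (1 - (av (u k) (zz t g))\<^sup>2)) \<partial>P)"
    proof -
      have "integrable P (\<lambda>g. 1 - (av (u k) (zz t g))\<^sup>2)" if "k \<in> I" for k
      proof (rule integrable_bounded[where B=1])
        show "\<bar>1 - (av (u k) (zz t g))\<^sup>2\<bar> \<le> 1" for g
          using avu[OF that, of "zz t g"] by (simp add: abs_le_iff abs_square_le_1)
      qed measurable
      then show ?thesis
        by (subst Bochner_Integration.integral_sum) (auto intro!: integrable_mult_right simp del: right_diff_distrib)
    qed
    moreover have "(\<integral>g. E0 - av2 A (zz t g) \<partial>P) = E0 - (\<integral>g. av2 A (zz t g) \<partial>P)"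
    proof -
      define Am where "Am = (\<Sum>\<sigma>\<in>S. \<Sum>\<tau>\<in>S. \<bar>A \<sigma> \<tau>\<bar>)"
      have "\<bar>A \<sigma> \<tau>\<bar> \<le> Am" if "\<sigma> \<in> S" "\<tau> \<in> S" for \<sigma> \<tau>
      proof -
        have "\<bar>A \<sigma> \<tau>\<bar> \<le> (\<Sum>\<tau>\<in>S. \<bar>A \<sigma> \<tau>\<bar>)" using that finite_S by (intro member_le_sum) auto
        also have "\<dots> \<le> Am" unfolding Am_def using that finite_S
          by (intro member_le_sum[of \<sigma> S "\<lambda>\<sigma>. \<Sum>\<tau>\<in>S. \<bar>A \<sigma> \<tau>\<bar>"] sum_nonneg) auto
        finally show ?thesis .
      qed
      then have "integrable P (\<lambda>g. av2 A (zz t g))" by (intro integrable_bounded[where B=Am] av2_bound) measurable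
      then show ?thesis
        using prob_space.prob_space[OF prob_space_PiM_gauss, of I]
        by (subst Bochner_Integration.integral_diff[OF
              finite_measure.integrable_const[OF prob_space.finite_measure[OF prob_space_PiM_gauss]]]) simp_all
    qed
    ultimately show ?thesis using DERIV_mean_lnZ[of t] by simp
  qed
  \<comment> \<open>Subtracting the exact primitive of the \<open>E0\<close> term leaves a
    derivative that contains only the small mean of \<open>A\<close>.\<close>
  let ?G = "\<lambda>t. (\<integral>g. ln (Z (zz t g)) \<partial>P) - a0 * E0 / 2 * (sin t)\<^sup>2"
  have DG: "(?G has_real_derivative - (a0 * (sin t * cos t) * (\<integral>g. av2 A (zz t g) \<partial>P))) (at t)" for t
    by (rule derivative_eq_intros D refl | simp)+ (simp add: algebra_simps)
  obtain t where t: "0 < t" "t < pi / 2" "?G (pi / 2) - ?G 0 = (pi / 2 - 0) * - (a0 * (sin t * cos t) * (\<integral>g. av2 A (zz t g) \<partial>P))"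
    using MVT2[of 0 "pi/2" ?G, OF _ DG] by auto
  have Ab: "\<bar>\<integral>g. av2 A (zz t g) \<partial>P\<bar> \<le> b / 2"
  proof -
    define Qm where "Qm = (\<Sum>\<sigma>\<in>S. \<Sum>\<tau>\<in>S. \<bar>Q \<sigma> \<tau>\<bar>)"
    have "\<bar>Q \<sigma> \<tau>\<bar> \<le> Qm" if "\<sigma> \<in> S" "\<tau> \<in> S" for \<sigma> \<tau>
    proof -
      have "\<bar>Q \<sigma> \<tau>\<bar> \<le> (\<Sum>\<tau>\<in>S. \<bar>Q \<sigma> \<tau>\<bar>)" using that finite_S by (intro member_le_sum) auto
      also have "\<dots> \<le> Qm" unfolding Qm_def using that finite_S
        by (intro member_le_sum[of \<sigma> S "\<lambda>\<sigma>. \<Sum>\<tau>\<in>S. \<bar>Q \<sigma> \<tau>\<bar>"] sum_nonneg) auto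
      finally show ?thesis .
    qed
    then have iQ: "integrable P (\<lambda>g. av2 Q (zz t g))" by (intro integrable_bounded[where B=Qm] av2_bound) measurable
    have pw: "\<bar>av2 A z\<bar> \<le> (1/2) * av2 Q z" for z
    proof -
      have "av2 A z \<le> av2 (\<lambda>\<sigma> \<tau>. (1/2) * Q \<sigma> \<tau>) z" "av2 (\<lambda>\<sigma> \<tau>. (-1/2) * Q \<sigma> \<tau>) z \<le> av2 A z"
        using AQ by (intro av2_mono; force simp: abs_le_iff)+
      then show ?thesis unfolding av2_cmult by (simp add: abs_le_iff)
    qed
    have iA: "integrable P (\<lambda>g. \<bar>av2 A (zz t g)\<bar>)"
      by (rule Bochner_Integration.integrable_bound[OF integrable_mult_right[OF iQ, of "1/2"]])
        (measurable, use pw in \<open>auto intro!: always_eventually intro: order_trans[OF _ abs_ge_self]\<close>)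
    have "\<bar>\<integral>g. av2 A (zz t g) \<partial>P\<bar> \<le> (\<integral>g. \<bar>av2 A (zz t g)\<bar> \<partial>P)" by (rule integral_abs_bound)
    also have "\<dots> \<le> (\<integral>g. (1/2) * av2 Q (zz t g) \<partial>P)"
      using iA iQ pw by (intro integral_mono integrable_mult_right) auto
    also have "\<dots> = (1/2) * (\<integral>g. av2 Q (zz t g) \<partial>P)" by (rule integral_mult_right_zero)
    also have "\<dots> \<le> b / 2" using mean_Q_le[OF less_imp_le[OF t(1)] less_imp_le[OF t(2)], folded b_def] by linarith
    finally show ?thesis .
  qed
  have "\<bar>?G (pi / 2) - ?G 0\<bar> = pi / 2 * (a0 * (\<bar>sin t\<bar> * \<bar>cos t\<bar>) * \<bar>\<integral>g. av2 A (zz t g) \<partial>P\<bar>)"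
    unfolding t(3) abs_mult abs_minus_cancel using a0 by (simp add: abs_mult)
  also have "\<dots> \<le> pi / 2 * (a0 * (1 * 1) * (b / 2))"
    using a0 Ab abs_sin_le_one[of t] abs_cos_le_one[of t]
    by (intro mult_left_mono mult_mono mult_nonneg_nonneg) auto
  finally show ?thesis by (simp add: b_def algebra_simps)
qed

end

section \<open>The free energy of the bipartite model\<close>

type_synonym index = "(nat \<times> nat) + (nat + nat)"

text \<open>The last two families serve twice: in the interpolation they index auxiliary Gaussian
  fields on the two layers, in the disorder they index the random signs.\<close>

definition index_set :: "nat \<Rightarrow> index set" where
  "index_set N = ({1..N} \<times> {1..N}) <+> ({1..N} <+> {1..N})"

fun spin :: "index \<Rightarrow> config \<Rightarrow> real" where
  "spin (Inl (i, j)) \<sigma> = fst \<sigma> i * snd \<sigma> j"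
| "spin (Inr (Inl i)) \<sigma> = fst \<sigma> i"
| "spin (Inr (Inr j)) \<sigma> = snd \<sigma> j"

lemma index_cases [case_names pair left right]:
  fixes k :: index
  obtains i j where "k = Inl (i, j)" | i where "k = Inr (Inl i)" | i where "k = Inr (Inr i)"
  by (metis obj_sumE surj_pair)

lemma finite_index_set [simp]: "finite (index_set N)"
  by (simp add: index_set_def)

lemma sum_index_set:
  fixes f :: "index \<Rightarrow> real"
  shows "sum f (index_set N) = (\<Sum>i=1..N. \<Sum>j=1..N. f (Inl (i, j))) + ((\<Sum>i=1..N. f (Inr (Inl i))) + (\<Sum>j=1..N. f (Inr (Inr j))))"
  unfolding index_set_def by (simp add: sum.Plus sum.cartesian_product comp_def case_prod_beta)

lemma prod_index_set:
  fixes f :: "index \<Rightarrow> real"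
  shows "prod f (index_set N) = (\<Prod>i=1..N. \<Prod>j=1..N. f (Inl (i, j))) * ((\<Prod>i=1..N. f (Inr (Inl i))) * (\<Prod>j=1..N. f (Inr (Inr j))))"
  unfolding index_set_def by (simp add: prod.Plus prod.cartesian_product comp_def case_prod_beta)

lemma configs_nonempty: "configs N \<noteq> {}"
  using card_configs[of N] by force

lemma config_spins:
  assumes "\<sigma> \<in> configs N" "i \<in> {1..N}"
  shows "fst \<sigma> i \<in> {-1, 1}" "snd \<sigma> i \<in> {-1, 1}"
  using assms unfolding configs_def by (auto dest: PiE_mem)

lemma spin_abs:
  assumes "k \<in> index_set N" "\<sigma> \<in> configs N"
  shows "\<bar>spin k \<sigma>\<bar> = 1"
  using assms config_spins[OF assms(2)] unfolding index_set_def
  by (cases k rule: index_cases) (force simp: abs_mult)+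

lemma sum_PiE_prod:
  fixes f :: "nat \<Rightarrow> real \<Rightarrow> real"
  shows "(\<Sum>s\<in>{1..N} \<rightarrow>\<^sub>E {-1, 1}. \<Prod>i=1..N. f i (s i)) = (\<Prod>i=1..N. f i (- 1) + f i 1)"
  by (subst prod_sum_PiE[symmetric]) auto

lemma sum_PiE_prod2:
  fixes f :: "nat \<Rightarrow> real \<Rightarrow> real \<Rightarrow> real"
  shows "(\<Sum>s\<in>{1..N} \<rightarrow>\<^sub>E {-1, 1}. \<Sum>t\<in>{1..N} \<rightarrow>\<^sub>E {-1, 1}. \<Prod>i=1..N. f i (s i) (t i)) =
    (\<Prod>i=1..N. f i (- 1) (- 1) + f i (- 1) 1 + (f i 1 (- 1) + f i 1 1))"
proof -
  have "(\<Sum>t\<in>{1..N} \<rightarrow>\<^sub>E {-1, 1}. \<Prod>i=1..N. f i (s i) (t i)) = (\<Prod>i=1..N. f i (s i) (- 1) + f i (s i) 1)" for s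
    by (rule sum_PiE_prod[where f="\<lambda>i. f i (s i)"])
  then show ?thesis
    using sum_PiE_prod[where f="\<lambda>i s. f i s (- 1) + f i s 1" and N=N] by simp
qed

lemma sum_configs:
  fixes f :: "(nat \<Rightarrow> real) \<Rightarrow> (nat \<Rightarrow> real) \<Rightarrow> real"
  shows "(\<Sum>\<sigma>\<in>configs N. f (fst \<sigma>) (snd \<sigma>)) = (\<Sum>s\<in>{1..N} \<rightarrow>\<^sub>E {-1, 1}. \<Sum>t\<in>{1..N} \<rightarrow>\<^sub>E {-1, 1}. f s t)"
  unfolding configs_def sum.cartesian_product by (simp add: case_prod_beta)

lemma sum_configs_exp:
  "(\<Sum>\<sigma>\<in>configs N. exp ((\<Sum>i=1..N. a i * fst \<sigma> i) + (\<Sum>j=1..N. b j * snd \<sigma> j))) =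
    (\<Prod>i=1..N. 2 * cosh (a i)) * (\<Prod>j=1..N. 2 * cosh (b j))" for a b :: "nat \<Rightarrow> real"
proof -
  have "(\<Sum>\<sigma>\<in>configs N. exp ((\<Sum>i=1..N. a i * fst \<sigma> i) + (\<Sum>j=1..N. b j * snd \<sigma> j))) =
    (\<Sum>s\<in>{1..N} \<rightarrow>\<^sub>E {-1, 1}. \<Sum>t\<in>{1..N} \<rightarrow>\<^sub>E {-1, 1}. (\<Prod>i=1..N. exp (a i * s i)) * (\<Prod>i=1..N. exp (b i * t i)))"
    by (subst sum_configs[symmetric]) (simp add: exp_add exp_sum)
  also have "\<dots> = (\<Prod>i=1..N. exp (a i * (- 1)) + exp (a i * 1)) * (\<Prod>i=1..N. exp (b i * (- 1)) + exp (b i * 1))"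
    unfolding sum_product[symmetric] sum_PiE_prod[where f="\<lambda>i x. exp (a i * x)"] sum_PiE_prod[where f="\<lambda>i x. exp (b i * x)"] ..
  moreover have "exp (x * (- 1)) + exp (x * 1) = 2 * cosh x" for x :: real by (simp add: cosh_def)
  ultimately show ?thesis by simp
qed

text \<open>Without couplings the sum over two replicas factorizes over sites. In a field
  \<open>a\<close> the product of the two spins at a site has mean \<open>(tanh a)\<^sup>2\<close>,
  which gives the factor \<open>cosh r + (tanh a)\<^sup>2 * sinh r\<close> next to the partition
  functions.\<close>

lemma sum_configs_exp_pair:
  fixes a b :: "nat \<Rightarrow> real"
  shows "(\<Sum>\<sigma>\<in>configs N. \<Sum>\<tau>\<in>configs N. exp (r * (\<Sum>i=1..N. fst \<sigma> i * fst \<tau> i) + q * (\<Sum>j=1..N. snd \<sigma> j * snd \<tau> j)) *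
       (exp ((\<Sum>i=1..N. a i * fst \<sigma> i) + (\<Sum>j=1..N. b j * snd \<sigma> j)) * exp ((\<Sum>i=1..N. a i * fst \<tau> i) + (\<Sum>j=1..N. b j * snd \<tau> j)))) =
     (\<Prod>i=1..N. (2 * cosh (a i))\<^sup>2 * (cosh r + (tanh (a i))\<^sup>2 * sinh r)) * (\<Prod>j=1..N. (2 * cosh (b j))\<^sup>2 * (cosh q + (tanh (b j))\<^sup>2 * sinh q))"
proof -
  let ?E = "{1..N} \<rightarrow>\<^sub>E {-1, 1} :: (nat \<Rightarrow> real) set"
  define f where "f r a i x y = exp (r * (x * y) + (a i * x + a i * y))" for r :: real and a :: "nat \<Rightarrow> real" and i :: nat and x y :: real
  have f1: "f r a i (- 1) (- 1) + f r a i (- 1) 1 + (f r a i 1 (- 1) + f r a i 1 1) = (2 * cosh (a i))\<^sup>2 * (cosh r + (tanh (a i))\<^sup>2 * sinh r)" for r a i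
  proof -
    define e e' where "e = exp (a i)" and "e' = exp (- a i)"
    define z z' where "z = exp r" and "z' = exp (- r)"
    have ee: "e * e' = 1" by (simp add: e_def e'_def flip: exp_add)
    have c: "(cosh (a i))\<^sup>2 = (e * e + e' * e' + 2) / 4" and s: "(sinh (a i))\<^sup>2 = (e * e + e' * e' - 2) / 4"
      unfolding cosh_def sinh_def e_def[symmetric] e'_def[symmetric] using ee by (simp_all add: power2_eq_square field_simps)
    have "(2 * cosh (a i))\<^sup>2 * (cosh r + (tanh (a i))\<^sup>2 * sinh r) = 4 * ((cosh (a i))\<^sup>2 * cosh r + (sinh (a i))\<^sup>2 * sinh r)"
      by (simp add: tanh_def field_simps power2_eq_square)
    also have "\<dots> = z * (e * e + e' * e') + 2 * z'"
      unfolding c s unfolding cosh_def sinh_def z_def[symmetric] z'_def[symmetric] by (simp add: field_simps)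
    also have "\<dots> = f r a i (- 1) (- 1) + f r a i (- 1) 1 + (f r a i 1 (- 1) + f r a i 1 1)"
      unfolding f_def z_def z'_def e_def e'_def by (simp add: distrib_left flip: exp_add)
    finally show ?thesis ..
  qed
  have "(\<Sum>\<sigma>\<in>configs N. \<Sum>\<tau>\<in>configs N. exp (r * (\<Sum>i=1..N. fst \<sigma> i * fst \<tau> i) + q * (\<Sum>j=1..N. snd \<sigma> j * snd \<tau> j)) *
       (exp ((\<Sum>i=1..N. a i * fst \<sigma> i) + (\<Sum>j=1..N. b j * snd \<sigma> j)) * exp ((\<Sum>i=1..N. a i * fst \<tau> i) + (\<Sum>j=1..N. b j * snd \<tau> j)))) =
    (\<Sum>\<sigma>\<in>configs N. \<Sum>\<tau>\<in>configs N. (\<Prod>i=1..N. f r a i (fst \<sigma> i) (fst \<tau> i)) * (\<Prod>i=1..N. f q b i (snd \<sigma> i) (snd \<tau> i)))"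
    unfolding f_def exp_sum[symmetric, OF finite_atLeastAtMost] exp_add[symmetric]
    by (intro sum.cong refl) (simp add: sum.distrib sum_distrib_left algebra_simps)
  also have "\<dots> = (\<Sum>\<sigma>\<in>configs N. (\<Sum>s\<in>?E. \<Prod>i=1..N. f r a i (fst \<sigma> i) (s i)) * (\<Sum>t\<in>?E. \<Prod>i=1..N. f q b i (snd \<sigma> i) (t i)))"
    by (subst sum_configs) (simp only: sum_product)
  also have "\<dots> = (\<Sum>s\<in>?E. \<Sum>s'\<in>?E. \<Prod>i=1..N. f r a i (s i) (s' i)) * (\<Sum>t\<in>?E. \<Sum>t'\<in>?E. \<Prod>i=1..N. f q b i (t i) (t' i))"
    by (subst sum_configs) (simp only: sum_product)
  also have "\<dots> = (\<Prod>i=1..N. (2 * cosh (a i))\<^sup>2 * (cosh r + (tanh (a i))\<^sup>2 * sinh r)) * (\<Prod>j=1..N. (2 * cosh (b j))\<^sup>2 * (cosh q + (tanh (b j))\<^sup>2 * sinh q))"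
    by (simp only: sum_PiE_prod2 f1)
  finally show ?thesis .
qed

lemma sum_signs:
  fixes s :: "nat \<Rightarrow> real"
  assumes "\<And>i. i \<in> {1..N} \<Longrightarrow> s i \<in> {-1, 1}"
  shows "\<exists>m\<le>N. (\<Sum>i=1..N. s i) = 2 * real m - real N"
  using assms
proof (induction N)
  case (Suc N)
  then obtain m where m: "m \<le> N" "(\<Sum>i=1..N. s i) = 2 * real m - real N" by force
  have "s (Suc N) = 1 \<or> s (Suc N) = - 1" using Suc.prems[of "Suc N"] by auto
  then show ?case
  proof
    assume "s (Suc N) = 1"
    then show ?thesis using m by (intro exI[of _ "Suc m"]) simp
  next
    assume "s (Suc N) = - 1"
    then show ?thesis using m by (intro exI[of _ m]) simp
  qed
qed auto

lemma integral_PiM_gauss_component: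
  fixes f :: "real \<Rightarrow> real"
  assumes "finite I" "k \<in> I" "f \<in> borel_measurable borel"
  shows "(\<integral>g. f (g k) \<partial>PiM I (\<lambda>_. gauss)) = (\<integral>x. f x \<partial>gauss)"
    and "integrable gauss f \<Longrightarrow> integrable (PiM I (\<lambda>_. gauss)) (\<lambda>g. f (g k))"
proof -
  have d: "distr (PiM I (\<lambda>_. gauss)) gauss (\<lambda>g. g k) = gauss"
    by (rule distr_PiM_component) (auto simp: assms gauss.prob_space_axioms)
  have m: "(\<lambda>g. g k) \<in> measurable (PiM I (\<lambda>_. gauss)) gauss" using assms by measurable
  have f: "f \<in> borel_measurable gauss" using assms by simp
  show "(\<integral>g. f (g k) \<partial>PiM I (\<lambda>_. gauss)) = (\<integral>x. f x \<partial>gauss)"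
    using integral_distr[OF m f] d by simp
  show "integrable (PiM I (\<lambda>_. gauss)) (\<lambda>g. f (g k))" if "integrable gauss f"
    using integrable_distr_eq[OF m f] d that by simp
qed

text \<open>The fields \<open>h1\<close>, \<open>h2\<close> make this the generating function of the
  magnetization; the model itself has both equal to 1.\<close>

definition partition ::
  "real \<Rightarrow> real \<Rightarrow> real \<Rightarrow> (nat \<Rightarrow> nat \<Rightarrow> real) \<Rightarrow> (nat \<Rightarrow> real) \<Rightarrow> (nat \<Rightarrow> real) \<Rightarrow> nat \<Rightarrow> real" where
  "partition \<beta> h1 h2 W \<chi>1 \<chi>2 N = (\<Sum>\<sigma>\<in>configs N. exp (\<beta> / sqrt (real N) * (\<Sum>i=1..N. \<Sum>j=1..N. W i j * fst \<sigma> i * snd \<sigma> j)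
     + h1 * (\<Sum>i=1..N. \<chi>1 i * fst \<sigma> i) + h2 * (\<Sum>i=1..N. \<chi>2 i * snd \<sigma> i)))"

text \<open>The signs are frozen here. The fixed-point equations do not mention them, since
  \<open>LQ\<close> is even in the field, so one pair \<open>p1\<close>, \<open>p2\<close> fits
  every realization.\<close>

locale bipartite =
  fixes \<beta> p1 p2 h1 h2 :: real and \<chi>1 \<chi>2 :: "nat \<Rightarrow> real" and N :: nat
  assumes N: "1 \<le> N" and \<beta>: "0 \<le> \<beta>" "8 * \<beta>\<^sup>2 < 1"
    and p: "0 \<le> p1" "p1 \<le> 1" "0 \<le> p2" "p2 \<le> 1"
    and fixpoint: "p1 = LQ (\<beta>\<^sup>2 * p2) h1" "p2 = LQ (\<beta>\<^sup>2 * p1) h2"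
    and signs: "\<And>i. i \<in> {1..N} \<Longrightarrow> \<chi>1 i \<in> {-1, 1}" "\<And>i. i \<in> {1..N} \<Longrightarrow> \<chi>2 i \<in> {-1, 1}"
begin

text \<open>Rotation by an angle from 0 to \<open>pi / 2\<close>, instead of square roots of time,
  keeps the coefficients smooth at both ends. The overlaps are crossed: a spin of one layer feels
  the field created by the other layer.\<close>

fun coef :: "index \<Rightarrow> real \<Rightarrow> real" where
  "coef (Inl _) t = \<beta> / sqrt (real N) * sin t"
| "coef (Inr (Inl _)) t = \<beta> * sqrt p2 * cos t"
| "coef (Inr (Inr _)) t = \<beta> * sqrt p1 * cos t"

fun coef' :: "index \<Rightarrow> real \<Rightarrow> real" where
  "coef' (Inl _) t = \<beta> / sqrt (real N) * cos t"
| "coef' (Inr (Inl _)) t = \<beta> * sqrt p2 * - sin t"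
| "coef' (Inr (Inr _)) t = \<beta> * sqrt p1 * - sin t"

definition field :: "config \<Rightarrow> real" where
  "field \<sigma> = h1 * (\<Sum>i=1..N. \<chi>1 i * fst \<sigma> i) + h2 * (\<Sum>i=1..N. \<chi>2 i * snd \<sigma> i)"

definition R1 :: "config \<Rightarrow> config \<Rightarrow> real" where "R1 \<sigma> \<tau> = (\<Sum>i=1..N. fst \<sigma> i * fst \<tau> i) / real N"
definition R2 :: "config \<Rightarrow> config \<Rightarrow> real" where "R2 \<sigma> \<tau> = (\<Sum>i=1..N. snd \<sigma> i * snd \<tau> i) / real N"

lemma N_pos: "0 < real N" using N by simp

lemma coef_bounds:
  shows "\<bar>coef k t\<bar> \<le> \<beta>" "\<bar>coef' k t\<bar> \<le> \<beta>"
proof -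
  have s: "1 \<le> sqrt (real N)" using N by simp
  have b: "\<bar>\<beta> / sqrt (real N)\<bar> \<le> \<beta>" using \<beta> s N_pos by (simp add: field_simps mult_le_cancel_left1)
  have q: "\<bar>\<beta> * sqrt p1\<bar> \<le> \<beta>" "\<bar>\<beta> * sqrt p2\<bar> \<le> \<beta>" using \<beta> p by (simp_all add: abs_mult mult_left_le)
  have m: "\<bar>a * b\<bar> \<le> \<beta>" if "\<bar>a\<bar> \<le> \<beta>" "\<bar>b\<bar> \<le> 1" for a b :: real
    using mult_mono[OF that] \<beta> by (simp add: abs_mult)
  show "\<bar>coef k t\<bar> \<le> \<beta>"
    by (cases k rule: index_cases) (simp_all only: coef.simps, (intro m b q abs_sin_le_one abs_cos_le_one)+)
  show "\<bar>coef' k t\<bar> \<le> \<beta>"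
    by (cases k rule: index_cases)
      (simp_all only: coef'.simps, (intro m b q; simp only: abs_minus_cancel abs_sin_le_one abs_cos_le_one)+)
qed

lemma coef_fun:
  "coef (Inl k) = (\<lambda>t. \<beta> / sqrt (real N) * sin t)"
  "coef (Inr (Inl i)) = (\<lambda>t. \<beta> * sqrt p2 * cos t)"
  "coef (Inr (Inr i)) = (\<lambda>t. \<beta> * sqrt p1 * cos t)"
  by (simp_all add: fun_eq_iff)

sublocale gaussian_gibbs "configs N" "index_set N" spin field coef coef' \<beta>
proof
  show "(coef k has_real_derivative coef' k t) (at t)" for k t
    by (cases k rule: index_cases) (simp_all only: coef_fun coef'.simps, (intro DERIV_cmult DERIV_sin DERIV_cos)+)
qed (use spin_abs configs_nonempty coef_bounds in auto)

text \<open>\<open>R1 R2 - p2 R1 - p1 R2\<close> equals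
  \<open>(R1 - p1) * (R2 - p2) - p1 * p2\<close>: the two auxiliary fields complete the interaction
  to a product of centred overlaps.\<close>

lemma covariance:
  "(\<Sum>k\<in>index_set N. coef k t * coef' k t * (spin k \<sigma> * spin k \<tau>)) =
    \<beta>\<^sup>2 * real N * (sin t * cos t) * ((R1 \<sigma> \<tau> - p1) * (R2 \<sigma> \<tau> - p2) + - (p1 * p2))"
proof -
  have s: "\<beta> / sqrt (real N) * (\<beta> / sqrt (real N)) = \<beta>\<^sup>2 / real N" by (simp add: power2_eq_square)
  have "(\<Sum>i=1..N. \<Sum>j=1..N. coef (Inl (i, j)) t * coef' (Inl (i, j)) t * (spin (Inl (i, j)) \<sigma> * spin (Inl (i, j)) \<tau>)) =
    (\<beta> / sqrt (real N) * (\<beta> / sqrt (real N))) * (sin t * cos t) * ((\<Sum>i=1..N. fst \<sigma> i * fst \<tau> i) * (\<Sum>j=1..N. snd \<sigma> j * snd \<tau> j))"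
    unfolding sum_product by (simp add: sum_distrib_left mult_ac)
  also have "\<dots> = \<beta>\<^sup>2 / real N * (sin t * cos t) * ((real N * R1 \<sigma> \<tau>) * (real N * R2 \<sigma> \<tau>))"
    unfolding s R1_def R2_def using N_pos by simp
  finally have 1: "(\<Sum>i=1..N. \<Sum>j=1..N. coef (Inl (i, j)) t * coef' (Inl (i, j)) t * (spin (Inl (i, j)) \<sigma> * spin (Inl (i, j)) \<tau>)) =
     \<beta>\<^sup>2 * real N * (sin t * cos t) * (R1 \<sigma> \<tau> * R2 \<sigma> \<tau>)" using N_pos by simp
  have neg: "\<beta> * s * c * (\<beta> * s * - n) * x = - (\<beta> * s * (\<beta> * s) * (n * c) * x)" for s c n x :: real
    by (simp add: algebra_simps)
  have "(\<Sum>i=1..N. coef (Inr (Inl i)) t * coef' (Inr (Inl i)) t * (spin (Inr (Inl i)) \<sigma> * spin (Inr (Inl i)) \<tau>)) =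
    - ((\<beta> * sqrt p2 * (\<beta> * sqrt p2)) * (sin t * cos t) * (\<Sum>i=1..N. fst \<sigma> i * fst \<tau> i))"
    unfolding coef.simps coef'.simps spin.simps sum_distrib_left sum_negf[symmetric] by (intro sum.cong refl neg)
  also have "\<beta> * sqrt p2 * (\<beta> * sqrt p2) = \<beta>\<^sup>2 * p2" using p by (simp add: power2_eq_square)
  also have "(\<Sum>i=1..N. fst \<sigma> i * fst \<tau> i) = real N * R1 \<sigma> \<tau>" using N_pos by (simp add: R1_def)
  finally have 2: "(\<Sum>i=1..N. coef (Inr (Inl i)) t * coef' (Inr (Inl i)) t * (spin (Inr (Inl i)) \<sigma> * spin (Inr (Inl i)) \<tau>)) =
    - (\<beta>\<^sup>2 * p2 * (sin t * cos t) * (real N * R1 \<sigma> \<tau>))" .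
  have "(\<Sum>i=1..N. coef (Inr (Inr i)) t * coef' (Inr (Inr i)) t * (spin (Inr (Inr i)) \<sigma> * spin (Inr (Inr i)) \<tau>)) =
    - ((\<beta> * sqrt p1 * (\<beta> * sqrt p1)) * (sin t * cos t) * (\<Sum>i=1..N. snd \<sigma> i * snd \<tau> i))"
    unfolding coef.simps coef'.simps spin.simps sum_distrib_left sum_negf[symmetric] by (intro sum.cong refl neg)
  also have "\<beta> * sqrt p1 * (\<beta> * sqrt p1) = \<beta>\<^sup>2 * p1" using p by (simp add: power2_eq_square)
  also have "(\<Sum>i=1..N. snd \<sigma> i * snd \<tau> i) = real N * R2 \<sigma> \<tau>" using N_pos by (simp add: R2_def)
  finally have 3: "(\<Sum>i=1..N. coef (Inr (Inr i)) t * coef' (Inr (Inr i)) t * (spin (Inr (Inr i)) \<sigma> * spin (Inr (Inr i)) \<tau>)) =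
    - (\<beta>\<^sup>2 * p1 * (sin t * cos t) * (real N * R2 \<sigma> \<tau>))" .
  show ?thesis unfolding sum_index_set 1 2 3 by (simp add: algebra_simps)
qed

definition \<alpha>1 :: "(index \<Rightarrow> real) \<Rightarrow> nat \<Rightarrow> real" where "\<alpha>1 g i = \<beta> * sqrt p2 * g (Inr (Inl i)) + h1 * \<chi>1 i"
definition \<alpha>2 :: "(index \<Rightarrow> real) \<Rightarrow> nat \<Rightarrow> real" where "\<alpha>2 g i = \<beta> * sqrt p1 * g (Inr (Inr i)) + h2 * \<chi>2 i"

lemma H_0: "H (zz 0 g) \<sigma> = (\<Sum>i=1..N. \<alpha>1 g i * fst \<sigma> i) + (\<Sum>j=1..N. \<alpha>2 g j * snd \<sigma> j)"
proof -
  have a: "(\<Sum>i=1..N. \<alpha>1 g i * f i) = (\<Sum>i=1..N. \<beta> * sqrt p2 * g (Inr (Inl i)) * f i) + h1 * (\<Sum>i=1..N. \<chi>1 i * f i)"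
    "(\<Sum>i=1..N. \<alpha>2 g i * f i) = (\<Sum>i=1..N. \<beta> * sqrt p1 * g (Inr (Inr i)) * f i) + h2 * (\<Sum>i=1..N. \<chi>2 i * f i)" for f
    unfolding \<alpha>1_def \<alpha>2_def sum_distrib_left sum.distrib[symmetric] by (intro sum.cong refl, simp add: algebra_simps)+
  show ?thesis unfolding a H_def zz_def sum_index_set field_def by simp
qed

lemma Z_0: "Z (zz 0 g) = (\<Prod>i=1..N. 2 * cosh (\<alpha>1 g i)) * (\<Prod>j=1..N. 2 * cosh (\<alpha>2 g j))"
  unfolding Z_def H_0 by (rule sum_configs_exp)

lemma H_pi_half: "H (zz (pi / 2) g) \<sigma> = \<beta> / sqrt (real N) * (\<Sum>i=1..N. \<Sum>j=1..N. g (Inl (i, j)) * fst \<sigma> i * snd \<sigma> j)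
     + h1 * (\<Sum>i=1..N. \<chi>1 i * fst \<sigma> i) + h2 * (\<Sum>i=1..N. \<chi>2 i * snd \<sigma> i)"
  unfolding H_def zz_def sum_index_set field_def
  by (simp add: sum_distrib_left mult_ac)

lemma Z_pi_half: "Z (zz (pi / 2) g) = partition \<beta> h1 h2 (\<lambda>i j. g (Inl (i, j))) \<chi>1 \<chi>2 N"
  unfolding Z_def H_pi_half partition_def ..

lemma sqrt_variance: "sqrt (\<beta>\<^sup>2 * p1) = \<beta> * sqrt p1" "sqrt (\<beta>\<^sup>2 * p2) = \<beta> * sqrt p2"
  using \<beta> by (simp_all add: real_sqrt_mult)

lemma LC_sign: "s \<in> {-1, 1} \<Longrightarrow> LC v (x * s) = LC v x" and LQ_sign: "s \<in> {-1, 1} \<Longrightarrow> LQ v (x * s) = LQ v x"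
  using LC_uminus[of v x] LQ_uminus[of v x] by auto

lemma mean_lnZ_0:
  "(\<integral>g. ln (Z (zz 0 g)) \<partial>P) = real N * (2 * ln 2 + LC (\<beta>\<^sup>2 * p2) h1 + LC (\<beta>\<^sup>2 * p1) h2)"
proof -
  have l: "ln (Z (zz 0 g)) = (\<Sum>i=1..N. ln 2 + lncosh (\<alpha>1 g i)) + (\<Sum>j=1..N. ln 2 + lncosh (\<alpha>2 g j))" for g
    unfolding Z_0 by (simp add: ln_mult ln_prod prod_pos lncosh_def)
  have m: "(\<lambda>y. lncosh (\<beta> * sqrt p * y + x)) \<in> borel_measurable borel" for p x by measurable
  have ig: "integrable gauss (\<lambda>y. lncosh (\<beta> * sqrt p * y + x))" for p x
    by (rule lncosh.integrable_gauss_mean)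
  have c1: "integrable P (\<lambda>g. lncosh (\<alpha>1 g i))" "(\<integral>g. lncosh (\<alpha>1 g i) \<partial>P) = LC (\<beta>\<^sup>2 * p2) h1" if i: "i \<in> {1..N}" for i
  proof -
    have k: "Inr (Inl i) \<in> index_set N" using i by (auto simp: index_set_def)
    show "integrable P (\<lambda>g. lncosh (\<alpha>1 g i))" unfolding \<alpha>1_def
      by (rule integral_PiM_gauss_component(2)[OF finite_index_set k m ig])
    have "(\<integral>g. lncosh (\<alpha>1 g i) \<partial>P) = LC (\<beta>\<^sup>2 * p2) (h1 * \<chi>1 i)" unfolding \<alpha>1_def
      by (subst integral_PiM_gauss_component(1)[OF finite_index_set k m]) (simp add: LC_def gauss_mean_def sqrt_variance)
    then show "(\<integral>g. lncosh (\<alpha>1 g i) \<partial>P) = LC (\<beta>\<^sup>2 * p2) h1" using LC_sign[OF signs(1)[OF i]] by simp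
  qed
  have c2: "integrable P (\<lambda>g. lncosh (\<alpha>2 g i))" "(\<integral>g. lncosh (\<alpha>2 g i) \<partial>P) = LC (\<beta>\<^sup>2 * p1) h2" if i: "i \<in> {1..N}" for i
  proof -
    have k: "Inr (Inr i) \<in> index_set N" using i by (auto simp: index_set_def)
    show "integrable P (\<lambda>g. lncosh (\<alpha>2 g i))" unfolding \<alpha>2_def
      by (rule integral_PiM_gauss_component(2)[OF finite_index_set k m ig])
    have "(\<integral>g. lncosh (\<alpha>2 g i) \<partial>P) = LC (\<beta>\<^sup>2 * p1) (h2 * \<chi>2 i)" unfolding \<alpha>2_def
      by (subst integral_PiM_gauss_component(1)[OF finite_index_set k m]) (simp add: LC_def gauss_mean_def sqrt_variance)
    then show "(\<integral>g. lncosh (\<alpha>2 g i) \<partial>P) = LC (\<beta>\<^sup>2 * p1) h2" using LC_sign[OF signs(2)[OF i]] by simp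
  qed
  have m1: "measure P (space P) = 1" by (rule prob_space.prob_space[OF prob_space_PiM_gauss])
  have const: "integrable P (\<lambda>_. a)" "(\<integral>g. a \<partial>P) = a" for a :: real
    using finite_measure.integrable_const[OF prob_space.finite_measure[OF prob_space_PiM_gauss]]
      prob_space.prob_space[OF prob_space_PiM_gauss, of "index_set N"] by simp_all
  have "(\<integral>g. ln (Z (zz 0 g)) \<partial>P) = (\<Sum>i=1..N. \<integral>g. ln 2 + lncosh (\<alpha>1 g i) \<partial>P) + (\<Sum>j=1..N. \<integral>g. ln 2 + lncosh (\<alpha>2 g j) \<partial>P)"
    unfolding l using c1(1) c2(1) const(1)
    by (subst Bochner_Integration.integral_add, intro Bochner_Integration.integrable_sum Bochner_Integration.integrable_add, simp, simp,
       intro Bochner_Integration.integrable_sum Bochner_Integration.integrable_add, simp, simp,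
       subst Bochner_Integration.integral_sum, intro Bochner_Integration.integrable_add, simp, simp,
       subst Bochner_Integration.integral_sum, intro Bochner_Integration.integrable_add, simp, simp, simp)
  also have "(\<Sum>i=1..N. \<integral>g. ln 2 + lncosh (\<alpha>1 g i) \<partial>P) = (\<Sum>i=1..N. ln 2 + LC (\<beta>\<^sup>2 * p2) h1)"
    using c1 m1 by (intro sum.cong refl) (subst Bochner_Integration.integral_add[OF const(1)], simp_all)
  also have "(\<Sum>j=1..N. \<integral>g. ln 2 + lncosh (\<alpha>2 g j) \<partial>P) = (\<Sum>i=1..N. ln 2 + LC (\<beta>\<^sup>2 * p1) h2)"
    using c2 m1 by (intro sum.cong refl) (subst Bochner_Integration.integral_add[OF const(1)], simp_all)
  finally show ?thesis by (simp add: algebra_simps)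
qed

lemma av2_exp_overlap_0:
  "av2 (\<lambda>\<sigma> \<tau>. exp (r * (\<Sum>i=1..N. fst \<sigma> i * fst \<tau> i) + q * (\<Sum>j=1..N. snd \<sigma> j * snd \<tau> j))) (zz 0 g) =
    (\<Prod>i=1..N. cosh r + (tanh (\<alpha>1 g i))\<^sup>2 * sinh r) * (\<Prod>j=1..N. cosh q + (tanh (\<alpha>2 g j))\<^sup>2 * sinh q)"
proof -
  let ?Z = "Z (zz 0 g)"
  let ?e = "\<lambda>\<sigma> \<tau>. exp (r * (\<Sum>i=1..N. fst \<sigma> i * fst \<tau> i) + q * (\<Sum>j=1..N. snd \<sigma> j * snd \<tau> j))"
  have "av2 ?e (zz 0 g) = (\<Sum>\<sigma>\<in>configs N. \<Sum>\<tau>\<in>configs N. ?e \<sigma> \<tau> * (exp (H (zz 0 g) \<sigma>) * exp (H (zz 0 g) \<tau>))) / (?Z * ?Z)"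
    unfolding av2_def weight_def by (simp add: sum_divide_distrib)
  also have "(\<Sum>\<sigma>\<in>configs N. \<Sum>\<tau>\<in>configs N. ?e \<sigma> \<tau> * (exp (H (zz 0 g) \<sigma>) * exp (H (zz 0 g) \<tau>))) =
    ?Z * ?Z * ((\<Prod>i=1..N. cosh r + (tanh (\<alpha>1 g i))\<^sup>2 * sinh r) * (\<Prod>j=1..N. cosh q + (tanh (\<alpha>2 g j))\<^sup>2 * sinh q))"
    unfolding H_0 sum_configs_exp_pair Z_0 prod.distrib power2_eq_square[of "2 * _"] by (simp only: mult_ac)
  finally show ?thesis using Z_pos[of "zz 0 g"] by simp
qed

text \<open>At angle 0 the sites are independent, and the mean of \<open>tanh\<close> squared at
  each site is \<open>p1\<close> or \<open>p2\<close> precisely by the fixed-point equations. The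
  overlaps are thus sums of independent signs centred at \<open>N * p1\<close> and
  \<open>N * p2\<close>.\<close>

lemma mean_exp_overlap_0:
  "integrable P (av2 (\<lambda>\<sigma> \<tau>. exp (r * (\<Sum>i=1..N. fst \<sigma> i * fst \<tau> i) + q * (\<Sum>j=1..N. snd \<sigma> j * snd \<tau> j))) \<circ> zz 0)"
  "(\<integral>g. av2 (\<lambda>\<sigma> \<tau>. exp (r * (\<Sum>i=1..N. fst \<sigma> i * fst \<tau> i) + q * (\<Sum>j=1..N. snd \<sigma> j * snd \<tau> j))) (zz 0 g) \<partial>P)
    = (cosh r + p1 * sinh r) ^ N * (cosh q + p2 * sinh q) ^ N"
proof -
  define F where "F k y = (case k of Inl _ \<Rightarrow> 1
     | Inr (Inl i) \<Rightarrow> cosh r + (tanh (\<beta> * sqrt p2 * y + h1 * \<chi>1 i))\<^sup>2 * sinh r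
     | Inr (Inr i) \<Rightarrow> cosh q + (tanh (\<beta> * sqrt p1 * y + h2 * \<chi>2 i))\<^sup>2 * sinh q)" for k :: index and y :: real
  have F: "av2 (\<lambda>\<sigma> \<tau>. exp (r * (\<Sum>i=1..N. fst \<sigma> i * fst \<tau> i) + q * (\<Sum>j=1..N. snd \<sigma> j * snd \<tau> j))) (zz 0 g) = (\<Prod>k\<in>index_set N. F k (g k))" for g
    unfolding av2_exp_overlap_0 prod_index_set F_def \<alpha>1_def \<alpha>2_def by simp
  have iq: "integrable gauss (\<lambda>y. (tanh (\<beta> * sqrt p * y + x))\<^sup>2)" for p x
    by (rule tanh_sq.integrable_gauss_mean)
  have iF: "integrable gauss (F k)" for k
    unfolding F_def
    by (cases k rule: index_cases)
      (simp_all only: sum.case, (intro Bochner_Integration.integrable_add integrable_mult_left iq gauss.integrable_const)+)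
  have I1: "(\<integral>y. F (Inr (Inl i)) y \<partial>gauss) = cosh r + p1 * sinh r" if "i \<in> {1..N}" for i
  proof -
    have "(\<integral>y. F (Inr (Inl i)) y \<partial>gauss) = cosh r + LQ (\<beta>\<^sup>2 * p2) (h1 * \<chi>1 i) * sinh r"
      unfolding F_def sum.case LQ_def gauss_mean_def sqrt_variance
      by (subst Bochner_Integration.integral_add[OF gauss.integrable_const integrable_mult_left[OF iq]])
        (simp only: integral_mult_left_zero, simp add: gauss.prob_space[unfolded space_gauss])
    then show ?thesis unfolding LQ_sign[OF signs(1)[OF that]] fixpoint(1)[symmetric] .
  qed
  have I2: "(\<integral>y. F (Inr (Inr i)) y \<partial>gauss) = cosh q + p2 * sinh q" if "i \<in> {1..N}" for i
  proof -
    have "(\<integral>y. F (Inr (Inr i)) y \<partial>gauss) = cosh q + LQ (\<beta>\<^sup>2 * p1) (h2 * \<chi>2 i) * sinh q"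
      unfolding F_def sum.case LQ_def gauss_mean_def sqrt_variance
      by (subst Bochner_Integration.integral_add[OF gauss.integrable_const integrable_mult_left[OF iq]])
        (simp only: integral_mult_left_zero, simp add: gauss.prob_space[unfolded space_gauss])
    then show ?thesis unfolding LQ_sign[OF signs(2)[OF that]] fixpoint(2)[symmetric] .
  qed
  have I0: "(\<integral>y. F (Inl k) y \<partial>gauss) = 1" for k using gauss.prob_space by (simp add: F_def)
  show "integrable P (av2 (\<lambda>\<sigma> \<tau>. exp (r * (\<Sum>i=1..N. fst \<sigma> i * fst \<tau> i) + q * (\<Sum>j=1..N. snd \<sigma> j * snd \<tau> j))) \<circ> zz 0)"
    unfolding comp_def F by (rule product_sigma_finite.product_integrable_prod[OF product_sigma_finite_gauss finite_index_set iF])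
  have "(\<integral>g. (\<Prod>k\<in>index_set N. F k (g k)) \<partial>P) = (\<Prod>k\<in>index_set N. \<integral>y. F k y \<partial>gauss)"
    by (rule product_sigma_finite.product_integral_prod[OF product_sigma_finite_gauss finite_index_set iF])
  then show "(\<integral>g. av2 (\<lambda>\<sigma> \<tau>. exp (r * (\<Sum>i=1..N. fst \<sigma> i * fst \<tau> i) + q * (\<Sum>j=1..N. snd \<sigma> j * snd \<tau> j))) (zz 0 g) \<partial>P)
    = (cosh r + p1 * sinh r) ^ N * (cosh q + p2 * sinh q) ^ N"
    unfolding F prod_index_set I0 by (simp only: I1 I2 cong: prod.cong) simp
qed

text \<open>The square in the exponent is linearized by \<open>D\<^sup>2 / 2 = max u (u D - u\<^sup>2 / 2)\<close>; as the overlap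
  takes only \<open>N + 1\<close> values, the maximum is bounded by a sum over as many \<open>u\<close>.\<close>

lemma initial_overlap:
  "(\<integral>g. av2 (\<lambda>\<sigma> \<tau>. exp (real N / 2 * ((R1 \<sigma> \<tau> - p1)\<^sup>2 + (R2 \<sigma> \<tau> - p2)\<^sup>2))) (zz 0 g) \<partial>P) \<le> (real N + 1)\<^sup>2"
proof -
  \<comment> \<open>The deviation of the overlap from \<open>p\<close> when the spins agree at
    \<open>m\<close> sites. It also serves as the linearization parameter, so the term matching the
    true overlaps is an equality.\<close>
  define d where "d p m = (2 * real m - real N) / real N - p" for p m
  define E where "E m n \<sigma> \<tau> = exp (d p1 m * (\<Sum>i=1..N. fst \<sigma> i * fst \<tau> i) + d p2 n * (\<Sum>j=1..N. snd \<sigma> j * snd \<tau> j))" for m n \<sigma> \<tau>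
  define K where "K m n = exp (- (real N * (d p1 m * p1 + (d p1 m)\<^sup>2 / 2)) - real N * (d p2 n * p2 + (d p2 n)\<^sup>2 / 2))" for m n
  have pw: "exp (real N / 2 * ((R1 \<sigma> \<tau> - p1)\<^sup>2 + (R2 \<sigma> \<tau> - p2)\<^sup>2)) \<le> (\<Sum>m\<le>N. \<Sum>n\<le>N. K m n * E m n \<sigma> \<tau>)"
    if "\<sigma> \<in> configs N" "\<tau> \<in> configs N" for \<sigma> \<tau>
  proof -
    have "fst \<sigma> i * fst \<tau> i \<in> {-1, 1}" "snd \<sigma> i * snd \<tau> i \<in> {-1, 1}" if "i \<in> {1..N}" for i
      using config_spins[OF \<open>\<sigma> \<in> configs N\<close> that] config_spins[OF \<open>\<tau> \<in> configs N\<close> that] by auto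
    then obtain m n where mn: "m \<le> N" "n \<le> N" "(\<Sum>i=1..N. fst \<sigma> i * fst \<tau> i) = 2 * real m - real N" "(\<Sum>i=1..N. snd \<sigma> i * snd \<tau> i) = 2 * real n - real N"
      using sum_signs[of N "\<lambda>i. fst \<sigma> i * fst \<tau> i"] sum_signs[of N "\<lambda>i. snd \<sigma> i * snd \<tau> i"] by blast
    have s: "2 * real m - real N = real N * (d p1 m + p1)" "2 * real n - real N = real N * (d p2 n + p2)"
      unfolding d_def using N_pos by simp_all
    have R: "R1 \<sigma> \<tau> - p1 = d p1 m" "R2 \<sigma> \<tau> - p2 = d p2 n" unfolding R1_def R2_def d_def mn by simp_all
    have "exp (real N / 2 * ((R1 \<sigma> \<tau> - p1)\<^sup>2 + (R2 \<sigma> \<tau> - p2)\<^sup>2)) = K m n * E m n \<sigma> \<tau>"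
      unfolding R K_def E_def mn s exp_add[symmetric] by (simp add: algebra_simps power2_eq_square)
    also have "\<dots> \<le> (\<Sum>n\<le>N. K m n * E m n \<sigma> \<tau>)"
      using mn by (intro member_le_sum) (auto simp: K_def E_def)
    also have "\<dots> \<le> (\<Sum>m\<le>N. \<Sum>n\<le>N. K m n * E m n \<sigma> \<tau>)"
      using mn by (intro member_le_sum[of m "{..N}" "\<lambda>m. \<Sum>n\<le>N. K m n * E m n \<sigma> \<tau>"] sum_nonneg) (auto simp: K_def E_def)
    finally show ?thesis .
  qed
  have sumE: "av2 (\<lambda>\<sigma> \<tau>. \<Sum>m\<le>N. \<Sum>n\<le>N. K m n * E m n \<sigma> \<tau>) z = (\<Sum>m\<le>N. \<Sum>n\<le>N. K m n * av2 (E m n) z)" for z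
  proof -
    have a: "av (\<lambda>\<sigma>. \<Sum>m\<in>A. f m \<sigma>) z = (\<Sum>m\<in>A. av (f m) z)" for f :: "nat \<Rightarrow> config \<Rightarrow> real" and A
      unfolding av_def sum_distrib_right by (rule sum.swap)
    show ?thesis unfolding av2_alt a av_cmult ..
  qed
  have iE: "integrable P (\<lambda>g. K m n * av2 (E m n) (zz 0 g))" for m n
    using mean_exp_overlap_0(1)[of "d p1 m" "d p2 n"] unfolding E_def comp_def by (rule integrable_mult_right)
  have bE: "(\<integral>g. K m n * av2 (E m n) (zz 0 g) \<partial>P) \<le> 1" for m n
  proof -
    let ?r = "d p1 m" and ?q = "d p2 n"
    \<comment> \<open>Hoeffding's lemma for a sign with mean \<open>p\<close>, once per site; its
      right side is exactly what \<open>K m n\<close> divides out.\<close>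
    have c: "(cosh r + p * sinh r) ^ N \<le> exp (real N * (r * p + r\<^sup>2 / 2))" "0 \<le> (cosh r + p * sinh r) ^ N" if "0 \<le> p" "p \<le> 1" for r p :: real
    proof -
      have "\<bar>p * sinh r\<bar> \<le> cosh r"
      proof -
        have "\<bar>sinh r\<bar> \<le> cosh r" by (simp add: sinh_def cosh_def abs_le_iff)
        moreover have "\<bar>p\<bar> * \<bar>sinh r\<bar> \<le> 1 * \<bar>sinh r\<bar>" using that by (intro mult_right_mono) auto
        ultimately show ?thesis by (simp add: abs_mult)
      qed
      then have 0: "0 \<le> cosh r + p * sinh r" by linarith
      show "0 \<le> (cosh r + p * sinh r) ^ N" by (intro zero_le_power 0)
      show "(cosh r + p * sinh r) ^ N \<le> exp (real N * (r * p + r\<^sup>2 / 2))"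
        unfolding exp_of_nat_mult using that by (intro power_mono cosh_add_sinh_le 0) auto
    qed
    have "(\<integral>g. K m n * av2 (E m n) (zz 0 g) \<partial>P) = K m n * ((cosh ?r + p1 * sinh ?r) ^ N * (cosh ?q + p2 * sinh ?q) ^ N)"
      unfolding E_def mean_exp_overlap_0(2)[symmetric] by (rule integral_mult_right_zero)
    also have "\<dots> \<le> K m n * (exp (real N * (?r * p1 + ?r\<^sup>2 / 2)) * exp (real N * (?q * p2 + ?q\<^sup>2 / 2)))"
      using p by (intro mult_left_mono mult_mono c) (auto simp: K_def)
    also have "\<dots> = 1" unfolding K_def exp_add[symmetric] by simp
    finally show ?thesis .
  qed
  have "(\<integral>g. av2 (\<lambda>\<sigma> \<tau>. exp (real N / 2 * ((R1 \<sigma> \<tau> - p1)\<^sup>2 + (R2 \<sigma> \<tau> - p2)\<^sup>2))) (zz 0 g) \<partial>P) \<le> (\<integral>g. (\<Sum>m\<le>N. \<Sum>n\<le>N. K m n * av2 (E m n) (zz 0 g)) \<partial>P)"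
  proof (rule integral_mono')
    show "integrable P (\<lambda>g. \<Sum>m\<le>N. \<Sum>n\<le>N. K m n * av2 (E m n) (zz 0 g))" by (intro Bochner_Integration.integrable_sum iE)
    fix g
    show "av2 (\<lambda>\<sigma> \<tau>. exp (real N / 2 * ((R1 \<sigma> \<tau> - p1)\<^sup>2 + (R2 \<sigma> \<tau> - p2)\<^sup>2))) (zz 0 g) \<le> (\<Sum>m\<le>N. \<Sum>n\<le>N. K m n * av2 (E m n) (zz 0 g))"
      unfolding sumE[symmetric] by (rule av2_mono[OF pw])
    show "0 \<le> (\<Sum>m\<le>N. \<Sum>n\<le>N. K m n * av2 (E m n) (zz 0 g))"
      unfolding av2_def K_def E_def using weight_pos
      by (intro sum_nonneg mult_nonneg_nonneg) (auto intro: less_imp_le)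
  qed
  also have "\<dots> = (\<Sum>m\<le>N. \<Sum>n\<le>N. \<integral>g. K m n * av2 (E m n) (zz 0 g) \<partial>P)"
    by (subst Bochner_Integration.integral_sum, intro Bochner_Integration.integrable_sum iE, subst Bochner_Integration.integral_sum, rule iE, rule refl)
  also have "\<dots> \<le> (\<Sum>m\<le>N. \<Sum>n\<le>N. 1)" by (intro sum_mono bE)
  also have "\<dots> = (real N + 1)\<^sup>2" by (simp add: power2_eq_square add.commute)
  finally show ?thesis .
qed

lemma R_diag: "\<sigma> \<in> configs N \<Longrightarrow> R1 \<sigma> \<sigma> = 1" "\<sigma> \<in> configs N \<Longrightarrow> R2 \<sigma> \<sigma> = 1"
proof -
  assume s: "\<sigma> \<in> configs N"
  have "(\<Sum>i=1..N. fst \<sigma> i * fst \<sigma> i) = (\<Sum>i=1..N. 1)" "(\<Sum>i=1..N. snd \<sigma> i * snd \<sigma> i) = (\<Sum>i=1..N. 1)"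
    using config_spins[OF s] by (intro sum.cong; force)+
  then show "R1 \<sigma> \<sigma> = 1" "R2 \<sigma> \<sigma> = 1" using N_pos by (auto simp: R1_def R2_def)
qed

text \<open>A product of deviations is at most half the sum of their squares, so the centred
  covariance fits the coupling. The initial bound is polynomial in \<open>N\<close>, and its
  logarithm makes the total error logarithmic.\<close>

lemma mean_ln_partition:
  "\<bar>(\<integral>g. ln (partition \<beta> h1 h2 (\<lambda>i j. g (Inl (i, j))) \<chi>1 \<chi>2 N) \<partial>P) -
     real N * (2 * ln 2 + LC (\<beta>\<^sup>2 * p2) h1 + LC (\<beta>\<^sup>2 * p1) h2 + \<beta>\<^sup>2 / 2 * ((1 - p1) * (1 - p2)))\<bar>
   \<le> pi * \<beta>\<^sup>2 / (1 - 8 * \<beta>\<^sup>2) * ln (real N + 1)"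
proof -
  let ?A = "\<lambda>\<sigma> \<tau>. (R1 \<sigma> \<tau> - p1) * (R2 \<sigma> \<tau> - p2)" and ?Q = "\<lambda>\<sigma> \<tau>. (R1 \<sigma> \<tau> - p1)\<^sup>2 + (R2 \<sigma> \<tau> - p2)\<^sup>2"
  \<comment> \<open>The condition \<open>4 * a0 < l0\<close> reads
    \<open>4 * \<beta>\<^sup>2 * N < N / 2\<close>; here the hypothesis
    \<open>8 * \<beta>\<^sup>2 < 1\<close> is spent.\<close>
  interpret replica_coupling "configs N" "index_set N" spin field coef coef' \<beta>
     "\<beta>\<^sup>2 * real N" "- (p1 * p2)" "(1 - p1) * (1 - p2)" "real N / 2" "(real N + 1)\<^sup>2" ?A ?Q
  proof
    show "\<bar>?A \<sigma> \<tau>\<bar> \<le> ?Q \<sigma> \<tau> / 2" for \<sigma> \<tau>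
    proof -
      have "0 \<le> (\<bar>R1 \<sigma> \<tau> - p1\<bar> - \<bar>R2 \<sigma> \<tau> - p2\<bar>)\<^sup>2" by simp
      then show ?thesis by (simp add: abs_mult power2_diff)
    qed
    show "4 * (\<beta>\<^sup>2 * real N) < real N / 2" using mult_strict_right_mono[OF \<beta>(2) N_pos] by simp
    show "?Q \<sigma> \<tau> = ?Q \<tau> \<sigma>" for \<sigma> \<tau> by (simp add: R1_def R2_def mult.commute)
    show "(\<integral>g. av2 (\<lambda>\<sigma> \<tau>. exp (real N / 2 * ?Q \<sigma> \<tau>)) (zz 0 g) \<partial>P) \<le> (real N + 1)\<^sup>2"
      by (rule initial_overlap)
    show "?A \<sigma> \<sigma> = (1 - p1) * (1 - p2)" if "\<sigma> \<in> configs N" for \<sigma> by (simp add: R_diag[OF that])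
    show "1 \<le> (real N + 1)\<^sup>2" by simp
    show "0 \<le> \<beta>\<^sup>2 * real N" by simp
  qed (rule covariance)
  have "pi / 2 * (\<beta>\<^sup>2 * real N * (ln ((real N + 1)\<^sup>2) / (real N / 2 - 4 * (\<beta>\<^sup>2 * real N))) / 2) = pi * \<beta>\<^sup>2 / (1 - 8 * \<beta>\<^sup>2) * ln (real N + 1)"
  proof -
    have "real N / 2 - 4 * (\<beta>\<^sup>2 * real N) = real N * (1 - 8 * \<beta>\<^sup>2) / 2" by (simp add: algebra_simps)
    moreover have "ln ((real N + 1)\<^sup>2) = 2 * ln (real N + 1)" using N_pos by (simp add: ln_realpow)
    ultimately show ?thesis using N_pos \<beta>(2) by (simp add: field_simps)
  qed
  with mean_lnZ_interpolation show ?thesis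
    unfolding mean_lnZ_0 Z_pi_half by (simp add: algebra_simps)
qed

end

section \<open>Concentration in the disorder and almost sure convergence\<close>

lemma ln_sum_exp_lipschitz:
  fixes f g :: "'a \<Rightarrow> real"
  assumes "finite S" "S \<noteq> {}" "\<And>s. s \<in> S \<Longrightarrow> \<bar>f s - g s\<bar> \<le> d"
  shows "\<bar>ln (\<Sum>s\<in>S. exp (f s)) - ln (\<Sum>s\<in>S. exp (g s))\<bar> \<le> d"
proof -
  have le: "ln (\<Sum>s\<in>S. exp (f s)) \<le> d + ln (\<Sum>s\<in>S. exp (g s))" if "\<And>s. s \<in> S \<Longrightarrow> f s \<le> d + g s" for f g :: "'a \<Rightarrow> real"
  proof -
    have pos: "0 < (\<Sum>s\<in>S. exp (f s))" "0 < (\<Sum>s\<in>S. exp (g s))" using assms(1,2) by (auto intro!: sum_pos)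
    have "(\<Sum>s\<in>S. exp (f s)) \<le> (\<Sum>s\<in>S. exp (d + g s))" using that by (intro sum_mono) simp
    also have "\<dots> = exp d * (\<Sum>s\<in>S. exp (g s))" by (simp add: exp_add sum_distrib_left)
    finally have "ln (\<Sum>s\<in>S. exp (f s)) \<le> ln (exp d * (\<Sum>s\<in>S. exp (g s)))" using pos by (subst ln_le_cancel_iff) auto
    then show ?thesis using pos by (simp add: ln_mult)
  qed
  have "f s \<le> d + g s" "g s \<le> d + f s" if "s \<in> S" for s using assms(3)[OF that] by (auto simp: abs_le_iff)
  from le[of f g, OF this(1)] le[of g f, OF this(2)] show ?thesis by (auto simp: abs_le_iff)
qed

text \<open>The law of the actual disorder: unlike in the interpolation, the two site families now
  carry the random signs.\<close>

fun law :: "index \<Rightarrow> real measure" where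
  "law (Inl _) = gauss"
| "law (Inr _) = rademacher"

lemma sub_gaussian_law: "sub_gaussian (law k)"
  by (cases k) (simp_all add: sub_gaussian_gauss sub_gaussian_rademacher)

lemma sets_law [simp, measurable_cong]: "sets (law k) = sets borel"
  by (cases k) simp_all

lemma prob_space_law: "prob_space (law k)"
  by (rule sub_gaussian_prob_space[OF sub_gaussian_law])

lemma product_sigma_finite_law: "product_sigma_finite law"
  by (rule product_sigma_finite.intro) (rule prob_space_imp_sigma_finite[OF prob_space_law])

definition ln_part :: "real \<Rightarrow> real \<Rightarrow> real \<Rightarrow> nat \<Rightarrow> (index \<Rightarrow> real) \<Rightarrow> real" where
  "ln_part \<beta> h1 h2 N y = ln (partition \<beta> h1 h2 (\<lambda>i j. y (Inl (i, j))) (\<lambda>i. y (Inr (Inl i))) (\<lambda>i. y (Inr (Inr i))) N) / real N"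

fun factor :: "real \<Rightarrow> real \<Rightarrow> real \<Rightarrow> nat \<Rightarrow> index \<Rightarrow> real" where
  "factor \<beta> h1 h2 N (Inl _) = \<beta> / sqrt (real N)"
| "factor \<beta> h1 h2 N (Inr (Inl _)) = h1"
| "factor \<beta> h1 h2 N (Inr (Inr _)) = h2"

lemma partition_eq:
  "partition \<beta> h1 h2 (\<lambda>i j. y (Inl (i, j))) (\<lambda>i. y (Inr (Inl i))) (\<lambda>i. y (Inr (Inr i))) N =
    (\<Sum>\<sigma>\<in>configs N. exp (\<Sum>k\<in>index_set N. factor \<beta> h1 h2 N k * y k * spin k \<sigma>))"
  unfolding partition_def sum_index_set by (simp add: sum_distrib_left mult_ac add.assoc)

lemma ln_part_lipschitz:
  assumes "k \<in> index_set N" "1 \<le> N"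
  shows "\<bar>ln_part \<beta> h1 h2 N (y(k := s)) - ln_part \<beta> h1 h2 N (y(k := t))\<bar> \<le> \<bar>factor \<beta> h1 h2 N k\<bar> / real N * \<bar>s - t\<bar>"
proof -
  let ?e = "\<lambda>y \<sigma>. \<Sum>k\<in>index_set N. factor \<beta> h1 h2 N k * y k * spin k \<sigma>"
  have "\<bar>ln (\<Sum>\<sigma>\<in>configs N. exp (?e (y(k := s)) \<sigma>)) - ln (\<Sum>\<sigma>\<in>configs N. exp (?e (y(k := t)) \<sigma>))\<bar> \<le> \<bar>factor \<beta> h1 h2 N k\<bar> * \<bar>s - t\<bar>"
  proof (rule ln_sum_exp_lipschitz[OF finite_configs configs_nonempty])
    fix \<sigma> assume \<sigma>: "\<sigma> \<in> configs N"
    have e: "?e (y(k := v)) \<sigma> = factor \<beta> h1 h2 N k * v * spin k \<sigma> + (\<Sum>j\<in>index_set N - {k}. factor \<beta> h1 h2 N j * y j * spin j \<sigma>)" for v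
      using assms(1) by (subst sum.remove[of _ k]) (auto intro!: sum.cong)
    have "?e (y(k := s)) \<sigma> - ?e (y(k := t)) \<sigma> = factor \<beta> h1 h2 N k * (s - t) * spin k \<sigma>"
      unfolding e by (simp add: algebra_simps)
    then show "\<bar>?e (y(k := s)) \<sigma> - ?e (y(k := t)) \<sigma>\<bar> \<le> \<bar>factor \<beta> h1 h2 N k\<bar> * \<bar>s - t\<bar>"
      using spin_abs[OF assms(1) \<sigma>] by (simp add: abs_mult)
  qed
  then show ?thesis unfolding ln_part_def partition_eq diff_divide_distrib[symmetric] using assms(2)
    by (simp add: abs_divide divide_right_mono)
qed

lemma ln_part_measurable:
  assumes "\<And>k. sets (\<mu> k) = sets (borel :: real measure)"
  shows "ln_part \<beta> h1 h2 N \<in> borel_measurable (PiM (index_set N) \<mu>)"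
proof -
  have "sets (PiM (index_set N) \<mu>) = sets (PiM (index_set N) (\<lambda>_. borel :: real measure))"
    by (rule sets_PiM_cong) (auto simp: assms)
  moreover have "ln_part \<beta> h1 h2 N \<in> borel_measurable (PiM (index_set N) (\<lambda>_. borel))"
    unfolding ln_part_def partition_eq by measurable
  ultimately show ?thesis by (simp cong: measurable_cong_sets)
qed

text \<open>\<open>N\<^sup>2\<close> couplings contribute \<open>\<beta>\<^sup>2 / N\<^sup>3\<close>
  each, and \<open>N\<close> signs per layer contribute a squared field over
  \<open>N\<^sup>2\<close>. A total of order \<open>1 / N\<close> makes the tails exponentially
  small in \<open>N\<close>.\<close>

lemma factor_sum:
  assumes "1 \<le> N"
  shows "(\<Sum>k\<in>index_set N. (\<bar>factor \<beta> h1 h2 N k\<bar> / real N)\<^sup>2) = (\<beta>\<^sup>2 + h1\<^sup>2 + h2\<^sup>2) / real N"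
  using assms unfolding sum_index_set by (simp add: power_divide field_simps power2_eq_square)

lemma ln_part_concentration:
  assumes "1 \<le> N" "0 < \<epsilon>"
  shows "measure (PiM (index_set N) law) {y \<in> space (PiM (index_set N) law). \<epsilon> \<le> \<bar>ln_part \<beta> h1 h2 N y - integral\<^sup>L (PiM (index_set N) law) (ln_part \<beta> h1 h2 N)\<bar>}
     \<le> 2 * exp (- \<epsilon>\<^sup>2 / (4 * ((\<beta>\<^sup>2 + h1\<^sup>2 + h2\<^sup>2 + 1) / real N)))"
proof (rule sub_gaussian_concentration[OF sub_gaussian_law finite_index_set ln_part_measurable[OF sets_law]])
  \<comment> \<open>The added 1 keeps the variance proxy positive when \<beta> and both fields
    vanish.\<close>
  show "(\<Sum>k\<in>index_set N. (\<bar>factor \<beta> h1 h2 N k\<bar> / real N)\<^sup>2) \<le> (\<beta>\<^sup>2 + h1\<^sup>2 + h2\<^sup>2 + 1) / real N"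
    unfolding factor_sum[OF assms(1)] by (intro divide_right_mono) auto
  have "0 \<le> \<beta>\<^sup>2" "0 \<le> h1\<^sup>2" "0 \<le> h2\<^sup>2" by auto
  then show "0 < (\<beta>\<^sup>2 + h1\<^sup>2 + h2\<^sup>2 + 1) / real N" using assms(1) by (intro divide_pos_pos) linarith+
qed (use assms ln_part_lipschitz in auto)

lemma integrable_ln_part:
  assumes "1 \<le> N"
  shows "integrable (PiM (index_set N) law) (ln_part \<beta> h1 h2 N)"
proof (rule conjunct1[OF sub_gaussian_tensorization[where \<mu>=law and L="\<lambda>k. \<bar>factor \<beta> h1 h2 N k\<bar> / real N"]])
qed (use assms sub_gaussian_law ln_part_measurable[OF sets_law] ln_part_lipschitz in auto)

lemma ln_part_mean:
  assumes N: "1 \<le> N" and \<beta>: "0 \<le> \<beta>" "8 * \<beta>\<^sup>2 < 1"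
    and p: "0 \<le> p1" "p1 \<le> 1" "0 \<le> p2" "p2 \<le> 1"
    and fixpoint: "p1 = LQ (\<beta>\<^sup>2 * p2) h1" "p2 = LQ (\<beta>\<^sup>2 * p1) h2"
  shows "\<bar>integral\<^sup>L (PiM (index_set N) law) (ln_part \<beta> h1 h2 N)
      - (2 * ln 2 + LC (\<beta>\<^sup>2 * p2) h1 + LC (\<beta>\<^sup>2 * p1) h2 + \<beta>\<^sup>2 / 2 * ((1 - p1) * (1 - p2)))\<bar>
    \<le> pi * \<beta>\<^sup>2 / (1 - 8 * \<beta>\<^sup>2) * (ln (real N + 1) / real N)"
proof -
  define K where "K = (Inr ` ({1..N} <+> {1..N}) :: index set)"
  define L where "L = (Inl ` ({1..N} \<times> {1..N}) :: index set)"
  have KL: "K \<union> L = index_set N" "L \<union> K = index_set N" "K \<inter> L = {}" "L \<inter> K = {}" "finite K" "finite L"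
    unfolding K_def L_def index_set_def Plus_def by auto
  define \<Lambda> where "\<Lambda> = 2 * ln 2 + LC (\<beta>\<^sup>2 * p2) h1 + LC (\<beta>\<^sup>2 * p1) h2 + \<beta>\<^sup>2 / 2 * ((1 - p1) * (1 - p2))"
  define b where "b = pi * \<beta>\<^sup>2 / (1 - 8 * \<beta>\<^sup>2) * (ln (real N + 1) / real N)"
  define G where "G x = (\<integral>y. ln_part \<beta> h1 h2 N (merge K L (x, y)) \<partial>PiM L (\<lambda>_. gauss))" for x
  have lawL: "PiM L law = PiM L (\<lambda>_. gauss)" by (rule PiM_cong) (auto simp: L_def)
  have eq: "integral\<^sup>L (PiM (index_set N) law) (ln_part \<beta> h1 h2 N) = (\<integral>x. G x \<partial>PiM K law)"
    using product_sigma_finite.product_integral_fold[OF product_sigma_finite_law KL(3,5,6), of "ln_part \<beta> h1 h2 N"] integrable_ln_part[OF N]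
    unfolding KL(1) lawL G_def by simp
  have val: "\<bar>G x - \<Lambda>\<bar> \<le> b" if x: "\<forall>k\<in>K. x k \<in> {-1, 1}" for x
  proof -
    define \<chi>1 where "\<chi>1 i = x (Inr (Inl i))" for i
    define \<chi>2 where "\<chi>2 i = x (Inr (Inr i))" for i
    interpret bipartite \<beta> p1 p2 h1 h2 \<chi>1 \<chi>2 N
      using x N by unfold_locales (auto simp: \<beta> p \<chi>1_def \<chi>2_def K_def fixpoint[symmetric])
    define f where "f g = ln (partition \<beta> h1 h2 (\<lambda>i j. g (Inl (i, j))) \<chi>1 \<chi>2 N)" for g :: "index \<Rightarrow> real"
    have fi: "integrable (PiM (L \<union> K) (\<lambda>_. gauss)) f"
      using integrable_lnZ[of "pi / 2"] unfolding Z_pi_half KL f_def .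
    \<comment> \<open>The interpolation lives on all coordinates; at its end point the auxiliary
      site Gaussians have coefficient 0 and integrate out.\<close>
    have "(\<integral>g. f g \<partial>PiM (index_set N) (\<lambda>_. gauss)) = (\<integral>y. (\<integral>z. f (merge L K (y, z)) \<partial>PiM K (\<lambda>_. gauss)) \<partial>PiM L (\<lambda>_. gauss))"
      using product_sigma_finite.product_integral_fold[OF product_sigma_finite_gauss KL(4,6,5) fi] unfolding KL .
    also have "\<dots> = (\<integral>y. f y \<partial>PiM L (\<lambda>_. gauss))"
    proof (rule Bochner_Integration.integral_cong[OF refl])
      fix y
      have "f (merge L K (y, z)) = f y" for z
        unfolding f_def partition_def merge_def L_def by (intro arg_cong[where f=ln] sum.cong refl arg_cong[where f=exp] arg_cong2[where f="(+)"] arg_cong2[where f="(*)"]) auto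
      then show "(\<integral>z. f (merge L K (y, z)) \<partial>PiM K (\<lambda>_. gauss)) = f y"
        using prob_space.prob_space[OF prob_space_PiM_gauss, of K] by simp
    qed
    also have "\<dots> = real N * G x"
    proof -
      have "ln_part \<beta> h1 h2 N (merge K L (x, y)) = f y / real N" for y
        unfolding ln_part_def f_def partition_def merge_def L_def K_def \<chi>1_def \<chi>2_def
        by (intro arg_cong2[where f="(/)"] arg_cong[where f=ln] sum.cong refl arg_cong[where f=exp] arg_cong2[where f="(+)"] arg_cong2[where f="(*)"]) auto
      then show ?thesis using N by (simp add: G_def)
    qed
    finally have "\<bar>real N * G x - real N * \<Lambda>\<bar> \<le> pi * \<beta>\<^sup>2 / (1 - 8 * \<beta>\<^sup>2) * ln (real N + 1)"
      using mean_ln_partition unfolding f_def \<Lambda>_def by simp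
    then have "real N * \<bar>G x - \<Lambda>\<bar> \<le> pi * \<beta>\<^sup>2 / (1 - 8 * \<beta>\<^sup>2) * ln (real N + 1)"
      by (simp add: abs_mult flip: right_diff_distrib)
    moreover have "b = pi * \<beta>\<^sup>2 / (1 - 8 * \<beta>\<^sup>2) * ln (real N + 1) / real N" by (simp add: b_def)
    moreover have "0 < real N" using N by simp
    ultimately show ?thesis by (simp only: pos_le_divide_eq mult.commute[of _ "real N"])
  qed
  have pK: "prob_space (PiM K law)" by (rule prob_space_PiM[OF prob_space_law])
  have "AE x in PiM K law. x k \<in> {-1, 1}" if "k \<in> K" for k
  proof (rule AE_PiM_component[OF prob_space_law that])
    have "law k = rademacher" using that by (auto simp: K_def)
    then show "AE x in law k. x \<in> {-1, 1}" using AE_rademacher by (simp only:)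
  qed
  then have "AE x in PiM K law. \<forall>k\<in>K. x k \<in> {-1, 1}" using KL(5) by (subst AE_finite_all) auto
  then have AEb: "AE x in PiM K law. \<bar>G x - \<Lambda>\<bar> \<le> b" by eventually_elim (rule val)
  have mG: "G \<in> borel_measurable (PiM K law)"
  proof -
    have "(\<lambda>xy. ln_part \<beta> h1 h2 N (merge K L xy)) \<in> borel_measurable (PiM K law \<Otimes>\<^sub>M PiM L law)"
      using measurable_comp[OF measurable_merge, of "ln_part \<beta> h1 h2 N" K L law borel] ln_part_measurable[OF sets_law]
      by (simp add: KL comp_def)
    then show ?thesis unfolding G_def lawL
      by (intro sigma_finite_measure.borel_measurable_lebesgue_integral[OF prob_space_imp_sigma_finite[OF prob_space_PiM_gauss]])
        (simp add: case_prod_beta)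
  qed
  have iG: "integrable (PiM K law) (\<lambda>x. G x - \<Lambda>)"
    by (rule finite_measure.integrable_const_bound[OF prob_space.finite_measure[OF pK], of _ b]) (use AEb mG in auto)
  have "integrable (PiM K law) (\<lambda>x. (G x - \<Lambda>) + \<Lambda>)"
    by (intro Bochner_Integration.integrable_add iG finite_measure.integrable_const[OF prob_space.finite_measure[OF pK]])
  then have iG': "integrable (PiM K law) G" by simp
  have "(\<integral>x. G x \<partial>PiM K law) - \<Lambda> = (\<integral>x. G x - \<Lambda> \<partial>PiM K law)"
    using prob_space.prob_space[OF pK]
    by (subst Bochner_Integration.integral_diff[OF iG' finite_measure.integrable_const[OF prob_space.finite_measure[OF pK]]]) simp
  also have "\<bar>\<dots>\<bar> \<le> (\<integral>x. \<bar>G x - \<Lambda>\<bar> \<partial>PiM K law)" by (rule integral_abs_bound)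
  also have "\<dots> \<le> (\<integral>x. b \<partial>PiM K law)"
    by (rule integral_mono_AE[OF integrable_abs[OF iG] finite_measure.integrable_const[OF prob_space.finite_measure[OF pK]] AEb])
  also have "\<dots> = b" using prob_space.prob_space[OF pK] by simp
  finally show ?thesis unfolding eq \<Lambda>_def b_def .
qed

lemma ln_over_n_tendsto_0: "(\<lambda>N. ln (real N + 1) / real N) \<longlonglongrightarrow> 0"
proof (rule Lim_null_comparison)
  have "(\<lambda>N. ln (real (Suc N)) / real (Suc N)) \<longlonglongrightarrow> 0"
    using LIMSEQ_Suc[OF lim_ln_over_n] by simp
  from tendsto_mult_right_zero[OF this, of 2]
  show "(\<lambda>N. 2 * (ln (real (Suc N)) / real (Suc N))) \<longlonglongrightarrow> 0" .
  show "\<forall>\<^sub>F N in sequentially. norm (ln (real N + 1) / real N) \<le> 2 * (ln (real (Suc N)) / real (Suc N))"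
    using eventually_ge_at_top[of 1]
  proof eventually_elim
    case (elim N)
    have l: "0 \<le> ln (real N + 1)" by simp
    have "ln (real N + 1) * (real N + 1) \<le> ln (real N + 1) * (2 * real N)" using elim by (intro mult_left_mono l) auto
    then show ?case using elim l by (simp add: field_simps)
  qed
qed

text \<open>Independence identifies the law of the finitely many variables in play with
  \<open>PiM (index_set N) law\<close>. Concentration and Borel-Cantelli bring the free energy to
  its mean, which converges by \<open>ln_part_mean\<close>.\<close>

lemma (in prob_space) AE_ln_partition_tendsto:
  fixes W :: "nat \<Rightarrow> nat \<Rightarrow> 'a \<Rightarrow> real" and \<chi>1 \<chi>2 :: "nat \<Rightarrow> 'a \<Rightarrow> real"
  assumes indep: "indep_vars (\<lambda>_. borel) (case_sum (\<lambda>(i, j). W i j) (case_sum \<chi>1 \<chi>2)) (({1..} \<times> {1..}) <+> ({1..} <+> {1..}))"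
    and W: "\<And>i j. 1 \<le> i \<Longrightarrow> 1 \<le> j \<Longrightarrow> distributed M lborel (W i j) std_normal_density"
    and \<chi>1: "\<And>i. 1 \<le> i \<Longrightarrow> distr M borel (\<chi>1 i) = rademacher"
    and \<chi>2: "\<And>i. 1 \<le> i \<Longrightarrow> distr M borel (\<chi>2 i) = rademacher"
    and \<beta>: "0 \<le> \<beta>" "8 * \<beta>\<^sup>2 < 1"
    and p: "0 \<le> p1" "p1 \<le> 1" "0 \<le> p2" "p2 \<le> 1"
    and fixpoint: "p1 = LQ (\<beta>\<^sup>2 * p2) h1" "p2 = LQ (\<beta>\<^sup>2 * p1) h2"
  shows "AE \<omega> in M. (\<lambda>N. ln (partition \<beta> h1 h2 (\<lambda>i j. W i j \<omega>) (\<lambda>i. \<chi>1 i \<omega>) (\<lambda>i. \<chi>2 i \<omega>) N) / real N) \<longlonglongrightarrow>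
     2 * ln 2 + LC (\<beta>\<^sup>2 * p2) h1 + LC (\<beta>\<^sup>2 * p1) h2 + \<beta>\<^sup>2 / 2 * ((1 - p1) * (1 - p2))"
proof -
  define V :: "index \<Rightarrow> 'a \<Rightarrow> real" where "V = case_sum (\<lambda>(i, j). W i j) (case_sum \<chi>1 \<chi>2)"
  define F where "F N \<omega> = ln (partition \<beta> h1 h2 (\<lambda>i j. W i j \<omega>) (\<lambda>i. \<chi>1 i \<omega>) (\<lambda>i. \<chi>2 i \<omega>) N) / real N" for N \<omega>
  define m where "m N = integral\<^sup>L (PiM (index_set N) law) (ln_part \<beta> h1 h2 N)" for N
  define c where "c = 1 / (4 * (\<beta>\<^sup>2 + h1\<^sup>2 + h2\<^sup>2 + 1))"
  have c: "0 < c" unfolding c_def by (intro divide_pos_pos mult_pos_pos) (auto intro!: add_nonneg_pos)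
  define \<Lambda> where "\<Lambda> = 2 * ln 2 + LC (\<beta>\<^sup>2 * p2) h1 + LC (\<beta>\<^sup>2 * p1) h2 + \<beta>\<^sup>2 / 2 * ((1 - p1) * (1 - p2))"
  define X where "X N \<omega> = (\<lambda>k\<in>index_set N. V k \<omega>)" for N \<omega>
  have sub: "index_set N \<subseteq> ({1..} \<times> {1..}) <+> ({1..} <+> {1..})" for N by (auto simp: index_set_def)
  have rv: "random_variable borel (V k)" if "k \<in> index_set N" for k N
    using indep sub[of N] that unfolding indep_vars_def V_def by auto
  have dV: "distr M borel (V k) = law k" if k: "k \<in> index_set N" for k N
  proof (cases k rule: index_cases)
    case (pair i j)
    then have "distributed M lborel (W i j) std_normal_density" using k by (intro W) (auto simp: index_set_def)
    then have "distr M lborel (W i j) = gauss" by (simp add: distributed_def gauss_def)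
    moreover have "distr M lborel (W i j) = distr M borel (W i j)" by (rule distr_cong) auto
    ultimately show ?thesis by (simp add: V_def pair)
  qed (use k \<chi>1 \<chi>2 in \<open>auto simp: V_def index_set_def\<close>)
  have X: "X N \<in> measurable M (PiM (index_set N) (\<lambda>_. borel))" for N
    unfolding X_def using rv by (intro measurable_restrict) auto
  have lawX: "distr M (PiM (index_set N) (\<lambda>_. borel)) (X N) = PiM (index_set N) law" if N: "1 \<le> N" for N
  proof -
    have ne: "index_set N \<noteq> {}" using N unfolding index_set_def by (auto simp: Plus_def)
    have "indep_vars (\<lambda>_. borel) V (index_set N)" unfolding V_def by (rule indep_vars_subset[OF indep sub])
    then have "distr M (PiM (index_set N) (\<lambda>_. borel)) (X N) = PiM (index_set N) (\<lambda>k. distr M borel (V k))"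
      unfolding X_def by (subst (asm) indep_vars_iff_distr_eq_PiM'[OF ne rv]) auto
    also have "\<dots> = PiM (index_set N) law" by (rule PiM_cong) (auto simp: dV)
    finally show ?thesis .
  qed
  have FX: "F N \<omega> = ln_part \<beta> h1 h2 N (X N \<omega>)" for N \<omega>
    unfolding F_def ln_part_def partition_def X_def V_def
    by (intro arg_cong2[where f="(/)"] arg_cong[where f=ln] sum.cong refl arg_cong[where f=exp] arg_cong2[where f="(+)"] arg_cong2[where f="(*)"])
      (auto simp: index_set_def)
  have Fm [measurable]: "F N \<in> borel_measurable M" for N
    unfolding FX by (rule measurable_compose[OF X ln_part_measurable]) simp
  \<comment> \<open>The variance proxy is of order \<open>1 / N\<close>, so the tail bound is a
    geometric sequence in \<open>N\<close> and hence summable.\<close>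
  have tail: "measure M {\<omega> \<in> space M. \<epsilon> \<le> \<bar>F N \<omega> - m N\<bar>} \<le> 2 * exp (- (\<epsilon>\<^sup>2 * c)) ^ N" if "1 \<le> N" "0 < \<epsilon>" for N \<epsilon>
  proof -
    let ?A = "{y \<in> space (PiM (index_set N) law). \<epsilon> \<le> \<bar>ln_part \<beta> h1 h2 N y - m N\<bar>}"
    have sp: "space (PiM (index_set N) law) = space (PiM (index_set N) (\<lambda>_. borel :: real measure))"
      by (simp add: lawX[OF that(1), symmetric])
    have lm: "ln_part \<beta> h1 h2 N \<in> borel_measurable (PiM (index_set N) (\<lambda>_. borel))"
      by (rule ln_part_measurable) simp
    have A: "?A \<in> sets (PiM (index_set N) (\<lambda>_. borel))" unfolding sp using lm by measurable
    have "measure M {\<omega> \<in> space M. \<epsilon> \<le> \<bar>F N \<omega> - m N\<bar>} = measure M (X N -` ?A \<inter> space M)"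
      using measurable_space[OF X] by (intro arg_cong[where f="measure M"]) (auto simp: FX sp)
    also have "\<dots> = measure (PiM (index_set N) law) ?A"
      unfolding lawX[OF that(1), symmetric] by (rule measure_distr[symmetric, OF X]) (use A in \<open>simp add: lawX[OF that(1)]\<close>)
    also have "\<dots> \<le> 2 * exp (- \<epsilon>\<^sup>2 / (4 * ((\<beta>\<^sup>2 + h1\<^sup>2 + h2\<^sup>2 + 1) / real N)))"
      unfolding m_def by (rule ln_part_concentration[OF that])
    also have "- \<epsilon>\<^sup>2 / (4 * ((\<beta>\<^sup>2 + h1\<^sup>2 + h2\<^sup>2 + 1) / real N)) = real N * (- (\<epsilon>\<^sup>2 * c))"
      by (simp add: c_def)
    finally show ?thesis by (simp only: exp_of_nat_mult)
  qed
  have "AE \<omega> in M. \<forall>\<^sub>F N in sequentially. \<bar>F N \<omega> - m N\<bar> < inverse (real (Suc r))" for r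
  proof -
    let ?\<epsilon> = "inverse (real (Suc r))"
    let ?A = "\<lambda>N. {\<omega> \<in> space M. ?\<epsilon> \<le> \<bar>F N \<omega> - m N\<bar>}"
    have "summable (\<lambda>N. 2 * exp (- (?\<epsilon>\<^sup>2 * c)) ^ N)"
      using c by (intro summable_mult summable_geometric) (simp add: mult_pos_pos)
    then have "summable (\<lambda>N. measure M (?A N))"
      by (rule summable_comparison_test'[where N=1]) (use tail in auto)
    then have "AE \<omega> in M. \<forall>\<^sub>F N in sequentially. \<omega> \<in> space M - ?A N"
      by (intro borel_cantelli_AE1) (auto simp: emeasure_eq_measure)
    then show ?thesis by eventually_elim (auto elim!: eventually_mono)
  qed
  then have "AE \<omega> in M. \<forall>r. \<forall>\<^sub>F N in sequentially. \<bar>F N \<omega> - m N\<bar> < inverse (real (Suc r))"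
    by (simp add: AE_all_countable)
  then show ?thesis
  proof eventually_elim
    case (elim \<omega>)
    have "(\<lambda>N. F N \<omega> - m N) \<longlonglongrightarrow> 0"
    proof (rule LIMSEQ_I)
      fix e :: real assume "e > 0"
      then obtain r where "inverse (real (Suc r)) < e" using reals_Archimedean by blast
      moreover obtain N0 where "\<And>N. N \<ge> N0 \<Longrightarrow> \<bar>F N \<omega> - m N\<bar> < inverse (real (Suc r))"
        using elim unfolding eventually_sequentially by blast
      ultimately show "\<exists>no. \<forall>n\<ge>no. norm (F n \<omega> - m n - 0) < e" by (intro exI[of _ N0]) force
    qed
    moreover have "(\<lambda>N. m N - (2 * ln 2 + LC (\<beta>\<^sup>2 * p2) h1 + LC (\<beta>\<^sup>2 * p1) h2 + \<beta>\<^sup>2 / 2 * ((1 - p1) * (1 - p2)))) \<longlonglongrightarrow> 0"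
    proof (rule Lim_null_comparison)
      show "(\<lambda>N. pi * \<beta>\<^sup>2 / (1 - 8 * \<beta>\<^sup>2) * (ln (real N + 1) / real N)) \<longlonglongrightarrow> 0"
        by (rule tendsto_mult_right_zero[OF ln_over_n_tendsto_0])
      show "\<forall>\<^sub>F N in sequentially. norm (m N - (2 * ln 2 + LC (\<beta>\<^sup>2 * p2) h1 + LC (\<beta>\<^sup>2 * p1) h2 + \<beta>\<^sup>2 / 2 * ((1 - p1) * (1 - p2))))
         \<le> pi * \<beta>\<^sup>2 / (1 - 8 * \<beta>\<^sup>2) * (ln (real N + 1) / real N)"
        using eventually_ge_at_top[of 1]
        by eventually_elim (use ln_part_mean[OF _ \<beta> p fixpoint] in \<open>simp add: m_def\<close>)
    qed
    ultimately have "(\<lambda>N. (F N \<omega> - m N) + (m N - \<Lambda>)) \<longlonglongrightarrow> 0 + 0"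
      unfolding \<Lambda>_def by (rule tendsto_add)
    then have "(\<lambda>N. F N \<omega> - \<Lambda>) \<longlonglongrightarrow> 0" by simp
    then have "(\<lambda>N. F N \<omega>) \<longlonglongrightarrow> \<Lambda>" by (rule LIM_zero_cancel)
    then show ?case unfolding F_def \<Lambda>_def .
  qed
qed

section \<open>The Gaertner--Ellis theorem\<close>

text \<open>A finite space with all subsets measurable makes every function integrable; the uniform
  bound \<open>R\<close> replaces exponential tightness.\<close>

locale bounded_sequence =
  fixes P :: "nat \<Rightarrow> 's measure" and X :: "nat \<Rightarrow> 's \<Rightarrow> 'a::euclidean_space" and R :: real
  assumes prob: "\<And>N. prob_space (P N)" and finite_space: "\<And>N. finite (space (P N))"
    and sets_P: "\<And>N. sets (P N) = Pow (space (P N))"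
    and bounded: "\<And>N s. s \<in> space (P N) \<Longrightarrow> norm (X N s) \<le> R"
begin

lemma integrable: "integrable (P N) (f :: 's \<Rightarrow> real)"
proof (rule finite_measure.integrable_const_bound[OF prob_space.finite_measure[OF prob]])
  show "AE s in P N. norm (f s) \<le> (\<Sum>s\<in>space (P N). \<bar>f s\<bar>)"
    using finite_space by (intro AE_I2) (auto intro!: member_le_sum)
  show "f \<in> borel_measurable (P N)" by (auto simp: measurable_def sets_P)
qed

definition pr :: "nat \<Rightarrow> 'a set \<Rightarrow> real" where "pr N A = measure (P N) {s \<in> space (P N). X N s \<in> A}"
definition mgf :: "nat \<Rightarrow> 'a \<Rightarrow> real" where "mgf N l = (\<integral>s. exp (real N * (l \<bullet> X N s)) \<partial>P N)"
definition logmgf :: "nat \<Rightarrow> 'a \<Rightarrow> real" where "logmgf N l = ln (mgf N l) / real N"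
definition rate_seq :: "'a set \<Rightarrow> nat \<Rightarrow> ereal" where
  "rate_seq A N = ereal (1 / real N) * ereal_ln (measure (P N) {s \<in> space (P N). X N s \<in> A})"

lemma pr_eq: "pr N A = (\<integral>s. indicator A (X N s) \<partial>P N)"
proof -
  have "(\<integral>s. indicator A (X N s) \<partial>P N) = (\<integral>s. indicator {s \<in> space (P N). X N s \<in> A} s \<partial>P N :: real)"
    by (intro Bochner_Integration.integral_cong) (auto simp: indicator_def)
  then show ?thesis by (simp add: pr_def sets_P Int_absorb1 subset_eq)
qed

lemma pr_mono: "A \<subseteq> B \<Longrightarrow> pr N A \<le> pr N B"
  unfolding pr_eq by (intro integral_mono integrable) (auto simp: indicator_def)

lemma pr_nonneg: "0 \<le> pr N A" by (simp add: pr_def)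

lemma mgf_bounds: "exp (- (real N * (norm l * R))) \<le> mgf N l" "mgf N l \<le> exp (real N * (norm l * R))"
proof -
  have c: "(\<integral>s. a \<partial>P N) = a" for a :: real using prob_space.prob_space[OF prob, of N] by simp
  have b: "\<bar>l \<bullet> X N s\<bar> \<le> norm l * R" if "s \<in> space (P N)" for s
    by (rule order_trans[OF Cauchy_Schwarz_ineq2]) (intro mult_left_mono bounded that norm_ge_zero)
  have "(\<integral>s. exp (- (real N * (norm l * R))) \<partial>P N) \<le> mgf N l" unfolding mgf_def
  proof (intro integral_mono integrable)
    fix s assume "s \<in> space (P N)"
    then have "- (norm l * R) \<le> l \<bullet> X N s" using b[of s] by linarith
    from mult_left_mono[OF this, of "real N"] show "exp (- (real N * (norm l * R))) \<le> exp (real N * (l \<bullet> X N s))"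
      by simp
  qed
  then show "exp (- (real N * (norm l * R))) \<le> mgf N l" by (simp only: c)
  have "mgf N l \<le> (\<integral>s. exp (real N * (norm l * R)) \<partial>P N)" unfolding mgf_def
    using b by (intro integral_mono integrable) (auto simp: abs_le_iff intro!: mult_left_mono)
  then show "mgf N l \<le> exp (real N * (norm l * R))" by (simp only: c)
qed

lemma mgf_pos: "0 < mgf N l" using mgf_bounds(1)[where N=N and l=l] exp_gt_zero by (rule less_le_trans[rotated])

lemma mgf_exp: "1 \<le> N \<Longrightarrow> mgf N l = exp (real N * logmgf N l)"
  using mgf_pos[of N l] by (simp add: logmgf_def)

lemma logmgf_bound: "1 \<le> N \<Longrightarrow> \<bar>logmgf N l\<bar> \<le> norm l * R"
proof -
  assume N: "1 \<le> N"
  have "real N * logmgf N l \<le> real N * (norm l * R)" "- (real N * (norm l * R)) \<le> real N * logmgf N l"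
    using mgf_bounds[where N=N and l=l] unfolding mgf_exp[OF N] exp_le_cancel_iff by auto
  then have *: "real N * logmgf N l \<le> real N * (norm l * R)" "real N * (- (norm l * R)) \<le> real N * logmgf N l" by auto
  have "y \<le> z" if "real N * y \<le> real N * z" for y z using that N by simp
  from this[OF *(1)] this[OF *(2)] show ?thesis by linarith
qed

text \<open>Markov's inequality under the measure weighted by
  \<open>exp (N * (l \<bullet> X))\<close>, left unnormalized. It gives the plain half-space bound
  for \<open>l = 0\<close> and the concentration of tilted laws for general
  \<open>l\<close>.\<close>

lemma tilted_chernoff:
  "(\<integral>s. indicator {x. c \<le> e \<bullet> x} (X N s) * exp (real N * (l \<bullet> X N s)) \<partial>P N) \<le> exp (- (real N * (t * c))) * mgf N (l + t *\<^sub>R e)"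
  if "0 \<le> t"
proof -
  have "(\<integral>s. indicator {x. c \<le> e \<bullet> x} (X N s) * exp (real N * (l \<bullet> X N s)) \<partial>P N) \<le>
     (\<integral>s. exp (- (real N * (t * c))) * exp (real N * ((l + t *\<^sub>R e) \<bullet> X N s)) \<partial>P N)"
  proof (intro integral_mono integrable)
    fix s
    show "indicator {x. c \<le> e \<bullet> x} (X N s) * exp (real N * (l \<bullet> X N s)) \<le> exp (- (real N * (t * c))) * exp (real N * ((l + t *\<^sub>R e) \<bullet> X N s))"
    proof (cases "c \<le> e \<bullet> X N s")
      case True
      have "real N * (t * c) \<le> real N * (t * (e \<bullet> X N s))" using that True by (intro mult_left_mono) auto
      then show ?thesis using True by (simp add: inner_add_left distrib_left flip: exp_add)
    qed simp
  qed
  then show ?thesis by (simp add: mgf_def)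
qed

lemma pr_halfspace: "pr N {x. c \<le> l \<bullet> x} \<le> exp (- (real N * c)) * mgf N l"
  using tilted_chernoff[where t=1 and c=c and e=l and N=N and l=0] by (simp add: pr_eq)

lemma rate_seq_le:
  assumes "1 \<le> N" "pr N A \<le> K * exp (- (real N * b))" "0 < K"
  shows "rate_seq A N \<le> ereal (ln K / real N - b)"
proof (cases "pr N A = 0")
  case True
  then show ?thesis using assms(1) by (simp add: rate_seq_def ereal_ln_def pr_def)
next
  case False
  then have pos: "0 < pr N A" using pr_nonneg[of N A] by simp
  then have "ln (pr N A) \<le> ln (K * exp (- (real N * b)))" using assms(2,3) by (subst ln_le_cancel_iff) auto
  also have "\<dots> = ln K - real N * b" using assms(3) by (simp add: ln_mult)
  finally have "ln (pr N A) / real N \<le> (ln K - real N * b) / real N" by (rule divide_right_mono) simp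
  then show ?thesis using False assms(1) unfolding rate_seq_def pr_def[symmetric] ereal_ln_def by (simp add: diff_divide_distrib)
qed

lemma rate_seq_ge:
  assumes "1 \<le> N" "K * exp (- (real N * b)) \<le> pr N A" "0 < K"
  shows "ereal (ln K / real N - b) \<le> rate_seq A N"
proof -
  have pos: "0 < pr N A" by (rule less_le_trans[OF _ assms(2)]) (use assms(3) in simp)
  have "ln K - real N * b = ln (K * exp (- (real N * b)))" using assms(3) by (simp add: ln_mult)
  also have "\<dots> \<le> ln (pr N A)" using assms(2,3) pos by (subst ln_le_cancel_iff) auto
  finally have "(ln K - real N * b) / real N \<le> ln (pr N A) / real N" by (rule divide_right_mono) simp
  then show ?thesis using pos assms(1) unfolding rate_seq_def pr_def[symmetric] ereal_ln_def by (simp add: diff_divide_distrib)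
qed

lemma rate_seq_mono:
  assumes "1 \<le> N" "A \<subseteq> B" shows "rate_seq A N \<le> rate_seq B N"
proof -
  have "ereal_ln (pr N A) \<le> ereal_ln (pr N B)"
    using pr_mono[OF assms(2), of N] pr_nonneg[of N A] by (auto simp: ereal_ln_def)
  then show ?thesis unfolding rate_seq_def pr_def[symmetric] by (intro ereal_mult_left_mono) auto
qed

end

locale gartner_ellis = bounded_sequence P X R
  for P :: "nat \<Rightarrow> 's measure" and X :: "nat \<Rightarrow> 's \<Rightarrow> 'a::euclidean_space" and R +
  fixes \<Lambda> :: "'a \<Rightarrow> real" and \<Lambda>' :: "'a \<Rightarrow> 'a"
  assumes lim: "\<And>l. (\<lambda>N. logmgf N l) \<longlonglongrightarrow> \<Lambda> l"
    and diff: "\<And>l. (\<Lambda> has_derivative (\<lambda>h. \<Lambda>' l \<bullet> h)) (at l)"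
begin

definition rate :: "'a \<Rightarrow> ereal" where "rate x = (SUP l. ereal (l \<bullet> x - \<Lambda> l))"

lemma \<Lambda>_0: "\<Lambda> 0 = 0"
proof -
  have "(\<lambda>N. logmgf N 0) \<longlonglongrightarrow> 0"
    using prob_space.prob_space[OF prob] by (simp add: logmgf_def mgf_def)
  with lim[of 0] show ?thesis by (rule LIMSEQ_unique)
qed

lemma \<Lambda>_bound: "\<bar>\<Lambda> l\<bar> \<le> norm l * R"
proof (rule tendsto_upperbound[OF tendsto_rabs[OF lim]])
  show "\<forall>\<^sub>F N in sequentially. \<bar>logmgf N l\<bar> \<le> norm l * R"
    using eventually_ge_at_top[of 1] by eventually_elim (rule logmgf_bound)
qed simp

lemma rate_ge: "ereal (l \<bullet> x - \<Lambda> l) \<le> rate x"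
  unfolding rate_def by (rule SUP_upper) simp

lemma rate_nonneg: "0 \<le> rate x"
  using rate_ge[of 0 x] by (simp add: \<Lambda>_0 zero_ereal_def)

lemma ln_const_tendsto_0: "(\<lambda>N. ln K / real N) \<longlonglongrightarrow> 0"
  by (rule lim_const_over_n)

text \<open>Each point of \<open>C\<close> lies in an open half-space on which Chernoff's bound
  costs at least \<open>a\<close>. As \<open>X\<close> stays in a ball, finitely many of them
  suffice, and their number vanishes on the logarithmic scale.\<close>

lemma upper_bound_aux:
  assumes C: "closed C" and a: "\<And>x. x \<in> C \<Longrightarrow> ereal a < rate x" and \<delta>: "0 < \<delta>"
  shows "\<forall>\<^sub>F N in sequentially. rate_seq C N \<le> ereal (- a + \<delta>)"
proof -
  define C' where "C' = C \<inter> cball 0 R"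
  have comp: "compact C'" unfolding C'_def using C by (intro closed_Int_compact) auto
  have cov: "C' \<subseteq> (\<Union>l\<in>UNIV. {x. a + \<Lambda> l < l \<bullet> x})"
  proof
    fix x assume "x \<in> C'"
    then have "ereal a < rate x" using a by (auto simp: C'_def)
    then obtain l where "ereal a < ereal (l \<bullet> x - \<Lambda> l)" unfolding rate_def less_SUP_iff by auto
    then show "x \<in> (\<Union>l\<in>UNIV. {x. a + \<Lambda> l < l \<bullet> x})" by (auto intro!: exI[of _ l])
  qed
  obtain T where T: "finite T" "C' \<subseteq> (\<Union>l\<in>T. {x. a + \<Lambda> l < l \<bullet> x})"
    by (rule compactE_image[OF comp _ cov]) (auto simp: open_halfspace_gt)
  define K where "K = real (card T) + 1"
  have K: "0 < K" by (simp add: K_def)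
  have "\<forall>\<^sub>F N in sequentially. \<forall>l\<in>T. logmgf N l < \<Lambda> l + \<delta> / 2"
    using order_tendstoD(2)[OF lim] \<delta> by (intro eventually_ball_finite T) (auto intro!: ballI)
  moreover have "\<forall>\<^sub>F N in sequentially. ln K / real N < \<delta> / 2"
    using order_tendstoD(2)[OF ln_const_tendsto_0, of "\<delta> / 2" K] \<delta> by simp
  ultimately show ?thesis using eventually_ge_at_top[of 1]
  proof eventually_elim
    case (elim N)
    have "pr N C \<le> (\<integral>s. (\<Sum>l\<in>T. indicator {x. a + \<Lambda> l \<le> l \<bullet> x} (X N s)) \<partial>P N)"
      unfolding pr_eq
    proof (intro integral_mono integrable)
      fix s assume s: "s \<in> space (P N)"
      show "indicator C (X N s) \<le> (\<Sum>l\<in>T. indicator {x. a + \<Lambda> l \<le> l \<bullet> x} (X N s) :: real)"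
      proof (cases "X N s \<in> C")
        case True
        then have "X N s \<in> C'" using bounded[OF s] by (simp add: C'_def)
        then obtain l where l: "l \<in> T" "a + \<Lambda> l < l \<bullet> X N s" using T by auto
        then have "(1::real) = indicator {x. a + \<Lambda> l \<le> l \<bullet> x} (X N s)" by simp
        also have "\<dots> \<le> (\<Sum>l\<in>T. indicator {x. a + \<Lambda> l \<le> l \<bullet> x} (X N s))"
          using l T by (intro member_le_sum[of l T "\<lambda>l. indicator {x. a + \<Lambda> l \<le> l \<bullet> x} (X N s)"]) auto
        finally show ?thesis using True by simp
      qed (simp add: sum_nonneg)
    qed
    also have "\<dots> = (\<Sum>l\<in>T. pr N {x. a + \<Lambda> l \<le> l \<bullet> x})"
      unfolding pr_eq by (rule Bochner_Integration.integral_sum) (rule integrable)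
    also have "\<dots> \<le> (\<Sum>l\<in>T. exp (- (real N * (a - \<delta> / 2))))"
    proof (rule sum_mono)
      fix l assume l: "l \<in> T"
      have "pr N {x. a + \<Lambda> l \<le> l \<bullet> x} \<le> exp (- (real N * (a + \<Lambda> l))) * mgf N l" by (rule pr_halfspace)
      also have "\<dots> = exp (real N * (logmgf N l - \<Lambda> l - a))" using elim(3)
        by (simp add: mgf_exp algebra_simps flip: exp_add)
      also have "\<dots> \<le> exp (real N * (- (a - \<delta> / 2)))"
        using elim(1) l by (subst exp_le_cancel_iff, intro mult_left_mono) force+
      finally show "pr N {x. a + \<Lambda> l \<le> l \<bullet> x} \<le> exp (- (real N * (a - \<delta> / 2)))" by (simp only: mult_minus_right)
    qed
    also have "\<dots> \<le> K * exp (- (real N * (a - \<delta> / 2)))" by (simp add: K_def)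
    finally have "rate_seq C N \<le> ereal (ln K / real N - (a - \<delta> / 2))" using elim(3) K by (intro rate_seq_le)
    also have "\<dots> \<le> ereal (- a + \<delta>)" unfolding ereal_less_eq using elim(2) by linarith
    finally show ?case .
  qed
qed

lemma upper_bound:
  assumes "closed C" shows "limsup (rate_seq C) \<le> - (INF x\<in>C. rate x)"
proof -
  have "(INF x\<in>C. rate x) \<le> - limsup (rate_seq C)"
  \<comment> \<open>Working with levels strictly below the infimum also covers an infinite
    infimum.\<close>
  proof (rule dense_le)
    fix y assume y: "y < (INF x\<in>C. rate x)"
    show "y \<le> - limsup (rate_seq C)"
    proof (cases y)
      case (real a)
      have "limsup (rate_seq C) \<le> ereal (- a) + ereal \<delta>" if "0 < \<delta>" for \<delta>
      proof -
        have "ereal a < rate x" if "x \<in> C" for x using less_le_trans[OF y INF_lower[OF that]] real by simp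
        from upper_bound_aux[OF assms this \<open>0 < \<delta>\<close>] show ?thesis by (simp add: Limsup_bounded)
      qed
      then have "limsup (rate_seq C) \<le> ereal (- a)" by (rule ereal_le_epsilon2)
      then have "- ereal (- a) \<le> - limsup (rate_seq C)" by (simp only: ereal_minus_le_minus)
      then show ?thesis using real by simp
    qed (use y in auto)
  qed
  then have "- (- limsup (rate_seq C)) \<le> - (INF x\<in>C. rate x)" by (simp only: ereal_minus_le_minus)
  then show ?thesis by simp
qed

text \<open>Under the law tilted by \<open>l\<close>, the variable concentrates at
  \<open>\<Lambda>' l\<close>: differentiability provides a small \<open>t\<close> for which the
  extra tilt \<open>t *\<^sub>R e\<close> costs less than the gain
  \<open>t * (e \<bullet> \<Lambda>' l + \<delta>)\<close> of Chernoff's bound.\<close>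

lemma tilted_tail_tendsto_0:
  assumes "0 < \<delta>"
  shows "(\<lambda>N. (\<integral>s. indicator {x. e \<bullet> \<Lambda>' l + \<delta> \<le> e \<bullet> x} (X N s) * exp (real N * (l \<bullet> X N s)) \<partial>P N) / mgf N l) \<longlonglongrightarrow> 0"
proof -
  define a where "a = \<Lambda>' l"
  have "((\<lambda>t. \<Lambda> (l + t *\<^sub>R e)) has_derivative (\<lambda>t. a \<bullet> (t *\<^sub>R e))) (at 0)"
    unfolding a_def by (rule has_derivative_compose[where g=\<Lambda> and g'="\<lambda>h. \<Lambda>' l \<bullet> h"]) (auto intro!: derivative_eq_intros diff)
  then have "((\<lambda>t. \<Lambda> (l + t *\<^sub>R e)) has_real_derivative a \<bullet> e) (at 0)"
    by (simp add: has_field_derivative_def mult_commute_abs)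
  then have "((\<lambda>t. (\<Lambda> (l + t *\<^sub>R e) - \<Lambda> l) / t) \<longlongrightarrow> a \<bullet> e) (at 0)" by (simp add: has_field_derivative_iff)
  then have "\<forall>\<^sub>F t in at 0. (\<Lambda> (l + t *\<^sub>R e) - \<Lambda> l) / t < a \<bullet> e + \<delta>" using assms by (intro order_tendstoD(2)) auto
  then have "\<forall>\<^sub>F t in at_right 0. (\<Lambda> (l + t *\<^sub>R e) - \<Lambda> l) / t < a \<bullet> e + \<delta>"
    by (simp add: eventually_at_split)
  then have "\<forall>\<^sub>F t in at_right 0. (\<Lambda> (l + t *\<^sub>R e) - \<Lambda> l) / t < a \<bullet> e + \<delta> \<and> 0 < (t::real)"
    using eventually_at_right_less by eventually_elim auto
  then obtain t where t: "0 < t" "(\<Lambda> (l + t *\<^sub>R e) - \<Lambda> l) / t < a \<bullet> e + \<delta>"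
    using eventually_happens[of _ "at_right (0::real)"] by auto
  \<comment> \<open>The exponential gain of the chosen \<open>t\<close>; half of it absorbs the
    convergence of \<open>logmgf\<close> to its limit.\<close>
  define r where "r = t * (e \<bullet> a + \<delta>) - (\<Lambda> (l + t *\<^sub>R e) - \<Lambda> l)"
  have r: "0 < r" using t by (simp add: r_def field_simps inner_commute)
  have "(\<lambda>N. logmgf N (l + t *\<^sub>R e) - logmgf N l - t * (e \<bullet> a + \<delta>)) \<longlonglongrightarrow> \<Lambda> (l + t *\<^sub>R e) - \<Lambda> l - t * (e \<bullet> a + \<delta>)"
    by (intro tendsto_diff lim tendsto_const)
  moreover have "\<Lambda> (l + t *\<^sub>R e) - \<Lambda> l - t * (e \<bullet> a + \<delta>) = - r" by (simp add: r_def)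
  ultimately have ev: "\<forall>\<^sub>F N in sequentially. logmgf N (l + t *\<^sub>R e) - logmgf N l - t * (e \<bullet> a + \<delta>) < - (r / 2)"
    using r by (intro order_tendstoD(2)) auto
  show ?thesis
  proof (rule Lim_null_comparison)
    show "\<forall>\<^sub>F N in sequentially. norm ((\<integral>s. indicator {x. e \<bullet> \<Lambda>' l + \<delta> \<le> e \<bullet> x} (X N s) * exp (real N * (l \<bullet> X N s)) \<partial>P N) / mgf N l) \<le> exp (- (r / 2)) ^ N"
      using ev eventually_ge_at_top[of 1]
    proof eventually_elim
      case (elim N)
      let ?I = "\<integral>s. indicator {x. e \<bullet> \<Lambda>' l + \<delta> \<le> e \<bullet> x} (X N s) * exp (real N * (l \<bullet> X N s)) \<partial>P N"
      have I0: "0 \<le> ?I" by (intro integral_nonneg_AE) auto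
      have "?I / mgf N l \<le> exp (- (real N * (t * (e \<bullet> a + \<delta>)))) * mgf N (l + t *\<^sub>R e) / mgf N l"
        using tilted_chernoff[where t=t and c="e \<bullet> \<Lambda>' l + \<delta>" and e=e and N=N and l=l] t mgf_pos[of N l] by (intro divide_right_mono) (auto simp: a_def)
      also have "\<dots> = exp (real N * (logmgf N (l + t *\<^sub>R e) - logmgf N l - t * (e \<bullet> a + \<delta>)))"
        unfolding mgf_exp[OF elim(2)] exp_diff[symmetric] exp_add[symmetric] by (simp add: algebra_simps)
      also have "\<dots> \<le> exp (real N * - (r / 2))" using elim(1) by (subst exp_le_cancel_iff) (intro mult_left_mono, auto)
      also have "\<dots> = exp (- (r / 2)) ^ N" by (rule exp_of_nat_mult)
      finally show ?case using I0 mgf_pos[of N l] by (simp add: less_imp_le)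
    qed
    show "(\<lambda>N. exp (- (r / 2)) ^ N) \<longlonglongrightarrow> 0" using r by (intro LIMSEQ_power_zero) auto
  qed
qed

text \<open>At least half of the tilted mass sits in a small ball around
  \<open>\<Lambda>' l\<close>. On that ball the tilt is nearly constant, so undoing it costs
  \<open>l \<bullet> \<Lambda>' l - \<Lambda> l\<close> up to \<open>\<epsilon>\<close>.\<close>

lemma lower_bound_exposed:
  assumes G: "open G" "\<Lambda>' l \<in> G" and \<epsilon>: "0 < \<epsilon>"
  shows "\<forall>\<^sub>F N in sequentially. ereal (- (l \<bullet> \<Lambda>' l - \<Lambda> l) - \<epsilon>) \<le> rate_seq G N"
proof -
  define a where "a = \<Lambda>' l"
  obtain \<delta>0 where \<delta>0: "0 < \<delta>0" "cball a \<delta>0 \<subseteq> G" using G open_contains_cball a_def by blast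
  \<comment> \<open>Small enough that the tilt varies by at most \<open>\<epsilon> / 4\<close> over
    the ball; the 1 avoids division by zero at \<open>l = 0\<close>.\<close>
  define \<delta> where "\<delta> = min \<delta>0 (\<epsilon> / 4 / (norm l + 1))"
  have \<delta>: "0 < \<delta>" "cball a \<delta> \<subseteq> G" "norm l * \<delta> \<le> \<epsilon> / 4"
  proof -
    have n: "0 < norm l + 1" using norm_ge_zero[of l] by linarith
    show "0 < \<delta>" using \<delta>0 \<epsilon> n by (simp add: \<delta>_def)
    show "cball a \<delta> \<subseteq> G" using \<delta>0 by (auto simp: \<delta>_def)
    have "norm l * \<delta> \<le> (norm l + 1) * (\<epsilon> / 4 / (norm l + 1))" using n \<open>0 < \<delta>\<close> by (intro mult_mono) (auto simp: \<delta>_def)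
    moreover have "q * (\<epsilon> / 4 / q) = \<epsilon> / 4" if "0 < q" for q :: real using that by simp
    from this[OF n] have "(norm l + 1) * (\<epsilon> / 4 / (norm l + 1)) = \<epsilon> / 4" .
    ultimately show "norm l * \<delta> \<le> \<epsilon> / 4" by (simp only:)
  qed
  define \<delta>' where "\<delta>' = \<delta> / (real DIM('a) + 1)"
  have \<delta>': "0 < \<delta>'" using \<delta> by (simp add: \<delta>'_def)
  \<comment> \<open>A point that exceeds the centre by less than \<open>\<delta>'\<close> in all
    directions of \<open>E\<close> is within \<open>\<delta>\<close> of it, as the norm is at most
    the sum of absolute coordinates. Finitely many half-spaces thus cover the complement of the
    ball.\<close>
  define E where "E = (Basis :: 'a set) \<union> uminus ` Basis"
  have E: "finite E" by (simp add: E_def)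
  define B where "B e N = (\<integral>s. indicator {x. e \<bullet> a + \<delta>' \<le> e \<bullet> x} (X N s) * exp (real N * (l \<bullet> X N s)) \<partial>P N)" for e N
  have "(\<lambda>N. \<Sum>e\<in>E. B e N / mgf N l) \<longlonglongrightarrow> (\<Sum>e\<in>E. 0)"
    unfolding B_def a_def by (intro tendsto_sum tilted_tail_tendsto_0 \<delta>')
  then have ev1: "\<forall>\<^sub>F N in sequentially. (\<Sum>e\<in>E. B e N / mgf N l) < 1 / 2" by (intro order_tendstoD(2)) auto
  have ev2: "\<forall>\<^sub>F N in sequentially. \<Lambda> l - \<epsilon> / 4 < logmgf N l" using \<epsilon> by (intro order_tendstoD(1)[OF lim]) auto
  have ev3: "\<forall>\<^sub>F N in sequentially. - (\<epsilon> / 4) < ln (1 / 2) / real N" using \<epsilon> by (intro order_tendstoD(1)[OF ln_const_tendsto_0]) auto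
  from ev1 ev2 ev3 eventually_ge_at_top[of 1] show ?thesis
  proof eventually_elim
    case (elim N)
    have far: "\<exists>e\<in>E. e \<bullet> a + \<delta>' \<le> e \<bullet> x" if "x \<notin> cball a \<delta>" for x
    proof (rule ccontr)
      assume "\<not> ?thesis"
      then have le: "e \<bullet> (x - a) < \<delta>'" if "e \<in> E" for e using that by (auto simp: inner_diff_right not_le)
      have "norm (x - a) \<le> (\<Sum>b\<in>Basis. \<bar>(x - a) \<bullet> b\<bar>)" by (rule norm_le_l1)
      also have "\<dots> \<le> (\<Sum>b\<in>(Basis :: 'a set). \<delta>')"
      proof (rule sum_mono)
        fix b :: 'a assume b: "b \<in> Basis"
        have "b \<bullet> (x - a) < \<delta>'" "(- b) \<bullet> (x - a) < \<delta>'" using b by (auto intro!: le simp: E_def simp del: inner_minus_left)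
        then show "\<bar>(x - a) \<bullet> b\<bar> \<le> \<delta>'" by (simp add: abs_le_iff inner_commute[of "x - a"])
      qed
      also have "\<dots> \<le> \<delta>" using \<delta>(1) by (simp add: \<delta>'_def field_simps)
      finally show False using that by (simp add: dist_norm norm_minus_commute)
    qed
    have "mgf N l \<le> (\<integral>s. indicator (cball a \<delta>) (X N s) * exp (real N * (l \<bullet> a + norm l * \<delta>)) + (\<Sum>e\<in>E. indicator {x. e \<bullet> a + \<delta>' \<le> e \<bullet> x} (X N s) * exp (real N * (l \<bullet> X N s))) \<partial>P N)"
      unfolding mgf_def
    proof (intro integral_mono integrable)
      fix s
      let ?x = "X N s"
      let ?S = "\<Sum>e\<in>E. indicator {x. e \<bullet> a + \<delta>' \<le> e \<bullet> x} ?x * exp (real N * (l \<bullet> ?x))"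
      show "exp (real N * (l \<bullet> ?x)) \<le> indicator (cball a \<delta>) ?x * exp (real N * (l \<bullet> a + norm l * \<delta>)) + ?S"
      proof (cases "?x \<in> cball a \<delta>")
        case True
        have "l \<bullet> (?x - a) \<le> norm l * norm (?x - a)" by (rule norm_cauchy_schwarz)
        also have "\<dots> \<le> norm l * \<delta>" using True by (intro mult_left_mono) (auto simp: dist_norm norm_minus_commute)
        finally have "l \<bullet> ?x \<le> l \<bullet> a + norm l * \<delta>" by (simp add: inner_diff_right)
        moreover have "0 \<le> ?S" by (intro sum_nonneg) auto
        ultimately show ?thesis using True by (simp add: add_increasing2 mult_left_mono)
      next
        case False
        then obtain e where e: "e \<in> E" "e \<bullet> a + \<delta>' \<le> e \<bullet> ?x" using far by blast
        then have "exp (real N * (l \<bullet> ?x)) = indicator {x. e \<bullet> a + \<delta>' \<le> e \<bullet> x} ?x * exp (real N * (l \<bullet> ?x))" by simp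
        also have "\<dots> \<le> ?S" using e E
          by (intro member_le_sum[of e E "\<lambda>e. indicator {x. e \<bullet> a + \<delta>' \<le> e \<bullet> x} ?x * exp (real N * (l \<bullet> ?x))"]) auto
        finally show ?thesis using False by simp
      qed
    qed
    also have "\<dots> = pr N (cball a \<delta>) * exp (real N * (l \<bullet> a + norm l * \<delta>)) + (\<Sum>e\<in>E. B e N)"
      unfolding pr_eq B_def by (simp add: integrable Bochner_Integration.integral_sum)
    also have "(\<Sum>e\<in>E. B e N) \<le> mgf N l / 2"
      using elim(1) mgf_pos[of N l] by (simp add: sum_divide_distrib[symmetric] field_simps)
    finally have "1 / 2 * mgf N l \<le> pr N (cball a \<delta>) * exp (real N * (l \<bullet> a + norm l * \<delta>))" by simp
    then have "1 / 2 * mgf N l * exp (- (real N * (l \<bullet> a + norm l * \<delta>))) \<le> pr N (cball a \<delta>) * exp (real N * (l \<bullet> a + norm l * \<delta>)) * exp (- (real N * (l \<bullet> a + norm l * \<delta>)))"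
      by (rule mult_right_mono) simp
    also have "\<dots> = pr N (cball a \<delta>)" by (simp add: mult.assoc flip: exp_add)
    also have "\<dots> \<le> pr N G" by (rule pr_mono[OF \<delta>(2)])
    finally have "1 / 2 * exp (- (real N * (l \<bullet> a + norm l * \<delta> - logmgf N l))) \<le> pr N G"
      unfolding mgf_exp[OF elim(4)] by (simp add: algebra_simps flip: exp_add)
    then have "ereal (ln (1 / 2) / real N - (l \<bullet> a + norm l * \<delta> - logmgf N l)) \<le> rate_seq G N"
      using elim(4) by (intro rate_seq_ge) auto
    moreover have "- (l \<bullet> \<Lambda>' l - \<Lambda> l) - \<epsilon> \<le> ln (1 / 2) / real N - (l \<bullet> a + norm l * \<delta> - logmgf N l)"
      using elim(2,3) \<delta>(3) \<epsilon> unfolding a_def by linarith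
    ultimately show ?case by (meson ereal_less_eq(3) order_trans)
  qed
qed

text \<open>An arbitrary point \<open>x\<close> of finite rate is approximated by exposed points: maximizing
  \<open>l \<bullet> x - \<Lambda> l - \<epsilon> |l|\<^sup>2 / 2\<close> yields \<open>l\<close> with \<open>\<Lambda>' l = x - \<epsilon> l\<close> close to \<open>x\<close> and no larger rate.\<close>

lemma lower_bound:
  assumes G: "open G" "x \<in> G"
  shows "- rate x \<le> liminf (rate_seq G)"
proof (cases "rate x")
  case (real v)
  have v: "l \<bullet> x - \<Lambda> l \<le> v" for l using rate_ge[of l x] real by simp
  have v0: "0 \<le> v" using rate_nonneg[of x] real by simp
  obtain b :: 'a where "b \<in> Basis" using nonempty_Basis unfolding ex_in_conv[symmetric] by blast
  then have R: "0 \<le> R" using \<Lambda>_bound[of b] by simp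
  obtain \<rho> where \<rho>: "0 < \<rho>" "ball x \<rho> \<subseteq> G" using G open_contains_ball by blast
  \<comment> \<open>The maximizer will satisfy
    \<open>\<epsilon> / 2 * (l \<bullet> l) \<le> v\<close>, so the squared norm of
    \<open>\<epsilon> *\<^sub>R l\<close> is at most \<open>2 * \<epsilon> * v\<close>, less than
    the square of \<open>\<rho>\<close>.\<close>
  define \<epsilon> where "\<epsilon> = \<rho>\<^sup>2 / (4 * (v + 1))"
  have \<epsilon>: "0 < \<epsilon>" using \<rho> v0 by (simp add: \<epsilon>_def)
  define f where "f l = l \<bullet> x - \<Lambda> l - \<epsilon> / 2 * (l \<bullet> l)" for l
  have f': "(f has_derivative (\<lambda>h. h \<bullet> x - \<Lambda>' l \<bullet> h - \<epsilon> / 2 * (l \<bullet> h + h \<bullet> l))) (at l)" for l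
    unfolding f_def
    by (intro has_derivative_diff has_derivative_mult_right diff
        has_derivative_inner[OF has_derivative_ident has_derivative_ident]
        bounded_linear_imp_has_derivative bounded_linear_inner_left)
  \<comment> \<open>Beyond this radius the quadratic penalty beats the linear growth of the rest and
    \<open>f \<le> 0 = f 0\<close>, so the maximum over the ball is global.\<close>
  define r where "r = 2 * (norm x + R) / \<epsilon> + 1"
  have r: "0 < r" using R \<epsilon> by (simp add: r_def add_nonneg_pos)
  have "continuous_on (cball 0 r) f"
    using f' by (meson has_derivative_continuous continuous_at_imp_continuous_on)
  then obtain l where l: "l \<in> cball 0 r" "\<And>k. k \<in> cball 0 r \<Longrightarrow> f k \<le> f l"
    using continuous_attains_sup[of "cball 0 r" f] r by auto
  have f0: "f 0 = 0" by (simp add: f_def \<Lambda>_0)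
  have fl0: "0 \<le> f l" using l(2)[of 0] r f0 by simp
  have max: "f k \<le> f l" for k
  proof (cases "k \<in> cball 0 r")
    case False
    then have k: "r < norm k" by (simp add: dist_norm)
    have "f k \<le> norm k * norm x + norm k * R - \<epsilon> / 2 * (norm k * norm k)"
      unfolding f_def using norm_cauchy_schwarz[of k x] \<Lambda>_bound[of k] by (simp add: abs_le_iff dot_square_norm power2_eq_square)
    also have "\<dots> = norm k * ((norm x + R) - \<epsilon> / 2 * norm k)" by (simp add: algebra_simps)
    also have "\<dots> \<le> 0"
    proof (rule mult_nonneg_nonpos)
      have "\<epsilon> / 2 * r \<le> \<epsilon> / 2 * norm k" using k \<epsilon> by (intro mult_left_mono) auto
      moreover have "\<epsilon> / 2 * r = norm x + R + \<epsilon> / 2" using \<epsilon> by (simp add: r_def field_simps)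
      ultimately show "(norm x + R) - \<epsilon> / 2 * norm k \<le> 0" using \<epsilon> by linarith
    qed simp
    finally show ?thesis using fl0 by linarith
  qed (rule l(2))
  have "(\<lambda>h. h \<bullet> x - \<Lambda>' l \<bullet> h - \<epsilon> / 2 * (l \<bullet> h + h \<bullet> l)) = (\<lambda>h. 0)"
    by (rule differential_zero_maxmin[OF _ open_UNIV f']) (use max in auto)
  then have e: "h \<bullet> x - \<Lambda>' l \<bullet> h - \<epsilon> / 2 * (l \<bullet> h + h \<bullet> l) = 0" for h by (rule fun_cong)
  have "h \<bullet> (x - \<Lambda>' l - \<epsilon> *\<^sub>R l) = 0" for h
    using e[of h] unfolding inner_diff_right inner_scaleR_right inner_commute[of l h] inner_commute[of "\<Lambda>' l" h]
    by (simp add: algebra_simps)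
  then have "x - \<Lambda>' l - \<epsilon> *\<^sub>R l = 0" by (metis inner_eq_zero_iff)
  then have x: "\<Lambda>' l = x - \<epsilon> *\<^sub>R l" by (simp add: algebra_simps)
  have ll: "\<epsilon> / 2 * (l \<bullet> l) \<le> v" using fl0 v[of l] by (simp add: f_def)
  have "(norm (\<epsilon> *\<^sub>R l))\<^sup>2 = \<epsilon> * 2 * (\<epsilon> / 2 * (l \<bullet> l))" using \<epsilon> by (simp add: power_mult_distrib dot_square_norm power2_eq_square)
  also have "\<dots> \<le> \<epsilon> * 2 * v" using ll \<epsilon> by (intro mult_left_mono) auto
  also have "\<dots> < \<rho>\<^sup>2"
  proof -
    have "\<epsilon> * (4 * (v + 1)) = \<rho>\<^sup>2" using v0 by (simp add: \<epsilon>_def)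
    moreover have "\<epsilon> * 2 * v < \<epsilon> * (4 * (v + 1))" using \<epsilon> v0 by (simp add: mult.assoc)
    ultimately show ?thesis by simp
  qed
  finally have "norm (\<epsilon> *\<^sub>R l) < \<rho>" using \<rho> by (simp add: power2_less_imp_less)
  then have in_G: "\<Lambda>' l \<in> G" using \<rho> by (auto simp: x dist_norm)
  have "l \<bullet> \<Lambda>' l - \<Lambda> l \<le> v" using v[of l] mult_nonneg_nonneg[OF less_imp_le[OF \<epsilon>] inner_ge_zero[of l]]
    by (simp add: x inner_diff_right)
  have "ereal (- v) \<le> liminf (rate_seq G) + ereal e" if e: "0 < e" for e
  proof -
    have "\<forall>\<^sub>F N in sequentially. ereal (- v - e) \<le> rate_seq G N"
      using lower_bound_exposed[OF G(1) in_G e]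
    proof eventually_elim
      case (elim N)
      have "ereal (- v - e) \<le> ereal (- (l \<bullet> \<Lambda>' l - \<Lambda> l) - e)" using \<open>l \<bullet> \<Lambda>' l - \<Lambda> l \<le> v\<close> by simp
      with elim show ?case by (rule order_trans[rotated])
    qed
    then have "ereal (- v - e) \<le> liminf (rate_seq G)" by (rule Liminf_bounded)
    then have "ereal (- v - e) + ereal e \<le> liminf (rate_seq G) + ereal e" by (rule add_right_mono)
    then show ?thesis by simp
  qed
  then have "ereal (- v) \<le> liminf (rate_seq G)" by (rule ereal_le_epsilon2)
  then show ?thesis using real by simp
qed (use rate_nonneg[of x] in auto)

theorem large_deviations: "large_deviation_principle P X rate"
  unfolding large_deviation_principle_def Let_def rate_seq_def[symmetric]
proof (intro conjI allI ballI rate_nonneg)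
  fix A :: "'a set"
  have lower: "- rate x \<le> liminf (rate_seq A)" if "x \<in> interior A" for x
  proof -
    have "- rate x \<le> liminf (rate_seq (interior A))" by (rule lower_bound[OF open_interior that])
    also have "\<dots> \<le> liminf (rate_seq A)"
      by (rule Liminf_mono[OF eventually_mono[OF eventually_ge_at_top[of 1]]]) (rule rate_seq_mono[OF _ interior_subset])
    finally show ?thesis .
  qed
  have "- liminf (rate_seq A) \<le> (INF x\<in>interior A. rate x)"
    by (rule INF_greatest) (use lower in \<open>simp add: ereal_uminus_le_reorder\<close>)
  then show "- (INF x\<in>interior A. rate x) \<le> liminf (rate_seq A)" by (simp add: ereal_uminus_le_reorder)
  show "liminf (rate_seq A) \<le> limsup (rate_seq A)" by (rule Liminf_le_Limsup) simp
  have "limsup (rate_seq A) \<le> limsup (rate_seq (closure A))"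
    by (rule Limsup_mono[OF eventually_mono[OF eventually_ge_at_top[of 1]]]) (rule rate_seq_mono[OF _ closure_subset])
  also have "\<dots> \<le> - (INF x\<in>closure A. rate x)" by (rule upper_bound) simp
  finally show "limsup (rate_seq A) \<le> - (INF x\<in>closure A. rate x)" .
qed

text \<open>The whole space has probability 1, so the upper bound applied to it forces the infimum
  down to 0. This fixes the additive constant in the Legendre formulas.\<close>

lemma INF_rate: "(INF x. rate x) = 0"
proof (rule antisym)
  have "rate_seq UNIV = (\<lambda>N. 0)"
    using prob_space.prob_space[OF prob] by (auto simp: rate_seq_def ereal_ln_def fun_eq_iff zero_ereal_def)
  then have "limsup (rate_seq UNIV) = 0" by (simp add: Limsup_const)
  with upper_bound[of UNIV] have "- (INF x. rate x) \<ge> - 0" by simp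
  then show "(INF x. rate x) \<le> 0" by (simp only: ereal_minus_le_minus)
qed (auto intro!: INF_greatest rate_nonneg)

end

section \<open>Uniqueness for the Hamilton--Jacobi equation\<close>

lemma has_derivative_quadratic:
  fixes f :: "'a::real_normed_vector \<Rightarrow> real"
  assumes "bounded_linear D" and "\<And>y. y \<in> S \<Longrightarrow> \<bar>f y - f x - D (y - x)\<bar> \<le> C * (norm (y - x))\<^sup>2"
  shows "(f has_derivative D) (at x within S)"
  unfolding has_derivative_within_alt
proof (intro conjI assms allI impI)
  fix e :: real assume e: "0 < e"
  have "\<bar>f y - f x - D (y - x)\<bar> \<le> e * norm (y - x)" if "y \<in> S" "norm (y - x) < e / (\<bar>C\<bar> + 1)" for y
  proof -
    have "\<bar>f y - f x - D (y - x)\<bar> \<le> C * (norm (y - x))\<^sup>2" by (rule assms(2)[OF that(1)])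
    also have "\<dots> \<le> (\<bar>C\<bar> + 1) * (norm (y - x))\<^sup>2" by (intro mult_right_mono) auto
    also have "\<dots> = ((\<bar>C\<bar> + 1) * norm (y - x)) * norm (y - x)" by (simp add: power2_eq_square)
    also have "\<dots> \<le> e * norm (y - x)"
    proof (rule mult_right_mono)
      have "norm (y - x) * (\<bar>C\<bar> + 1) < e" using that(2) by (subst (asm) pos_less_divide_eq) auto
      then show "(\<bar>C\<bar> + 1) * norm (y - x) \<le> e" by (simp add: mult.commute)
    qed simp
    finally show ?thesis .
  qed
  then show "\<exists>d>0. \<forall>y\<in>S. norm (y - x) < d \<longrightarrow> norm (f y - f x - D (y - x)) \<le> e * norm (y - x)"
    using e by (intro exI[of _ "e / (\<bar>C\<bar> + 1)"]) (auto intro!: divide_pos_pos)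
qed

text \<open>The square makes the cut-off continuously differentiable; the barrier needs a profile
  that is flat on one side and still has a gradient everywhere.\<close>

lemma DERIV_max_0_sq: "((\<lambda>x. (max 0 x)\<^sup>2) has_real_derivative 2 * max 0 x) (at x)"
  unfolding has_field_derivative_def
proof (rule has_derivative_quadratic[where C=1])
  fix y :: real
  have *: "(max 0 y)\<^sup>2 - (max 0 x)\<^sup>2 - 2 * max 0 x * (y - x) = (max 0 y - max 0 x)\<^sup>2 + 2 * max 0 x * (max 0 y - y)"
    by (cases "0 \<le> x") (simp_all add: power2_eq_square algebra_simps)
  have "0 \<le> (max 0 y - max 0 x)\<^sup>2 + 2 * max 0 x * (max 0 y - y)"
    by (intro add_nonneg_nonneg mult_nonneg_nonneg) auto
  moreover have "(max 0 y - max 0 x)\<^sup>2 + 2 * max 0 x * (max 0 y - y) \<le> (y - x)\<^sup>2"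
  proof (cases "0 \<le> x"; cases "0 \<le> y")
    assume "\<not> 0 \<le> x" "0 \<le> y"
    then show ?thesis using power_mono[of y "y - x" 2] by simp
  next
    assume "\<not> 0 \<le> x" "\<not> 0 \<le> y"
    then show ?thesis by simp
  qed (auto simp: power2_eq_square algebra_simps)
  ultimately show "\<bar>(max 0 y)\<^sup>2 - (max 0 x)\<^sup>2 - 2 * max 0 x * (y - x)\<bar> \<le> 1 * (norm (y - x))\<^sup>2"
    unfolding * by simp
qed (rule bounded_linear_mult_right)

lemma directional_derivative_le:
  fixes f :: "'a::real_normed_vector \<Rightarrow> real" and \<kappa> :: "real \<Rightarrow> real"
  assumes D: "(f has_derivative D) (at p within S)"
    and \<kappa>: "(\<kappa> has_real_derivative c) (at 0)"
    and le: "0 < e" "\<And>s. 0 < s \<Longrightarrow> s < e \<Longrightarrow> p + s *\<^sub>R d \<in> S \<and> f (p + s *\<^sub>R d) - \<kappa> s \<le> f p - \<kappa> 0"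
    and p: "p \<in> S"
  shows "D d \<le> c"
proof -
  have "((\<lambda>s. p + s *\<^sub>R d) has_derivative (\<lambda>s. s *\<^sub>R d)) (at 0 within {0..<e})"
    by (auto intro!: derivative_eq_intros)
  moreover have "(\<lambda>s. p + s *\<^sub>R d) ` {0..<e} \<subseteq> S" using le p by (force simp: le_less)
  ultimately have "((\<lambda>s. f (p + s *\<^sub>R d)) has_derivative (\<lambda>s. D (s *\<^sub>R d))) (at 0 within {0..<e})"
    using has_derivative_in_compose[of "\<lambda>s. p + s *\<^sub>R d" "\<lambda>s. s *\<^sub>R d" 0 "{0..<e}" f D]
      has_derivative_subset[OF D, of "(\<lambda>s. p + s *\<^sub>R d) ` {0..<e}"] by simp
  moreover have "(\<lambda>s. D (s *\<^sub>R d)) = (*) (D d)"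
    using has_derivative_linear[OF D] by (auto simp: fun_eq_iff linear_scale)
  ultimately have "((\<lambda>s. f (p + s *\<^sub>R d)) has_real_derivative D d) (at 0 within {0..<e})"
    by (simp add: has_field_derivative_def)
  from DERIV_diff[OF this has_field_derivative_at_within[OF \<kappa>]]
  have "((\<lambda>s. f (p + s *\<^sub>R d) - \<kappa> s) has_real_derivative D d - c) (at 0 within {0..<e})" .
  then have "((\<lambda>s. (f (p + s *\<^sub>R d) - \<kappa> s - (f p - \<kappa> 0)) / s) \<longlongrightarrow> D d - c) (at 0 within {0..<e})"
    by (simp add: has_field_derivative_iff)
  moreover have "at 0 within {0..<e} = at_right 0"
  proof -
    have "open {-e<..<e}" "(0::real) \<in> {-e<..<e}" "{0..<e} \<inter> {-e<..<e} - {0} = {0<..} \<inter> {-e<..<e} - {0}" using le by auto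
    then show ?thesis by (intro at_within_nhd[of 0 "{-e<..<e}"])
  qed
  ultimately have "((\<lambda>s. (f (p + s *\<^sub>R d) - \<kappa> s - (f p - \<kappa> 0)) / s) \<longlongrightarrow> D d - c) (at_right 0)" by simp
  moreover have "\<forall>\<^sub>F s in at_right 0. (f (p + s *\<^sub>R d) - \<kappa> s - (f p - \<kappa> 0)) / s \<le> 0"
    using eventually_at_right_less[of 0] eventually_at_right_real[OF le(1)]
    by eventually_elim (use le(2) in \<open>auto simp: divide_le_0_iff\<close>)
  ultimately have "D d - c \<le> 0" by (rule tendsto_upperbound) simp
  then show ?thesis by simp
qed

text \<open>\<open>v1\<close>, \<open>v2\<close> are the spatial derivatives of the difference where
  it touches a barrier with derivatives \<open>f0 * q1\<close>, \<open>f0 * q2\<close> and time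
  derivative \<open>f0 + \<eta>\<close>. The equation allows only \<open>f0\<close>. On a face one
  spatial equality weakens to an inequality, in the favourable direction because its coefficient is
  nonnegative.\<close>

lemma barrier_contradiction:
  fixes G1 G2 v1 v2 q1 q2 f0 \<eta> \<epsilon> K :: real
  assumes "0 \<le> f0" "0 < \<eta>" "f0 + \<eta> \<le> G1 * v2 + G2 * v1 + \<epsilon> * (v1 * v2)" "\<bar>\<epsilon>\<bar> = 1"
    and G: "0 \<le> G1" "G1 \<le> 1" "0 \<le> G2" "G2 \<le> 1"
    and q: "q1 \<le> 3/8" "q2 \<le> 3/8" "\<bar>q1\<bar> \<le> K" "\<bar>q2\<bar> \<le> K"
    and f0: "f0 * K\<^sup>2 \<le> 1/4"
    and v: "(v1 = f0 * q1 \<and> v2 = f0 * q2) \<or> (v1 \<le> f0 * q1 \<and> v2 = f0 * q2 \<and> f0 * K \<le> G2) \<or> (v1 = f0 * q1 \<and> v2 \<le> f0 * q2 \<and> f0 * K \<le> G1)"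
  shows False
proof -
  have Gq: "G * q \<le> 3/8" if "0 \<le> G" "G \<le> 1" "q \<le> 3/8" for G q :: real
  proof -
    have "G * q \<le> G * (3/8)" using that by (intro mult_left_mono) auto
    also have "\<dots> \<le> 3/8" using that by simp
    finally show ?thesis .
  qed
  have prod: "\<bar>q1 * q2\<bar> \<le> K\<^sup>2" unfolding abs_mult power2_eq_square using q by (intro mult_mono) auto
  have e: "\<epsilon> * x \<le> \<bar>x\<bar>" for x using assms(4) by (auto simp: abs_if split: if_splits)
  have "\<epsilon> * (f0 * (q1 * q2)) \<le> f0 * K\<^sup>2"
    using e[of "f0 * (q1 * q2)"] mult_left_mono[OF prod assms(1)] assms(1) by (simp add: abs_mult)
  \<comment> \<open>The budget is 3/8 + 3/8 for the linear terms and 1/4 for the quadratic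
    one.\<close>
  then have "G1 * q2 + G2 * q1 + \<epsilon> * (f0 * (q1 * q2)) \<le> 1"
    using Gq[OF G(1,2) q(2)] Gq[OF G(3,4) q(1)] f0 by linarith
  from mult_left_mono[OF this assms(1)]
  have main: "G1 * (f0 * q2) + G2 * (f0 * q1) + \<epsilon> * ((f0 * q1) * (f0 * q2)) \<le> f0" by (simp add: algebra_simps)
  \<comment> \<open>On a face the quadratic term may lower the coefficient of the slack, but by no
    more than \<open>f0 * K \<le> G\<close>.\<close>
  have sgn: "0 \<le> a * (G + \<epsilon> * (f0 * q))" if "0 \<le> a" "f0 * K \<le> G" "\<bar>q\<bar> \<le> K" for a G q
  proof -
    have "\<bar>\<epsilon> * (f0 * q)\<bar> \<le> f0 * K" using assms(1,4) that(3) by (simp add: abs_mult mult_left_mono)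
    then show ?thesis using that by (intro mult_nonneg_nonneg) linarith+
  qed
  from v show False
  proof (elim disjE conjE)
    assume "v1 = f0 * q1" "v2 = f0 * q2" then show False using main assms(2,3) by simp
  next
    assume *: "v1 \<le> f0 * q1" "v2 = f0 * q2" "f0 * K \<le> G2"
    have "0 \<le> (f0 * q1 - v1) * (G2 + \<epsilon> * (f0 * q2))" using * q by (intro sgn) auto
    moreover have "G1 * v2 + G2 * v1 + \<epsilon> * (v1 * v2) = G1 * (f0 * q2) + G2 * (f0 * q1) + \<epsilon> * ((f0 * q1) * (f0 * q2)) - (f0 * q1 - v1) * (G2 + \<epsilon> * (f0 * q2))"
      unfolding * by (simp add: algebra_simps)
    ultimately show False using main assms(2,3) by linarith
  next
    assume *: "v1 = f0 * q1" "v2 \<le> f0 * q2" "f0 * K \<le> G1"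
    have "0 \<le> (f0 * q2 - v2) * (G1 + \<epsilon> * (f0 * q1))" using * q by (intro sgn) auto
    moreover have "G1 * v2 + G2 * v1 + \<epsilon> * (v1 * v2) = G1 * (f0 * q2) + G2 * (f0 * q1) + \<epsilon> * ((f0 * q1) * (f0 * q2)) - (f0 * q2 - v2) * (G1 + \<epsilon> * (f0 * q1))"
      unfolding * by (simp add: algebra_simps)
    ultimately show False using main assms(2,3) by linarith
  qed
qed

section \<open>Local propagation of zeros of the difference of two solutions\<close>

lemma axis_simps [simp]:
  "axis (1::2) (x::real) $ 1 = x" "axis (1::2) (x::real) $ 2 = 0" "axis (2::2) (x::real) $ 1 = 0" "axis (2::2) (x::real) $ 2 = x"
  by (auto simp: axis_def)

lemma hj_domain_iff: "(t, y) \<in> hj_domain T \<longleftrightarrow> 0 \<le> t \<and> t < T \<and> 0 \<le> y $ 1 \<and> 0 \<le> y $ 2"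
  by (auto simp: hj_domain_def orthant_def forall_2)

lemma orthant_2_iff: "y \<in> orthant \<longleftrightarrow> 0 \<le> y $ 1 \<and> 0 \<le> y $ 2"
  by (auto simp: orthant_def forall_2)

text \<open>With \<open>G\<close> the gradient of the known solution, expanding the product of two
  gradients gives the equation for the difference with \<open>\<epsilon> = 1\<close>, and for its
  negative with \<open>\<epsilon> = -1\<close>. Treating both signs lets one-sided bounds
  suffice.\<close>

locale hj_difference =
  fixes T :: real and w :: "real \<times> (real^2) \<Rightarrow> real" and D :: "real \<times> (real^2) \<Rightarrow> real \<times> (real^2) \<Rightarrow> real"
    and G :: "real \<times> (real^2) \<Rightarrow> real^2" and \<epsilon> :: real
  assumes D: "\<And>p. p \<in> hj_domain T \<Longrightarrow> (w has_derivative D p) (at p within hj_domain T)"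
    and eq: "\<And>p. p \<in> hj_domain T \<Longrightarrow> D p (1, 0) = G p $ 1 * D p (0, axis 2 1) + G p $ 2 * D p (0, axis 1 1)
        + \<epsilon> * (D p (0, axis 1 1) * D p (0, axis 2 1))"
    and G01: "\<And>p i. p \<in> hj_domain T \<Longrightarrow> 0 \<le> G p $ i \<and> G p $ i \<le> 1"
    and G_pos: "\<And>p i. p \<in> hj_domain T \<Longrightarrow> 0 < snd p $ i \<Longrightarrow> 0 < G p $ i"
    and G_cont: "continuous_on (hj_domain T) G"
    and init: "\<And>y. y \<in> orthant \<Longrightarrow> 0 < T \<Longrightarrow> w (0, y) = 0"
    and \<epsilon>: "\<bar>\<epsilon>\<bar> = 1"
begin

lemma w_continuous: "continuous_on (hj_domain T) w"
  using D by (auto simp: continuous_on_eq_continuous_within intro: has_derivative_continuous)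

lemma D_zero:
  assumes "p \<in> hj_domain T" "D p (1, 0) = 0" "D p (0, axis 1 1) = 0" "D p (0, axis 2 1) = 0"
  shows "D p d = 0"
proof -
  have lin: "linear (D p)" by (rule has_derivative_linear[OF D[OF assms(1)]])
  have "d = fst d *\<^sub>R (1, 0) + (snd d $ 1) *\<^sub>R (0, axis 1 1) + (snd d $ 2) *\<^sub>R (0, axis 2 1)"
    by (auto simp: prod_eq_iff vec_eq_iff forall_2)
  then show ?thesis using assms linear_add[OF lin] linear_scale[OF lin] by (metis add_0 mult_zero_right real_scaleR_def)
qed

end

text \<open>The level sets of \<open>\<Theta>\<close> are noncharacteristic, since \<open>\<tau>' \<le> 1/4\<close> while the speed of propagation
  of the known solution is at most 2; the term \<open>c\<^sup>2 / s\<close> keeps them away from the corner of the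
  orthant, where the gradient of the known solution may vanish.\<close>

definition \<tau> :: "real \<Rightarrow> real \<Rightarrow> real" where "\<tau> c s = (s + c\<^sup>2 / s) / 4"

definition \<Theta> :: "real \<Rightarrow> real \<times> (real^2) \<Rightarrow> real" where "\<Theta> c p = fst p + \<tau> c (snd p $ 1 + snd p $ 2)"

lemma \<tau>_diff_le:
  assumes "0 < s" "s \<le> s'" shows "\<tau> c s' - \<tau> c s \<le> (s' - s) / 4"
proof -
  have "c\<^sup>2 / s' \<le> c\<^sup>2 / s" using assms by (intro divide_left_mono) auto
  moreover have "(s' + a) / 4 - (s + b) / 4 \<le> (s' - s) / 4" if "a \<le> b" for a b :: real
    using divide_right_mono[OF that, of 4] by (simp add: add_divide_distrib diff_divide_distrib)
  ultimately show ?thesis unfolding \<tau>_def by blast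
qed

text \<open>The minimum of \<open>s + c\<^sup>2 / s\<close> is at \<open>s = c\<close>. A sublevel
  set of \<open>\<Theta> c\<close> that starts at a point with coordinate sum \<open>c\<close>
  therefore never exceeds the time of that point.\<close>

lemma \<tau>_min:
  assumes "0 < s" "0 < c" shows "\<tau> c c \<le> \<tau> c s"
proof -
  have "0 \<le> (s - c)\<^sup>2 / s" using assms by simp
  also have "(s - c)\<^sup>2 / s = s + c\<^sup>2 / s - 2 * c" using assms by (simp add: power2_eq_square field_simps)
  finally show ?thesis using assms by (simp add: \<tau>_def power2_eq_square)
qed

lemma DERIV_\<tau>:
  assumes "s \<noteq> 0" shows "(\<tau> c has_real_derivative (1 - c\<^sup>2 / s\<^sup>2) / 4) (at s)"
  unfolding \<tau>_def using assms
  by (auto intro!: derivative_eq_intros simp: power2_eq_square field_simps)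

context hj_difference
begin

text \<open>The Holmgren step. Vanishing below the level of \<open>\<Theta> c\<close> forces value
  and derivative of \<open>w\<close> at the point to be zero, which brings \<open>w\<close> below a
  barrier that is flat near the point.\<close>

lemma local_vanishing:
  assumes p0: "(t0, y0) \<in> hj_domain T" and s0: "0 < y0 $ 1 + y0 $ 2"
    and zero: "\<And>p. p \<in> hj_domain T \<Longrightarrow> 0 < snd p $ 1 + snd p $ 2 \<Longrightarrow> \<Theta> c p < \<Theta> c (t0, y0) \<Longrightarrow> w p = 0"
  shows "\<exists>\<rho>>0. \<forall>p\<in>hj_domain T. dist p (t0, y0) < \<rho> \<longrightarrow> w p \<le> 0"
proof -
  define m where "m = \<Theta> c (t0, y0)"
  define s0 where "s0 = y0 $ 1 + y0 $ 2"
  have s0: "0 < s0" using s0 by (simp add: s0_def)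
  have t0: "0 \<le> t0" "t0 < T" "0 \<le> y0 $ 1" "0 \<le> y0 $ 2" using p0 by (auto simp: hj_domain_iff)
  have w0: "w (t0, y0) = 0"
  proof (cases "t0 = 0")
    case False
    then have t: "0 < t0" using t0 by simp
    have tend: "((\<lambda>s. w (t0 - s, y0)) \<longlongrightarrow> w (t0, y0)) (at_right 0)"
    proof -
      have 1: "((\<lambda>s. (t0 - s, y0)) \<longlongrightarrow> (t0, y0)) (at_right 0)" by (auto intro!: tendsto_eq_intros)
      have 2: "\<forall>\<^sub>F s in at_right 0. (t0 - s, y0) \<in> hj_domain T"
        using eventually_at_right_less[of 0] eventually_at_right_real[OF t] by eventually_elim (use t0 in \<open>auto simp: hj_domain_iff\<close>)
      show ?thesis by (rule continuous_on_tendsto_compose[OF w_continuous 1 p0 2])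
    qed
    moreover have "\<forall>\<^sub>F s in at_right 0. w (t0 - s, y0) = 0"
      using eventually_at_right_less[of 0] eventually_at_right_real[OF t]
      by eventually_elim (intro zero, use t0 s0 in \<open>auto simp: hj_domain_iff \<Theta>_def s0_def\<close>)
    ultimately have "((\<lambda>s. 0) \<longlongrightarrow> w (t0, y0)) (at_right (0::real))" by (rule Lim_transform_eventually)
    then show ?thesis by (simp add: tendsto_const_iff)
  qed (use init t0 in \<open>auto simp: orthant_2_iff\<close>)
  \<comment> \<open>Vanishing along a segment gives both inequalities for the one-sided derivative
    in its direction.\<close>
  have dirD: "D (t0, y0) d = 0" if "0 < e" "\<And>s. 0 < s \<Longrightarrow> s < e \<Longrightarrow> (t0, y0) + s *\<^sub>R d \<in> hj_domain T \<and> w ((t0, y0) + s *\<^sub>R d) = 0" for e d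
  proof -
    have 1: "D (t0, y0) d \<le> 0"
      by (rule directional_derivative_le[OF D[OF p0] DERIV_const \<open>0 < e\<close> _ p0, of d]) (use that w0 in auto)
    have "(\<lambda>h. - D (t0, y0) h) d \<le> 0"
      by (rule directional_derivative_le[OF has_derivative_minus[OF D[OF p0]] DERIV_const \<open>0 < e\<close> _ p0, of d]) (use that w0 in auto)
    with 1 show ?thesis by simp
  qed
  have D0: "D (t0, y0) d = 0" for d
  proof (cases "t0 = 0")
    case True
    \<comment> \<open>At time 0 the initial values kill the spatial derivatives, and the equation
      kills the time derivative.\<close>
    have "D (t0, y0) (0, axis i 1) = 0" for i
    proof (rule dirD[of 1])
      fix s :: real assume s: "0 < s" "s < 1"
      have "(t0, y0) + s *\<^sub>R (0, axis i 1) = (0, y0 + s *\<^sub>R axis i 1)" using True by simp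
      moreover have "y0 + s *\<^sub>R axis i 1 \<in> orthant" using t0 s by (auto simp: orthant_2_iff axis_def)
      ultimately show "(t0, y0) + s *\<^sub>R (0, axis i 1) \<in> hj_domain T \<and> w ((t0, y0) + s *\<^sub>R (0, axis i 1)) = 0"
        using init[of "y0 + s *\<^sub>R axis i 1"] t0 by (simp only: hj_domain_def) simp
    qed simp
    moreover from this have "D (t0, y0) (1, 0) = 0" by (simp add: eq[OF p0])
    ultimately show ?thesis using D_zero[OF p0] by blast
  next
    case False
    then have t: "0 < t0" using t0 by simp
    have "D (t0, y0) (- 1, 0) = 0"
    proof (rule dirD[OF t])
      fix s assume "0 < s" "s < t0"
      then show "(t0, y0) + s *\<^sub>R (- 1, 0) \<in> hj_domain T \<and> w ((t0, y0) + s *\<^sub>R (- 1, 0)) = 0"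
        using t0 s0 by (auto simp: hj_domain_iff \<Theta>_def s0_def intro!: zero)
    qed
    \<comment> \<open>Raising a coordinate by \<open>s\<close> increases \<open>\<tau> c\<close> by
      at most \<open>s / 4\<close>, less than the time \<open>s\<close> gained by going back, so the
      segment enters the region of zeros. Coordinates are only raised, so a point on a face causes
      no trouble.\<close>
    moreover have "D (t0, y0) (- 1, axis i 1) = 0" for i
    proof (rule dirD[OF t])
      fix s assume s: "0 < s" "s < t0"
      have sum: "(y0 + s *\<^sub>R axis i 1) $ 1 + (y0 + s *\<^sub>R axis i 1) $ 2 = s0 + s"
        using exhaust_2[of i] by (auto simp: s0_def)
      have "\<tau> c (s0 + s) - \<tau> c s0 \<le> s / 4" using \<tau>_diff_le[of s0 "s0 + s" c] s0 s by simp
      then have "\<Theta> c (t0 - s, y0 + s *\<^sub>R axis i 1) < \<Theta> c (t0, y0)" using s unfolding \<Theta>_def by (simp only: fst_conv snd_conv sum) (simp add: s0_def)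
      moreover have "(t0 - s, y0 + s *\<^sub>R axis i 1) \<in> hj_domain T" using t0 s by (auto simp: hj_domain_iff axis_def)
      ultimately have "w (t0 - s, y0 + s *\<^sub>R axis i 1) = 0" using sum s0 s by (intro zero) auto
      then show "(t0, y0) + s *\<^sub>R (- 1, axis i 1) \<in> hj_domain T \<and> w ((t0, y0) + s *\<^sub>R (- 1, axis i 1)) = 0"
        using \<open>(t0 - s, y0 + s *\<^sub>R axis i 1) \<in> hj_domain T\<close> by simp
    qed
    moreover have lin: "linear (D (t0, y0))" by (rule has_derivative_linear[OF D[OF p0]])
    ultimately have "D (t0, y0) (1, 0) = 0" "D (t0, y0) (0, axis i 1) = 0" for i
      using linear_diff[OF lin, of "(-1, axis i 1)" "(-1, 0)"] linear_neg[OF lin, of "(-1, 0)"] by simp_all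
    then show ?thesis using D_zero[OF p0] by blast
  qed
  text \<open>As the derivative vanishes, \<open>w = o(r)\<close> on a ball of radius \<open>r\<close>, below a barrier of height of order \<open>r\<close>.\<close>
  define K1 where "K1 = 1 + c\<^sup>2 / s0\<^sup>2"
  define K where "K = K1 + 1"
  have K1: "1 \<le> K1" by (simp add: K1_def)
  have K: "1 \<le> K" using K1 by (simp add: K_def)
  \<comment> \<open>The penalty then has partial derivatives of at most
    \<open>2 * \<mu> = 1 / 8\<close>; with 1/4 from \<open>\<tau> c\<close> this makes the 3/8 of
    \<open>barrier_contradiction\<close>.\<close>
  define \<mu> :: real where "\<mu> = 1 / 16"
  \<comment> \<open>The point is not the corner. If it lies on a face, its other coordinate is
    positive and so is the gradient component there, with a margin nearby by continuity; otherwise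
    the face is out of reach.\<close>
  obtain \<delta> \<rho>1 where \<delta>: "0 < \<delta>" "0 < \<rho>1"
    "\<And>p i j. p \<in> hj_domain T \<Longrightarrow> dist p (t0, y0) < \<rho>1 \<Longrightarrow> i \<noteq> j \<Longrightarrow> snd p $ i = 0 \<Longrightarrow> \<delta> \<le> G p $ j"
  proof -
    have ex: "\<exists>\<delta> \<rho>. 0 < \<delta> \<and> 0 < \<rho> \<and> (\<forall>p\<in>hj_domain T. dist p (t0, y0) < \<rho> \<longrightarrow> snd p $ i = 0 \<longrightarrow> \<delta> \<le> G p $ j)" if ij: "i \<noteq> j" for i j :: 2
    proof (cases "y0 $ i = 0")
      case True
      then have "0 < y0 $ j" using s0 t0 ij exhaust_2[of i] exhaust_2[of j] by (auto simp: s0_def)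
      then have Gj: "0 < G (t0, y0) $ j" using G_pos[OF p0, of j] by simp
      have "continuous_on (hj_domain T) (\<lambda>p. G p $ j)" by (intro continuous_on_component G_cont)
      then obtain \<rho> where \<rho>: "0 < \<rho>" "\<And>p. p \<in> hj_domain T \<Longrightarrow> dist p (t0, y0) < \<rho> \<Longrightarrow> dist (G p $ j) (G (t0, y0) $ j) < G (t0, y0) $ j / 2"
        using p0 Gj unfolding continuous_on_iff by (meson half_gt_zero)
      have "G (t0, y0) $ j / 2 \<le> G p $ j" if "p \<in> hj_domain T" "dist p (t0, y0) < \<rho>" for p
        using \<rho>(2)[OF that] by (auto simp: dist_real_def abs_if split: if_splits)
      then show ?thesis using Gj \<rho>(1) half_gt_zero by blast
    next
      case False
      then have y0i: "0 < y0 $ i" using t0 exhaust_2[of i] by auto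
      have "snd p $ i \<noteq> 0" if "dist p (t0, y0) < y0 $ i" for p :: "real \<times> (real^2)"
      proof -
        have "\<bar>(snd p - y0) $ i\<bar> \<le> norm (snd p - y0)" by (rule component_le_norm_cart)
        also have "\<dots> \<le> dist p (t0, y0)" using dist_snd_le[of p "(t0, y0)"] by (simp add: dist_norm)
        finally show ?thesis using that by (auto simp: abs_if split: if_splits)
      qed
      then show ?thesis using y0i by (intro exI[of _ 1] exI[of _ "y0 $ i"]) auto
    qed
    obtain d1 r1 where 1: "0 < d1" "0 < r1" "\<And>p. p \<in> hj_domain T \<Longrightarrow> dist p (t0, y0) < r1 \<Longrightarrow> snd p $ 1 = 0 \<Longrightarrow> d1 \<le> G p $ 2" using ex[of 1 2] by auto
    obtain d2 r2 where 2: "0 < d2" "0 < r2" "\<And>p. p \<in> hj_domain T \<Longrightarrow> dist p (t0, y0) < r2 \<Longrightarrow> snd p $ 2 = 0 \<Longrightarrow> d2 \<le> G p $ 1" using ex[of 2 1] by auto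
    show thesis
    proof (rule that[of "min d1 d2" "min r1 r2"])
      fix p i j assume *: "p \<in> hj_domain T" "dist p (t0, y0) < min r1 r2" "i \<noteq> j" "snd p $ i = 0"
      consider "i = 1" "j = 2" | "i = 2" "j = 1" using *(3) exhaust_2[of i] exhaust_2[of j] by auto
      then show "min d1 d2 \<le> G p $ j" by cases (use * 1(3)[of p] 2(3)[of p] in auto)
    qed (use 1 2 in auto)
  qed
  \<comment> \<open>The barrier slope will satisfy \<open>f0 \<le> k * \<mu>\<close>, so these are
    the bounds \<open>f0 * K\<^sup>2 \<le> 1 / 4\<close> and \<open>f0 * K \<le> \<delta>\<close>.
    Neither involves the radius \<open>r\<close> chosen below.\<close>
  define k where "k = min (1 / (4 * \<mu> * K\<^sup>2)) (\<delta> / (\<mu> * K))"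
  have k: "0 < k" "k * \<mu> * K\<^sup>2 \<le> 1 / 4" "k * \<mu> * K \<le> \<delta>"
  proof -
    have mk: "0 < \<mu> * K\<^sup>2" "0 < \<mu> * K" using K by (simp_all add: \<mu>_def)
    show "0 < k" using mk \<delta> by (simp add: k_def)
    have "k * (\<mu> * K\<^sup>2) \<le> 1 / (4 * \<mu> * K\<^sup>2) * (\<mu> * K\<^sup>2)" using mk by (intro mult_right_mono) (auto simp: k_def)
    also have "\<dots> = 1 / 4" using K by (simp add: \<mu>_def)
    finally show "k * \<mu> * K\<^sup>2 \<le> 1 / 4" by (simp add: mult.assoc)
    have "k * (\<mu> * K) \<le> \<delta> / (\<mu> * K) * (\<mu> * K)" using mk by (intro mult_right_mono) (auto simp: k_def)
    also have "\<dots> = \<delta>" using K by (simp add: \<mu>_def)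
    finally show "k * \<mu> * K \<le> \<delta>" by (simp add: mult.assoc)
  qed
  \<comment> \<open>\<open>K2 * r\<close> bounds the distance from \<open>(t0, y0)\<close> of the
    points with \<open>\<Theta> \<ge> m\<close> in the comparison region:
    \<open>\<Theta> \<ge> m\<close> bounds their time from below, \<open>Q \<le> \<mu> * r\<close>
    from above.\<close>
  define K2 where "K2 = 4 * K1 + \<mu> + 2"
  have K2: "0 < K2" using K1 by (simp add: K2_def \<mu>_def)
  \<comment> \<open>Makes \<open>\<kappa> * (K2 * r)\<close> half of the barrier height
    \<open>F (\<mu> * r) = k * \<mu>\<^sup>2 * r / 4\<close>.\<close>
  define \<kappa> where "\<kappa> = k * \<mu>\<^sup>2 / 8 / K2"
  have \<kappa>: "0 < \<kappa>" using k K2 by (simp add: \<kappa>_def \<mu>_def)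
  obtain \<rho>2 where \<rho>2': "0 < \<rho>2" "\<forall>p\<in>hj_domain T. norm (p - (t0, y0)) < \<rho>2 \<longrightarrow>
      norm (w p - w (t0, y0) - D (t0, y0) (p - (t0, y0))) \<le> \<kappa> * norm (p - (t0, y0))"
    using D[OF p0] \<kappa> unfolding has_derivative_within_alt by blast
  have \<rho>2: "\<bar>w p\<bar> \<le> \<kappa> * norm (p - (t0, y0))" if "p \<in> hj_domain T" "norm (p - (t0, y0)) < \<rho>2" for p
    using \<rho>2'(2)[rule_format, OF that] unfolding D0 w0 real_norm_def diff_zero .
  define t1 where "t1 = (t0 + T) / 2"
  have t1: "t0 < t1" "t1 < T" using t0 by (auto simp: t1_def)
  define r where "r = min (s0 / 8) (min ((t1 - t0) / (K2 + 1)) (min (\<rho>1 / (K2 + 1)) (\<rho>2 / (K2 + 1))))"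
  have r: "0 < r" "4 * r \<le> s0 / 2" "K2 * r < t1 - t0" "K2 * r < \<rho>1" "K2 * r < \<rho>2"
  proof -
    show r0: "0 < r" using s0 t1 K2 \<delta> \<rho>2'(1) by (simp add: r_def)
    show "4 * r \<le> s0 / 2" by (simp add: r_def)
    have lt: "K2 * r < x" if "0 < x" "r \<le> x / (K2 + 1)" for x
    proof -
      have "r * (K2 + 1) \<le> x" using that(2) K2 by (subst (asm) pos_le_divide_eq) auto
      then show ?thesis using r0 by (simp add: algebra_simps)
    qed
    show "K2 * r < t1 - t0" by (rule lt) (use t1 in \<open>simp_all add: r_def\<close>)
    show "K2 * r < \<rho>1" by (rule lt) (use \<delta> in \<open>simp_all add: r_def\<close>)
    show "K2 * r < \<rho>2" by (rule lt) (use \<rho>2' in \<open>simp_all add: r_def\<close>)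
  qed
  \<comment> \<open>The penalty bends the level set of \<open>\<Theta> c\<close>: where
    \<open>\<Theta> \<ge> m\<close> and \<open>Q < \<mu> * r\<close>, the distance of
    \<open>y\<close> from \<open>y0\<close> stays below \<open>r\<close>. This makes the comparison
    region compact.\<close>
  define Q where "Q t a b = t + \<tau> c (a + b) - m + \<mu> / r * ((a - y0 $ 1)\<^sup>2 + (b - y0 $ 2)\<^sup>2)" for t a b
  define n2 where "n2 y = (y $ 1 - y0 $ 1)\<^sup>2 + (y $ 2 - y0 $ 2)\<^sup>2" for y :: "real^2"
  have Q0: "Q t0 (y0 $ 1) (y0 $ 2) = 0" by (simp add: Q_def m_def \<Theta>_def)
  have comp: "\<bar>y $ i - y0 $ i\<bar> \<le> r" if "n2 y \<le> r\<^sup>2" for y i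
  proof -
    have "(y $ i - y0 $ i)\<^sup>2 \<le> r\<^sup>2"
      using that exhaust_2[of i] zero_le_power2[of "y $ 1 - y0 $ 1"] zero_le_power2[of "y $ 2 - y0 $ 2"] unfolding n2_def by (elim disjE; simp; linarith)
    from abs_le_square_iff[THEN iffD2, OF this] r(1) show ?thesis by linarith
  qed
  have s_near: "s0 / 2 \<le> y $ 1 + y $ 2" "\<bar>y $ 1 + y $ 2 - s0\<bar> \<le> 2 * r" if "n2 y \<le> r\<^sup>2" for y
  proof -
    have *: "\<bar>u + v - (a + b)\<bar> \<le> 2 * r" if "\<bar>u - a\<bar> \<le> r" "\<bar>v - b\<bar> \<le> r" for u v a b :: real
      using that by linarith
    show 1: "\<bar>y $ 1 + y $ 2 - s0\<bar> \<le> 2 * r" unfolding s0_def by (intro * comp that)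
    show "s0 / 2 \<le> y $ 1 + y $ 2" using 1 r(1,2) by linarith
  qed
  have \<tau>': "\<bar>(1 - c\<^sup>2 / s\<^sup>2) / 4\<bar> \<le> K1" "(1 - c\<^sup>2 / s\<^sup>2) / 4 \<le> 1 / 4" if "s0 / 2 \<le> s" for s
  proof -
    have "c\<^sup>2 / s\<^sup>2 \<le> c\<^sup>2 / (s0 / 2)\<^sup>2" using that s0 by (intro divide_left_mono power_mono) auto
    also have "\<dots> = 4 * (c\<^sup>2 / s0\<^sup>2)" by (simp add: power_divide)
    finally have "c\<^sup>2 / s\<^sup>2 \<le> 4 * (c\<^sup>2 / s0\<^sup>2)" .
    moreover have "\<bar>(1 - a) / 4\<bar> \<le> 1 + b \<and> (1 - a) / 4 \<le> 1 / 4" if "0 \<le> a" "a \<le> 4 * b" for a b :: real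
      using that by (intro conjI abs_leI; simp add: field_simps)
    moreover have "0 \<le> c\<^sup>2 / s\<^sup>2" by simp
    ultimately show "\<bar>(1 - c\<^sup>2 / s\<^sup>2) / 4\<bar> \<le> K1" "(1 - c\<^sup>2 / s\<^sup>2) / 4 \<le> 1 / 4"
      unfolding K1_def by blast+
  qed
  have \<tau>_near: "\<bar>\<tau> c s - \<tau> c s0\<bar> \<le> K1 * \<bar>s - s0\<bar>" if "s0 / 2 \<le> s" for s
  proof (rule field_differentiable_bound[of "{s0/2..}" "\<tau> c" "\<lambda>s. (1 - c\<^sup>2 / s\<^sup>2) / 4" K1 s s0, unfolded real_norm_def])
    show "(\<tau> c has_field_derivative (1 - c\<^sup>2 / z\<^sup>2) / 4) (at z within {s0 / 2..})" if "z \<in> {s0/2..}" for z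
      by (rule has_field_derivative_at_within[OF DERIV_\<tau>]) (use that s0 in auto)
  qed (use that s0 \<tau>'(1) in auto)
  have near: "norm ((t, y) - (t0, y0)) \<le> K2 * r" "t - t0 \<le> K2 * r"
    if n: "n2 y \<le> r\<^sup>2" and Qle: "Q t (y $ 1) (y $ 2) \<le> \<mu> * r" and ge: "m \<le> \<Theta> c (t, y)" for t y
  proof -
    have "0 \<le> \<mu> / r * ((y $ 1 - y0 $ 1)\<^sup>2 + (y $ 2 - y0 $ 2)\<^sup>2)" using r by (simp add: \<mu>_def)
    then have le: "t + \<tau> c (y $ 1 + y $ 2) - m \<le> \<mu> * r" using Qle unfolding Q_def by linarith
    have "K1 * \<bar>y $ 1 + y $ 2 - s0\<bar> \<le> K1 * (2 * r)" using s_near(2)[OF n] K1 by (intro mult_left_mono) auto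
    then have \<tau>d: "\<bar>\<tau> c (y $ 1 + y $ 2) - \<tau> c s0\<bar> \<le> K1 * (2 * r)" using \<tau>_near[OF s_near(1)[OF n]] by linarith
    have mm: "m = t0 + \<tau> c s0" by (simp add: m_def \<Theta>_def s0_def)
    have up: "t - t0 \<le> 2 * K1 * r + \<mu> * r" using le \<tau>d unfolding mm by linarith
    have lo: "- (2 * K1 * r) \<le> t - t0" using ge \<tau>d unfolding mm \<Theta>_def by simp
    have Kr: "0 \<le> K1 * r" "0 \<le> \<mu> * r" using K1 r by (auto simp: \<mu>_def)
    have K2r: "K2 * r = 4 * K1 * r + \<mu> * r + 2 * r" by (simp add: K2_def algebra_simps)
    show "t - t0 \<le> K2 * r" using up Kr r unfolding K2r by linarith
    have "norm ((t, y) - (t0, y0)) \<le> norm (t - t0) + norm (y - y0)" unfolding diff_Pair by (rule norm_Pair_le)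
    also have "norm (y - y0) \<le> (\<Sum>i\<in>UNIV. \<bar>(y - y0) $ i\<bar>)" by (rule norm_le_l1_cart)
    also have "\<dots> \<le> 2 * r" using comp[OF n, of 1] comp[OF n, of 2] by (simp add: sum_2)
    finally show "norm ((t, y) - (t0, y0)) \<le> K2 * r" using up lo Kr r unfolding K2r real_norm_def by linarith
  qed
  define N where "N = ({0..t1} \<times> (orthant \<inter> {y. n2 y \<le> r\<^sup>2})) \<inter> {p. Q (fst p) (snd p $ 1) (snd p $ 2) \<le> \<mu> * r}"
  have N_dom: "N \<subseteq> hj_domain T" using t1 by (auto simp: N_def hj_domain_def)
  have n2_cont: "continuous_on UNIV n2" unfolding n2_def by (intro continuous_intros)
  define B where "B = {0..t1} \<times> (orthant \<inter> {y. n2 y \<le> r\<^sup>2})"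
  have orth: "closed (orthant :: (real^2) set)"
    unfolding orthant_def by (intro closed_Collect_all closed_Collect_le continuous_intros)
  have compB: "compact B"
    unfolding B_def
  proof (intro compact_Times)
    have "{y. n2 y \<le> r\<^sup>2} \<subseteq> cball y0 (2 * r)"
    proof
      fix y assume "y \<in> {y. n2 y \<le> r\<^sup>2}"
      then have n: "n2 y \<le> r\<^sup>2" by simp
      have "norm (y - y0) \<le> (\<Sum>i\<in>UNIV. \<bar>(y - y0) $ i\<bar>)" by (rule norm_le_l1_cart)
      also have "\<dots> \<le> 2 * r" using comp[OF n, of 1] comp[OF n, of 2] by (simp add: sum_2)
      finally show "y \<in> cball y0 (2 * r)" by (simp add: dist_norm norm_minus_commute)
    qed
    then have "bounded (orthant \<inter> {y. n2 y \<le> r\<^sup>2})" using bounded_cball bounded_subset by blast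
    moreover have "closed (orthant \<inter> {y. n2 y \<le> r\<^sup>2})"
      using orth n2_cont by (intro closed_Int closed_Collect_le) (auto intro: continuous_intros)
    ultimately show "compact (orthant \<inter> {y. n2 y \<le> r\<^sup>2})" by (simp add: compact_eq_bounded_closed)
  qed auto
  have Q_cont: "continuous_on B (\<lambda>p. Q (fst p) (snd p $ 1) (snd p $ 2))"
    unfolding Q_def \<tau>_def using s_near(1) s0 by (intro continuous_intros) (fastforce simp: B_def)+
  have N_eq: "N = B \<inter> (\<lambda>p. Q (fst p) (snd p $ 1) (snd p $ 2)) -` {..\<mu> * r}" by (auto simp: N_def B_def)
  have "closed (B \<inter> (\<lambda>p. Q (fst p) (snd p $ 1) (snd p $ 2)) -` {..\<mu> * r})"
    by (intro continuous_closed_preimage Q_cont compact_imp_closed[OF compB] closed_atMost)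
  from compact_Int_closed[OF compB this] have compN: "compact N" unfolding N_eq by (simp only: Int_left_absorb)
  define U where "U = {t'. t' < t1} \<times> {y'. n2 y' < r\<^sup>2}"
  have U_pos: "0 < snd q $ 1 + snd q $ 2" if "q \<in> U" for q
    using that s_near(1)[of "snd q"] s0 by (auto simp: U_def)
  have "continuous_on U (\<lambda>p. Q (fst p) (snd p $ 1) (snd p $ 2))"
    unfolding Q_def \<tau>_def by (intro continuous_intros) (use U_pos in fastforce)+
  moreover have "open U" unfolding U_def
    using n2_cont by (intro open_Times open_Collect_less) (auto intro: continuous_intros)
  ultimately have U_open: "open (U \<inter> (\<lambda>p. Q (fst p) (snd p $ 1) (snd p $ 2)) -` {..<b})" for b
    by (intro continuous_open_preimage) auto
  have nbhd: "\<exists>e>0. \<forall>p'. dist p' (t, y) < e \<longrightarrow> fst p' < t1 \<and> n2 (snd p') < r\<^sup>2 \<and> Q (fst p') (snd p' $ 1) (snd p' $ 2) < b"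
    if "t < t1" "n2 y < r\<^sup>2" "Q t (y $ 1) (y $ 2) < b" for t y b
  proof -
    have "(t, y) \<in> U \<inter> (\<lambda>p. Q (fst p) (snd p $ 1) (snd p $ 2)) -` {..<b}" using that by (simp add: U_def)
    with U_open obtain e where e: "0 < e" "ball (t, y) e \<subseteq> U \<inter> (\<lambda>p. Q (fst p) (snd p $ 1) (snd p $ 2)) -` {..<b}" by (rule openE)
    have "fst p' < t1 \<and> n2 (snd p') < r\<^sup>2 \<and> Q (fst p') (snd p' $ 1) (snd p' $ 2) < b" if "dist p' (t, y) < e" for p'
    proof -
      have "p' \<in> ball (t, y) e" using that by (simp add: dist_commute)
      then have "p' \<in> U \<inter> (\<lambda>p. Q (fst p) (snd p $ 1) (snd p $ 2)) -` {..<b}" using e(2) by blast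
      then show ?thesis by (cases p') (simp add: U_def)
    qed
    then show ?thesis using e(1) by blast
  qed
  have norm_axis': "norm (axis i z :: real^2) = \<bar>z\<bar>" for i z by (simp add: norm_eq_sqrt_inner inner_axis_axis)
  have mr: "0 < \<mu> / r" "0 < \<mu> * r" using r by (simp_all add: \<mu>_def)
  \<comment> \<open>Zero up to \<open>\<mu> * r / 2\<close>, so the barrier vanishes around the
    point itself while it rises to order \<open>r\<close> at \<open>Q = \<mu> * r\<close>.\<close>
  define F where "F x = k / r * (max 0 (x - \<mu> * r / 2))\<^sup>2" for x
  define F' where "F' x = k / r * (2 * max 0 (x - \<mu> * r / 2))" for x
  have DF: "(F has_real_derivative F' x) (at x)" for x
    unfolding F_def F'_def
    by (rule DERIV_cong[OF DERIV_cmult[OF DERIV_chain2[OF DERIV_max_0_sq DERIV_diff[OF DERIV_ident DERIV_const]]]]) simp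
  have Fnn: "0 \<le> F x" "0 \<le> F' x" for x using k r by (auto simp: F_def F'_def)
  \<comment> \<open>The term \<open>\<eta> * fst p\<close> makes the comparison strict; a positive
    maximum of the difference to the barrier is refuted at the contact point
    \<open>P\<close>.\<close>
  have main: "w p \<le> F (Q (fst p) (snd p $ 1) (snd p $ 2)) + \<eta> * fst p" if \<eta>: "0 < \<eta>" and p: "p \<in> N" for \<eta> p
  proof (rule ccontr)
    assume neg: "\<not> ?thesis"
    let ?K = "\<lambda>t a b. F (Q t a b) + \<eta> * t"
    let ?f = "\<lambda>p. w p - ?K (fst p) (snd p $ 1) (snd p $ 2)"
    have "continuous_on UNIV F" by (rule DERIV_continuous_on) (rule DF)
    then have "continuous_on N (\<lambda>p. F (Q (fst p) (snd p $ 1) (snd p $ 2)))"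
      by (rule continuous_on_compose2[OF _ continuous_on_subset[OF Q_cont]]) (auto simp: N_def B_def)
    then have "continuous_on N ?f"
      by (intro continuous_intros continuous_on_subset[OF w_continuous N_dom])
    then obtain P where P: "P \<in> N" "\<And>p. p \<in> N \<Longrightarrow> ?f p \<le> ?f P"
      using continuous_attains_sup[OF compN] p by blast
    have fP: "0 < ?f P" using P(2)[OF p] neg by simp
    obtain t y where ty: "P = (t, y)" by (cases P)
    have PD: "(t, y) \<in> hj_domain T" using P(1) N_dom ty by auto
    have Py: "0 \<le> y $ 1" "0 \<le> y $ 2" "0 \<le> t" "t < T" using PD by (auto simp: hj_domain_iff)
    have Pn: "n2 y \<le> r\<^sup>2" "Q t (y $ 1) (y $ 2) \<le> \<mu> * r" using P(1) by (auto simp: N_def ty)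
    have s: "s0 / 2 \<le> y $ 1 + y $ 2" by (rule s_near(1)[OF Pn(1)])
    have wK: "F (Q t (y $ 1) (y $ 2)) + \<eta> * t < w (t, y)" using fP by (simp add: ty)
    have "0 \<le> \<eta> * t" using \<eta> Py by simp
    then have wpos: "0 < w (t, y)" using wK Fnn(1)[of "Q t (y $ 1) (y $ 2)"] by linarith
    have tpos: "0 < t" using wpos init[of y] Py t0 by (cases "t = 0") (auto simp: orthant_2_iff)
    have ge: "m \<le> \<Theta> c (t, y)" using zero[OF PD] wpos s s0 unfolding m_def by (cases "\<Theta> c (t, y) < \<Theta> c (t0, y0)") auto
    note nr = near[OF Pn ge]
    \<comment> \<open>On the level \<open>Q = \<mu> * r\<close> the barrier is higher than
      \<open>w\<close>, which is at most \<open>\<kappa>\<close> times the distance from the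
      point.\<close>
    have Qlt: "Q t (y $ 1) (y $ 2) < \<mu> * r"
    proof (rule ccontr)
      assume "\<not> ?thesis"
      then have Qe: "Q t (y $ 1) (y $ 2) = \<mu> * r" using Pn by simp
      have "w (t, y) \<le> \<kappa> * norm ((t, y) - (t0, y0))" using \<rho>2[OF PD] nr(1) r(5) by (auto simp: abs_le_iff)
      also have "\<dots> \<le> \<kappa> * (K2 * r)" using nr(1) \<kappa> by (intro mult_left_mono) auto
      also have "\<dots> = k * \<mu>\<^sup>2 * r / 8" using K2 by (simp add: \<kappa>_def)
      also have "\<dots> \<le> F (\<mu> * r)" using r k by (simp add: F_def \<mu>_def power2_eq_square)
      finally show False using wK \<open>0 \<le> \<eta> * t\<close> Qe by simp
    qed
    \<comment> \<open>As \<open>w > 0\<close> at \<open>P\<close> excludes the region of zeros,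
      \<open>\<Theta> \<ge> m\<close> holds there and the penalty alone is at most
      \<open>Q\<close>.\<close>
    have nlt: "n2 y < r\<^sup>2"
    proof -
      have "\<mu> / r * n2 y \<le> Q t (y $ 1) (y $ 2)" using ge unfolding Q_def n2_def \<Theta>_def by simp
      then have "\<mu> / r * n2 y < \<mu> / r * r\<^sup>2" using Qlt r by (simp add: power2_eq_square)
      then show ?thesis using mult_less_cancel_left_pos[OF mr(1)] by blast
    qed
    have tlt: "t < t1" using nr(2) r(3) by linarith
    obtain e where e: "0 < e" "\<And>p'. p' \<in> hj_domain T \<Longrightarrow> dist p' (t, y) < e \<Longrightarrow> p' \<in> N"
    proof -
      obtain e where "0 < e" and e: "\<And>p'. dist p' (t, y) < e \<Longrightarrow> fst p' < t1 \<and> n2 (snd p') < r\<^sup>2 \<and> Q (fst p') (snd p' $ 1) (snd p' $ 2) < \<mu> * r"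
        using nbhd[OF tlt nlt Qlt] by blast
      have "p' \<in> N" if "p' \<in> hj_domain T" "dist p' (t, y) < e" for p'
        using that(1) e[OF that(2)] by (auto simp: N_def hj_domain_def)
      then show thesis using that \<open>0 < e\<close> by blast
    qed
    define f0 where "f0 = F' (Q t (y $ 1) (y $ 2))"
    define q where "q i = (1 - c\<^sup>2 / (y $ 1 + y $ 2)\<^sup>2) / 4 + \<mu> / r * (2 * (y $ i - y0 $ i))" for i
    have sne: "y $ 1 + y $ 2 \<noteq> 0" using s s0 by simp
    have Kt: "((\<lambda>s. ?K (t + s * - 1) (y $ 1) (y $ 2)) has_real_derivative - (f0 + \<eta>)) (at 0)"
      unfolding f0_def Q_def
      by (rule DERIV_cong[OF DERIV_add[OF DERIV_chain2[OF DF] ]])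
        (rule derivative_eq_intros refl | simp)+
    have Ka: "((\<lambda>s. ?K t (y $ 1 + s * z) (y $ 2)) has_real_derivative z * (f0 * q 1)) (at 0)" for z
    proof -
      have "((\<lambda>s. Q t (y $ 1 + s * z) (y $ 2)) has_real_derivative z * q 1) (at 0)"
        unfolding Q_def q_def
        by (rule derivative_eq_intros DERIV_chain2[OF DERIV_\<tau>] sne refl | simp add: sne)+ (simp add: algebra_simps)
      from DERIV_add[OF DERIV_chain2[OF DF this] DERIV_const[of "\<eta> * t"]] show ?thesis by (simp add: f0_def mult_ac)
    qed
    have Kb: "((\<lambda>s. ?K t (y $ 1) (y $ 2 + s * z)) has_real_derivative z * (f0 * q 2)) (at 0)" for z
    proof -
      have "((\<lambda>s. Q t (y $ 1) (y $ 2 + s * z)) has_real_derivative z * q 2) (at 0)"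
        unfolding Q_def q_def
        by (rule derivative_eq_intros DERIV_chain2[OF DERIV_\<tau>] sne refl | simp add: sne)+ (simp add: algebra_simps)
      from DERIV_add[OF DERIV_chain2[OF DF this] DERIV_const[of "\<eta> * t"]] show ?thesis by (simp add: f0_def mult_ac)
    qed
    have near_N: "(t, y) + s *\<^sub>R d \<in> N" if "(t, y) + s *\<^sub>R d \<in> hj_domain T" "norm (s *\<^sub>R d) < e" for s d
      by (rule e(2)[OF that(1)]) (use that(2) in \<open>simp add: dist_norm\<close>)
    have lin: "linear (D (t, y))" by (rule has_derivative_linear[OF D[OF PD]])
    have dt: "f0 + \<eta> \<le> D (t, y) (1, 0)"
    proof -
      have "D (t, y) (- 1, 0) \<le> - (f0 + \<eta>)"
      proof (rule directional_derivative_le[OF D[OF PD] Kt, of "min e t"])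
        fix s assume s: "0 < s" "s < min e t"
        have dom: "(t, y) + s *\<^sub>R (- 1, 0) \<in> hj_domain T" using s Py by (simp add: hj_domain_iff)
        have "(t, y) + s *\<^sub>R (- 1, 0) \<in> N" by (rule near_N[OF dom]) (use s in \<open>simp add: norm_Pair\<close>)
        from P(2)[OF this] dom show "(t, y) + s *\<^sub>R (- 1, 0) \<in> hj_domain T \<and>
          w ((t, y) + s *\<^sub>R (- 1, 0)) - ?K (t + s * - 1) (y $ 1) (y $ 2) \<le> w (t, y) - ?K (t + 0 * - 1) (y $ 1) (y $ 2)"
          by (simp add: ty)
      qed (use e tpos PD in auto)
      then show ?thesis using linear_neg[OF lin, of "(1, 0)"] by simp
    qed
    \<comment> \<open>Moving inwards is always possible, moving outwards only off the face: this
      yields an equality inside and an inequality on the face.\<close>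
    have d1: "z * D (t, y) (0, axis 1 1) \<le> z * (f0 * q 1)" if z: "z = 1 \<or> (z = - 1 \<and> 0 < y $ 1)" for z
    proof -
      define e' where "e' = (if z = 1 then e else min e (y $ 1))"
      have "D (t, y) (0, axis 1 z) \<le> z * (f0 * q 1)"
      proof (rule directional_derivative_le[OF D[OF PD] Ka, of e'])
        fix s assume s: "0 < s" "s < e'"
        have dom: "(t, y) + s *\<^sub>R (0, axis 1 z) \<in> hj_domain T" using s Py z by (auto simp: hj_domain_iff e'_def split: if_splits)
        have "(t, y) + s *\<^sub>R (0, axis 1 z) \<in> N" by (rule near_N[OF dom]) (use s z in \<open>auto simp: norm_Pair norm_axis' e'_def split: if_splits\<close>)
        from P(2)[OF this] dom show "(t, y) + s *\<^sub>R (0, axis 1 z) \<in> hj_domain T \<and>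
          w ((t, y) + s *\<^sub>R (0, axis 1 z)) - ?K t (y $ 1 + s * z) (y $ 2) \<le> w (t, y) - ?K t (y $ 1 + 0 * z) (y $ 2)"
          by (simp add: ty)
      qed (use e z PD in \<open>auto simp: e'_def\<close>)
      moreover have "(0, axis 1 z) = z *\<^sub>R (0 :: real, axis 1 1 :: real^2)" by (simp add: vec_eq_iff forall_2)
      ultimately show ?thesis by (simp only: linear_scale[OF lin] real_scaleR_def)
    qed
    have d2: "z * D (t, y) (0, axis 2 1) \<le> z * (f0 * q 2)" if z: "z = 1 \<or> (z = - 1 \<and> 0 < y $ 2)" for z
    proof -
      define e' where "e' = (if z = 1 then e else min e (y $ 2))"
      have "D (t, y) (0, axis 2 z) \<le> z * (f0 * q 2)"
      proof (rule directional_derivative_le[OF D[OF PD] Kb, of e'])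
        fix s assume s: "0 < s" "s < e'"
        have dom: "(t, y) + s *\<^sub>R (0, axis 2 z) \<in> hj_domain T" using s Py z by (auto simp: hj_domain_iff e'_def split: if_splits)
        have "(t, y) + s *\<^sub>R (0, axis 2 z) \<in> N" by (rule near_N[OF dom]) (use s z in \<open>auto simp: norm_Pair norm_axis' e'_def split: if_splits\<close>)
        from P(2)[OF this] dom show "(t, y) + s *\<^sub>R (0, axis 2 z) \<in> hj_domain T \<and>
          w ((t, y) + s *\<^sub>R (0, axis 2 z)) - ?K t (y $ 1) (y $ 2 + s * z) \<le> w (t, y) - ?K t (y $ 1) (y $ 2 + 0 * z)"
          by (simp add: ty)
      qed (use e z PD in \<open>auto simp: e'_def\<close>)
      moreover have "(0, axis 2 z) = z *\<^sub>R (0 :: real, axis 2 1 :: real^2)" by (simp add: vec_eq_iff forall_2)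
      ultimately show ?thesis by (simp only: linear_scale[OF lin] real_scaleR_def)
    qed
    have f0b: "0 \<le> f0" "f0 \<le> k * \<mu>"
    proof -
      show "0 \<le> f0" by (simp add: f0_def Fnn)
      have "max 0 (Q t (y $ 1) (y $ 2) - \<mu> * r / 2) \<le> \<mu> * r / 2" by (rule max.boundedI) (use Qlt mr in linarith)+
      then have "f0 \<le> k / r * (2 * (\<mu> * r / 2))" unfolding f0_def F'_def using k r by (intro mult_left_mono) auto
      then show "f0 \<le> k * \<mu>" using r by simp
    qed
    have qb: "q i \<le> 3 / 8" "\<bar>q i\<bar> \<le> K" for i
    proof -
      have "\<bar>\<nu> * (2 * x)\<bar> = \<nu> * (2 * \<bar>x\<bar>)" if "0 < \<nu>" for \<nu> x :: real using that by (simp add: abs_mult)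
      from this[OF mr(1)] have "\<bar>\<mu> / r * (2 * (y $ i - y0 $ i))\<bar> = \<mu> / r * (2 * \<bar>y $ i - y0 $ i\<bar>)"
        .
      also have "\<dots> \<le> \<mu> / r * (2 * r)" using comp[OF Pn(1), of i] r by (intro mult_left_mono) (auto simp: \<mu>_def)
      also have "\<dots> = 1 / 8" using r by (simp add: \<mu>_def)
      finally have b: "\<bar>\<mu> / r * (2 * (y $ i - y0 $ i))\<bar> \<le> 1 / 8" .
      show "q i \<le> 3 / 8" "\<bar>q i\<bar> \<le> K" using b \<tau>'[OF s] unfolding q_def K_def by linarith+
    qed
    have dist: "dist (t, y) (t0, y0) < \<rho>1" using nr(1) r(4) by (simp add: dist_norm)
    have fK: "f0 * K\<^sup>2 \<le> 1 / 4" by (rule order_trans[OF mult_right_mono[OF f0b(2)] k(2)]) simp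
    have fK2: "f0 * K \<le> \<delta>" by (rule order_trans[OF mult_right_mono[OF f0b(2)] k(3)]) (use K in simp)
    show False
    proof (rule barrier_contradiction[OF f0b(1) \<eta> _ \<epsilon> _ _ _ _ qb(1)[of 1] qb(1)[of 2] qb(2)[of 1] qb(2)[of 2] fK])
      show "f0 + \<eta> \<le> G (t, y) $ 1 * D (t, y) (0, axis 2 1) + G (t, y) $ 2 * D (t, y) (0, axis 1 1) + \<epsilon> * (D (t, y) (0, axis 1 1) * D (t, y) (0, axis 2 1))"
        using dt eq[OF PD] by simp
      have 1: "D (t, y) (0, axis 1 1) \<le> f0 * q 1" "0 < y $ 1 \<Longrightarrow> D (t, y) (0, axis 1 1) = f0 * q 1" using d1[of 1] d1[of "-1"] by auto
      have 2: "D (t, y) (0, axis 2 1) \<le> f0 * q 2" "0 < y $ 2 \<Longrightarrow> D (t, y) (0, axis 2 1) = f0 * q 2" using d2[of 1] d2[of "-1"] by auto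
      have 3: "y $ 1 = 0 \<Longrightarrow> \<delta> \<le> G (t, y) $ 2" "y $ 2 = 0 \<Longrightarrow> \<delta> \<le> G (t, y) $ 1"
        using \<delta>(3)[OF PD dist, of 1 2] \<delta>(3)[OF PD dist, of 2 1] by auto
      show "(D (t, y) (0, axis 1 1) = f0 * q 1 \<and> D (t, y) (0, axis 2 1) = f0 * q 2) \<or>
        (D (t, y) (0, axis 1 1) \<le> f0 * q 1 \<and> D (t, y) (0, axis 2 1) = f0 * q 2 \<and> f0 * K \<le> G (t, y) $ 2) \<or>
        (D (t, y) (0, axis 1 1) = f0 * q 1 \<and> D (t, y) (0, axis 2 1) \<le> f0 * q 2 \<and> f0 * K \<le> G (t, y) $ 1)"
      proof (cases "y $ 1 = 0")
        case True
        then have "0 < y $ 2" using s s0 by simp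
        then show ?thesis using 1 2 3(1)[OF True] fK2 by auto
      next
        case False
        then have y1: "0 < y $ 1" using Py by simp
        then show ?thesis
        proof (cases "y $ 2 = 0")
          case True
          then show ?thesis using 1 2 3(2)[OF True] fK2 y1 by auto
        qed (use 1 2 Py y1 in auto)
      qed
    qed (use G01[OF PD] in auto)
  qed
  have le: "w p \<le> F (Q (fst p) (snd p $ 1) (snd p $ 2))" if p: "p \<in> N" for p
  proof (rule field_le_epsilon)
    fix e :: real assume e: "0 < e"
    have f: "0 \<le> fst p" using p by (auto simp: N_def)
    have "w p \<le> F (Q (fst p) (snd p $ 1) (snd p $ 2)) + e / (fst p + 1) * fst p" using e f p by (intro main) auto
    also have "e / (fst p + 1) * fst p \<le> e" using e f by (simp add: field_simps)
    finally show "w p \<le> F (Q (fst p) (snd p $ 1) (snd p $ 2)) + e" by simp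
  qed
  have "n2 y0 < r\<^sup>2" "Q t0 (y0 $ 1) (y0 $ 2) < \<mu> * r / 2" using r mr Q0 by (simp_all add: n2_def)
  then obtain \<rho> where \<rho>: "0 < \<rho>" "\<And>p. dist p (t0, y0) < \<rho> \<Longrightarrow>
      fst p < t1 \<and> n2 (snd p) < r\<^sup>2 \<and> Q (fst p) (snd p $ 1) (snd p $ 2) < \<mu> * r / 2"
    using nbhd[OF t1(1)] by blast
  show ?thesis
  proof (intro exI[of _ \<rho>] conjI ballI impI \<rho>(1))
    fix p assume p: "p \<in> hj_domain T" "dist p (t0, y0) < \<rho>"
    note b = \<rho>(2)[OF p(2)]
    have "0 < \<mu> * r" using r by (simp add: \<mu>_def)
    then have "p \<in> N" using p(1) b by (auto simp: N_def hj_domain_def less_imp_le)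
    from le[OF this] show "w p \<le> 0" using b by (simp add: F_def)
  qed
qed

end

text \<open>At a minimal point of \<open>\<Theta> c\<close> in the closure of the support, the local
  result holds for \<open>w\<close> and for \<open>- w\<close>, so \<open>w\<close> vanishes nearby,
  contrary to the choice of the point.\<close>

lemma hj_unique:
  fixes g h :: "real \<Rightarrow> real^2 \<Rightarrow> real" and G :: "real \<times> (real^2) \<Rightarrow> real^2"
  assumes h: "hj_solution T \<phi> h"
    and g0: "\<And>y. y \<in> orthant \<Longrightarrow> g 0 y = \<phi> y"
    and gD: "\<And>p. p \<in> hj_domain T \<Longrightarrow>
      ((\<lambda>(t, y). g t y) has_derivative (\<lambda>d. G p $ 1 * G p $ 2 * fst d + G p \<bullet> snd d)) (at p within hj_domain T)"
    and G01: "\<And>p i. p \<in> hj_domain T \<Longrightarrow> 0 \<le> G p $ i \<and> G p $ i \<le> 1"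
    and G_pos: "\<And>p i. p \<in> hj_domain T \<Longrightarrow> 0 < snd p $ i \<Longrightarrow> 0 < G p $ i"
    and G_cont: "continuous_on (hj_domain T) G"
    and p: "(t, y) \<in> hj_domain T"
  shows "h t y = g t y"
proof -
  define w where "w p = h (fst p) (snd p) - g (fst p) (snd p)" for p
  have "\<forall>p\<in>hj_domain T. \<exists>D. ((\<lambda>(t, y). h t y) has_derivative D) (at p within hj_domain T) \<and>
      D (1, 0) - D (0, axis 1 1) * D (0, axis 2 1) = 0" using h by (simp add: hj_solution_def)
  then obtain H where H: "\<And>p. p \<in> hj_domain T \<Longrightarrow> ((\<lambda>(t, y). h t y) has_derivative H p) (at p within hj_domain T)"
      "\<And>p. p \<in> hj_domain T \<Longrightarrow> H p (1, 0) = H p (0, axis 1 1) * H p (0, axis 2 1)"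
    by (metis eq_iff_diff_eq_0)
  define D where "D p d = H p d - (G p $ 1 * G p $ 2 * fst d + G p \<bullet> snd d)" for p d
  have Dw: "(w has_derivative D p) (at p within hj_domain T)" if "p \<in> hj_domain T" for p
    using has_derivative_diff[OF H(1)[OF that] gD[OF that]] unfolding w_def D_def by (simp add: split_def)
  have eq: "D p (1, 0) = G p $ 1 * D p (0, axis 2 1) + G p $ 2 * D p (0, axis 1 1) + D p (0, axis 1 1) * D p (0, axis 2 1)"
    if "p \<in> hj_domain T" for p
    unfolding D_def using H(2)[OF that] by (simp add: inner_axis algebra_simps)
  have w0: "w (0, y) = 0" if "y \<in> orthant" for y using that h g0 by (simp add: w_def hj_solution_def)
  interpret A: hj_difference T w D G 1
    by unfold_locales (use Dw eq w0 G01 G_pos G_cont in auto)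
  interpret B: hj_difference T "\<lambda>p. - w p" "\<lambda>p d. - D p d" G "-1"
    by unfold_locales (use Dw eq w0 G01 G_pos G_cont in \<open>auto intro!: has_derivative_minus\<close>)
  have *: "w p = 0" if pd: "p \<in> hj_domain T" and ps: "0 < snd p $ 1 + snd p $ 2" for p
  proof (rule ccontr)
    assume wp: "w p \<noteq> 0"
    \<comment> \<open>With this \<open>c\<close>, \<open>p\<close> sits at the minimum of
      \<open>\<tau> c\<close>, so all competitors in \<open>S\<close> have times up to that of
      \<open>p\<close> and stay below the open end \<open>T\<close>.\<close>
    define c where "c = snd p $ 1 + snd p $ 2"
    define \<theta> where "\<theta> = \<Theta> c p"
    have c: "0 < c" using ps by (simp add: c_def)
    have \<theta>: "\<theta> = fst p + \<tau> c c" "0 < \<theta>" "fst p < T" using pd c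
      by (auto simp: \<theta>_def \<Theta>_def c_def[symmetric] \<tau>_def hj_domain_def intro!: add_nonneg_pos)
    define S where "S = {q \<in> hj_domain T. 0 < snd q $ 1 + snd q $ 2 \<and> w q \<noteq> 0 \<and> \<Theta> c q \<le> \<theta>}"
    \<comment> \<open>From \<open>\<tau> c s \<le> \<theta>\<close> both \<open>s\<close> and
      \<open>c\<^sup>2 / s\<close> are at most \<open>4 * \<theta>\<close>: the set is bounded and
      keeps away from the corner, hence compact inside the domain.\<close>
    define L where "L = {q :: real \<times> (real^2). fst q \<in> {0..fst p} \<and> 0 \<le> snd q $ 1 \<and> 0 \<le> snd q $ 2 \<and>
      c\<^sup>2 / (4 * \<theta>) \<le> snd q $ 1 + snd q $ 2 \<and> snd q $ 1 + snd q $ 2 \<le> 4 * \<theta>}"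
    have pS: "p \<in> S" using pd ps wp by (simp add: S_def \<theta>_def)
    have SL: "S \<subseteq> L"
    proof
      fix q assume q: "q \<in> S"
      define s where "s = snd q $ 1 + snd q $ 2"
      have s: "0 < s" and q': "0 \<le> fst q" "0 \<le> snd q $ 1" "0 \<le> snd q $ 2" "fst q + \<tau> c s \<le> \<theta>"
        using q by (auto simp: S_def s_def \<Theta>_def hj_domain_def orthant_def)
      have 1: "fst q \<le> fst p" using \<tau>_min[OF s c] q' \<theta> by simp
      have "\<tau> c s \<le> \<theta>" using q' by simp
      then have "s + c\<^sup>2 / s \<le> 4 * \<theta>" by (simp add: \<tau>_def)
      moreover have "0 < c\<^sup>2 / s" using s c by simp
      ultimately have 2: "s \<le> 4 * \<theta>" "c\<^sup>2 / s \<le> 4 * \<theta>" using s by linarith+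
      have "c\<^sup>2 / (4 * \<theta>) \<le> s" using 2(2) s \<theta>(2) by (simp add: pos_divide_le_eq mult.commute)
      then show "q \<in> L" using 1 2 q' by (simp add: L_def s_def)
    qed
    have cL: "closed L" unfolding L_def by (auto intro!: closed_Collect_conj closed_Collect_le continuous_intros)
    have "L \<subseteq> {0..fst p} \<times> cball 0 (4 * \<theta>)"
    proof
      fix q assume "q \<in> L"
      moreover have "norm (snd q) \<le> \<bar>snd q $ 1\<bar> + \<bar>snd q $ 2\<bar>" using norm_le_l1_cart[of "snd q"] by (simp add: sum_2)
      ultimately show "q \<in> {0..fst p} \<times> cball 0 (4 * \<theta>)" by (auto simp: L_def mem_Times_iff)
    qed
    then have "bounded L" by (rule bounded_subset[rotated]) (intro bounded_Times bounded_cball bounded_closed_interval)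
    have clS: "closure S \<subseteq> L" by (rule closure_minimal[OF SL cL])
    have comp: "compact (closure S)" using \<open>bounded L\<close> clS by (meson bounded_subset closed_closure compact_eq_bounded_closed)
    have Lpos: "0 < snd q $ 1 + snd q $ 2" "q \<in> hj_domain T" if "q \<in> L" for q
    proof -
      have "0 < c\<^sup>2 / (4 * \<theta>)" using c \<theta> by simp
      then show "0 < snd q $ 1 + snd q $ 2" using that unfolding L_def by simp
      show "q \<in> hj_domain T" using that \<theta> by (cases q) (auto simp: L_def hj_domain_iff)
    qed
    have "continuous_on L (\<Theta> c)" unfolding \<Theta>_def \<tau>_def
      by (intro continuous_intros) (use Lpos(1) in fastforce)+
    then have "continuous_on (closure S) (\<Theta> c)" by (rule continuous_on_subset[OF _ clS])
    moreover have "closure S \<noteq> {}" using pS closure_subset by auto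
    ultimately obtain P where P: "P \<in> closure S" "\<And>q. q \<in> closure S \<Longrightarrow> \<Theta> c P \<le> \<Theta> c q"
      using continuous_attains_inf[OF comp] by blast
    have P\<theta>: "\<Theta> c P \<le> \<theta>" using P(2)[of p] pS closure_subset by (auto simp: \<theta>_def)
    obtain t0 y0 where ty: "P = (t0, y0)" by (cases P)
    have PL: "P \<in> L" using P(1) clS by blast
    have PD: "(t0, y0) \<in> hj_domain T" and Ps: "0 < y0 $ 1 + y0 $ 2" using Lpos[OF PL] by (auto simp: ty)
    have zero: "w q = 0" if "q \<in> hj_domain T" "0 < snd q $ 1 + snd q $ 2" "\<Theta> c q < \<Theta> c (t0, y0)" for q
    proof (rule ccontr)
      assume "w q \<noteq> 0"
      then have "q \<in> S" using that P\<theta> by (simp add: S_def ty)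
      then show False using P(2)[of q] that(3) closure_subset by (auto simp: ty)
    qed
    obtain r1 where r1: "0 < r1" "\<And>q. q \<in> hj_domain T \<Longrightarrow> dist q P < r1 \<Longrightarrow> w q \<le> 0"
      using A.local_vanishing[OF PD Ps, of c] zero unfolding ty by blast
    obtain r2 where r2: "0 < r2" "\<And>q. q \<in> hj_domain T \<Longrightarrow> dist q P < r2 \<Longrightarrow> - w q \<le> 0"
      using B.local_vanishing[OF PD Ps, of c] zero unfolding ty by (metis neg_equal_0_iff_equal)
    obtain q where q: "q \<in> S" "dist q P < min r1 r2"
      using P(1) r1(1) r2(1) unfolding closure_approachable by (metis min_less_iff_conj)
    have qd: "q \<in> hj_domain T" "w q \<noteq> 0" using q by (auto simp: S_def)
    show False using r1(2)[OF qd(1)] r2(2)[OF qd(1)] q(2) qd(2) by simp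
  qed
  \<comment> \<open>The corner was excluded above and follows by continuity along an axis.\<close>
  have "w (t, y) = 0"
  proof (cases "y $ 1 + y $ 2 = 0")
    case True
    have 1: "((\<lambda>s. (t, y + s *\<^sub>R axis 1 1)) \<longlongrightarrow> (t, y)) (at_right (0::real))" by (auto intro!: tendsto_eq_intros)
    have dom: "\<forall>\<^sub>F s in at_right 0. (t, y + s *\<^sub>R axis 1 1) \<in> hj_domain T"
      using eventually_at_right_less[of 0] by eventually_elim (use p in \<open>auto simp: hj_domain_iff\<close>)
    have "((\<lambda>s. w (t, y + s *\<^sub>R axis 1 1)) \<longlongrightarrow> w (t, y)) (at_right 0)"
      by (rule continuous_on_tendsto_compose[OF A.w_continuous 1 p dom])
    moreover have "\<forall>\<^sub>F s in at_right 0. w (t, y + s *\<^sub>R axis 1 1) = 0"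
      using dom eventually_at_right_less[of 0] by eventually_elim (intro *, use True in \<open>auto simp: algebra_simps\<close>)
    ultimately have "((\<lambda>s. 0) \<longlongrightarrow> w (t, y)) (at_right (0::real))" by (rule Lim_transform_eventually)
    then show ?thesis by (simp add: tendsto_const_iff)
  next
    case False
    then show ?thesis using p by (intro *) (auto simp: hj_domain_iff)
  qed
  then show ?thesis by (simp add: w_def)
qed

section \<open>The solution of the Hamilton--Jacobi equation\<close>

definition saddle :: "real \<Rightarrow> real^2 \<Rightarrow> real^2 \<Rightarrow> real \<times> real \<Rightarrow> bool" where
  "saddle t y x p \<longleftrightarrow> fst p = LQ (2 * (y $ 1 + t * snd p)) (x $ 1) \<and> snd p = LQ (2 * (y $ 2 + t * fst p)) (x $ 2)"

text \<open>The choice is harmless: for \<open>0 \<le> t \<le> 1 / 16\<close> and \<open>y\<close>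
  in the orthant, \<open>saddle_lipschitz\<close> with \<open>d = 0\<close> shows that there is at
  most one saddle point.\<close>

definition overlap :: "real \<Rightarrow> real^2 \<Rightarrow> real^2 \<Rightarrow> real \<times> real" where
  "overlap t y x = (SOME p. saddle t y x p)"

text \<open>The replica-symmetric functional. Its derivative in \<open>fst p\<close> is
  \<open>t\<close> times the defect of the equation for \<open>snd p\<close>, and
  conversely.\<close>

definition potential :: "real \<Rightarrow> real^2 \<Rightarrow> real^2 \<Rightarrow> real \<times> real \<Rightarrow> real" where
  "potential t y x p =
     (y $ 1 + t * snd p) - LC (2 * (y $ 1 + t * snd p)) (x $ 1) +
     ((y $ 2 + t * fst p) - LC (2 * (y $ 2 + t * fst p)) (x $ 2)) - t * (fst p * snd p)"

definition hopf :: "real \<Rightarrow> real^2 \<Rightarrow> real^2 \<Rightarrow> real" where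
  "hopf t y x = potential t y x (overlap t y x)"

definition magnetizations :: "real \<Rightarrow> real^2 \<Rightarrow> real^2 \<Rightarrow> real^2" where
  "magnetizations t y x = (\<chi> i. if i = 1 then LT (2 * (y $ 1 + t * snd (overlap t y x))) (x $ 1)
     else LT (2 * (y $ 2 + t * fst (overlap t y x))) (x $ 2))"

definition overlap_vec :: "real \<Rightarrow> real^2 \<Rightarrow> real^2 \<Rightarrow> real^2" where
  "overlap_vec t y x = (\<chi> i. if i = 1 then fst (overlap t y x) else snd (overlap t y x))"

lemma overlap_vec_simps [simp]:
  "overlap_vec t y x $ 1 = fst (overlap t y x)" "overlap_vec t y x $ 2 = snd (overlap t y x)"
  by (simp_all add: overlap_vec_def)

lemma saddle_bounds:
  assumes "saddle t y x p" shows "0 \<le> fst p" "fst p \<le> 1" "0 \<le> snd p" "snd p \<le> 1"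
  using assms LQ_nonneg LQ_le_1 unfolding saddle_def by metis+

text \<open>Eliminating one unknown leaves a map of the real line that composes two maps with
  Lipschitz constant \<open>2 * t \<le> 1 / 8\<close>, a contraction with constant 1/64.\<close>

lemma saddle_overlap:
  assumes t: "0 \<le> t" "t \<le> 1 / 16" and y: "y \<in> orthant"
  shows "saddle t y x (overlap t y x)"
proof -
  have y: "0 \<le> y $ 1" "0 \<le> y $ 2" using y by (auto simp: orthant_2_iff)
  \<comment> \<open>Truncating at 0 defines the map on the whole line, a complete space, with
    nonnegative variances. The fixed point is a value of \<open>LQ\<close>, hence nonnegative, where
    the truncation is void.\<close>
  define k where "k p = LQ (2 * (y $ 2 + t * max 0 p)) (x $ 2)" for p
  define f where "f p = LQ (2 * (y $ 1 + t * k p)) (x $ 1)" for p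
  have k: "0 \<le> k p" for p by (simp add: k_def LQ_nonneg)
  have "dist (f p) (f q) \<le> 1 / 64 * dist p q" for p q
  proof -
    have "\<bar>f p - f q\<bar> \<le> \<bar>2 * (y $ 1 + t * k p) - 2 * (y $ 1 + t * k q)\<bar> + 2 * \<bar>x $ 1 - x $ 1\<bar>"
      unfolding f_def by (rule LQ_lipschitz) (use y t k in simp_all)
    also have "\<dots> = 2 * t * \<bar>k p - k q\<bar>"
      using t by (simp add: abs_mult flip: right_diff_distrib)
    also have "\<bar>k p - k q\<bar> \<le> \<bar>2 * (y $ 2 + t * max 0 p) - 2 * (y $ 2 + t * max 0 q)\<bar> + 2 * \<bar>x $ 2 - x $ 2\<bar>"
      unfolding k_def by (rule LQ_lipschitz) (use y t in simp_all)
    also have "\<dots> = 2 * t * \<bar>max 0 p - max 0 q\<bar>"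
      using t by (simp add: abs_mult flip: right_diff_distrib)
    also have "\<bar>max 0 p - max 0 q\<bar> \<le> \<bar>p - q\<bar>" by linarith
    finally have 1: "\<bar>f p - f q\<bar> \<le> 2 * t * (2 * t * \<bar>p - q\<bar>)" using t by (simp add: mult_left_mono)
    have "2 * t * (2 * t * \<bar>p - q\<bar>) \<le> 1 / 8 * (1 / 8 * \<bar>p - q\<bar>)"
      using t by (intro mult_mono) auto
    with 1 show ?thesis by (simp add: dist_real_def)
  qed
  then have "\<exists>!p. f p = p" by (intro banach_fix_type[of "1/64"]) auto
  then obtain p where p: "f p = p" by auto
  then have "0 \<le> p" using LQ_nonneg unfolding f_def by metis
  then have "saddle t y x (p, k p)" using p by (simp add: saddle_def f_def k_def)
  then show ?thesis unfolding overlap_def by (rule someI)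
qed

lemma mult_diff_abs_le:
  fixes a a' b b' :: real
  assumes "0 \<le> b'" "b' \<le> 1" "0 \<le> a"
  shows "\<bar>a' * b' - a * b\<bar> \<le> \<bar>a' - a\<bar> + a * \<bar>b' - b\<bar>"
proof -
  have "a' * b' - a * b = (a' - a) * b' + a * (b' - b)" by (simp add: algebra_simps)
  also have "\<bar>\<dots>\<bar> \<le> \<bar>a' - a\<bar> * b' + a * \<bar>b' - b\<bar>"
    using assms by (intro order_trans[OF abs_triangle_ineq]) (simp add: abs_mult)
  also have "\<bar>a' - a\<bar> * b' \<le> \<bar>a' - a\<bar> * 1" using assms by (intro mult_left_mono) auto
  finally show ?thesis by simp
qed

text \<open>For \<open>t \<le> 1 / 16\<close> each unknown reacts to the other with a factor of at
  most 1/8, so the feedback between the two equations can be absorbed on the left.\<close>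

lemma saddle_lipschitz:
  assumes s: "saddle t y x p" "saddle t' y' x' p'"
    and t: "0 \<le> t" "t \<le> 1 / 16" "0 \<le> t'" and y: "y \<in> orthant" "y' \<in> orthant"
    and d: "\<bar>t' - t\<bar> + \<bar>y' $ 1 - y $ 1\<bar> + \<bar>y' $ 2 - y $ 2\<bar> + \<bar>x' $ 1 - x $ 1\<bar> + \<bar>x' $ 2 - x $ 2\<bar> \<le> d"
  shows "\<bar>fst p' - fst p\<bar> + \<bar>snd p' - snd p\<bar> \<le> 5 * d"
    and "\<bar>(y' $ 1 + t' * snd p') - (y $ 1 + t * snd p)\<bar> \<le> 2 * d"
    and "\<bar>(y' $ 2 + t' * fst p') - (y $ 2 + t * fst p)\<bar> \<le> 2 * d"
proof -
  note b = saddle_bounds[OF s(1)] saddle_bounds[OF s(2)]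
  have y: "0 \<le> y $ 1" "0 \<le> y $ 2" "0 \<le> y' $ 1" "0 \<le> y' $ 2" using y by (auto simp: orthant_2_iff)
  have e1: "\<bar>t' * snd p' - t * snd p\<bar> \<le> \<bar>t' - t\<bar> + t * \<bar>snd p' - snd p\<bar>" by (rule mult_diff_abs_le) (use b t in auto)
  have e2: "\<bar>t' * fst p' - t * fst p\<bar> \<le> \<bar>t' - t\<bar> + t * \<bar>fst p' - fst p\<bar>" by (rule mult_diff_abs_le) (use b t in auto)
  have m: "t * \<bar>snd p' - snd p\<bar> \<le> 1 / 16 * \<bar>snd p' - snd p\<bar>" "t * \<bar>fst p' - fst p\<bar> \<le> 1 / 16 * \<bar>fst p' - fst p\<bar>"
    using t by (intro mult_right_mono; simp)+
  have f1: "fst p = LQ (2 * (y $ 1 + t * snd p)) (x $ 1)" "fst p' = LQ (2 * (y' $ 1 + t' * snd p')) (x' $ 1)"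
    and f2: "snd p = LQ (2 * (y $ 2 + t * fst p)) (x $ 2)" "snd p' = LQ (2 * (y' $ 2 + t' * fst p')) (x' $ 2)"
    using s unfolding saddle_def by blast+
  have nn: "0 \<le> t * fst p" "0 \<le> t * snd p" "0 \<le> t' * fst p'" "0 \<le> t' * snd p'" using b t by simp_all
  have l1: "\<bar>fst p' - fst p\<bar> \<le> \<bar>2 * (y' $ 1 + t' * snd p') - 2 * (y $ 1 + t * snd p)\<bar> + 2 * \<bar>x' $ 1 - x $ 1\<bar>"
    by (subst f1(1), subst f1(2), rule LQ_lipschitz) (use nn y in auto)
  have l2: "\<bar>snd p' - snd p\<bar> \<le> \<bar>2 * (y' $ 2 + t' * fst p') - 2 * (y $ 2 + t * fst p)\<bar> + 2 * \<bar>x' $ 2 - x $ 2\<bar>"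
    by (subst f2(1), subst f2(2), rule LQ_lipschitz) (use nn y in auto)
  have add: "\<bar>a' + b' - (a + b)\<bar> \<le> \<bar>a' - a\<bar> + \<bar>b' - b\<bar>" for a a' b b' :: real by linarith
  have double: "\<bar>2 * a' - 2 * a\<bar> = 2 * \<bar>a' - a\<bar>" for a a' :: real
    using abs_mult[of 2 "a' - a"] by (simp only: right_diff_distrib abs_numeral)
  \<comment> \<open>Adding the two chains gives \<open>A + B \<le> 4 * d + (A + B) / 8\<close>,
    which is below \<open>5 * d\<close>; reinserting this bounds \<open>U1\<close> and
    \<open>U2\<close> by \<open>2 * d\<close>.\<close>
  have gap: "A + B \<le> 5 * d \<and> U1 \<le> 2 * d \<and> U2 \<le> 2 * d"
    if "A \<le> 2 * U1 + 2 * X1" "B \<le> 2 * U2 + 2 * X2" "U1 \<le> Y1 + E1" "U2 \<le> Y2 + E2" "E1 \<le> D + M1" "E2 \<le> D + M2"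
      "M1 \<le> 1 / 16 * B" "M2 \<le> 1 / 16 * A" "D + Y1 + Y2 + X1 + X2 \<le> d" "0 \<le> D" "0 \<le> Y1" "0 \<le> Y2" "0 \<le> X1" "0 \<le> X2" "0 \<le> A" "0 \<le> B"
    for A B U1 U2 X1 X2 Y1 Y2 E1 E2 D M1 M2 :: real
  proof -
    have 1: "A + B \<le> 5 * d" using that by linarith
    have "U1 \<le> 2 * d" using 1 that(3,5,7,9-) by linarith
    moreover have "U2 \<le> 2 * d" using 1 that(4,6,8,9-) by linarith
    ultimately show ?thesis using 1 by blast
  qed
  have *: "\<bar>fst p' - fst p\<bar> + \<bar>snd p' - snd p\<bar> \<le> 5 * d \<and> \<bar>(y' $ 1 + t' * snd p') - (y $ 1 + t * snd p)\<bar> \<le> 2 * d \<and>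
      \<bar>(y' $ 2 + t' * fst p') - (y $ 2 + t * fst p)\<bar> \<le> 2 * d"
    by (rule gap[OF l1[unfolded double] l2[unfolded double] add add e1 e2 m d]) simp_all
  show "\<bar>fst p' - fst p\<bar> + \<bar>snd p' - snd p\<bar> \<le> 5 * d" "\<bar>(y' $ 1 + t' * snd p') - (y $ 1 + t * snd p)\<bar> \<le> 2 * d"
    "\<bar>(y' $ 2 + t' * fst p') - (y $ 2 + t * fst p)\<bar> \<le> 2 * d" using * by blast+
qed

text \<open>The potential is critical at a saddle point, so the variation of the saddle point
  contributes only at second order.\<close>

lemma hopf_remainder:
  assumes t: "0 \<le> t" "t \<le> 1 / 16" "0 \<le> t'" "t' \<le> 1 / 16" and y: "y \<in> orthant" "y' \<in> orthant"
    and d: "\<bar>t' - t\<bar> + \<bar>y' $ 1 - y $ 1\<bar> + \<bar>y' $ 2 - y $ 2\<bar> + \<bar>x' $ 1 - x $ 1\<bar> + \<bar>x' $ 2 - x $ 2\<bar> \<le> d"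
  shows "\<bar>hopf t' y' x' - hopf t y x - (overlap_vec t y x $ 1 * overlap_vec t y x $ 2 * (t' - t)
      + overlap_vec t y x \<bullet> (y' - y) - magnetizations t y x \<bullet> (x' - x))\<bar> \<le> 102 * d\<^sup>2"
proof -
  define p where "p = overlap t y x"
  define p' where "p' = overlap t' y' x'"
  have s: "saddle t y x p" "saddle t' y' x' p'" unfolding p_def p'_def by (intro saddle_overlap t y)+
  note b = saddle_bounds[OF s(1)] saddle_bounds[OF s(2)]
  note lip = saddle_lipschitz[OF s t(1-3) y d]
  have y: "0 \<le> y $ 1" "0 \<le> y $ 2" "0 \<le> y' $ 1" "0 \<le> y' $ 2" using y by (auto simp: orthant_2_iff)
  have nn: "0 \<le> t * fst p" "0 \<le> t * snd p" "0 \<le> t' * fst p'" "0 \<le> t' * snd p'" using b t by simp_all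
  have d0: "0 \<le> d" using d by linarith
  define u1 where "u1 = y $ 1 + t * snd p"
  define u2 where "u2 = y $ 2 + t * fst p"
  define v1 where "v1 = y' $ 1 + t' * snd p'"
  define v2 where "v2 = y' $ 2 + t' * fst p'"
  have u: "0 \<le> u1" "0 \<le> u2" "0 \<le> v1" "0 \<le> v2" using y nn by (simp_all add: u1_def u2_def v1_def v2_def)
  \<comment> \<open>The variances are doubled, so their change is at most \<open>4 * d\<close>; with
    \<open>d\<close> for the field this gives \<open>2 * (5 * d)\<^sup>2\<close>.\<close>
  have sq: "2 * (\<bar>2 * v - 2 * u\<bar> + \<bar>a\<bar>)\<^sup>2 \<le> 50 * d\<^sup>2" if "\<bar>v - u\<bar> \<le> 2 * d" "\<bar>a\<bar> \<le> d" for u v a :: real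
  proof -
    have "(\<bar>2 * v - 2 * u\<bar> + \<bar>a\<bar>)\<^sup>2 \<le> (5 * d)\<^sup>2" by (rule power_mono) (use that in linarith)+
    then show ?thesis by (simp add: power_mult_distrib)
  qed
  define r1 where "r1 = LC (2 * v1) (x' $ 1) - LC (2 * u1) (x $ 1) - (1 - fst p) / 2 * (2 * v1 - 2 * u1) - LT (2 * u1) (x $ 1) * (x' $ 1 - x $ 1)"
  define r2 where "r2 = LC (2 * v2) (x' $ 2) - LC (2 * u2) (x $ 2) - (1 - snd p) / 2 * (2 * v2 - 2 * u2) - LT (2 * u2) (x $ 2) * (x' $ 2 - x $ 2)"
  have fp: "fst p = LQ (2 * u1) (x $ 1)" "snd p = LQ (2 * u2) (x $ 2)" using s(1) unfolding saddle_def u1_def u2_def by blast+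
  have "\<bar>r1\<bar> \<le> 2 * (\<bar>2 * v1 - 2 * u1\<bar> + \<bar>x' $ 1 - x $ 1\<bar>)\<^sup>2"
    unfolding r1_def fp by (rule LC_remainder) (use u in auto)
  also have "\<dots> \<le> 50 * d\<^sup>2" by (rule sq) (use lip(2) d in \<open>simp add: u1_def v1_def, linarith\<close>)
  finally have r1: "\<bar>r1\<bar> \<le> 50 * d\<^sup>2" .
  have "\<bar>r2\<bar> \<le> 2 * (\<bar>2 * v2 - 2 * u2\<bar> + \<bar>x' $ 2 - x $ 2\<bar>)\<^sup>2"
    unfolding r2_def fp by (rule LC_remainder) (use u in auto)
  also have "\<dots> \<le> 50 * d\<^sup>2" by (rule sq) (use lip(3) d in \<open>simp add: u2_def v2_def, linarith\<close>)
  finally have r2: "\<bar>r2\<bar> \<le> 50 * d\<^sup>2" .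
  \<comment> \<open>All that is left of the variation of the saddle point: criticality cancels its
    linear part. Together with the two remainders of \<open>LC\<close>, the constant is 2 + 50 +
    50.\<close>
  define q where "q = t' * ((fst p' - fst p) * (snd p' - snd p))"
  have q: "\<bar>q\<bar> \<le> 2 * d\<^sup>2"
  proof -
    have "\<bar>q\<bar> = t' * (\<bar>fst p' - fst p\<bar> * \<bar>snd p' - snd p\<bar>)" using t by (simp add: q_def abs_mult)
    also have "\<dots> \<le> 1 / 16 * ((5 * d) * (5 * d))" by (intro mult_mono) (use t lip(1) d0 in auto)
    also have "\<dots> \<le> 2 * d\<^sup>2" by (simp add: power2_eq_square)
    finally show ?thesis .
  qed
  have "hopf t' y' x' - hopf t y x - (overlap_vec t y x $ 1 * overlap_vec t y x $ 2 * (t' - t)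
      + overlap_vec t y x \<bullet> (y' - y) - magnetizations t y x \<bullet> (x' - x)) = - q - r1 - r2"
  proof -
    have dots: "overlap_vec t y x \<bullet> (y' - y) = fst p * (y' $ 1 - y $ 1) + snd p * (y' $ 2 - y $ 2)"
      "magnetizations t y x \<bullet> (x' - x) = LT (2 * u1) (x $ 1) * (x' $ 1 - x $ 1) + LT (2 * u2) (x $ 2) * (x' $ 2 - x $ 2)"
      by (simp_all add: inner_vec_def sum_2 magnetizations_def p_def u1_def u2_def)
    have h: "hopf t y x = u1 - LC (2 * u1) (x $ 1) + (u2 - LC (2 * u2) (x $ 2)) - t * (fst p * snd p)"
      "hopf t' y' x' = v1 - LC (2 * v1) (x' $ 1) + (v2 - LC (2 * v2) (x' $ 2)) - t' * (fst p' * snd p')"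
      by (simp_all add: hopf_def potential_def p_def p'_def u1_def u2_def v1_def v2_def)
    have alg: "v1 - a1 + (v2 - a2) - t' * (c1 * c2) - (u1 - b1 + (u2 - b2) - t * (p1 * p2)) - (p1 * p2 * (t' - t)
        + (p1 * (w1 - z1) + p2 * (w2 - z2)) - (m1 + m2)) =
        - (t' * ((c1 - p1) * (c2 - p2))) - (a1 - b1 - (1 - p1) / 2 * (2 * v1 - 2 * u1) - m1) - (a2 - b2 - (1 - p2) / 2 * (2 * v2 - 2 * u2) - m2)"
      if "u1 = z1 + t * p2" "u2 = z2 + t * p1" "v1 = w1 + t' * c2" "v2 = w2 + t' * c1"
      for u1 u2 v1 v2 a1 a2 b1 b2 c1 c2 p1 p2 z1 z2 w1 w2 m1 m2 :: real
      unfolding that by (simp add: field_simps)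
    show ?thesis unfolding dots h q_def r1_def r2_def overlap_vec_simps p_def[symmetric]
      by (rule alg) (simp_all add: u1_def u2_def v1_def v2_def)
  qed
  then show ?thesis using q r1 r2 by linarith
qed

lemma norm_components_le:
  fixes y :: "real^2" shows "\<bar>y $ 1\<bar> + \<bar>y $ 2\<bar> \<le> 2 * norm y"
  using component_le_norm_cart[of y 1] component_le_norm_cart[of y 2] by linarith

lemma hopf_has_derivative_hj:
  assumes p: "(t, y) \<in> hj_domain (1 / 16)"
  shows "((\<lambda>(t, y). hopf t y x) has_derivative
    (\<lambda>d. overlap_vec t y x $ 1 * overlap_vec t y x $ 2 * fst d + overlap_vec t y x \<bullet> snd d)) (at (t, y) within hj_domain (1 / 16))"
\<comment> \<open>918 = 102 * 9, as the sum of the coordinate changes is at most three times the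
  norm.\<close>
proof (rule has_derivative_quadratic[where C=918])
  show "bounded_linear (\<lambda>d. overlap_vec t y x $ 1 * overlap_vec t y x $ 2 * fst d + overlap_vec t y x \<bullet> snd d)"
    by (intro bounded_linear_add bounded_linear_const_mult bounded_linear_fst bounded_linear_inner_right_comp bounded_linear_snd)
next
  fix q assume q: "q \<in> hj_domain (1 / 16)"
  obtain t' y' where ty: "q = (t', y')" by (cases q)
  define d where "d = 3 * norm (q - (t, y))"
  have n: "\<bar>t' - t\<bar> \<le> norm (q - (t, y))" "norm (y' - y) \<le> norm (q - (t, y))"
    using dist_fst_le[of q "(t, y)"] dist_snd_le[of q "(t, y)"] by (simp_all add: ty dist_norm)
  have "\<bar>t' - t\<bar> + \<bar>y' $ 1 - y $ 1\<bar> + \<bar>y' $ 2 - y $ 2\<bar> + \<bar>x $ 1 - x $ 1\<bar> + \<bar>x $ 2 - x $ 2\<bar> \<le> d"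
    using n norm_components_le[of "y' - y"] unfolding d_def by simp
  from hopf_remainder[OF _ _ _ _ _ _ this] p q
  have "\<bar>hopf t' y' x - hopf t y x - (overlap_vec t y x $ 1 * overlap_vec t y x $ 2 * (t' - t) + overlap_vec t y x \<bullet> (y' - y))\<bar> \<le> 102 * d\<^sup>2"
    by (simp add: ty hj_domain_def)
  also have "102 * d\<^sup>2 = 918 * (norm (q - (t, y)))\<^sup>2" by (simp add: d_def power_mult_distrib)
  finally show "\<bar>(case q of (t, y) \<Rightarrow> hopf t y x) - (case (t, y) of (t, y) \<Rightarrow> hopf t y x) -
    (overlap_vec t y x $ 1 * overlap_vec t y x $ 2 * fst (q - (t, y)) + overlap_vec t y x \<bullet> snd (q - (t, y)))\<bar> \<le> 918 * (norm (q - (t, y)))\<^sup>2"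
    by (simp add: ty)
qed

lemma hopf_has_derivative_external_field:
  assumes t: "0 \<le> t" "t \<le> 1 / 16"
  shows "(hopf t 0 has_derivative (\<lambda>d. - magnetizations t 0 x \<bullet> d)) (at x)"
proof (rule has_derivative_quadratic[where C=408])
  show "bounded_linear (\<lambda>d. - magnetizations t 0 x \<bullet> d)" by (rule bounded_linear_inner_right)
next
  fix x' :: "real^2"
  define d where "d = 2 * norm (x' - x)"
  have y: "(0 :: real^2) \<in> orthant" by (simp add: orthant_def)
  have "\<bar>t - t\<bar> + \<bar>(0 :: real^2) $ 1 - (0 :: real^2) $ 1\<bar> + \<bar>(0 :: real^2) $ 2 - (0 :: real^2) $ 2\<bar> + \<bar>x' $ 1 - x $ 1\<bar> + \<bar>x' $ 2 - x $ 2\<bar> \<le> d"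
    using norm_components_le[of "x' - x"] unfolding d_def by simp
  from hopf_remainder[OF t t y y this]
  have "\<bar>hopf t 0 x' - hopf t 0 x - - magnetizations t 0 x \<bullet> (x' - x)\<bar> \<le> 102 * d\<^sup>2" by simp
  also have "102 * d\<^sup>2 = 408 * (norm (x' - x))\<^sup>2" by (simp add: d_def power_mult_distrib)
  finally show "\<bar>hopf t 0 x' - hopf t 0 x - - magnetizations t 0 x \<bullet> (x' - x)\<bar> \<le> 408 * (norm (x' - x))\<^sup>2" .
qed

lemma overlap_vec_continuous: "continuous_on (hj_domain (1 / 16)) (\<lambda>(t, y). overlap_vec t y x)"
proof -
  have "dist (overlap_vec (fst p) (snd p) x $ i) (overlap_vec (fst q) (snd q) x $ i) \<le> 15 * dist p q"
    if p: "p \<in> hj_domain (1 / 16)" and q: "q \<in> hj_domain (1 / 16)" for p q i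
  proof -
    have s: "saddle (fst p) (snd p) x (overlap (fst p) (snd p) x)" "saddle (fst q) (snd q) x (overlap (fst q) (snd q) x)"
      using p q by (auto simp: hj_domain_def intro!: saddle_overlap)
    have n: "\<bar>fst q - fst p\<bar> \<le> dist p q" "norm (snd q - snd p) \<le> dist p q"
      using dist_fst_le[of q p] dist_snd_le[of q p] by (simp_all add: dist_norm norm_minus_commute)
    have "\<bar>fst q - fst p\<bar> + \<bar>snd q $ 1 - snd p $ 1\<bar> + \<bar>snd q $ 2 - snd p $ 2\<bar> + \<bar>x $ 1 - x $ 1\<bar> + \<bar>x $ 2 - x $ 2\<bar> \<le> 3 * dist p q"
      using n norm_components_le[of "snd q - snd p"] by simp
    from saddle_lipschitz(1)[OF s _ _ _ _ _ this] p q
    have "\<bar>fst (overlap (fst q) (snd q) x) - fst (overlap (fst p) (snd p) x)\<bar> +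
        \<bar>snd (overlap (fst q) (snd q) x) - snd (overlap (fst p) (snd p) x)\<bar> \<le> 5 * (3 * dist p q)"
      by (auto simp: hj_domain_def)
    then have "dist (overlap_vec (fst p) (snd p) x $ 1) (overlap_vec (fst q) (snd q) x $ 1) \<le> 15 * dist p q"
      "dist (overlap_vec (fst p) (snd p) x $ 2) (overlap_vec (fst q) (snd q) x $ 2) \<le> 15 * dist p q"
      unfolding overlap_vec_simps dist_real_def by linarith+
    then show ?thesis using exhaust_2[of i] by metis
  qed
  then have "continuous_on (hj_domain (1 / 16)) (\<lambda>p. overlap_vec (fst p) (snd p) x $ i)" for i
    by (intro lipschitz_on_continuous_on[of 15] lipschitz_onI) auto
  then have "continuous_on (hj_domain (1 / 16)) (\<lambda>p. \<chi> i. overlap_vec (fst p) (snd p) x $ i)" by (rule continuous_on_vec_lambda)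
  then show ?thesis by (simp add: split_def)
qed

text \<open>Averaging over the sign of the field leaves the mean of \<open>LC\<close> at
  \<open>x\<close> and at \<open>- x\<close>, which agree.\<close>

lemma initial_condition_eq:
  "initial_condition y x = y $ 1 - LC (2 * y $ 1) (x $ 1) + (y $ 2 - LC (2 * y $ 2) (x $ 2))"
proof -
  interpret r: prob_space rademacher by (rule prob_space_rademacher)
  interpret g: prob_space gauss by (rule gauss.prob_space_axioms)
  interpret pair_sigma_finite gauss rademacher ..
  have "(\<integral>p. ln (cosh (sqrt v * fst p + z * snd p)) \<partial>(gauss \<Otimes>\<^sub>M rademacher)) = LC v z" for v z
  proof -
    let ?f = "\<lambda>p. lncosh (sqrt v * fst p + z * snd p)"
    note m = lncosh.measurable_f
    have m1: "(\<lambda>s. lncosh (sqrt v * a + z * s)) \<in> borel_measurable borel" for a using m by measurable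
    have m2: "?f \<in> borel_measurable (gauss \<Otimes>\<^sub>M rademacher)" using m by measurable
    have i: "integrable gauss (\<lambda>a. lncosh (sqrt v * a + b))" for b by (rule lncosh.integrable_gauss_mean)
    have int: "integrable (gauss \<Otimes>\<^sub>M rademacher) ?f"
    proof (rule Fubini_integrable[OF m2])
      have "(\<integral>s. norm (?f (a, s)) \<partial>rademacher) = (\<bar>lncosh (sqrt v * a + z)\<bar> + \<bar>lncosh (sqrt v * a + - z)\<bar>) / 2" for a
        by (subst integral_rademacher) (use m1 in auto)
      then show "integrable gauss (\<lambda>a. \<integral>s. norm (?f (a, s)) \<partial>rademacher)"
        using i[of z] i[of "- z"] by (simp only:) (intro integrable_divide_zero Bochner_Integration.integrable_add integrable_abs impI)
      show "AE a in gauss. integrable rademacher (\<lambda>s. ?f (a, s))" using m1 by (auto intro!: integrable_rademacher)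
    qed
    have "(\<integral>p. ?f p \<partial>(gauss \<Otimes>\<^sub>M rademacher)) = (\<integral>a. (\<integral>s. ?f (a, s) \<partial>rademacher) \<partial>gauss)"
      by (rule integral_fst'[OF int, symmetric])
    also have "\<dots> = (\<integral>a. (lncosh (sqrt v * a + z) + lncosh (sqrt v * a + - z)) / 2 \<partial>gauss)"
    proof (rule Bochner_Integration.integral_cong[OF refl])
      show "(\<integral>s. ?f (a, s) \<partial>rademacher) = (lncosh (sqrt v * a + z) + lncosh (sqrt v * a + - z)) / 2" for a
        by (subst integral_rademacher) (use m1 in auto)
    qed
    also have "\<dots> = (LC v z + LC v (- z)) / 2"
      using i[of z] i[of "- z"] unfolding LC_def gauss_mean_def by (simp only: integral_divide_zero Bochner_Integration.integral_add)
    also have "\<dots> = LC v z" by (simp add: LC_uminus)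
    finally show ?thesis by (simp add: lncosh_def)
  qed
  then show ?thesis by (simp add: initial_condition_def sum_2 gauss_def[symmetric])
qed

lemma hopf_0: "hopf 0 y x = initial_condition y x"
  by (simp add: hopf_def potential_def initial_condition_eq)

lemma hj_solution_hopf: "hj_solution (1 / 16) (\<lambda>y. initial_condition y x) (\<lambda>t y. hopf t y x)"
  unfolding hj_solution_def
proof (intro conjI ballI)
  fix p assume p: "p \<in> hj_domain (1 / 16)"
  obtain t y where ty: "p = (t, y)" by (cases p)
  let ?D = "\<lambda>d. overlap_vec t y x $ 1 * overlap_vec t y x $ 2 * fst d + overlap_vec t y x \<bullet> snd d"
  have "((\<lambda>(t, y). hopf t y x) has_derivative ?D) (at p within hj_domain (1 / 16))"
    using hopf_has_derivative_hj p unfolding ty by blast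
  moreover have "?D (1, 0) - ?D (0, axis 1 1) * ?D (0, axis 2 1) = 0" by (simp add: inner_axis)
  ultimately show "\<exists>D. ((\<lambda>(t, y). hopf t y x) has_derivative D) (at p within hj_domain (1 / 16)) \<and>
      D (1, 0) - D (0, axis 1 1) * D (0, axis 2 1) = 0" by (intro exI[of _ ?D] conjI)
qed (rule hopf_0)

text \<open>The gradient components are values of \<open>LQ\<close>, so they lie in [0, 1], and off
  a face the variance is positive, which makes the corresponding component positive; these are the
  hypotheses of \<open>hj_unique\<close>.\<close>

lemma hj_solution_eq_hopf:
  assumes h: "hj_solution (1 / 16) (\<lambda>y. initial_condition y x) h" and p: "(t, y) \<in> hj_domain (1 / 16)"
  shows "h t y = hopf t y x"
proof (rule hj_unique[OF h _ _ _ _ overlap_vec_continuous p])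
  fix p assume p: "p \<in> hj_domain (1 / 16)"
  obtain t y where ty: "p = (t, y)" by (cases p)
  have s: "saddle t y x (overlap t y x)" using p by (auto simp: ty hj_domain_def intro!: saddle_overlap)
  note b = saddle_bounds[OF s]
  show "((\<lambda>(t, y). hopf t y x) has_derivative (\<lambda>d. (case p of (t, y) \<Rightarrow> overlap_vec t y x) $ 1 * (case p of (t, y) \<Rightarrow> overlap_vec t y x) $ 2 * fst d +
      (case p of (t, y) \<Rightarrow> overlap_vec t y x) \<bullet> snd d)) (at p within hj_domain (1 / 16))"
    using hopf_has_derivative_hj p unfolding ty split_conv by blast
  show "0 \<le> (case p of (t, y) \<Rightarrow> overlap_vec t y x) $ i \<and> (case p of (t, y) \<Rightarrow> overlap_vec t y x) $ i \<le> 1" for i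
    using b exhaust_2[of i] by (auto simp: ty)
  show "0 < (case p of (t, y) \<Rightarrow> overlap_vec t y x) $ i" if "0 < snd p $ i" for i
  proof -
    have t: "0 \<le> t" using p by (simp add: ty hj_domain_def)
    have nn: "0 \<le> t * fst (overlap t y x)" "0 \<le> t * snd (overlap t y x)" using b t by simp_all
    show ?thesis
    proof (cases "i = 1")
      case True
      have "0 < LQ (2 * (y $ 1 + t * snd (overlap t y x))) (x $ 1)" by (rule LQ_pos) (use that nn True in \<open>simp add: ty\<close>)
      then have "0 < fst (overlap t y x)" using s unfolding saddle_def by metis
      then show ?thesis using True by (simp add: ty)
    next
      case False
      then have i: "i = 2" using exhaust_2[of i] by simp
      have "0 < LQ (2 * (y $ 2 + t * fst (overlap t y x))) (x $ 2)" by (rule LQ_pos) (use that nn i in \<open>simp add: ty\<close>)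
      then have "0 < snd (overlap t y x)" using s unfolding saddle_def by metis
      then show ?thesis using i by (simp add: ty)
    qed
  qed
qed (rule hopf_0)

section \<open>Free energy and magnetization\<close>

lemma inner_vec_2: "x \<bullet> y = x $ 1 * y $ 1 + x $ 2 * (y :: real^2) $ 2"
  by (simp add: inner_vec_def sum_2)

lemma energy_partition: "(\<Sum>\<sigma>\<in>configs N. exp (energy \<beta> W \<chi>1 \<chi>2 N \<sigma>)) = partition \<beta> 1 1 W \<chi>1 \<chi>2 N"
  by (simp add: energy_def partition_def)

lemma partition_pos: "0 < partition \<beta> h1 h2 W \<chi>1 \<chi>2 N"
  unfolding partition_def using configs_nonempty by (intro sum_pos) auto

lemma space_gibbs_measure: "space (gibbs_measure \<beta> W \<chi>1 \<chi>2 N) = configs N"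
  by (simp add: gibbs_measure_def space_point_measure)

lemma sets_gibbs_measure: "sets (gibbs_measure \<beta> W \<chi>1 \<chi>2 N) = Pow (configs N)"
  by (simp add: gibbs_measure_def sets_point_measure)

lemma prob_space_gibbs_measure: "prob_space (gibbs_measure \<beta> W \<chi>1 \<chi>2 N)"
proof (rule prob_spaceI)
  let ?Z = "\<Sum>\<sigma>\<in>configs N. exp (energy \<beta> W \<chi>1 \<chi>2 N \<sigma>)"
  have Z: "0 < ?Z" unfolding energy_partition by (rule partition_pos)
  have "emeasure (gibbs_measure \<beta> W \<chi>1 \<chi>2 N) (configs N) = (\<Sum>\<sigma>\<in>configs N. ennreal (exp (energy \<beta> W \<chi>1 \<chi>2 N \<sigma>) / ?Z))"
    unfolding gibbs_measure_def by (rule emeasure_point_measure_finite) auto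
  also have "\<dots> = ennreal (\<Sum>\<sigma>\<in>configs N. exp (energy \<beta> W \<chi>1 \<chi>2 N \<sigma>) / ?Z)"
    by (rule sum_ennreal) (use Z in \<open>simp add: divide_nonneg_pos\<close>)
  also have "(\<Sum>\<sigma>\<in>configs N. exp (energy \<beta> W \<chi>1 \<chi>2 N \<sigma>) / ?Z) = 1"
    using Z by (simp flip: sum_divide_distrib)
  finally show "emeasure (gibbs_measure \<beta> W \<chi>1 \<chi>2 N) (space (gibbs_measure \<beta> W \<chi>1 \<chi>2 N)) = 1"
    by (simp add: space_gibbs_measure)
qed

lemma abs_spin_average_le:
  fixes c s :: "nat \<Rightarrow> real"
  assumes "\<And>i. i \<in> {1..N} \<Longrightarrow> c i \<in> {-1, 1}" "\<And>i. i \<in> {1..N} \<Longrightarrow> s i \<in> {-1, 1}"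
  shows "\<bar>\<Sum>i=1..N. c i * s i\<bar> \<le> real N"
proof -
  have "\<bar>\<Sum>i=1..N. c i * s i\<bar> \<le> (\<Sum>i=1..N. \<bar>c i * s i\<bar>)" by (rule sum_abs)
  also have "\<dots> \<le> (\<Sum>i=1..N. 1)"
  proof (rule sum_mono)
    fix i assume i: "i \<in> {1..N}"
    show "\<bar>c i * s i\<bar> \<le> 1" using assms(1)[OF i] assms(2)[OF i] by auto
  qed
  finally show ?thesis by simp
qed

lemma norm_magnetization_le:
  assumes "\<sigma> \<in> configs N" and s: "\<And>i. i \<in> {1..N} \<Longrightarrow> \<chi>1 i \<in> {-1, 1}" "\<And>i. i \<in> {1..N} \<Longrightarrow> \<chi>2 i \<in> {-1, 1}"
  shows "norm (magnetization \<chi>1 \<chi>2 N \<sigma>) \<le> 2"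
proof -
  \<comment> \<open>For \<open>N = 0\<close> the quotient is 0 by convention, so the bound holds
    there too.\<close>
  have average: "\<bar>1 / real N * a\<bar> \<le> 1" if "\<bar>a\<bar> \<le> real N" for a
    using that by (cases "N = 0") (simp_all add: abs_mult divide_le_eq)
  have b: "\<bar>\<Sum>i=1..N. \<chi>1 i * fst \<sigma> i\<bar> \<le> real N" "\<bar>\<Sum>i=1..N. \<chi>2 i * snd \<sigma> i\<bar> \<le> real N"
    using config_spins[OF assms(1)] s by (intro abs_spin_average_le; blast)+
  have "norm (magnetization \<chi>1 \<chi>2 N \<sigma>) \<le> \<bar>magnetization \<chi>1 \<chi>2 N \<sigma> $ 1\<bar> + \<bar>magnetization \<chi>1 \<chi>2 N \<sigma> $ 2\<bar>"
    using norm_le_l1_cart[of "magnetization \<chi>1 \<chi>2 N \<sigma>"] by (simp add: sum_2)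
  moreover have "\<bar>magnetization \<chi>1 \<chi>2 N \<sigma> $ 1\<bar> \<le> 1" unfolding magnetization_def vector_2 by (rule average[OF b(1)])
  moreover have "\<bar>magnetization \<chi>1 \<chi>2 N \<sigma> $ 2\<bar> \<le> 1" unfolding magnetization_def vector_2 by (rule average[OF b(2)])
  ultimately show ?thesis by linarith
qed

text \<open>Shifting the supremum by the actual fields (1, 1) shows that the conjugate of
  \<open>h\<close> is the rate function plus the affine function
  \<open>m $ 1 + m $ 2 + h (vector [1, 1])\<close>. As the rate has infimum 0, both normalizing
  constants follow.\<close>

lemma conjugate_rate:
  fixes h :: "real^2 \<Rightarrow> real"
  assumes rate: "\<And>m. rate m = (SUP l. ereal (l \<bullet> m - (h (vector [1, 1]) - h (vector [1, 1] + l))))"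
    and INF: "(INF m. rate m) = 0" and nn: "\<And>m. 0 \<le> rate m"
  shows "magnetization_rate h = rate"
    and "(INF m. SUP x. ereal (h x + m \<bullet> x - (m $ 1 + m $ 2))) = ereal (h (vector [1, 1]))"
proof -
  define e :: "real^2" where "e = vector [1, 1]"
  have em: "e \<bullet> m = m $ 1 + m $ 2" for m by (simp add: e_def inner_vec_2)
  have shift: "(SUP x. f x) = (SUP l. f (e + l))" for f :: "real^2 \<Rightarrow> ereal"
  proof (rule antisym)
    show "(SUP x. f x) \<le> (SUP l. f (e + l))"
    proof (rule SUP_least)
      fix x show "f x \<le> (SUP l. f (e + l))" by (rule SUP_upper2[of "x - e"]) auto
    qed
  qed (rule SUP_mono, blast)
  have sup: "(SUP x. ereal (x \<bullet> m + h x + c)) = ereal (m $ 1 + m $ 2 + c + h e) + rate m" for m c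
  proof -
    have "(SUP x. ereal (x \<bullet> m + h x + c)) = (SUP l. ereal ((e + l) \<bullet> m + h (e + l) + c))" by (rule shift)
    also have "\<dots> = (SUP l. ereal (m $ 1 + m $ 2 + c + h e) + ereal (l \<bullet> m - (h e - h (e + l))))"
      by (simp add: em inner_add_left algebra_simps)
    also have "\<dots> = ereal (m $ 1 + m $ 2 + c + h e) + rate m"
      unfolding rate e_def by (rule SUP_ereal_add_right) auto
    finally show ?thesis .
  qed
  have conj: "conjugate h m = ereal (m $ 1 + m $ 2 + h e) + rate m" for m
    using sup[of m 0] by (simp add: conjugate_def)
  have "(SUP m. ereal (m $ 1 + m $ 2) - conjugate h m) = (SUP m. ereal (- h e) + - rate m)"
  proof (rule SUP_cong[OF refl])
    show "ereal (m $ 1 + m $ 2) - conjugate h m = ereal (- h e) + - rate m" for m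
      using nn[of m] unfolding conj by (cases "rate m") auto
  qed
  also have "\<dots> = ereal (- h e) + (SUP m. - rate m)" by (rule SUP_ereal_add_right) auto
  also have "(SUP m. - rate m) = 0" using INF by (simp add: ereal_SUP_uminus_eq)
  finally have S: "(SUP m. ereal (m $ 1 + m $ 2) - conjugate h m) = ereal (- h e)" by simp
  show "magnetization_rate h = rate"
  proof
    fix m show "magnetization_rate h m = rate m"
      using nn[of m] unfolding magnetization_rate_def S unfolding conj by (cases "rate m") auto
  qed
  have "(SUP x. ereal (h x + m \<bullet> x - (m $ 1 + m $ 2))) = ereal (h e) + rate m" for m
    using sup[of m "- (m $ 1 + m $ 2)"] by (simp add: inner_commute algebra_simps)
  then have "(INF m. SUP x. ereal (h x + m \<bullet> x - (m $ 1 + m $ 2))) = (INF m. ereal (h e) + rate m)" by simp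
  also have "\<dots> = ereal (h e) + (INF m. rate m)" by (rule INF_ereal_add_right) (use nn in auto)
  finally show "(INF m. SUP x. ereal (h x + m \<bullet> x - (m $ 1 + m $ 2))) = ereal (h (vector [1, 1]))"
    using INF by (simp add: e_def)
qed

text \<open>Tilting the Gibbs measure by the magnetization changes only the external fields, so the
  limits of the partition functions in all fields contain the scaled cumulant generating
  function.\<close>

lemma free_energy_and_large_deviations:
  fixes h :: "real^2 \<Rightarrow> real"
  assumes s: "\<And>i. 1 \<le> i \<Longrightarrow> \<chi>1 i \<in> {-1, 1}" "\<And>i. 1 \<le> i \<Longrightarrow> \<chi>2 i \<in> {-1, 1}"
    and partition_lim: "\<And>x. (\<lambda>N. ln (partition \<beta> (x $ 1) (x $ 2) W \<chi>1 \<chi>2 N) / real N) \<longlonglongrightarrow> 2 * ln 2 + c - h x"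
    and h_deriv: "\<And>x. (h has_derivative (\<lambda>d. h' x \<bullet> d)) (at x)"
  shows "(\<lambda>N. ereal (free_energy \<beta> W \<chi>1 \<chi>2 N)) \<longlonglongrightarrow> (INF m. SUP x. ereal (h x + m \<bullet> x - (m $ 1 + m $ 2))) - ereal c"
    and "large_deviation_principle (gibbs_measure \<beta> W \<chi>1 \<chi>2) (magnetization \<chi>1 \<chi>2) (magnetization_rate h)"
proof -
  define e :: "real^2" where "e = vector [1, 1]"
  have e: "e $ 1 = 1" "e $ 2 = 1" by (simp_all add: e_def)
  have P: "prob_space (gibbs_measure \<beta> W \<chi>1 \<chi>2 N)" for N by (rule prob_space_gibbs_measure)
  have F: "finite (space (gibbs_measure \<beta> W \<chi>1 \<chi>2 N))" for N by (simp add: space_gibbs_measure)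
  have S: "sets (gibbs_measure \<beta> W \<chi>1 \<chi>2 N) = Pow (space (gibbs_measure \<beta> W \<chi>1 \<chi>2 N))" for N
    by (simp add: space_gibbs_measure sets_gibbs_measure)
  have B: "norm (magnetization \<chi>1 \<chi>2 N \<sigma>) \<le> 2" if "\<sigma> \<in> space (gibbs_measure \<beta> W \<chi>1 \<chi>2 N)" for N \<sigma>
    by (rule norm_magnetization_le) (use that s in \<open>simp_all add: space_gibbs_measure\<close>)
  interpret bounded_sequence "gibbs_measure \<beta> W \<chi>1 \<chi>2" "magnetization \<chi>1 \<chi>2" 2
    by (rule bounded_sequence.intro[OF P F S B])
  \<comment> \<open>The factor \<open>N\<close> in the exponent cancels the normalization of the
    magnetization, so \<open>l\<close> is added to the fields (1, 1).\<close>
  have mgf: "mgf N l = partition \<beta> ((e + l) $ 1) ((e + l) $ 2) W \<chi>1 \<chi>2 N / partition \<beta> (e $ 1) (e $ 2) W \<chi>1 \<chi>2 N" if N: "1 \<le> N" for N l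
  proof -
    have "mgf N l = (\<Sum>\<sigma>\<in>configs N. exp (real N * (l \<bullet> magnetization \<chi>1 \<chi>2 N \<sigma>)) * exp (energy \<beta> W \<chi>1 \<chi>2 N \<sigma>)) / partition \<beta> 1 1 W \<chi>1 \<chi>2 N"
      unfolding mgf_def integral_gibbs_measure energy_partition ..
    also have "(\<Sum>\<sigma>\<in>configs N. exp (real N * (l \<bullet> magnetization \<chi>1 \<chi>2 N \<sigma>)) * exp (energy \<beta> W \<chi>1 \<chi>2 N \<sigma>)) =
        partition \<beta> ((e + l) $ 1) ((e + l) $ 2) W \<chi>1 \<chi>2 N"
      unfolding partition_def
    proof (rule sum.cong[OF refl])
      fix \<sigma>
      have "real N * (l \<bullet> magnetization \<chi>1 \<chi>2 N \<sigma>) = l $ 1 * (\<Sum>i=1..N. \<chi>1 i * fst \<sigma> i) + l $ 2 * (\<Sum>i=1..N. \<chi>2 i * snd \<sigma> i)"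
        using N by (simp add: inner_vec_2 magnetization_def distrib_left)
      then show "exp (real N * (l \<bullet> magnetization \<chi>1 \<chi>2 N \<sigma>)) * exp (energy \<beta> W \<chi>1 \<chi>2 N \<sigma>) =
        exp (\<beta> / sqrt (real N) * (\<Sum>i=1..N. \<Sum>j=1..N. W i j * fst \<sigma> i * snd \<sigma> j) +
          (e + l) $ 1 * (\<Sum>i=1..N. \<chi>1 i * fst \<sigma> i) + (e + l) $ 2 * (\<Sum>i=1..N. \<chi>2 i * snd \<sigma> i))"
        unfolding exp_add[symmetric] energy_def by (simp add: e distrib_right)
    qed
    finally show ?thesis by (simp add: e)
  qed
  define \<Lambda> where "\<Lambda> l = h e - h (e + l)" for l
  interpret gartner_ellis "gibbs_measure \<beta> W \<chi>1 \<chi>2" "magnetization \<chi>1 \<chi>2" 2 \<Lambda> "\<lambda>l. - h' (e + l)"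
  proof
    fix l
    have "(\<lambda>N. ln (partition \<beta> ((e + l) $ 1) ((e + l) $ 2) W \<chi>1 \<chi>2 N) / real N - ln (partition \<beta> (e $ 1) (e $ 2) W \<chi>1 \<chi>2 N) / real N)
        \<longlonglongrightarrow> (2 * ln 2 + c - h (e + l)) - (2 * ln 2 + c - h e)"
      by (intro tendsto_diff partition_lim)
    then have "(\<lambda>N. ln (partition \<beta> ((e + l) $ 1) ((e + l) $ 2) W \<chi>1 \<chi>2 N) / real N - ln (partition \<beta> (e $ 1) (e $ 2) W \<chi>1 \<chi>2 N) / real N)
        \<longlonglongrightarrow> \<Lambda> l"
      by (simp add: \<Lambda>_def)
    moreover have "\<forall>\<^sub>F N in sequentially. ln (partition \<beta> ((e + l) $ 1) ((e + l) $ 2) W \<chi>1 \<chi>2 N) / real N - ln (partition \<beta> (e $ 1) (e $ 2) W \<chi>1 \<chi>2 N) / real N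
        = logmgf N l"
      using eventually_ge_at_top[of 1]
    proof eventually_elim
      fix N :: nat assume "1 \<le> N"
      then show "ln (partition \<beta> ((e + l) $ 1) ((e + l) $ 2) W \<chi>1 \<chi>2 N) / real N - ln (partition \<beta> (e $ 1) (e $ 2) W \<chi>1 \<chi>2 N) / real N = logmgf N l"
        unfolding logmgf_def mgf[OF \<open>1 \<le> N\<close>] by (simp only: ln_divide_pos[OF partition_pos partition_pos] diff_divide_distrib)
    qed
    ultimately show "(\<lambda>N. logmgf N l) \<longlonglongrightarrow> \<Lambda> l" by (rule Lim_transform_eventually)
    have "((\<lambda>l. h (e + l)) has_derivative (\<lambda>d. h' (e + l) \<bullet> d)) (at l)"
      by (rule has_derivative_compose[of "\<lambda>l. e + l" "\<lambda>d. d", OF _ h_deriv[of "e + l"]]) (auto intro!: derivative_eq_intros)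
    then show "(\<Lambda> has_derivative (\<lambda>d. - h' (e + l) \<bullet> d)) (at l)"
      unfolding \<Lambda>_def by (auto intro!: derivative_eq_intros)
  qed
  note cr = conjugate_rate[of rate h, OF _ INF_rate rate_nonneg]
  have r: "rate m = (SUP l. ereal (l \<bullet> m - (h (vector [1, 1]) - h (vector [1, 1] + l))))" for m
    by (simp add: rate_def \<Lambda>_def e_def)
  show "large_deviation_principle (gibbs_measure \<beta> W \<chi>1 \<chi>2) (magnetization \<chi>1 \<chi>2) (magnetization_rate h)"
    unfolding cr(1)[OF r] by (rule large_deviations)
  have "(\<lambda>N. 2 * ln 2 - ln (partition \<beta> (e $ 1) (e $ 2) W \<chi>1 \<chi>2 N) / real N) \<longlonglongrightarrow> 2 * ln 2 - (2 * ln 2 + c - h e)"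
    by (intro tendsto_diff tendsto_const partition_lim)
  then have "(\<lambda>N. 2 * ln 2 - ln (partition \<beta> 1 1 W \<chi>1 \<chi>2 N) / real N) \<longlonglongrightarrow> h e - c" by (simp add: e)
  moreover have "\<forall>\<^sub>F N in sequentially. 2 * ln 2 - ln (partition \<beta> 1 1 W \<chi>1 \<chi>2 N) / real N = free_energy \<beta> W \<chi>1 \<chi>2 N"
    using eventually_ge_at_top[of 1]
  proof eventually_elim
    fix N :: nat assume N: "1 \<le> N"
    have l4: "ln (4 :: real) = 2 * ln 2" using ln_realpow[of 2 2] by simp
    have eq: "ln (1 / 4 ^ N * partition \<beta> 1 1 W \<chi>1 \<chi>2 N) = ln (partition \<beta> 1 1 W \<chi>1 \<chi>2 N) - real N * (2 * ln 2)"
      using partition_pos[of \<beta> 1 1 W \<chi>1 \<chi>2 N] by (simp add: ln_div ln_realpow l4)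
    show "2 * ln 2 - ln (partition \<beta> 1 1 W \<chi>1 \<chi>2 N) / real N = free_energy \<beta> W \<chi>1 \<chi>2 N"
      unfolding free_energy_def energy_partition eq using N by (simp add: field_simps)
  qed
  ultimately have "(\<lambda>N. free_energy \<beta> W \<chi>1 \<chi>2 N) \<longlonglongrightarrow> h e - c" by (rule Lim_transform_eventually)
  then show "(\<lambda>N. ereal (free_energy \<beta> W \<chi>1 \<chi>2 N)) \<longlonglongrightarrow> (INF m. SUP x. ereal (h x + m \<bullet> x - (m $ 1 + m $ 2))) - ereal c"
    unfolding cr(2)[OF r] by (simp add: e_def)
qed

lemma ln_partition_external_field_lipschitz:
  assumes s: "\<And>i. i \<in> {1..N} \<Longrightarrow> \<chi>1 i \<in> {-1, 1}" "\<And>i. i \<in> {1..N} \<Longrightarrow> \<chi>2 i \<in> {-1, 1}"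
  shows "\<bar>ln (partition \<beta> h1 h2 W \<chi>1 \<chi>2 N) / real N - ln (partition \<beta> k1 k2 W \<chi>1 \<chi>2 N) / real N\<bar> \<le> \<bar>h1 - k1\<bar> + \<bar>h2 - k2\<bar>"
proof -
  have "\<bar>ln (partition \<beta> h1 h2 W \<chi>1 \<chi>2 N) - ln (partition \<beta> k1 k2 W \<chi>1 \<chi>2 N)\<bar> \<le> \<bar>h1 - k1\<bar> * real N + \<bar>h2 - k2\<bar> * real N"
    unfolding partition_def
  proof (rule ln_sum_exp_lipschitz[OF finite_configs configs_nonempty])
    fix \<sigma> assume \<sigma>: "\<sigma> \<in> configs N"
    define A where "A = \<beta> / sqrt (real N) * (\<Sum>i=1..N. \<Sum>j=1..N. W i j * fst \<sigma> i * snd \<sigma> j)"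
    define B where "B = (\<Sum>i=1..N. \<chi>1 i * fst \<sigma> i)"
    define C where "C = (\<Sum>i=1..N. \<chi>2 i * snd \<sigma> i)"
    have bc: "\<bar>B\<bar> \<le> real N" "\<bar>C\<bar> \<le> real N"
      unfolding B_def C_def using config_spins[OF \<sigma>] s by (intro abs_spin_average_le; blast)+
    have "A + h1 * B + h2 * C - (A + k1 * B + k2 * C) = (h1 - k1) * B + (h2 - k2) * C" by (simp add: algebra_simps)
    also have "\<bar>\<dots>\<bar> \<le> \<bar>h1 - k1\<bar> * \<bar>B\<bar> + \<bar>h2 - k2\<bar> * \<bar>C\<bar>" by (rule order_trans[OF abs_triangle_ineq]) (simp add: abs_mult)
    also have "\<dots> \<le> \<bar>h1 - k1\<bar> * real N + \<bar>h2 - k2\<bar> * real N" by (rule add_mono; rule mult_left_mono) (use bc in auto)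
    finally show "\<bar>A + h1 * B + h2 * C - (A + k1 * B + k2 * C)\<bar> \<le> \<bar>h1 - k1\<bar> * real N + \<bar>h2 - k2\<bar> * real N" .
  qed
  then have "\<bar>ln (partition \<beta> h1 h2 W \<chi>1 \<chi>2 N) - ln (partition \<beta> k1 k2 W \<chi>1 \<chi>2 N)\<bar> / real N \<le> \<bar>h1 - k1\<bar> + \<bar>h2 - k2\<bar>"
    by (cases "N = 0") (simp_all add: divide_le_eq distrib_right)
  then show ?thesis by (simp add: diff_divide_distrib[symmetric] abs_divide)
qed

text \<open>The exceptional null set depends on the field. Rational fields give a countable union,
  and a common Lipschitz bound in the field carries convergence to all of them.\<close>

lemma tendsto_of_dense_equicontinuous:
  fixes a :: "nat \<Rightarrow> real^2 \<Rightarrow> real" and L :: "real^2 \<Rightarrow> real"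
  assumes lim: "\<And>q :: rat \<times> rat. (\<lambda>N. a N (vector [of_rat (fst q), of_rat (snd q)])) \<longlonglongrightarrow> L (vector [of_rat (fst q), of_rat (snd q)])"
    and lip: "\<And>N x y. \<bar>a N x - a N y\<bar> \<le> \<bar>x $ 1 - y $ 1\<bar> + \<bar>x $ 2 - y $ 2\<bar>"
    and cont: "isCont L x"
  shows "(\<lambda>N. a N x) \<longlonglongrightarrow> L x"
proof (rule LIMSEQ_I)
  fix r :: real assume r: "0 < r"
  obtain d where d: "0 < d" "\<And>y. dist y x < d \<Longrightarrow> dist (L y) (L x) < r / 3"
    using cont r unfolding continuous_at by (metis LIM_def dist_self divide_pos_pos zero_less_numeral)
  define \<epsilon> where "\<epsilon> = min (d / 2) (r / 6)"
  have \<epsilon>: "0 < \<epsilon>" "2 * \<epsilon> \<le> d" "6 * \<epsilon> \<le> r" using d r by (auto simp: \<epsilon>_def)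
  have "\<exists>q. \<bar>of_rat q - z\<bar> < \<epsilon>" for z :: real
    using of_rat_dense[of "z - \<epsilon>" "z + \<epsilon>"] \<epsilon> by (auto simp: abs_less_iff) (metis add_less_cancel_right diff_add_cancel less_diff_eq minus_diff_eq neg_less_iff_less add.commute diff_less_eq)
  then obtain q1 q2 where q: "\<bar>of_rat q1 - x $ 1\<bar> < \<epsilon>" "\<bar>of_rat q2 - x $ 2\<bar> < \<epsilon>" by metis
  define y :: "real^2" where "y = vector [of_rat q1, of_rat q2]"
  have y: "\<bar>y $ 1 - x $ 1\<bar> < \<epsilon>" "\<bar>y $ 2 - x $ 2\<bar> < \<epsilon>" using q by (simp_all add: y_def)
  have "dist y x \<le> \<bar>y $ 1 - x $ 1\<bar> + \<bar>y $ 2 - x $ 2\<bar>"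
    using norm_le_l1_cart[of "y - x"] by (simp add: dist_norm sum_2)
  then have Ly: "\<bar>L y - L x\<bar> < r / 3" using y \<epsilon> d(2)[of y] by (simp add: dist_real_def)
  have "(\<lambda>N. a N y) \<longlonglongrightarrow> L y" using lim[of "(q1, q2)"] by (simp add: y_def)
  then obtain n0 where n0: "\<And>N. n0 \<le> N \<Longrightarrow> \<bar>a N y - L y\<bar> < r / 3"
    using LIMSEQ_D[of "\<lambda>N. a N y" "L y" "r / 3"] r by auto
  have "\<bar>a N x - L x\<bar> < r" if "n0 \<le> N" for N
  proof -
    have "\<bar>a N x - a N y\<bar> \<le> \<bar>y $ 1 - x $ 1\<bar> + \<bar>y $ 2 - x $ 2\<bar>" using lip[of N y x] by (simp add: abs_minus_commute)
    then show ?thesis using n0[OF that] Ly y \<epsilon> by argo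
  qed
  then show "\<exists>no. \<forall>N\<ge>no. norm (a N x - L x) < r" by auto
qed

lemma (in prob_space) AE_signs:
  assumes "indep_vars (\<lambda>_. borel) X I" "\<And>i. i \<in> J \<Longrightarrow> k i \<in> I" "\<And>i. i \<in> J \<Longrightarrow> distr M borel (X (k i)) = rademacher"
    and "countable J"
  shows "AE \<omega> in M. \<forall>i\<in>J. X (k i) \<omega> \<in> {-1, 1}"
proof (subst AE_ball_countable[OF assms(4)], rule ballI)
  fix i assume i: "i \<in> J"
  have m: "X (k i) \<in> borel_measurable M" using assms(1,2) i by (auto simp: indep_vars_def)
  have "AE x in distr M borel (X (k i)). x \<in> {-1, 1}" unfolding assms(3)[OF i] by (rule AE_rademacher)
  then show "AE \<omega> in M. X (k i) \<omega> \<in> {-1, 1}" by (rule AE_distrD[OF m])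
qed

theorem theorem1p1:
  fixes M :: "'w measure"
    and W :: "nat \<Rightarrow> nat \<Rightarrow> 'w \<Rightarrow> real"
    and \<chi>1 \<chi>2 :: "nat \<Rightarrow> 'w \<Rightarrow> real"
  assumes "prob_space M"
    and "prob_space.indep_vars M (\<lambda>_. borel)
           (case_sum (\<lambda>(i, j). W i j) (case_sum \<chi>1 \<chi>2))
           (({1..} \<times> {1..}) <+> ({1..} <+> {1..}))"
    and "\<And>i j. 1 \<le> i \<Longrightarrow> 1 \<le> j \<Longrightarrow> distributed M lborel (W i j) std_normal_density"
    and "\<And>i. 1 \<le> i \<Longrightarrow> distr M borel (\<chi>1 i) = rademacher"
    and "\<And>i. 1 \<le> i \<Longrightarrow> distr M borel (\<chi>2 i) = rademacher"
  shows "\<exists>\<beta>s \<ge> 1 / (2 * sqrt 2). \<exists>g :: real \<Rightarrow> real^2 \<Rightarrow> real^2 \<Rightarrow> real.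
    (\<forall>x. hj_solution (\<beta>s\<^sup>2 / 2) (\<lambda>y. initial_condition y x) (\<lambda>t y. g t y x) \<and>
         (\<forall>h. hj_solution (\<beta>s\<^sup>2 / 2) (\<lambda>y. initial_condition y x) h \<longrightarrow>
              (\<forall>(t, y) \<in> hj_domain (\<beta>s\<^sup>2 / 2). h t y = g t y x))) \<and>
    (\<forall>\<beta>. 0 \<le> \<beta> \<and> \<beta> < \<beta>s \<longrightarrow>
      (AE \<omega> in M.
        ((\<lambda>N. ereal (free_energy \<beta> (\<lambda>i j. W i j \<omega>) (\<lambda>i. \<chi>1 i \<omega>) (\<lambda>i. \<chi>2 i \<omega>) N)) \<longlonglongrightarrow>
          (INF m. SUP x. ereal (g (\<beta>\<^sup>2 / 2) 0 x + m \<bullet> x - (m $ 1 + m $ 2))) - ereal (\<beta>\<^sup>2 / 2)) \<and>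
        large_deviation_principle
          (gibbs_measure \<beta> (\<lambda>i j. W i j \<omega>) (\<lambda>i. \<chi>1 i \<omega>) (\<lambda>i. \<chi>2 i \<omega>))
          (magnetization (\<lambda>i. \<chi>1 i \<omega>) (\<lambda>i. \<chi>2 i \<omega>))
          (magnetization_rate (g (\<beta>\<^sup>2 / 2) 0))))"
proof -
  interpret prob_space M by fact
  \<comment> \<open>Its square is 1/8, so \<open>\<beta> < \<beta>s\<close> provides both
    \<open>8 * \<beta>\<^sup>2 < 1\<close> for the interpolation and
    \<open>\<beta>\<^sup>2 / 2 \<le> 1 / 16\<close> for the saddle point.\<close>
  define \<beta>s :: real where "\<beta>s = 1 / (2 * sqrt 2)"
  have T: "\<beta>s\<^sup>2 / 2 = 1 / 16" by (simp add: \<beta>s_def power_divide power_mult_distrib)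
  have main: "AE \<omega> in M.
      ((\<lambda>N. ereal (free_energy \<beta> (\<lambda>i j. W i j \<omega>) (\<lambda>i. \<chi>1 i \<omega>) (\<lambda>i. \<chi>2 i \<omega>) N)) \<longlonglongrightarrow>
        (INF m. SUP x. ereal (hopf (\<beta>\<^sup>2 / 2) 0 x + m \<bullet> x - (m $ 1 + m $ 2))) - ereal (\<beta>\<^sup>2 / 2)) \<and>
      large_deviation_principle
        (gibbs_measure \<beta> (\<lambda>i j. W i j \<omega>) (\<lambda>i. \<chi>1 i \<omega>) (\<lambda>i. \<chi>2 i \<omega>))
        (magnetization (\<lambda>i. \<chi>1 i \<omega>) (\<lambda>i. \<chi>2 i \<omega>))
        (magnetization_rate (hopf (\<beta>\<^sup>2 / 2) 0))" if \<beta>: "0 \<le> \<beta>" "\<beta> < \<beta>s" for \<beta>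
  proof -
    have "\<beta>\<^sup>2 < \<beta>s\<^sup>2" using \<beta> by (intro power_strict_mono) auto
    then have \<beta>2: "8 * \<beta>\<^sup>2 < 1" "\<beta>\<^sup>2 / 2 \<le> 1 / 16" using T by simp_all
    have t: "0 \<le> \<beta>\<^sup>2 / 2" by simp
    have lim: "AE \<omega> in M. (\<lambda>N. ln (partition \<beta> (x $ 1) (x $ 2) (\<lambda>i j. W i j \<omega>) (\<lambda>i. \<chi>1 i \<omega>) (\<lambda>i. \<chi>2 i \<omega>) N) / real N) \<longlonglongrightarrow>
        2 * ln 2 + \<beta>\<^sup>2 / 2 - hopf (\<beta>\<^sup>2 / 2) 0 x" for x
    proof -
      define p where "p = overlap (\<beta>\<^sup>2 / 2) 0 x"
      have s: "saddle (\<beta>\<^sup>2 / 2) 0 x p" unfolding p_def by (rule saddle_overlap[OF t \<beta>2(2)]) (simp add: orthant_def)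
      have z: "2 * ((0 :: real^2) $ i + \<beta>\<^sup>2 / 2 * a) = \<beta>\<^sup>2 * a" for i a by simp
      have fixpoint: "fst p = LQ (\<beta>\<^sup>2 * snd p) (x $ 1)" "snd p = LQ (\<beta>\<^sup>2 * fst p) (x $ 2)"
        using s unfolding saddle_def z by blast+
      \<comment> \<open>With \<open>t = \<beta>\<^sup>2 / 2\<close>, the terms of
        \<open>hopf\<close> outside \<open>LC\<close> are \<open>t * (p1 + p2 - p1 * p2)\<close>,
        which is \<open>t\<close> minus \<open>t * ((1 - p1) * (1 - p2))\<close>; this is the origin
        of the correction \<open>\<beta>\<^sup>2 / 2\<close> in the limit.\<close>
      have eq: "2 * ln 2 + LC (\<beta>\<^sup>2 * snd p) (x $ 1) + LC (\<beta>\<^sup>2 * fst p) (x $ 2) + \<beta>\<^sup>2 / 2 * ((1 - fst p) * (1 - snd p)) =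
          2 * ln 2 + \<beta>\<^sup>2 / 2 - hopf (\<beta>\<^sup>2 / 2) 0 x"
        by (simp add: hopf_def potential_def p_def[symmetric]) (simp add: field_simps)
      from AE_ln_partition_tendsto[OF assms(2) assms(3) assms(4) assms(5) \<beta>(1) \<beta>2(1) saddle_bounds[OF s] fixpoint]
      show ?thesis unfolding eq .
    qed
    have "AE \<omega> in M. \<forall>q :: rat \<times> rat. (\<lambda>N. ln (partition \<beta> ((vector [of_rat (fst q), of_rat (snd q)] :: real^2) $ 1)
        ((vector [of_rat (fst q), of_rat (snd q)] :: real^2) $ 2) (\<lambda>i j. W i j \<omega>) (\<lambda>i. \<chi>1 i \<omega>) (\<lambda>i. \<chi>2 i \<omega>) N) / real N) \<longlonglongrightarrow>
        2 * ln 2 + \<beta>\<^sup>2 / 2 - hopf (\<beta>\<^sup>2 / 2) 0 (vector [of_rat (fst q), of_rat (snd q)])"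
      unfolding AE_all_countable by (intro allI lim)
    moreover have "AE \<omega> in M. \<forall>i\<in>{1..}. \<chi>1 i \<omega> \<in> {-1, 1}"
      using AE_signs[OF assms(2), of "{1..}" "\<lambda>i. Inr (Inl i)"] assms(4) by auto
    moreover have "AE \<omega> in M. \<forall>i\<in>{1..}. \<chi>2 i \<omega> \<in> {-1, 1}"
      using AE_signs[OF assms(2), of "{1..}" "\<lambda>i. Inr (Inr i)"] assms(5) by auto
    ultimately show ?thesis
    proof eventually_elim
      fix \<omega>
      assume lim: "\<forall>q :: rat \<times> rat. (\<lambda>N. ln (partition \<beta> ((vector [of_rat (fst q), of_rat (snd q)] :: real^2) $ 1)
          ((vector [of_rat (fst q), of_rat (snd q)] :: real^2) $ 2) (\<lambda>i j. W i j \<omega>) (\<lambda>i. \<chi>1 i \<omega>) (\<lambda>i. \<chi>2 i \<omega>) N) / real N) \<longlonglongrightarrow>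
          2 * ln 2 + \<beta>\<^sup>2 / 2 - hopf (\<beta>\<^sup>2 / 2) 0 (vector [of_rat (fst q), of_rat (snd q)])"
        and s: "\<forall>i\<in>{1..}. \<chi>1 i \<omega> \<in> {-1, 1}" "\<forall>i\<in>{1..}. \<chi>2 i \<omega> \<in> {-1, 1}"
      note D = hopf_has_derivative_external_field[OF t \<beta>2(2)]
      have L: "(\<lambda>N. ln (partition \<beta> (x $ 1) (x $ 2) (\<lambda>i j. W i j \<omega>) (\<lambda>i. \<chi>1 i \<omega>) (\<lambda>i. \<chi>2 i \<omega>) N) / real N) \<longlonglongrightarrow>
          2 * ln 2 + \<beta>\<^sup>2 / 2 - hopf (\<beta>\<^sup>2 / 2) 0 x" for x
      proof (rule tendsto_of_dense_equicontinuous)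
        show "isCont (\<lambda>x. 2 * ln 2 + \<beta>\<^sup>2 / 2 - hopf (\<beta>\<^sup>2 / 2) 0 x) x"
          by (intro continuous_intros has_derivative_continuous[OF D])
      qed (use lim s in \<open>auto intro!: ln_partition_external_field_lipschitz\<close>)
      show "(\<lambda>N. ereal (free_energy \<beta> (\<lambda>i j. W i j \<omega>) (\<lambda>i. \<chi>1 i \<omega>) (\<lambda>i. \<chi>2 i \<omega>) N)) \<longlonglongrightarrow>
          (INF m. SUP x. ereal (hopf (\<beta>\<^sup>2 / 2) 0 x + m \<bullet> x - (m $ 1 + m $ 2))) - ereal (\<beta>\<^sup>2 / 2) \<and>
        large_deviation_principle
          (gibbs_measure \<beta> (\<lambda>i j. W i j \<omega>) (\<lambda>i. \<chi>1 i \<omega>) (\<lambda>i. \<chi>2 i \<omega>))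
          (magnetization (\<lambda>i. \<chi>1 i \<omega>) (\<lambda>i. \<chi>2 i \<omega>)) (magnetization_rate (hopf (\<beta>\<^sup>2 / 2) 0))"
        by (intro conjI free_energy_and_large_deviations[OF _ _ L D]) (use s in auto)
    qed
  qed
  show ?thesis
  proof (intro exI[of _ \<beta>s] conjI exI[of _ hopf] allI impI)
    show "hj_solution (\<beta>s\<^sup>2 / 2) (\<lambda>y. initial_condition y x) (\<lambda>t y. hopf t y x)" for x
      unfolding T by (rule hj_solution_hopf)
    show "\<forall>(t, y)\<in>hj_domain (\<beta>s\<^sup>2 / 2). h t y = hopf t y x"
      if "hj_solution (\<beta>s\<^sup>2 / 2) (\<lambda>y. initial_condition y x) h" for x h
      using hj_solution_eq_hopf that unfolding T by blast
  qed (use main in \<open>auto simp: \<beta>s_def\<close>)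
qed

end
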